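(* Let $A$ be a $c$-elliptic cone operator of order $m$, $A_\wedge$ its model operator, $\mathring\Lambda_\alpha$ a connected component of $\operatorname{bg-res}A_\wedge$, and $\mathcal D\in\mathfrak G_{\wedge,\alpha}$. Let $\Lambda$ be a closed sector with $\Lambda\setminus 0\subset\mathring\Lambda_\alpha$. Then $\Lambda$ is a sector of minimal growth for $A_{\wedge,\mathcal D}$ if and only if there are $C,R>0$ such that $\Lambda_R\subset\operatorname{res}A_{\wedge,\mathcal D}$ and $$\Big\|\pi_{\wedge,\max}\,\pi_{\mathcal K_{\wedge,\hat\lambda},\,\kappa_{|\lambda|^{1/m}}^{-1}\mathcal D}\Big|_{\mathcal E_{\wedge,\max}}\Big\|_{\mathscr L(\mathcal D_{\wedge,\max})}\le C\quad\text{for all }\lambda\in\Lambda_R,$$ where $\hat\lambda=\lambda/|\lambda|$.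
   Context: $M$ is a compact smooth manifold with nonempty boundary $Y$, $E\to M$ a Hermitian vector bundle with Hermitian connection, $\mathfrak m$ a smooth positive $b$-density, $x$ a boundary defining function such that in a collar of $Y$ one has $\mathfrak m=\frac{dx}{x}\otimes\mathfrak m_Y$ with $\mathfrak m_Y$ a smooth positive density on $Y$. A cone operator of order $m$ is $A=x^{-m}P$ where $P$ is a differential operator of order $m$ on sections of $E$ which near $Y$, in coordinates $(x,y)$ and (using parallel transport along the normal direction) a local frame of $E|_Y$, has the form $\sum_{k+|\alpha|\le m}a_{k\alpha}(x,y)D_y^\alpha(xD_x)^k$ with $a_{k\alpha}$ smooth up to $x=0$. $A$ is $c$-elliptic if its principal symbol is invertible over the interior (off the zero section) and near $Y$ the matrix $\sum_{k+|\alpha|=m}a_{k\alpha}(x,y)\eta^\alpha\xi^k$ is invertible for all real $(\xi,\eta)\ne0$, including at $x=0$. Model operator: on $Y^\wedge=[0,\infty)\times Y$, acting on sections of the pull-back of $E|_Y$ (again denoted $E$), $A_\wedge=x^{-m}\sum_{k+|\alpha|\le m}a_{k\alpha}(0,y)D_y^\alpha(xD_x)^k$. The Hilbert space is $x^{-m/2}L^2_b(Y^\wedge;E)=L^2(Y^\wedge,x^m\frac{dx}{x}\otimes\mathfrak m_Y;E)$. The group $(\kappa_\varrho u)(x,y)=\varrho^{m/2}u(\varrho x,y)$, $\varrho>0$, acts by isometries on it and $A_\wedge-\varrho^m\lambda=\varrho^m\kappa_\varrho(A_\wedge-\lambda)\kappa_\varrho^{-1}$. $\mathcal D_{\wedge,\min}$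 is the domain of the closure of $A_\wedge$ on $C_0^\infty(\mathring Y^\wedge;E)$; $\mathcal D_{\wedge,\max}=\{u\in x^{-m/2}L^2_b: A_\wedge u\in x^{-m/2}L^2_b\}$, a Hilbert space with inner product $(u,v)_{A_\wedge}=(A_\wedge u,A_\wedge v)+(u,v)$. $\mathcal D_{\wedge,\max}/\mathcal D_{\wedge,\min}$ is finite dimensional. $\mathcal E_{\wedge,\max}$ is the orthogonal complement of $\mathcal D_{\wedge,\min}$ in $\mathcal D_{\wedge,\max}$ and $\pi_{\wedge,\max}:\mathcal D_{\wedge,\max}\to\mathcal D_{\wedge,\max}$ is the orthogonal projection on it. $\mathfrak D_\wedge$ is the set of subspaces $\mathcal D$ with $\mathcal D_{\wedge,\min}\subset\mathcal D\subset\mathcal D_{\wedge,\max}$; $A_{\wedge,\mathcal D}$ is the closed operator $A_\wedge$ with domain $\mathcal D$. $\mathcal D_{\wedge,\min}$ and $\mathcal D_{\wedge,\max}$ are $\kappa$-invariant, so $\kappa_\varrho\mathcal D\in\mathfrak D_\wedge$ for $\mathcal D\in\mathfrak D_\wedge$. $\operatorname{bg-spec}A_\wedge=\bigcap_{\mathcal D\in\mathfrak D_\wedge}\operatorname{spec}A_{\wedge,\mathcal D}$ and $\operatorname{bg-res}A_\wedge=\mathbb C\setminus\operatorname{bg-spec}A_\wedge$; equivalently, $\lambda\in\operatorname{bg-res}A_\wedge$ iff $A_\wedge-\lambda$ is injective on $\mathcal D_{\wedge,\min}$ and surjective on $\mathcal D_{\wedge,\max}$. It is a union of open sectors, whose connected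 components are denoted $\mathring\Lambda_\alpha$. For $\lambda\in\operatorname{bg-res}A_\wedge$ all $A_{\wedge,\mathcal D}-\lambda$ are Fredholm, with index constant on each $\mathring\Lambda_\alpha$; $d''_\alpha=-\operatorname{ind}(A_{\wedge,\mathcal D_{\wedge,\min}}-\lambda)$, $\lambda\in\mathring\Lambda_\alpha$, and $\mathfrak G_{\wedge,\alpha}=\{\mathcal D\in\mathfrak D_\wedge:\dim\mathcal D/\mathcal D_{\wedge,\min}=d''_\alpha\}$ (the domains for which $A_{\wedge,\mathcal D}-\lambda$ has index $0$ for $\lambda\in\mathring\Lambda_\alpha$). $\mathcal K_{\wedge,\lambda}=\ker(A_{\wedge,\mathcal D_{\wedge,\max}}-\lambda)$. For $\lambda\in\mathring\Lambda_\alpha$ and $\mathcal D\in\mathfrak G_{\wedge,\alpha}$: $\lambda\in\operatorname{res}A_{\wedge,\mathcal D}$ iff $\mathcal K_{\wedge,\lambda}\cap\mathcal D=0$, and then $\mathcal D_{\wedge,\max}=\mathcal K_{\wedge,\lambda}\oplus\mathcal D$; $\pi_{\mathcal K_{\wedge,\lambda},\mathcal D}$ denotes the projection of $\mathcal D_{\wedge,\max}$ on $\mathcal K_{\wedge,\lambda}$ along $\mathcal D$. Since $\kappa_\varrho\mathcal K_{\wedge,\lambda}=\mathcal K_{\wedge,\varrho^m\lambda}$, the projection in the claim is defined when $\lambda\in\Lambda_R\subset\operatorname{res}A_{\wedge,\mathcal D}$. A closed sector is a set $\{re^{i\theta}:r\ge0,\ |\theta-\theta_0|\le a\}$; $\Lambda_R=\{\lambda\in\Lambda:|\lambda|\ge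 R\}$. A closed sector $\Lambda$ with $\Lambda\setminus0\subset\mathring\Lambda_\alpha$ is a sector of minimal growth for $A_{\wedge,\mathcal D}$ ($\mathcal D\in\mathfrak G_{\wedge,\alpha}$) if there is $R>0$ such that $A_{\wedge,\mathcal D}-\lambda$ is invertible for $\lambda\in\Lambda_R$ and, for some $C>0$, $\|(A_{\wedge,\mathcal D}-\lambda)^{-1}\|_{\mathscr L(x^{-m/2}L^2_b)}\le C/|\lambda|$ for $\lambda\in\Lambda_R$ (equivalently, $\|(A_{\wedge,\mathcal D}-\lambda)^{-1}\|_{\mathscr L(x^{-m/2}L^2_b,\mathcal D_{\wedge,\max})}\le C$). *)

theory Defs
  imports "HOL-Analysis.Analysis" "HOL-Library.Function_Algebras"
begin

type_synonym 'n pt = "(real, 'n) vec"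
type_synonym 'r cvec = "(complex, 'r) vec"
type_synonym 'r cmat = "((complex, 'r) vec, 'r) vec"
type_synonym ('a, 'f) csec = "real \<times> 'a \<Rightarrow> 'f"  \<comment> \<open>sections over the cone \<open>(0, \<infinity>) \<times> Y\<close>\<close>

section \<open>Smooth maps between subsets of normed spaces\<close>

primrec Ck :: "nat \<Rightarrow> 'c::real_normed_vector set \<Rightarrow> ('c \<Rightarrow> 'd::real_normed_vector) \<Rightarrow> bool" where
  "Ck 0 S f = continuous_on S f"
| "Ck (Suc k) S f =
     ((\<forall>x\<in>S. f differentiable (at x)) \<and> (\<forall>v. Ck k S (\<lambda>x. frechet_derivative f (at x) v)))"

text \<open>On an arbitrary set, smooth means locally extendable to a smooth map on an open set.
  This gives smoothness up to the boundary on relatively open subsets of a half-space.\<close>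

definition smooth_on :: "'c::real_normed_vector set \<Rightarrow> ('c \<Rightarrow> 'd::real_normed_vector) \<Rightarrow> bool" where
  "smooth_on S f \<longleftrightarrow>
     (\<forall>p\<in>S. \<exists>W g. open W \<and> p \<in> W \<and> (\<forall>k. Ck k W g) \<and> (\<forall>x\<in>W \<inter> S. g x = f x))"

section \<open>Partial derivatives in coordinates\<close>

text \<open>The model space of a manifold with boundary is the half-space in which the first
  coordinate (the least index) is nonnegative.  That coordinate plays the role of \<open>x\<close>, the others
  that of \<open>y\<close>.  If there is only one index, the boundary is zero-dimensional.\<close>

definition xi :: "'n::{finite,linorder}" where
  "xi = Min UNIV"

definition halfspace :: "(('n::{finite,linorder}) pt) set" where
  "halfspace = {v. v $ xi \<ge> 0}"

definition Dpart :: "'n::finite \<Rightarrow> ('n pt \<Rightarrow> ('r::finite) cvec) \<Rightarrow> 'n pt \<Rightarrow> 'r cvec" where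
  "Dpart i g v = (- \<i>) *s vector_derivative (\<lambda>t::real. g (v + t *\<^sub>R axis i 1)) (at 0)"

definition Dmulti :: "('n \<Rightarrow> nat) \<Rightarrow> (('n::{finite,linorder}) pt \<Rightarrow> ('r::finite) cvec)
    \<Rightarrow> 'n pt \<Rightarrow> 'r cvec" where
  "Dmulti \<alpha> g = foldr (\<lambda>i. Dpart i ^^ \<alpha> i) (sorted_list_of_set UNIV) g"

definition xDx :: "(('n::{finite,linorder}) pt \<Rightarrow> ('r::finite) cvec) \<Rightarrow> 'n pt \<Rightarrow> 'r cvec" where
  "xDx g v = (v $ xi) *\<^sub>R Dpart xi g v"

text \<open>The operator \<open>D\<^sub>y\<^sup>\<alpha> (x D\<^sub>x)\<^sup>k\<close>, with \<open>k\<close> and the tangential multi-index packed into one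
  multi-index whose entry at \<^term>\<open>xi\<close> is \<open>k\<close>.\<close>

definition bDmulti :: "('n \<Rightarrow> nat) \<Rightarrow> (('n::{finite,linorder}) pt \<Rightarrow> ('r::finite) cvec)
    \<Rightarrow> 'n pt \<Rightarrow> 'r cvec" where
  "bDmulti \<alpha> g = Dmulti (\<alpha>(xi := 0)) ((xDx ^^ \<alpha> xi) g)"

definition symbol_matrix :: "nat \<Rightarrow> (('n::finite \<Rightarrow> nat) \<Rightarrow> ('r::finite) cmat) \<Rightarrow> 'n pt \<Rightarrow> 'r cmat" where
  "symbol_matrix m a \<zeta> =
     (\<chi> j k. \<Sum>\<alpha> | sum \<alpha> UNIV = m. (\<Prod>i\<in>UNIV. complex_of_real (\<zeta> $ i) ^ \<alpha> i) * a \<alpha> $ j $ k)"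

section \<open>Geometric data\<close>

text \<open>The manifold \<open>M\<close> is the type \<open>'a\<close>.  The fibres of \<open>E\<close> are complex subspaces of an ambient
  complex vector space \<open>'f\<close>, which carries no further structure; abstract fibres can always
  be placed in such a space (e.g. their direct sum).  The fields are: the charts, the complex scalar multiplication of
  \<open>'f\<close>, the fibres, the metric (linear in the first slot), the local frames defining the smooth
  structure of \<open>E\<close>, the connection (vector field, section), the boundary defining function \<open>x\<close>,
  the width and the map of a collar \<open>[0, \<epsilon>) \<times> Y \<rightarrow> M\<close>, the \<open>b\<close>-density and the density on \<open>Y\<close>.\<close>

record ('a, 'n, 'f, 'r) cone_data =
  charts :: "('a set \<times> ('a \<Rightarrow> ('n::{finite,linorder}) pt)) set"
  scl :: "complex \<Rightarrow> 'f \<Rightarrow> 'f::ab_group_add"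
  fib :: "'a::{t2_space,second_countable_topology} \<Rightarrow> 'f set"
  herm :: "'a \<Rightarrow> 'f \<Rightarrow> 'f \<Rightarrow> complex"
  frames :: "('a set \<times> ('r::finite \<Rightarrow> 'a \<Rightarrow> 'f)) set"
  conn :: "(('a \<Rightarrow> real) \<Rightarrow> 'a \<Rightarrow> real) \<Rightarrow> ('a \<Rightarrow> 'f) \<Rightarrow> 'a \<Rightarrow> 'f"
  bdf :: "'a \<Rightarrow> real"
  width :: real
  collar :: "real \<times> 'a \<Rightarrow> 'a"
  dens :: "'a measure"
  densY :: "'a measure"

subsection \<open>Compact manifolds with boundary\<close>

definition bd :: "('a::{t2_space,second_countable_topology}, 'n::{finite,linorder}, 'f::ab_group_add, 'r::finite) cone_data \<Rightarrow> 'a set" where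
  "bd G = {p. \<exists>(U, \<phi>)\<in>charts G. p \<in> U \<and> \<phi> p $ xi = 0}"

definition compact_manifold_with_boundary :: "('a::{t2_space,second_countable_topology}, 'n::{finite,linorder}, 'f::ab_group_add, 'r::finite) cone_data \<Rightarrow> bool" where
  "compact_manifold_with_boundary G \<longleftrightarrow>
     compact (UNIV :: 'a set) \<and>
     (\<forall>(U, \<phi>)\<in>charts G. open U \<and> openin (top_of_set halfspace) (\<phi> ` U) \<and>
        (\<exists>\<psi>. homeomorphism U (\<phi> ` U) \<phi> \<psi>)) \<and>
     (\<Union>(fst ` charts G)) = UNIV \<and>
     (\<forall>(U, \<phi>)\<in>charts G. \<forall>(V, \<psi>)\<in>charts G. smooth_on (\<phi> ` (U \<inter> V)) (\<lambda>v. \<psi> (inv_into U \<phi> v))) \<and>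
     bd G \<noteq> {}"

definition smooth_fun :: "('a::{t2_space,second_countable_topology}, 'n::{finite,linorder}, 'f::ab_group_add, 'r::finite) cone_data
    \<Rightarrow> 'a set \<Rightarrow> ('a \<Rightarrow> 'b::real_normed_vector) \<Rightarrow> bool" where
  "smooth_fun G S f \<longleftrightarrow> (\<forall>(U, \<phi>)\<in>charts G. smooth_on (\<phi> ` (U \<inter> S)) (\<lambda>v. f (inv_into U \<phi> v)))"

definition interior_M :: "('a::{t2_space,second_countable_topology}, 'n::{finite,linorder}, 'f::ab_group_add, 'r::finite) cone_data \<Rightarrow> 'a set" where
  "interior_M G = - bd G"

subsection \<open>Hermitian vector bundles\<close>

definition frame_map :: "('a::{t2_space,second_countable_topology}, 'n::{finite,linorder}, 'f::ab_group_add, 'r::finite) cone_data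
    \<Rightarrow> ('r \<Rightarrow> 'a \<Rightarrow> 'f) \<Rightarrow> 'a \<Rightarrow> 'r cvec \<Rightarrow> 'f" where
  "frame_map G e p c = (\<Sum>j\<in>UNIV. scl G (c $ j) (e j p))"

definition coords :: "('a::{t2_space,second_countable_topology}, 'n::{finite,linorder}, 'f::ab_group_add, 'r::finite) cone_data
    \<Rightarrow> ('r \<Rightarrow> 'a \<Rightarrow> 'f) \<Rightarrow> 'a \<Rightarrow> 'f \<Rightarrow> 'r cvec" where
  "coords G e p = inv (frame_map G e p)"

definition hermitian_bundle :: "('a::{t2_space,second_countable_topology}, 'n::{finite,linorder}, 'f::ab_group_add, 'r::finite) cone_data \<Rightarrow> bool" where
  "hermitian_bundle G \<longleftrightarrow>
     vector_space (scl G) \<and>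
     (\<Union>(fst ` frames G)) = UNIV \<and>
     (\<forall>(W, e)\<in>frames G. open W \<and> (\<forall>p\<in>W. bij_betw (frame_map G e p) UNIV (fib G p))) \<and>
     (\<forall>(W, e)\<in>frames G. \<forall>(W', e')\<in>frames G. \<forall>j.
        smooth_fun G (W \<inter> W') (\<lambda>p. coords G e' p (e j p))) \<and>
     (\<forall>p. \<forall>v\<in>fib G p. \<forall>w\<in>fib G p.
        (\<forall>u\<in>fib G p. \<forall>c. herm G p (u + v) w = herm G p u w + herm G p v w \<and>
           herm G p (scl G c v) w = c * herm G p v w) \<and>
        herm G p w v = cnj (herm G p v w)) \<and>
     (\<forall>p. \<forall>v\<in>fib G p. v \<noteq> 0 \<longrightarrow> Re (herm G p v v) > 0) \<and>
     (\<forall>(W, e)\<in>frames G. \<forall>j k. smooth_fun G W (\<lambda>p. herm G p (e j p) (e k p)))"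

definition smooth_sections :: "('a::{t2_space,second_countable_topology}, 'n::{finite,linorder}, 'f::ab_group_add, 'r::finite) cone_data
    \<Rightarrow> 'a set \<Rightarrow> ('a \<Rightarrow> 'f) set" where
  "smooth_sections G S = {s. (\<forall>p\<in>S. s p \<in> fib G p) \<and>
     (\<forall>(W, e)\<in>frames G. smooth_fun G (W \<inter> S) (\<lambda>p. coords G e p (s p)))}"

subsection \<open>Connections and parallel transport\<close>

text \<open>Vector fields are derivations of \<open>C\<^sup>\<infinity>(M)\<close>.  The last clause makes them extensional.\<close>

definition vector_fields :: "('a::{t2_space,second_countable_topology}, 'n::{finite,linorder}, 'f::ab_group_add, 'r::finite) cone_data
    \<Rightarrow> (('a \<Rightarrow> real) \<Rightarrow> 'a \<Rightarrow> real) set" where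
  "vector_fields G = {X.
     (\<forall>f. smooth_fun G UNIV f \<longrightarrow> smooth_fun G UNIV (X f)) \<and>
     (\<forall>f g c. smooth_fun G UNIV f \<and> smooth_fun G UNIV g \<longrightarrow>
        X (\<lambda>p. f p + g p) = (\<lambda>p. X f p + X g p) \<and>
        X (\<lambda>p. c * f p) = (\<lambda>p. c * X f p) \<and>
        X (\<lambda>p. f p * g p) = (\<lambda>p. f p * X g p + g p * X f p)) \<and>
     (\<forall>f. \<not> smooth_fun G UNIV f \<longrightarrow> X f = (\<lambda>p. 0))}"

definition hermitian_connection :: "('a::{t2_space,second_countable_topology}, 'n::{finite,linorder}, 'f::ab_group_add, 'r::finite) cone_data \<Rightarrow> bool" where
  "hermitian_connection G \<longleftrightarrow>
     (\<forall>X\<in>vector_fields G. \<forall>s\<in>smooth_sections G UNIV.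
        conn G X s \<in> smooth_sections G UNIV \<and>
        (\<forall>Y\<in>vector_fields G. conn G (\<lambda>f p. X f p + Y f p) s = (\<lambda>p. conn G X s p + conn G Y s p)) \<and>
        (\<forall>g. smooth_fun G UNIV g \<longrightarrow>
           conn G (\<lambda>f p. g p * X f p) s = (\<lambda>p. scl G (of_real (g p)) (conn G X s p)) \<and>
           conn G X (\<lambda>p. scl G (of_real (g p)) (s p)) =
             (\<lambda>p. scl G (of_real (X g p)) (s p) + scl G (of_real (g p)) (conn G X s p))) \<and>
        (\<forall>c. conn G X (\<lambda>p. scl G c (s p)) = (\<lambda>p. scl G c (conn G X s p))) \<and>
        (\<forall>t\<in>smooth_sections G UNIV.
           conn G X (\<lambda>p. s p + t p) = (\<lambda>p. conn G X s p + conn G X t p) \<and>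
           (\<forall>p. Complex (X (\<lambda>q. Re (herm G q (s q) (t q))) p) (X (\<lambda>q. Im (herm G q (s q) (t q))) p)
              = herm G p (conn G X s p) (t p) + herm G p (s p) (conn G X t p))))"

definition extends_velocity :: "('a::{t2_space,second_countable_topology}, 'n::{finite,linorder}, 'f::ab_group_add, 'r::finite) cone_data
    \<Rightarrow> (real \<Rightarrow> 'a) \<Rightarrow> real set \<Rightarrow> real \<Rightarrow> (('a \<Rightarrow> real) \<Rightarrow> 'a \<Rightarrow> real) \<Rightarrow> bool" where
  "extends_velocity G \<gamma> I t X \<longleftrightarrow> X \<in> vector_fields G \<and>
     (\<forall>f. smooth_fun G UNIV f \<longrightarrow> ((\<lambda>s. f (\<gamma> s)) has_real_derivative X f (\<gamma> t)) (at t within I))"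

text \<open>Vanishing of the covariant derivative along \<open>\<gamma>\<close>: if \<open>w = \<Sum>\<^sub>j c\<^sub>j (s\<^sub>j \<circ> \<gamma>)\<close> near \<open>t\<close> with smooth
  sections \<open>s\<^sub>j\<close>, then \<open>Dw/dt = \<Sum>\<^sub>j c\<^sub>j' (s\<^sub>j \<circ> \<gamma>) + c\<^sub>j \<nabla>\<^sub>\<gamma>\<^sub>' s\<^sub>j\<close>.\<close>

definition parallel_along :: "('a::{t2_space,second_countable_topology}, 'n::{finite,linorder}, 'f::ab_group_add, 'r::finite) cone_data
    \<Rightarrow> (real \<Rightarrow> 'a) \<Rightarrow> real set \<Rightarrow> (real \<Rightarrow> 'f) \<Rightarrow> bool" where
  "parallel_along G \<gamma> I w \<longleftrightarrow> (\<forall>t\<in>I. \<exists>(s :: 'r \<Rightarrow> 'a \<Rightarrow> 'f) c c'.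
     (\<forall>j. s j \<in> smooth_sections G UNIV \<and> (c j has_vector_derivative c' j) (at t within I)) \<and>
     (\<exists>\<delta>>0. \<forall>t'\<in>I. \<bar>t' - t\<bar> < \<delta> \<longrightarrow> w t' = (\<Sum>j\<in>UNIV. scl G (c j t') (s j (\<gamma> t')))) \<and>
     (\<forall>X. extends_velocity G \<gamma> I t X \<longrightarrow>
        (\<Sum>j\<in>UNIV. scl G (c' j) (s j (\<gamma> t)) + scl G (c j t) (conn G X (s j) (\<gamma> t))) = 0))"

subsection \<open>The collar and the densities\<close>

definition cyl :: "('a \<Rightarrow> ('n::{finite,linorder}) pt) \<Rightarrow> real \<times> 'a \<Rightarrow> 'n pt" where
  "cyl \<phi> z = \<phi> (snd z) + fst z *\<^sub>R axis xi 1"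

definition base_pt :: "('n::{finite,linorder}) pt \<Rightarrow> 'n pt" where
  "base_pt v = v - (v $ xi) *\<^sub>R axis xi 1"

definition cyl_inv :: "('a::{t2_space,second_countable_topology}, 'n::{finite,linorder}, 'f::ab_group_add, 'r::finite) cone_data
    \<Rightarrow> 'a set \<Rightarrow> ('a \<Rightarrow> 'n pt) \<Rightarrow> 'n pt \<Rightarrow> real \<times> 'a" where
  "cyl_inv G U \<phi> v = (v $ xi, inv_into (U \<inter> bd G) \<phi> (base_pt v))"

text \<open>A chart \<open>\<phi>\<close> of \<open>M\<close> restricts to a chart of \<open>Y\<close> (with first coordinate \<open>0\<close>), so \<^term>\<open>cyl\<close> gives
  coordinates \<open>(x, y)\<close> on \<open>[0, \<infinity>) \<times> Y\<close>.  \<^term>\<open>bdf G (collar G (t, y)) = t\<close> implies \<open>dx \<noteq> 0\<close> on \<open>Y\<close>.\<close>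

definition collar_structure :: "('a::{t2_space,second_countable_topology}, 'n::{finite,linorder}, 'f::ab_group_add, 'r::finite) cone_data \<Rightarrow> bool" where
  "collar_structure G \<longleftrightarrow>
     smooth_fun G UNIV (bdf G) \<and> (\<forall>p. bdf G p \<ge> 0 \<and> (bdf G p = 0 \<longleftrightarrow> p \<in> bd G)) \<and>
     width G > 0 \<and>
     (let N = {0..<width G} \<times> bd G in
       open (collar G ` N) \<and> (\<exists>d. homeomorphism N (collar G ` N) (collar G) d) \<and>
       (\<forall>y\<in>bd G. collar G (0, y) = y) \<and>
       (\<forall>(t, y)\<in>N. bdf G (collar G (t, y)) = t) \<and>
       (\<forall>(U, \<phi>)\<in>charts G. \<forall>(V, \<psi>)\<in>charts G.
          smooth_on (cyl \<phi> ` {z \<in> N. snd z \<in> U \<and> collar G z \<in> V})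
            (\<lambda>v. \<psi> (collar G (cyl_inv G U \<phi> v))) \<and>
          smooth_on (\<psi> ` (V \<inter> collar G ` {z \<in> N. snd z \<in> U}))
            (\<lambda>v. cyl \<phi> (inv_into N (collar G) (inv_into V \<psi> v)))))"

text \<open>Densities are measures that are smooth and positive with respect to Lebesgue measure in
  charts.  For \<open>Y\<close>, the integral of \<open>\<rho>\<close> over a subset of the boundary hyperplane is written as an
  integral over a cylinder of height \<open>1\<close>.\<close>

definition densities :: "('a::{t2_space,second_countable_topology}, 'n::{finite,linorder}, 'f::ab_group_add, 'r::finite) cone_data \<Rightarrow> bool" where
  "densities G \<longleftrightarrow>
     sets (dens G) = sets (restrict_space borel (interior_M G)) \<and>
     (\<forall>(U, \<phi>)\<in>charts G. \<exists>\<rho> :: 'n pt \<Rightarrow> real. smooth_on (\<phi> ` U) \<rho> \<and> (\<forall>v\<in>\<phi> ` U. \<rho> v > 0) \<and>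
        (\<forall>B\<in>sets borel. B \<subseteq> U \<inter> interior_M G \<longrightarrow>
           emeasure (dens G) B =
             (\<integral>\<^sup>+v\<in>\<phi> ` B. ennreal (\<rho> v / bdf G (inv_into U \<phi> v)) \<partial>lborel))) \<and>
     sets (densY G) = sets (restrict_space borel (bd G)) \<and>
     (\<forall>(U, \<phi>)\<in>charts G. \<exists>\<rho> :: 'n pt \<Rightarrow> real. smooth_on (\<phi> ` (U \<inter> bd G)) \<rho> \<and>
        (\<forall>v\<in>\<phi> ` (U \<inter> bd G). \<rho> v > 0) \<and>
        (\<forall>B\<in>sets borel. B \<subseteq> U \<inter> bd G \<longrightarrow>
           emeasure (densY G) B =
             (\<integral>\<^sup>+v\<in>{v. v $ xi \<in> {0<..<1} \<and> base_pt v \<in> \<phi> ` B}. ennreal (\<rho> (base_pt v)) \<partial>lborel))) \<and>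
     (\<forall>B\<in>sets (borel \<Otimes>\<^sub>M densY G). B \<subseteq> {0<..<width G} \<times> bd G \<longrightarrow>
        emeasure (dens G) (collar G ` B) =
          emeasure (density lborel (\<lambda>x. ennreal (1 / x)) \<Otimes>\<^sub>M densY G) B)"

definition cone_geometry :: "('a::{t2_space,second_countable_topology}, 'n::{finite,linorder}, 'f::ab_group_add, 'r::finite) cone_data \<Rightarrow> bool" where
  "cone_geometry G \<longleftrightarrow> compact_manifold_with_boundary G \<and> hermitian_bundle G \<and>
     hermitian_connection G \<and> collar_structure G \<and> densities G"

text \<open>Parallel transport of \<open>v \<in> E\<^sub>y\<close> along \<open>t \<mapsto> collar (t, y)\<close>, and the resulting identification
  of sections of \<open>E\<close> over the collar with sections of the pull-back of \<open>E|\<^sub>Y\<close>.\<close>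

definition transport :: "('a::{t2_space,second_countable_topology}, 'n::{finite,linorder}, 'f::ab_group_add, 'r::finite) cone_data
    \<Rightarrow> 'a \<Rightarrow> 'f \<Rightarrow> real \<Rightarrow> 'f" where
  "transport G y v = (SOME w. w 0 = v \<and> (\<forall>t\<in>{0..<width G}. w t \<in> fib G (collar G (t, y))) \<and>
     parallel_along G (\<lambda>t. collar G (t, y)) {0..<width G} w)"

definition pullback :: "('a::{t2_space,second_countable_topology}, 'n::{finite,linorder}, 'f::ab_group_add, 'r::finite) cone_data
    \<Rightarrow> ('a \<Rightarrow> 'f) \<Rightarrow> ('a, 'f) csec" where
  "pullback G u = (\<lambda>(t, y). THE v. v \<in> fib G y \<and> transport G y v t = u (collar G (t, y)))"

section \<open>Cone operators\<close>

text \<open>\<open>P = x\<^sup>m A\<close>.\<close>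

definition x_pow_times :: "('a::{t2_space,second_countable_topology}, 'n::{finite,linorder}, 'f::ab_group_add, 'r::finite) cone_data
    \<Rightarrow> nat \<Rightarrow> (('a \<Rightarrow> 'f) \<Rightarrow> 'a \<Rightarrow> 'f) \<Rightarrow> ('a \<Rightarrow> 'f) \<Rightarrow> 'a \<Rightarrow> 'f" where
  "x_pow_times G m A u p = scl G (of_real (bdf G p ^ m)) (A u p)"

definition interior_coeffs :: "('a::{t2_space,second_countable_topology}, 'n::{finite,linorder}, 'f::ab_group_add, 'r::finite) cone_data
    \<Rightarrow> nat \<Rightarrow> (('a \<Rightarrow> 'f) \<Rightarrow> 'a \<Rightarrow> 'f) \<Rightarrow> 'a set \<times> ('a \<Rightarrow> 'n pt) \<Rightarrow> 'a set \<times> ('r \<Rightarrow> 'a \<Rightarrow> 'f)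
    \<Rightarrow> (('n \<Rightarrow> nat) \<Rightarrow> 'n pt \<Rightarrow> 'r cmat) \<Rightarrow> bool" where
  "interior_coeffs G m P = (\<lambda>(U, \<phi>) (W, e) a.
     (\<forall>\<alpha>. sum \<alpha> UNIV \<le> m \<longrightarrow> smooth_on (\<phi> ` (U \<inter> W \<inter> interior_M G)) (a \<alpha>)) \<and>
     (\<forall>u\<in>smooth_sections G (interior_M G). \<forall>p\<in>U \<inter> W \<inter> interior_M G.
        coords G e p (P u p) =
          (\<Sum>\<alpha> | sum \<alpha> UNIV \<le> m. a \<alpha> (\<phi> p) *v
             Dmulti \<alpha> (\<lambda>v. coords G e (inv_into U \<phi> v) (u (inv_into U \<phi> v))) (\<phi> p))))"

definition cyl_rep :: "('a::{t2_space,second_countable_topology}, 'n::{finite,linorder}, 'f::ab_group_add, 'r::finite) cone_data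
    \<Rightarrow> 'a set \<times> ('a \<Rightarrow> 'n pt) \<Rightarrow> ('r \<Rightarrow> 'a \<Rightarrow> 'f) \<Rightarrow> ('a, 'f) csec \<Rightarrow> 'n pt \<Rightarrow> 'r cvec" where
  "cyl_rep G = (\<lambda>(U, \<phi>) e u v. coords G e (snd (cyl_inv G U \<phi> v)) (u (cyl_inv G U \<phi> v)))"

definition cone_coeffs :: "('a::{t2_space,second_countable_topology}, 'n::{finite,linorder}, 'f::ab_group_add, 'r::finite) cone_data
    \<Rightarrow> nat \<Rightarrow> (('a \<Rightarrow> 'f) \<Rightarrow> 'a \<Rightarrow> 'f) \<Rightarrow> 'a set \<times> ('a \<Rightarrow> 'n pt) \<Rightarrow> 'a set \<times> ('r \<Rightarrow> 'a \<Rightarrow> 'f)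
    \<Rightarrow> (('n \<Rightarrow> nat) \<Rightarrow> 'n pt \<Rightarrow> 'r cmat) \<Rightarrow> bool" where
  "cone_coeffs G m P = (\<lambda>(U, \<phi>) (W, e) a.
     (\<forall>\<alpha>. sum \<alpha> UNIV \<le> m \<longrightarrow> smooth_on (cyl \<phi> ` ({0..<width G} \<times> (U \<inter> W \<inter> bd G))) (a \<alpha>)) \<and>
     (\<forall>u\<in>smooth_sections G (interior_M G). \<forall>t\<in>{0<..<width G}. \<forall>y\<in>U \<inter> W \<inter> bd G.
        coords G e y (pullback G (P u) (t, y)) =
          (\<Sum>\<alpha> | sum \<alpha> UNIV \<le> m. a \<alpha> (cyl \<phi> (t, y)) *v
             bDmulti \<alpha> (cyl_rep G (U, \<phi>) e (pullback G u)) (cyl \<phi> (t, y)))))"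

definition cone_operator :: "('a::{t2_space,second_countable_topology}, 'n::{finite,linorder}, 'f::ab_group_add, 'r::finite) cone_data
    \<Rightarrow> nat \<Rightarrow> (('a \<Rightarrow> 'f) \<Rightarrow> 'a \<Rightarrow> 'f) \<Rightarrow> bool" where
  "cone_operator G m A \<longleftrightarrow>
     (\<forall>u\<in>smooth_sections G (interior_M G). \<forall>p\<in>interior_M G. A u p \<in> fib G p) \<and>
     (\<forall>C\<in>charts G. \<forall>F\<in>frames G.
        (\<exists>a. interior_coeffs G m (x_pow_times G m A) C F a) \<and>
        (\<exists>a. cone_coeffs G m (x_pow_times G m A) C F a))"

text \<open>The coefficients are determined by the operator, so quantifying over all of them is harmless.\<close>

definition c_elliptic :: "('a::{t2_space,second_countable_topology}, 'n::{finite,linorder}, 'f::ab_group_add, 'r::finite) cone_data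
    \<Rightarrow> nat \<Rightarrow> (('a \<Rightarrow> 'f) \<Rightarrow> 'a \<Rightarrow> 'f) \<Rightarrow> bool" where
  "c_elliptic G m A \<longleftrightarrow>
     (\<forall>(U, \<phi>)\<in>charts G. \<forall>(W, e)\<in>frames G. \<forall>a.
        (interior_coeffs G m (x_pow_times G m A) (U, \<phi>) (W, e) a \<longrightarrow>
          (\<forall>v\<in>\<phi> ` (U \<inter> W \<inter> interior_M G). \<forall>\<zeta>. \<zeta> \<noteq> 0 \<longrightarrow>
             invertible (symbol_matrix m (\<lambda>\<alpha>. a \<alpha> v) \<zeta>))) \<and>
        (cone_coeffs G m (x_pow_times G m A) (U, \<phi>) (W, e) a \<longrightarrow>
          (\<forall>v\<in>cyl \<phi> ` ({0..<width G} \<times> (U \<inter> W \<inter> bd G)). \<forall>\<zeta>. \<zeta> \<noteq> 0 \<longrightarrow>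
             invertible (symbol_matrix m (\<lambda>\<alpha>. a \<alpha> v) \<zeta>))))"

section \<open>The model operator\<close>

text \<open>Sections over the open cone \<open>(0, \<infinity>) \<times> Y\<close> are functions on \<^typ>\<open>real \<times> 'a\<close>; their values outside
  \<open>(0, \<infinity>) \<times> Y\<close> are irrelevant.\<close>

definition cone_smooth_sections :: "('a::{t2_space,second_countable_topology}, 'n::{finite,linorder}, 'f::ab_group_add, 'r::finite) cone_data
    \<Rightarrow> ('a, 'f) csec set" where
  "cone_smooth_sections G = {u. (\<forall>t>0. \<forall>y\<in>bd G. u (t, y) \<in> fib G y) \<and>
     (\<forall>(U, \<phi>)\<in>charts G. \<forall>(W, e)\<in>frames G.
        smooth_on (cyl \<phi> ` ({0<..} \<times> (U \<inter> W \<inter> bd G))) (cyl_rep G (U, \<phi>) e u))}"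

definition cone_test_sections :: "('a::{t2_space,second_countable_topology}, 'n::{finite,linorder}, 'f::ab_group_add, 'r::finite) cone_data
    \<Rightarrow> ('a, 'f) csec set" where
  "cone_test_sections G = {u \<in> cone_smooth_sections G.
     \<exists>K. compact K \<and> K \<subseteq> {0<..} \<times> bd G \<and> (\<forall>z\<in>({0<..} \<times> bd G) - K. u z = 0)}"

definition model_operator :: "('a::{t2_space,second_countable_topology}, 'n::{finite,linorder}, 'f::ab_group_add, 'r::finite) cone_data
    \<Rightarrow> nat \<Rightarrow> (('a \<Rightarrow> 'f) \<Rightarrow> 'a \<Rightarrow> 'f) \<Rightarrow> (('a, 'f) csec \<Rightarrow> ('a, 'f) csec) \<Rightarrow> bool" where
  "model_operator G m A Aw \<longleftrightarrow>
     (\<forall>u\<in>cone_smooth_sections G. \<forall>t>0.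
        (\<forall>y\<in>bd G. Aw u (t, y) \<in> fib G y) \<and>
        (\<forall>(U, \<phi>)\<in>charts G. \<forall>(W, e)\<in>frames G. \<forall>a.
           cone_coeffs G m (x_pow_times G m A) (U, \<phi>) (W, e) a \<longrightarrow>
           (\<forall>y\<in>U \<inter> W \<inter> bd G.
              coords G e y (Aw u (t, y)) = complex_of_real (1 / t ^ m) *s
                (\<Sum>\<alpha> | sum \<alpha> UNIV \<le> m. a \<alpha> (cyl \<phi> (0, y)) *v
                   bDmulti \<alpha> (cyl_rep G (U, \<phi>) e u) (cyl \<phi> (t, y))))))"

subsection \<open>The Hilbert space\<close>

text \<open>Elements of \<open>x\<^sup>-\<^sup>m\<^sup>/\<^sup>2 L\<^sup>2\<^sub>b\<close> are represented by sections; equality almost everywhere is made explicit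
  where it matters.  All domains below contain the null sections.\<close>

definition cone_measure :: "('a::{t2_space,second_countable_topology}, 'n::{finite,linorder}, 'f::ab_group_add, 'r::finite) cone_data
    \<Rightarrow> nat \<Rightarrow> (real \<times> 'a) measure" where
  "cone_measure G m =
     density (restrict_space lborel {0<..}) (\<lambda>x. ennreal (x ^ m * (1 / x))) \<Otimes>\<^sub>M densY G"

definition L2 :: "('a::{t2_space,second_countable_topology}, 'n::{finite,linorder}, 'f::ab_group_add, 'r::finite) cone_data
    \<Rightarrow> nat \<Rightarrow> ('a, 'f) csec set" where
  "L2 G m = {u. (\<forall>t>0. \<forall>y\<in>bd G. u (t, y) \<in> fib G y) \<and>
     (\<forall>(W, e)\<in>frames G. (\<lambda>z. coords G e (snd z) (u z))
        \<in> borel_measurable (restrict_space (cone_measure G m) ({0<..} \<times> (W \<inter> bd G)))) \<and>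
     integrable (cone_measure G m) (\<lambda>z. Re (herm G (snd z) (u z) (u z)))}"

definition ip :: "('a::{t2_space,second_countable_topology}, 'n::{finite,linorder}, 'f::ab_group_add, 'r::finite) cone_data
    \<Rightarrow> nat \<Rightarrow> ('a, 'f) csec \<Rightarrow> ('a, 'f) csec \<Rightarrow> complex" where
  "ip G m u v = (\<integral>z. herm G (snd z) (u z) (v z) \<partial>cone_measure G m)"

definition L2norm :: "('a::{t2_space,second_countable_topology}, 'n::{finite,linorder}, 'f::ab_group_add, 'r::finite) cone_data
    \<Rightarrow> nat \<Rightarrow> ('a, 'f) csec \<Rightarrow> real" where
  "L2norm G m u = sqrt (Re (ip G m u u))"

definition eq_ae :: "('a::{t2_space,second_countable_topology}, 'n::{finite,linorder}, 'f::ab_group_add, 'r::finite) cone_data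
    \<Rightarrow> nat \<Rightarrow> ('a, 'f) csec \<Rightarrow> ('a, 'f) csec \<Rightarrow> bool" where
  "eq_ae G m u v \<longleftrightarrow> (AE z in cone_measure G m. u z = v z)"

definition sscl :: "('a::{t2_space,second_countable_topology}, 'n::{finite,linorder}, 'f::ab_group_add, 'r::finite) cone_data
    \<Rightarrow> complex \<Rightarrow> ('a, 'f) csec \<Rightarrow> ('a, 'f) csec" where
  "sscl G c u = (\<lambda>z. scl G c (u z))"

definition kappa :: "('a::{t2_space,second_countable_topology}, 'n::{finite,linorder}, 'f::ab_group_add, 'r::finite) cone_data
    \<Rightarrow> nat \<Rightarrow> real \<Rightarrow> ('a, 'f) csec \<Rightarrow> ('a, 'f) csec" where
  "kappa G m \<rho> u = (\<lambda>(x, y). scl G (of_real (\<rho> powr (real m / 2))) (u (\<rho> * x, y)))"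

subsection \<open>Closed extensions\<close>

text \<open>In the definitions below \<open>B\<close> is a differential operator on \<open>(0, \<infinity>) \<times> Y\<close>, such as the model
  operator.  \<open>weak_eq G m B u f\<close> says that \<open>u, f\<close> are in \<open>L\<^sup>2\<close> and \<open>B u = f\<close> in the sense of
  distributions: \<open>(f, \<phi>) = (u, B\<^sup>\<star> \<phi>)\<close> for all test sections \<open>\<phi>\<close>, where \<open>\<psi> = B\<^sup>\<star> \<phi>\<close> is the formal adjoint,
  characterised by \<open>(B \<eta>, \<phi>) = (\<eta>, \<psi>)\<close> for all test sections \<open>\<eta>\<close>.\<close>

definition weak_eq :: "('a::{t2_space,second_countable_topology}, 'n::{finite,linorder}, 'f::ab_group_add, 'r::finite) cone_data
    \<Rightarrow> nat \<Rightarrow> (('a, 'f) csec \<Rightarrow> ('a, 'f) csec) \<Rightarrow> ('a, 'f) csec \<Rightarrow> ('a, 'f) csec \<Rightarrow> bool" where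
  "weak_eq G m B u f \<longleftrightarrow> u \<in> L2 G m \<and> f \<in> L2 G m \<and>
     (\<forall>\<phi>\<in>cone_test_sections G. \<forall>\<psi>\<in>cone_test_sections G.
        (\<forall>\<eta>\<in>cone_test_sections G. ip G m (B \<eta>) \<phi> = ip G m \<eta> \<psi>) \<longrightarrow> ip G m f \<phi> = ip G m u \<psi>)"

definition Dmax :: "('a::{t2_space,second_countable_topology}, 'n::{finite,linorder}, 'f::ab_group_add, 'r::finite) cone_data
    \<Rightarrow> nat \<Rightarrow> (('a, 'f) csec \<Rightarrow> ('a, 'f) csec) \<Rightarrow> ('a, 'f) csec set" where
  "Dmax G m B = {u. \<exists>f. weak_eq G m B u f}"

definition Amax :: "('a::{t2_space,second_countable_topology}, 'n::{finite,linorder}, 'f::ab_group_add, 'r::finite) cone_data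
    \<Rightarrow> nat \<Rightarrow> (('a, 'f) csec \<Rightarrow> ('a, 'f) csec) \<Rightarrow> ('a, 'f) csec \<Rightarrow> ('a, 'f) csec" where
  "Amax G m B u = (SOME f. weak_eq G m B u f)"

definition Dmin :: "('a::{t2_space,second_countable_topology}, 'n::{finite,linorder}, 'f::ab_group_add, 'r::finite) cone_data
    \<Rightarrow> nat \<Rightarrow> (('a, 'f) csec \<Rightarrow> ('a, 'f) csec) \<Rightarrow> ('a, 'f) csec set" where
  "Dmin G m B = {u \<in> L2 G m. \<exists>f\<in>L2 G m. \<forall>\<epsilon>>0. \<exists>\<phi>\<in>cone_test_sections G.
     L2norm G m (u - \<phi>) < \<epsilon> \<and> L2norm G m (f - B \<phi>) < \<epsilon>}"

definition graph_ip :: "('a::{t2_space,second_countable_topology}, 'n::{finite,linorder}, 'f::ab_group_add, 'r::finite) cone_data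
    \<Rightarrow> nat \<Rightarrow> (('a, 'f) csec \<Rightarrow> ('a, 'f) csec) \<Rightarrow> ('a, 'f) csec \<Rightarrow> ('a, 'f) csec \<Rightarrow> complex" where
  "graph_ip G m B u v = ip G m (Amax G m B u) (Amax G m B v) + ip G m u v"

definition graph_norm :: "('a::{t2_space,second_countable_topology}, 'n::{finite,linorder}, 'f::ab_group_add, 'r::finite) cone_data
    \<Rightarrow> nat \<Rightarrow> (('a, 'f) csec \<Rightarrow> ('a, 'f) csec) \<Rightarrow> ('a, 'f) csec \<Rightarrow> real" where
  "graph_norm G m B u = sqrt (Re (graph_ip G m B u u))"

definition Emax :: "('a::{t2_space,second_countable_topology}, 'n::{finite,linorder}, 'f::ab_group_add, 'r::finite) cone_data
    \<Rightarrow> nat \<Rightarrow> (('a, 'f) csec \<Rightarrow> ('a, 'f) csec) \<Rightarrow> ('a, 'f) csec set" where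
  "Emax G m B = {u \<in> Dmax G m B. \<forall>v\<in>Dmin G m B. graph_ip G m B u v = 0}"

text \<open>The projection on \<open>K\<close> along \<open>D\<close>; the value is determined up to null sections.\<close>

definition proj_along :: "('p \<Rightarrow> 'f::ab_group_add) set \<Rightarrow> ('p \<Rightarrow> 'f) set \<Rightarrow> ('p \<Rightarrow> 'f) \<Rightarrow> 'p \<Rightarrow> 'f" where
  "proj_along K D u = (SOME k. k \<in> K \<and> u - k \<in> D)"

definition pi_max :: "('a::{t2_space,second_countable_topology}, 'n::{finite,linorder}, 'f::ab_group_add, 'r::finite) cone_data
    \<Rightarrow> nat \<Rightarrow> (('a, 'f) csec \<Rightarrow> ('a, 'f) csec) \<Rightarrow> ('a, 'f) csec \<Rightarrow> ('a, 'f) csec" where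
  "pi_max G m B = proj_along (Emax G m B) (Dmin G m B)"

definition domains :: "('a::{t2_space,second_countable_topology}, 'n::{finite,linorder}, 'f::ab_group_add, 'r::finite) cone_data
    \<Rightarrow> nat \<Rightarrow> (('a, 'f) csec \<Rightarrow> ('a, 'f) csec) \<Rightarrow> ('a, 'f) csec set set" where
  "domains G m B = {D. module.subspace (sscl G) D \<and> Dmin G m B \<subseteq> D \<and> D \<subseteq> Dmax G m B}"

definition A_minus :: "('a::{t2_space,second_countable_topology}, 'n::{finite,linorder}, 'f::ab_group_add, 'r::finite) cone_data
    \<Rightarrow> nat \<Rightarrow> (('a, 'f) csec \<Rightarrow> ('a, 'f) csec) \<Rightarrow> complex \<Rightarrow> ('a, 'f) csec \<Rightarrow> ('a, 'f) csec" where
  "A_minus G m B \<mu> u = Amax G m B u - sscl G \<mu> u"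

definition ker_on :: "('a::{t2_space,second_countable_topology}, 'n::{finite,linorder}, 'f::ab_group_add, 'r::finite) cone_data
    \<Rightarrow> nat \<Rightarrow> (('a, 'f) csec \<Rightarrow> ('a, 'f) csec) \<Rightarrow> ('a, 'f) csec set \<Rightarrow> complex \<Rightarrow> ('a, 'f) csec set" where
  "ker_on G m B D \<mu> = {u \<in> D. eq_ae G m (A_minus G m B \<mu> u) 0}"

definition range_on :: "('a::{t2_space,second_countable_topology}, 'n::{finite,linorder}, 'f::ab_group_add, 'r::finite) cone_data
    \<Rightarrow> nat \<Rightarrow> (('a, 'f) csec \<Rightarrow> ('a, 'f) csec) \<Rightarrow> ('a, 'f) csec set \<Rightarrow> complex \<Rightarrow> ('a, 'f) csec set" where
  "range_on G m B D \<mu> = {f \<in> L2 G m. \<exists>u\<in>D. eq_ae G m (A_minus G m B \<mu> u) f}"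

definition null_sections :: "('a::{t2_space,second_countable_topology}, 'n::{finite,linorder}, 'f::ab_group_add, 'r::finite) cone_data
    \<Rightarrow> nat \<Rightarrow> ('a, 'f) csec set" where
  "null_sections G m = {u \<in> L2 G m. eq_ae G m u 0}"

subsection \<open>Resolvent, background resolvent set, index\<close>

definition resolvent :: "('a::{t2_space,second_countable_topology}, 'n::{finite,linorder}, 'f::ab_group_add, 'r::finite) cone_data
    \<Rightarrow> nat \<Rightarrow> (('a, 'f) csec \<Rightarrow> ('a, 'f) csec) \<Rightarrow> ('a, 'f) csec set \<Rightarrow> complex
    \<Rightarrow> ('a, 'f) csec \<Rightarrow> ('a, 'f) csec" where
  "resolvent G m B D \<mu> f = (SOME u. u \<in> D \<and> eq_ae G m (A_minus G m B \<mu> u) f)"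

definition res_set :: "('a::{t2_space,second_countable_topology}, 'n::{finite,linorder}, 'f::ab_group_add, 'r::finite) cone_data
    \<Rightarrow> nat \<Rightarrow> (('a, 'f) csec \<Rightarrow> ('a, 'f) csec) \<Rightarrow> ('a, 'f) csec set \<Rightarrow> complex set" where
  "res_set G m B D = {\<mu>. ker_on G m B D \<mu> = null_sections G m \<and> range_on G m B D \<mu> = L2 G m \<and>
     (\<exists>C. \<forall>f\<in>L2 G m. L2norm G m (resolvent G m B D \<mu> f) \<le> C * L2norm G m f)}"

definition spec :: "('a::{t2_space,second_countable_topology}, 'n::{finite,linorder}, 'f::ab_group_add, 'r::finite) cone_data
    \<Rightarrow> nat \<Rightarrow> (('a, 'f) csec \<Rightarrow> ('a, 'f) csec) \<Rightarrow> ('a, 'f) csec set \<Rightarrow> complex set" where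
  "spec G m B D = - res_set G m B D"

definition bg_spec :: "('a::{t2_space,second_countable_topology}, 'n::{finite,linorder}, 'f::ab_group_add, 'r::finite) cone_data
    \<Rightarrow> nat \<Rightarrow> (('a, 'f) csec \<Rightarrow> ('a, 'f) csec) \<Rightarrow> complex set" where
  "bg_spec G m B = (\<Inter>D\<in>domains G m B. spec G m B D)"

definition bg_res :: "('a::{t2_space,second_countable_topology}, 'n::{finite,linorder}, 'f::ab_group_add, 'r::finite) cone_data
    \<Rightarrow> nat \<Rightarrow> (('a, 'f) csec \<Rightarrow> ('a, 'f) csec) \<Rightarrow> complex set" where
  "bg_res G m B = - bg_spec G m B"

text \<open>\<open>V/W\<close> has finite dimension \<open>n\<close>: \<open>V\<close> is the direct sum of \<open>W\<close> and an \<open>n\<close>-dimensional space.\<close>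

definition quotient_dim :: "('a::{t2_space,second_countable_topology}, 'n::{finite,linorder}, 'f::ab_group_add, 'r::finite) cone_data
    \<Rightarrow> ('a, 'f) csec set \<Rightarrow> ('a, 'f) csec set \<Rightarrow> nat \<Rightarrow> bool" where
  "quotient_dim G V W n \<longleftrightarrow> (\<exists>S. finite S \<and> card S = n \<and> \<not> module.dependent (sscl G) S \<and>
     module.span (sscl G) S \<inter> W = {0} \<and> V = {s + w |s w. s \<in> module.span (sscl G) S \<and> w \<in> W})"

text \<open>\<open>B - \<mu>\<close> with domain \<open>D\<close> is Fredholm of index \<open>k\<close>.\<close>

definition fredholm_index :: "('a::{t2_space,second_countable_topology}, 'n::{finite,linorder}, 'f::ab_group_add, 'r::finite) cone_data
    \<Rightarrow> nat \<Rightarrow> (('a, 'f) csec \<Rightarrow> ('a, 'f) csec) \<Rightarrow> ('a, 'f) csec set \<Rightarrow> complex \<Rightarrow> int \<Rightarrow> bool" where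
  "fredholm_index G m B D \<mu> k \<longleftrightarrow> (\<exists>p q. quotient_dim G (ker_on G m B D \<mu>) (null_sections G m) p \<and>
     quotient_dim G (L2 G m) (range_on G m B D \<mu>) q \<and> k = int p - int q)"

text \<open>The domains \<open>D\<close> with \<open>dim D/D\<^sub>m\<^sub>i\<^sub>n = - ind (A\<^sub>m\<^sub>i\<^sub>n - \<mu>)\<close> for \<open>\<mu> \<in> \<Omega>\<close>, \<open>\<Omega>\<close> a component of the background
  resolvent set.\<close>

definition index_domains :: "('a::{t2_space,second_countable_topology}, 'n::{finite,linorder}, 'f::ab_group_add, 'r::finite) cone_data
    \<Rightarrow> nat \<Rightarrow> (('a, 'f) csec \<Rightarrow> ('a, 'f) csec) \<Rightarrow> complex set \<Rightarrow> ('a, 'f) csec set set" where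
  "index_domains G m B \<Omega> = {D \<in> domains G m B. \<exists>d. quotient_dim G D (Dmin G m B) d \<and>
     (\<forall>\<mu>\<in>\<Omega>. fredholm_index G m B (Dmin G m B) \<mu> (- int d))}"

subsection \<open>Sectors of minimal growth\<close>

definition closed_sector :: "complex set \<Rightarrow> bool" where
  "closed_sector \<Lambda> \<longleftrightarrow> (\<exists>\<theta>\<^sub>0 a. a \<ge> 0 \<and> \<Lambda> = {of_real r * cis \<theta> |r \<theta>. r \<ge> 0 \<and> \<bar>\<theta> - \<theta>\<^sub>0\<bar> \<le> a})"

definition outer_part :: "complex set \<Rightarrow> real \<Rightarrow> complex set" where
  "outer_part \<Lambda> R = {\<mu>\<in>\<Lambda>. norm \<mu> \<ge> R}"

definition minimal_growth :: "('a::{t2_space,second_countable_topology}, 'n::{finite,linorder}, 'f::ab_group_add, 'r::finite) cone_data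
    \<Rightarrow> nat \<Rightarrow> (('a, 'f) csec \<Rightarrow> ('a, 'f) csec) \<Rightarrow> ('a, 'f) csec set \<Rightarrow> complex set \<Rightarrow> bool" where
  "minimal_growth G m B D \<Lambda> \<longleftrightarrow> (\<exists>R>0. outer_part \<Lambda> R \<subseteq> res_set G m B D \<and>
     (\<exists>C>0. \<forall>\<mu>\<in>outer_part \<Lambda> R. \<forall>f\<in>L2 G m.
        L2norm G m (resolvent G m B D \<mu> f) \<le> C / norm \<mu> * L2norm G m f))"

end

theory Submission
  imports Defs
begin

text \<open>For \<open>\<rho>\<^sup>m = |\<lambda>|\<close>, conjugation with \<open>\<kappa>\<^sub>\<rho>\<close> turns \<open>A\<^sub>D - \<lambda>\<close> into \<open>|\<lambda>|\<close> times \<open>A\<^sub>E - \<mu>\<close>, where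
  \<open>E = \<kappa>\<^sub>\<rho>\<^sup>-\<^sup>1 D\<close> and \<open>\<mu> = \<lambda> / |\<lambda>|\<close>. So minimal growth means that the inverses of \<open>A\<^sub>E - \<mu>\<close> are bounded on
  \<open>L\<^sup>2\<close> uniformly, and \<open>\<mu>\<close> runs through a compact arc.

  The projection on the kernel along \<open>E\<close> is \<open>u \<mapsto> u - (A\<^sub>E - \<mu>)\<^sup>-\<^sup>1 (A - \<mu>) u\<close>, hence a bound on the inverse
  bounds it in the graph norm. Conversely, near a point \<open>\<nu>\<close> of the arc fix a domain \<open>W\<close> with \<open>\<nu>\<close> in its
  resolvent set. Given \<open>f\<close>, put \<open>w = (A\<^sub>W - \<nu>)\<^sup>-\<^sup>1 f\<close> and let \<open>k\<close> be the projection of \<open>\<pi>\<^sub>m\<^sub>a\<^sub>x w\<close> on the kernel of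
  \<open>A - \<mu>\<close> along \<open>E\<close>. Then \<open>w - k\<close> is in \<open>E\<close> and solves \<open>(A - \<mu>) (w - k) = f - (\<mu> - \<nu>) w\<close>, an error that can be
  absorbed. The hypothesis bounds only \<open>\<pi>\<^sub>m\<^sub>a\<^sub>x k\<close>, but the rest of \<open>k\<close> is in the minimal domain, where
  \<open>A - \<mu>\<close> is bounded below because \<open>A - \<nu>\<close> is. Finitely many \<open>\<nu>\<close> suffice by compactness.

  That the weakly defined maximal operator is single-valued rests on a
  formal adjoint for test sections supported in a chart, obtained by integration by parts, and on the
  lemma of du Bois-Reymond. The existence of \<open>\<pi>\<^sub>m\<^sub>a\<^sub>x\<close> rests on the completeness of \<open>L\<^sup>2\<close>.\<close>

section \<open>Smooth maps\<close>

text \<open>Sections are functions, not classes, and \<open>Amax\<close>, \<open>resolvent\<close>,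
  \<open>proj_along\<close> and \<open>pi_max\<close> are choices. Identities about them therefore
  take the form \<open>N (u - v) = 0\<close>, and estimates may use only the defining properties of
  the chosen values. This is why the abstract part works with semi-inner products on subsets, and
  why the resolvent set is used through \<open>onto\<close> and \<open>below\<close>, which do not
  see null sections. The hypothesis bounds the projection on \<open>Emax\<close> only. This suffices
  because \<open>w\<close> and its component in \<open>Emax\<close> differ by an element of the
  minimal domain, which lies in every domain \<open>E\<close>; so a projection of the component
  along \<open>E\<close> is also one of \<open>w\<close>. The bound of the inverse that is available
  at a single \<lambda> may depend on \<lambda>: it can start the absorption argument but must
  disappear from its result. \<open>weak_eq\<close> tests with formally adjoint pairs of test
  sections, so it determines \<open>f\<close> only if enough test sections have such a partner.
  Partners for sections supported in one chart are enough, since vanishing almost everywhere is a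
  local property.\<close>

lemma Ck_SucD:
  assumes "Ck (Suc k) S f" "x \<in> S"
  shows "(f has_derivative frechet_derivative f (at x)) (at x)"
  using assms frechet_derivative_works by auto

lemma Ck_Suc_imp: "Ck (Suc k) S f \<Longrightarrow> Ck k S f"
proof (induction k arbitrary: f)
  case 0
  then show ?case
    by (auto intro!: continuous_at_imp_continuous_on differentiable_imp_continuous_within)
next
  case (Suc k)
  from Suc.prems show ?case using Suc.IH by (metis Ck.simps(2))
qed

lemma Ck_subset: "Ck k S f \<Longrightarrow> T \<subseteq> S \<Longrightarrow> Ck k T f"
proof (induction k arbitrary: f)
  case 0
  then show ?case by (auto intro: continuous_on_subset)
next
  case (Suc k)
  then show ?case by auto
qed

text \<open>The derivative in \<open>Ck\<close> is taken in the whole space, so it is determined by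
  the values on \<open>S\<close> only because \<open>S\<close> is a neighbourhood of each of its
  points.\<close>

lemma Ck_cong:
  assumes "open S" "\<And>x. x \<in> S \<Longrightarrow> f x = g x"
  shows "Ck k S f \<longleftrightarrow> Ck k S g"
proof -
  have *: "Ck k S g" if "Ck k S f" "\<And>x. x \<in> S \<Longrightarrow> f x = g x" for f g k
    using that
  proof (induction k arbitrary: f g)
    case 0
    then show ?case by (auto cong: continuous_on_cong)
  next
    case (Suc k)
    have d: "(g has_derivative frechet_derivative f (at x)) (at x)" if "x \<in> S" for x
      using has_derivative_transform_within_open[OF Ck_SucD[OF Suc.prems(1) that] \<open>open S\<close> that]
        Suc.prems(2) by blast
    then have "frechet_derivative g (at x) = frechet_derivative f (at x)" if "x \<in> S" for x
      using that frechet_derivative_at by metis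
    moreover have "Ck k S (\<lambda>x. frechet_derivative f (at x) v)" for v
      using Suc.prems(1) by simp
    ultimately have "Ck k S (\<lambda>x. frechet_derivative g (at x) v)" for v
      using Suc.IH[of "\<lambda>x. frechet_derivative f (at x) v" "\<lambda>x. frechet_derivative g (at x) v"] by simp
    then show ?case using d by (auto intro: differentiableI)
  qed
  then show ?thesis using assms(2) by metis
qed

text \<open>\<open>frechet_derivative\<close> is a choice, unique where a derivative exists; this
  lets an explicit formula \<open>f'\<close> take its place.\<close>

lemma Ck_SucI:
  assumes "open S" "\<And>x. x \<in> S \<Longrightarrow> (f has_derivative f' x) (at x)" "\<And>v. Ck k S (\<lambda>x. f' x v)"
  shows "Ck (Suc k) S f"
proof -
  have "frechet_derivative f (at x) = f' x" if "x \<in> S" for x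
    using assms(2)[OF that] frechet_derivative_at by metis
  then have "Ck k S (\<lambda>x. frechet_derivative f (at x) v)" for v
    using assms(3)[of v] Ck_cong[OF assms(1), of "\<lambda>x. frechet_derivative f (at x) v"] by simp
  then show ?thesis using assms(2) by (auto intro: differentiableI)
qed

lemma Ck_local:
  assumes "\<And>x. x \<in> S \<Longrightarrow> \<exists>W. open W \<and> x \<in> W \<and> Ck k W f"
  shows "Ck k S f"
  using assms
proof (induction k arbitrary: f)
  case 0
  then show ?case
    by (metis Ck.simps(1) continuous_at_imp_continuous_on continuous_on_eq_continuous_at)
next
  case (Suc k)
  then show ?case by (metis Ck.simps(2))
qed

lemma Ck_const: "open S \<Longrightarrow> Ck k S (\<lambda>x. c)"
proof (induction k arbitrary: c)
  case (Suc k)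
  show ?case by (rule Ck_SucI[where f' = "\<lambda>x h. 0"]) (use Suc in auto)
qed auto

lemma Ck_linear:
  assumes "open S" "bounded_linear f"
  shows "Ck k S f"
proof (cases k)
  case 0
  then show ?thesis using assms(2) by (auto intro: linear_continuous_on)
next
  case (Suc j)
  then show ?thesis using assms
    by (auto intro!: Ck_SucI[where f' = "\<lambda>x. f"] bounded_linear_imp_has_derivative Ck_const
        simp del: Ck.simps)
qed

lemma Ck_add: "open S \<Longrightarrow> Ck k S f \<Longrightarrow> Ck k S g \<Longrightarrow> Ck k S (\<lambda>x. f x + g x)"
proof (induction k arbitrary: f g)
  case 0
  then show ?case by (auto intro: continuous_intros)
next
  case (Suc k)
  show ?case
    by (rule Ck_SucI[OF Suc.prems(1) has_derivative_add[OF Ck_SucD[OF Suc.prems(2)] Ck_SucD[OF Suc.prems(3)]]])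
      (use Suc in auto)
qed

lemma Ck_bilinear:
  assumes "bounded_bilinear h" "open S"
  shows "Ck k S f \<Longrightarrow> Ck k S g \<Longrightarrow> Ck k S (\<lambda>x. h (f x) (g x))"
proof (induction k arbitrary: f g)
  case 0
  then show ?case using bounded_bilinear.continuous_on[OF assms(1)] by auto
next
  case (Suc k)
  show ?case
    by (rule Ck_SucI[OF assms(2) bounded_bilinear.FDERIV[OF assms(1) Ck_SucD[OF Suc.prems(1)] Ck_SucD[OF Suc.prems(2)]]])
      (use Suc Ck_Suc_imp[OF Suc.prems(1)] Ck_Suc_imp[OF Suc.prems(2)] assms(2) in \<open>auto intro!: Ck_add\<close>)
qed

lemma Ck_sum:
  assumes "open S" "finite I" "\<And>i. i \<in> I \<Longrightarrow> Ck k S (f i)"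
  shows "Ck k S (\<lambda>x. \<Sum>i\<in>I. f i x)"
  using assms(2,3) by (induction I rule: finite_induct) (auto intro!: Ck_const Ck_add assms(1))

text \<open>The chain rule gives a derivative of \<open>f\<close> at \<open>g x\<close> in a
  direction that itself varies with \<open>x\<close>, whereas the induction hypothesis covers fixed
  directions. Expanding the direction in the basis separates the two; this is why the middle space
  is Euclidean.\<close>

lemma Ck_compose:
  fixes f :: "'b::euclidean_space \<Rightarrow> 'c::real_normed_vector" and g :: "'a::real_normed_vector \<Rightarrow> 'b"
  assumes "open S"
  shows "Ck k T f \<Longrightarrow> Ck k S g \<Longrightarrow> g ` S \<subseteq> T \<Longrightarrow> Ck k S (\<lambda>x. f (g x))"
proof (induction k arbitrary: f)
  case 0
  then show ?case by (auto intro: continuous_on_compose2)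
next
  case (Suc k)
  let ?D = "\<lambda>x v. \<Sum>b\<in>Basis. (frechet_derivative g (at x) v \<bullet> b) *\<^sub>R frechet_derivative f (at (g x)) b"
  show ?case
  proof (rule Ck_SucI[OF assms, where f' = ?D])
    fix x assume x: "x \<in> S"
    then have "g x \<in> T" using Suc.prems by auto
    note F = Ck_SucD[OF Suc.prems(1) this]
    interpret L: bounded_linear "frechet_derivative f (at (g x))"
      using F by (rule has_derivative_bounded_linear)
    have E: "frechet_derivative f (at (g x)) w = (\<Sum>b\<in>Basis. (w \<bullet> b) *\<^sub>R frechet_derivative f (at (g x)) b)" for w
      by (subst (1) euclidean_representation[of w, symmetric]) (simp only: L.sum L.scaleR)
    show "((\<lambda>x. f (g x)) has_derivative ?D x) (at x)"
      by (intro has_derivative_eq_rhs[OF has_derivative_compose[OF Ck_SucD[OF Suc.prems(2) x] F]] ext E)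
  next
    fix v
    have "Ck k S (\<lambda>x. frechet_derivative g (at x) v \<bullet> b)" for b
      using Suc.prems(2) Ck_const[OF assms]
      by (intro Ck_bilinear[OF bounded_bilinear_inner assms, of k "\<lambda>x. frechet_derivative g (at x) v" "\<lambda>_. b"]) auto
    moreover have "Ck k S (\<lambda>x. frechet_derivative f (at (g x)) b)" for b
      using Suc.IH[OF _ Ck_Suc_imp[OF Suc.prems(2)] Suc.prems(3), of "\<lambda>x. frechet_derivative f (at x) b"]
        Suc.prems(1) by simp
    ultimately show "Ck k S (\<lambda>x. ?D x v)"
      by (intro Ck_sum assms Ck_bilinear[OF bounded_bilinear_scaleR]) auto
  qed
qed

text \<open>The derivative of the reciprocal is a product of reciprocals and of the derivative of
  \<open>f\<close>, so \<open>k\<close> orders for the reciprocal yield one more.\<close>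

lemma Ck_inverse:
  fixes f :: "'a::real_normed_vector \<Rightarrow> 'b::real_normed_field"
  assumes "open S" "\<And>x. x \<in> S \<Longrightarrow> f x \<noteq> 0"
  shows "Ck k S f \<Longrightarrow> Ck k S (\<lambda>x. inverse (f x))"
proof (induction k)
  case 0
  then show ?case using assms by (auto intro!: continuous_intros)
next
  case (Suc k)
  show ?case
  proof (rule Ck_SucI[OF assms(1), where f' = "\<lambda>x h. (-1) *\<^sub>R (inverse (f x) * frechet_derivative f (at x) h * inverse (f x))"])
    fix x assume "x \<in> S"
    from Deriv.has_derivative_inverse[OF assms(2)[OF this] Ck_SucD[OF Suc.prems this]]
    show "((\<lambda>x. inverse (f x)) has_derivative (\<lambda>h. (-1) *\<^sub>R (inverse (f x) * frechet_derivative f (at x) h * inverse (f x)))) (at x)"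
      by simp
  next
    fix v
    have "Ck k S (\<lambda>x. inverse (f x))" using Suc Ck_Suc_imp by blast
    with Suc.prems show "Ck k S (\<lambda>x. (-1) *\<^sub>R (inverse (f x) * frechet_derivative f (at x) v * inverse (f x)))"
      by (intro Ck_bilinear[OF bounded_bilinear_scaleR] Ck_bilinear[OF bounded_bilinear_mult] Ck_const assms(1)) auto
  qed
qed

lemma smooth_on_open: "open S \<Longrightarrow> smooth_on S f \<longleftrightarrow> (\<forall>k. Ck k S f)"
proof
  assume S: "open S" "smooth_on S f"
  show "\<forall>k. Ck k S f"
  proof (intro allI Ck_local)
    fix k x assume "x \<in> S"
    then obtain W g where W: "open W" "x \<in> W" "Ck k W g" "\<forall>x\<in>W \<inter> S. g x = f x"
      using S(2) unfolding smooth_on_def by blast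
    then show "\<exists>W. open W \<and> x \<in> W \<and> Ck k W f"
      using Ck_cong[of "W \<inter> S" g f k] S(1) \<open>x \<in> S\<close> Ck_subset[of k W g "W \<inter> S"]
      by (metis IntI inf_le1 open_Int)
  qed
qed (auto simp: smooth_on_def)

lemma smooth_on_subset: "smooth_on S f \<Longrightarrow> T \<subseteq> S \<Longrightarrow> smooth_on T f"
  unfolding smooth_on_def by (meson IntD1 IntD2 IntI subsetD)

lemma smooth_on_cong: "(\<And>x. x \<in> S \<Longrightarrow> f x = g x) \<Longrightarrow> smooth_on S f \<longleftrightarrow> smooth_on S g"
  unfolding smooth_on_def by (metis IntD2)

lemma smooth_on_local:
  assumes "\<And>x. x \<in> S \<Longrightarrow> \<exists>W. open W \<and> x \<in> W \<and> smooth_on (W \<inter> S) f"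
  shows "smooth_on S f"
  unfolding smooth_on_def
proof
  fix p assume "p \<in> S"
  then obtain W where W: "open W" "p \<in> W" "smooth_on (W \<inter> S) f" using assms by blast
  then obtain W' g where "open W'" "p \<in> W'" "\<forall>k. Ck k W' g" "\<forall>x\<in>W' \<inter> (W \<inter> S). g x = f x"
    using \<open>p \<in> S\<close> unfolding smooth_on_def by blast
  then show "\<exists>W g. open W \<and> p \<in> W \<and> (\<forall>k. Ck k W g) \<and> (\<forall>x\<in>W \<inter> S. g x = f x)"
    using W by (intro exI[of _ "W' \<inter> W"] exI[of _ g]) (auto intro: Ck_subset)
qed

lemma smooth_on_continuous: "smooth_on S f \<Longrightarrow> continuous_on S f"
proof -
  assume f: "smooth_on S f"
  show ?thesis
  proof (unfold continuous_on_eq_continuous_within, intro ballI)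
    fix p assume "p \<in> S"
    then obtain W g where W: "open W" "p \<in> W" "Ck 0 W g" "\<forall>x\<in>W \<inter> S. g x = f x"
      using f unfolding smooth_on_def by blast
    then have g: "continuous (at p within S) g"
      by (metis Ck.simps(1) continuous_at_imp_continuous_at_within continuous_on_eq_continuous_at)
    have "openin (top_of_set S) (W \<inter> S)" using W(1) by (simp add: openin_open_Int Int_commute)
    from continuous_transform_within_openin[OF g this, of f] W(2,4) \<open>p \<in> S\<close>
    show "continuous (at p within S) f" by blast
  qed
qed

lemma smooth_on_const: "smooth_on S (\<lambda>x. c)"
  unfolding smooth_on_def using Ck_const open_UNIV by blast

lemma smooth_on_linear: "bounded_linear f \<Longrightarrow> smooth_on S f"
  unfolding smooth_on_def using Ck_linear open_UNIV by blast

lemma smooth_on_bilinear: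
  assumes "bounded_bilinear h" "smooth_on S f" "smooth_on S g"
  shows "smooth_on S (\<lambda>x. h (f x) (g x))"
  unfolding smooth_on_def
proof
  fix p assume p: "p \<in> S"
  obtain W f' where W: "open W" "p \<in> W" "\<forall>k. Ck k W f'" "\<forall>x\<in>W \<inter> S. f' x = f x"
    using assms(2) p unfolding smooth_on_def by blast
  obtain V g' where V: "open V" "p \<in> V" "\<forall>k. Ck k V g'" "\<forall>x\<in>V \<inter> S. g' x = g x"
    using assms(3) p unfolding smooth_on_def by blast
  have "Ck k (W \<inter> V) (\<lambda>x. h (f' x) (g' x))" for k
    using Ck_bilinear[OF assms(1), of "W \<inter> V" k f' g'] W V Ck_subset by (metis inf_le1 inf_le2 open_Int)
  then show "\<exists>W g'. open W \<and> p \<in> W \<and> (\<forall>k. Ck k W g') \<and> (\<forall>x\<in>W \<inter> S. g' x = h (f x) (g x))"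
    using W V by (intro exI[of _ "W \<inter> V"] exI[of _ "\<lambda>x. h (f' x) (g' x)"]) auto
qed

lemmas smooth_on_mult = smooth_on_bilinear[OF bounded_bilinear_mult]
  and smooth_on_scaleR = smooth_on_bilinear[OF bounded_bilinear_scaleR]

lemma smooth_on_add:
  assumes "smooth_on S f" "smooth_on S g"
  shows "smooth_on S (\<lambda>x. f x + g x)"
  unfolding smooth_on_def
proof
  fix p assume p: "p \<in> S"
  obtain W f' where W: "open W" "p \<in> W" "\<forall>k. Ck k W f'" "\<forall>x\<in>W \<inter> S. f' x = f x"
    using assms(1) p unfolding smooth_on_def by blast
  obtain V g' where V: "open V" "p \<in> V" "\<forall>k. Ck k V g'" "\<forall>x\<in>V \<inter> S. g' x = g x"
    using assms(2) p unfolding smooth_on_def by blast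
  have "Ck k (W \<inter> V) (\<lambda>x. f' x + g' x)" for k
    using Ck_add[of "W \<inter> V" k f' g'] W V Ck_subset by (metis inf_le1 inf_le2 open_Int)
  then show "\<exists>W g'. open W \<and> p \<in> W \<and> (\<forall>k. Ck k W g') \<and> (\<forall>x\<in>W \<inter> S. g' x = f x + g x)"
    using W V by (intro exI[of _ "W \<inter> V"] exI[of _ "\<lambda>x. f' x + g' x"]) auto
qed

lemma smooth_on_sum:
  "(\<And>i. i \<in> I \<Longrightarrow> smooth_on S (f i)) \<Longrightarrow> smooth_on S (\<lambda>x. \<Sum>i\<in>I. f i x)"
  by (induction I rule: infinite_finite_induct) (auto intro: smooth_on_const smooth_on_add)

lemma smooth_on_prod:
  fixes f :: "'i \<Rightarrow> 'a::real_normed_vector \<Rightarrow> 'b::real_normed_field"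
  shows "(\<And>i. i \<in> I \<Longrightarrow> smooth_on S (f i)) \<Longrightarrow> smooth_on S (\<lambda>x. \<Prod>i\<in>I. f i x)"
  by (induction I rule: infinite_finite_induct) (auto intro: smooth_on_const smooth_on_mult)

lemma smooth_on_power:
  fixes f :: "'a::real_normed_vector \<Rightarrow> 'b::real_normed_field"
  shows "smooth_on S f \<Longrightarrow> smooth_on S (\<lambda>x. f x ^ k)"
  by (induction k) (auto intro: smooth_on_const smooth_on_mult)

lemma smooth_on_compose:
  fixes f :: "'b::euclidean_space \<Rightarrow> 'c::real_normed_vector" and g :: "'a::real_normed_vector \<Rightarrow> 'b"
  assumes "smooth_on T f" "smooth_on S g" "g ` S \<subseteq> T"
  shows "smooth_on S (\<lambda>x. f (g x))"
  unfolding smooth_on_def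
proof
  fix p assume p: "p \<in> S"
  obtain V g' where V: "open V" "p \<in> V" "\<forall>k. Ck k V g'" "\<forall>x\<in>V \<inter> S. g' x = g x"
    using assms(2) p unfolding smooth_on_def by blast
  have "g p \<in> T" using assms(3) p by auto
  then obtain W f' where W: "open W" "g p \<in> W" "\<forall>k. Ck k W f'" "\<forall>x\<in>W \<inter> T. f' x = f x"
    using assms(1) unfolding smooth_on_def by blast
  have "continuous_on V g'" using V(3) Ck.simps(1) by blast
  \<comment> \<open>The local extension of \<open>g\<close> may leave the set where \<open>f\<close>
    is extended; on this smaller neighbourhood the two extensions can be composed.\<close>
  then have o: "open (V \<inter> g' -` W)" using V(1) W(1) by (simp add: continuous_on_open_vimage Int_commute)
  have "Ck k (V \<inter> g' -` W) (\<lambda>x. f' (g' x))" for k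
    by (rule Ck_compose[OF o, of _ W]) (use V(3) W(3) Ck_subset[of k V g'] in auto)
  moreover have "f' (g' x) = f (g x)" if "x \<in> V" "x \<in> S" "g' x \<in> W" for x
    using V(4) W(4) that assms(3) by (metis IntI image_subset_iff)
  moreover have "p \<in> V \<inter> g' -` W" using V(2,4) W(2) p by simp
  ultimately show "\<exists>W h. open W \<and> p \<in> W \<and> (\<forall>k. Ck k W h) \<and> (\<forall>x\<in>W \<inter> S. h x = f (g x))"
    using o by (intro exI[of _ "V \<inter> g' -` W"] exI[of _ "\<lambda>x. f' (g' x)"]) simp
qed

lemma smooth_on_inverse:
  fixes f :: "'a::real_normed_vector \<Rightarrow> 'b::{real_normed_field, euclidean_space}"
  assumes "smooth_on S f" "\<And>x. x \<in> S \<Longrightarrow> f x \<noteq> 0"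
  shows "smooth_on S (\<lambda>x. inverse (f x))"
proof (rule smooth_on_compose[OF _ assms(1)])
  show "smooth_on (- {0::'b}) inverse"
    using Ck_inverse[of "- {0::'b}" "\<lambda>x. x"] Ck_linear[OF _ bounded_linear_ident, of "- {0::'b}"]
    by (subst smooth_on_open) (auto simp: open_Compl)
qed (use assms(2) in auto)

lemma smooth_on_cmult: "smooth_on S f \<Longrightarrow> smooth_on S (\<lambda>x. c * f x)" for f :: "_ \<Rightarrow> 'b::real_normed_algebra"
  by (intro smooth_on_mult smooth_on_const)

lemma smooth_on_of_real:
  "smooth_on S f \<Longrightarrow> smooth_on S (\<lambda>x. complex_of_real (f x))"
  by (rule smooth_on_compose[OF smooth_on_linear[OF bounded_linear_of_real], where T = UNIV]) auto

lemma smooth_on_cnj: "smooth_on S f \<Longrightarrow> smooth_on S (\<lambda>x. cnj (f x))"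
  by (rule smooth_on_compose[OF smooth_on_linear[OF bounded_linear_cnj], where T = UNIV]) auto

lemma smooth_on_nth:
  fixes f :: "'a::real_normed_vector \<Rightarrow> ('b::euclidean_space, 'n::finite) vec"
  shows "smooth_on S f \<Longrightarrow> smooth_on S (\<lambda>x. f x $ i)"
  by (rule smooth_on_compose[OF smooth_on_linear[OF bounded_linear_vec_nth], where T = UNIV]) auto

lemma bounded_linear_axis: "bounded_linear (axis i :: 'b::real_normed_vector \<Rightarrow> ('b, 'n::finite) vec)"
proof (rule bounded_linear_intro[where K = 1])
  show "norm (axis i x :: ('b, 'n) vec) \<le> norm x * 1" for x
    by (simp add: norm_vec_def L2_set_def axis_def if_distrib[of norm] if_distrib[of "\<lambda>x. x\<^sup>2"] cong: if_cong)
qed (auto simp: axis_def vec_eq_iff)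

lemma smooth_on_vecI:
  fixes f :: "'a::real_normed_vector \<Rightarrow> ('b::euclidean_space, 'n::finite) vec"
  assumes "\<And>i. smooth_on S (\<lambda>x. f x $ i)"
  shows "smooth_on S f"
proof -
  have "(\<Sum>i\<in>UNIV. axis i (f x $ i)) = f x" for x
    by (simp add: vec_eq_iff axis_def if_distrib if_distribR sum.delta cong: if_cong)
  moreover have "smooth_on S (\<lambda>x. \<Sum>i\<in>UNIV. axis i (f x $ i) :: ('b, 'n) vec)"
    by (intro smooth_on_sum smooth_on_compose[OF smooth_on_linear[OF bounded_linear_axis] assms, where T = UNIV]) auto
  ultimately show ?thesis by simp
qed

lemma smooth_on_frechet_derivative:
  assumes "open S" "smooth_on S f"
  shows "smooth_on S (\<lambda>x. frechet_derivative f (at x) v)"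
    and "\<And>x. x \<in> S \<Longrightarrow> (f has_derivative frechet_derivative f (at x)) (at x)"
proof -
  have C: "Ck (Suc k) S f" for k using assms smooth_on_open by blast
  then show "smooth_on S (\<lambda>x. frechet_derivative f (at x) v)"
    using assms(1) by (simp add: smooth_on_open)
  show "(f has_derivative frechet_derivative f (at x)) (at x)" if "x \<in> S" for x
    using Ck_SucD[OF C that] .
qed

section \<open>Smooth cut-off functions on the line\<close>

definition flat :: "nat \<Rightarrow> real \<Rightarrow> real" where
  "flat n t = (if t > 0 then inverse t ^ n * exp (- inverse t) else 0)"

text \<open>With s = 1/t, the inequality (1 + s/k)^k \<le> e^s for k = n + 2 bounds s^(n+2) e^(-s)
  by k^k. Taking two powers more than n leaves the factor t^2, which makes the difference quotient
  at 0 small.\<close>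

lemma flat_le: "\<bar>flat n t\<bar> \<le> real (n + 2) ^ (n + 2) * t\<^sup>2"
proof (cases "t > 0")
  case True
  define s where "s = inverse t"
  have s: "s > 0" using True by (simp add: s_def)
  have "(s / real (n + 2)) ^ (n + 2) \<le> (1 + s / real (n + 2)) ^ (n + 2)"
    using s by (intro power_mono) auto
  also have "\<dots> \<le> exp s" using exp_ge_one_plus_x_over_n_power_n[of "n + 2" s] s by auto
  finally have "s ^ (n + 2) \<le> exp s * real (n + 2) ^ (n + 2)"
    by (simp add: power_divide divide_simps mult.commute)
  then have "s ^ n * s\<^sup>2 * exp (- s) \<le> real (n + 2) ^ (n + 2)"
    by (simp add: exp_minus field_simps power2_eq_square)
  then have "s ^ n * s\<^sup>2 * exp (- s) * t\<^sup>2 \<le> real (n + 2) ^ (n + 2) * t\<^sup>2"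
    by (intro mult_right_mono) auto
  moreover have "s ^ n * s\<^sup>2 * exp (- s) * t\<^sup>2 = s ^ n * exp (- s)"
    using True by (simp add: s_def field_simps)
  moreover have "flat n t = s ^ n * exp (- s)" using True by (simp add: flat_def s_def)
  moreover have "0 \<le> s ^ n * exp (- s)" using s by simp
  ultimately show ?thesis by linarith
next
  case False
  then show ?thesis by (simp add: flat_def)
qed

text \<open>Differentiation maps member n of the family to a combination of the members n + 1 and n
  + 2; carrying the index makes smoothness an induction. At 0 the quadratic bound
  \<open>flat_le\<close> yields derivative 0.\<close>

lemma flat_has_derivative:
  "(flat n has_real_derivative (flat (n + 2) t - real n * flat (n + 1) t)) (at t)"
proof -
  consider "t > 0" | "t < 0" | "t = 0" by linarith
  then show ?thesis
  proof cases
    case 1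
    have d: "((\<lambda>t. inverse t) has_real_derivative - (inverse t)\<^sup>2) (at t)"
      using DERIV_inverse[of t UNIV] 1 by (simp add: power2_eq_square)
    have "((\<lambda>t. inverse t ^ n * exp (- inverse t)) has_real_derivative
        (flat (n + 2) t - real n * flat (n + 1) t)) (at t)"
      by (rule DERIV_cong[OF DERIV_mult[OF DERIV_power[OF d] DERIV_fun_exp[OF DERIV_minus[OF d]]]], cases n)
        (use 1 in \<open>auto simp: flat_def algebra_simps power2_eq_square\<close>)
    then show ?thesis
      by (rule has_field_derivative_transform_within_open[where S = "{0<..}"]) (use 1 in \<open>auto simp: flat_def\<close>)
  next
    case 2
    have "((\<lambda>t. 0) has_real_derivative (flat (n + 2) t - real n * flat (n + 1) t)) (at t)"
      using 2 by (simp add: flat_def)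
    then show ?thesis
      by (rule has_field_derivative_transform_within_open[where S = "{..<0}"]) (use 2 in \<open>auto simp: flat_def\<close>)
  next
    case 3
    have "((\<lambda>h. flat n h / h) \<longlongrightarrow> 0) (at 0)"
    proof (rule Lim_null_comparison)
      show "\<forall>\<^sub>F h in at 0. norm (flat n h / h) \<le> real (n + 2) ^ (n + 2) * \<bar>h\<bar>"
        using flat_le[of n]
        by (intro eventually_at_filter[THEN iffD2] always_eventually)
          (auto simp: divide_simps power2_eq_square abs_mult mult.assoc)
      show "((\<lambda>h. real (n + 2) ^ (n + 2) * \<bar>h\<bar>) \<longlongrightarrow> 0) (at 0)"
        by (auto intro!: tendsto_eq_intros)
    qed
    then show ?thesis using 3 by (simp add: DERIV_def flat_def)
  qed
qed

lemma smooth_on_flat: "smooth_on S (flat n)"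
proof -
  have "Ck k UNIV (flat n)" for k n
  proof (induction k arbitrary: n)
    case 0
    show ?case using DERIV_continuous_on[OF has_field_derivative_at_within[OF flat_has_derivative]] by simp
  next
    case (Suc k)
    show ?case
    proof (rule Ck_SucI[where f' = "\<lambda>t h. (flat (n + 2) t + (- real n) * flat (n + 1) t) * h"])
      show "(flat n has_derivative (*) (flat (n + 2) x + (- real n) * flat (n + 1) x)) (at x)" for x
        using flat_has_derivative[of n x] by (simp add: has_field_derivative_def)
      show "Ck k UNIV (\<lambda>x. (flat (n + 2) x + (- real n) * flat (n + 1) x) * v)" for v
        by (intro Ck_bilinear[OF bounded_bilinear_mult] Ck_add Ck_const Suc open_UNIV)
    qed auto
  qed
  then show ?thesis unfolding smooth_on_def using open_UNIV by blast
qed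

section \<open>Smooth functions with compact support; integration by parts\<close>

definition cpt_smooth :: "'c::euclidean_space set \<Rightarrow> ('c \<Rightarrow> 'd::real_normed_vector) \<Rightarrow> bool" where
  "cpt_smooth V f \<longleftrightarrow> smooth_on UNIV f \<and> (\<exists>K. compact K \<and> K \<subseteq> V \<and> (\<forall>x. x \<notin> K \<longrightarrow> f x = 0))"

text \<open>\<open>V\<close> and the complement of \<open>K\<close> are open and cover the space;
  \<open>f\<close> is smooth on the first by assumption and zero on the second.\<close>

lemma cpt_smoothI:
  assumes "open V" "smooth_on V f" "compact K" "K \<subseteq> V" "\<And>x. x \<notin> K \<Longrightarrow> f x = 0"
  shows "cpt_smooth V f"
proof -
  have "smooth_on UNIV f"
  proof (rule smooth_on_local)
    fix x
    show "\<exists>W. open W \<and> x \<in> W \<and> smooth_on (W \<inter> UNIV) f"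
    proof (cases "x \<in> K")
      case True
      then show ?thesis using assms by (intro exI[of _ V]) auto
    next
      case False
      have "smooth_on (- K) f"
        by (subst smooth_on_cong[where g = "\<lambda>x. 0"]) (use assms(5) in \<open>auto intro: smooth_on_const\<close>)
      with False assms(3) show ?thesis
        by (intro exI[of _ "- K"]) (auto simp: open_Compl compact_imp_closed)
    qed
  qed
  then show ?thesis unfolding cpt_smooth_def using assms by blast
qed

lemma cpt_smooth_integrable:
  fixes f :: "'a::euclidean_space \<Rightarrow> 'b::{banach, second_countable_topology}"
  assumes "cpt_smooth V f"
  shows "integrable lborel f"
proof -
  obtain K where K: "smooth_on UNIV f" "compact K" "\<And>x. x \<notin> K \<Longrightarrow> f x = 0" "K \<subseteq> V"
    using assms unfolding cpt_smooth_def by blast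
  have "continuous_on K f" using smooth_on_continuous[OF K(1)] continuous_on_subset by blast
  from borel_integrable_compact[OF K(2) this]
  show ?thesis
    by (rule Bochner_Integration.integrable_cong[THEN iffD1, rotated 2]) (use K(3) in \<open>auto simp: indicator_def\<close>)
qed

text \<open>Lebesgue measure is translation invariant, so every difference quotient of
  \<open>F\<close> in direction \<open>e\<close> has integral 0; dominated convergence passes to the
  derivative. All integrations by parts below come from here.\<close>

lemma integral_derivative_zero:
  fixes F :: "'a::euclidean_space \<Rightarrow> 'b::euclidean_space"
  assumes "cpt_smooth V F"
  shows "(\<integral>x. frechet_derivative F (at x) e \<partial>lborel) = 0"
proof -
  obtain K where K: "smooth_on UNIV F" "compact K" "\<And>x. x \<notin> K \<Longrightarrow> F x = 0" "K \<subseteq> V"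
    using assms unfolding cpt_smooth_def by blast
  let ?D = "\<lambda>x. frechet_derivative F (at x) e"
  note smD = smooth_on_frechet_derivative(1)[OF open_UNIV K(1), of e]
  note dF = smooth_on_frechet_derivative(2)[OF open_UNIV K(1) UNIV_I]
  have D0: "?D x = 0" if "x \<notin> K" for x
  proof -
    have "(F has_derivative (\<lambda>h. 0)) (at x)"
      by (rule has_derivative_transform_within_open[where f = "\<lambda>x. 0" and s = "- K"])
        (use that K in \<open>auto simp: open_Compl compact_imp_closed\<close>)
    then show ?thesis using frechet_derivative_at by (metis (no_types, lifting))
  qed
  have "bounded (?D ` K)"
    using compact_imp_bounded[OF compact_continuous_image[OF continuous_on_subset[OF smooth_on_continuous[OF smD]] K(2)]]
    by auto
  then obtain B where B0: "\<And>x. x \<in> K \<Longrightarrow> norm (?D x) \<le> B" and Bp: "B > 0"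
    unfolding bounded_pos by auto
  have B: "norm (?D x) \<le> B" for x using B0[of x] D0[of x] Bp by (cases "x \<in> K") auto
  have line: "((\<lambda>s. F (x + s *\<^sub>R e)) has_derivative (\<lambda>h. h *\<^sub>R ?D (x + s *\<^sub>R e))) (at s)" for x s
  proof -
    have "((\<lambda>s. x + s *\<^sub>R e) has_derivative (\<lambda>h. h *\<^sub>R e)) (at s)"
      by (auto intro!: derivative_eq_intros)
    from has_derivative_compose[OF this dF]
    show ?thesis using linear_scale[OF has_derivative_linear[OF dF]] by (simp add: fun_eq_iff)
  qed
  \<comment> \<open>The mean value inequality bounds all difference quotients by \<open>B\<close>,
    uniformly in \<open>x\<close>; this is the height of the majorant for dominated
    convergence.\<close>
  have lip: "norm (F (x + t *\<^sub>R e) - F x) \<le> B * \<bar>t\<bar>" for x t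
  proof -
    have "norm ((\<lambda>s. F (x + s *\<^sub>R e)) t - (\<lambda>s. F (x + s *\<^sub>R e)) 0) \<le> B * norm (t - 0)"
    proof (rule differentiable_bound[where S = UNIV])
      show "onorm (\<lambda>h::real. h *\<^sub>R ?D (x + s *\<^sub>R e)) \<le> B" for s
        by (rule onorm_le) (use B[of "x + s *\<^sub>R e"] in \<open>simp add: mult.commute[of B] mult_left_mono\<close>)
    qed (use line in auto)
    then show ?thesis by simp
  qed
  define t :: "nat \<Rightarrow> real" where "t n = inverse (real (Suc n))" for n
  have t: "t n > 0" "t n \<le> 1" for n by (auto simp: t_def field_simps)
  have tlim: "t \<longlonglongrightarrow> 0" unfolding t_def by (rule LIMSEQ_inverse_real_of_nat)
  obtain r where r: "\<And>x. x \<in> K \<Longrightarrow> norm x \<le> r"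
    using compact_imp_bounded[OF K(2)] unfolding bounded_iff by blast
  let ?q = "\<lambda>n x. inverse (t n) *\<^sub>R (F (x + t n *\<^sub>R e) - F x)"
  have Fint: "integrable lborel F" using assms by (rule cpt_smooth_integrable)
  have T: "integrable lborel (\<lambda>x. F (x + c))" "(\<integral>x. F (x + c) \<partial>lborel) = (\<integral>x. F x \<partial>lborel)" for c
  proof -
    have "integrable (distr lborel borel ((+) c)) F" using Fint by (simp add: lborel_distr_plus)
    then show "integrable lborel (\<lambda>x. F (x + c))"
      using Fint by (subst (asm) integrable_distr_eq) (auto simp: add.commute)
    have "(\<integral>x. F x \<partial>distr lborel borel ((+) c)) = (\<integral>x. F (c + x) \<partial>lborel)"
      using borel_measurable_integrable[OF Fint] by (subst integral_distr) auto
    then show "(\<integral>x. F (x + c) \<partial>lborel) = (\<integral>x. F x \<partial>lborel)" by (simp add: lborel_distr_plus add.commute)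
  qed
  have zero: "(\<integral>x. ?q n x \<partial>lborel) = 0" for n
    using T[of "t n *\<^sub>R e"] Fint by simp
  have "(\<lambda>n. \<integral>x. ?q n x \<partial>lborel) \<longlonglongrightarrow> (\<integral>x. ?D x \<partial>lborel)"
  proof (rule integral_dominated_convergence)
    \<comment> \<open>Since \<open>t n\<close> is at most 1, the quotients vanish outside the ball
      of radius \<open>r + norm e\<close>, where \<open>r\<close> bounds the norm on
      \<open>K\<close>.\<close>
    show "integrable lborel (\<lambda>x. indicator (cball (0::'a) (r + norm e)) x *\<^sub>R B)"
      by (intro borel_integrable_compact) (auto intro: continuous_intros)
    show "?D \<in> borel_measurable lborel"
      using borel_measurable_continuous_onI[OF smooth_on_continuous[OF smD]] by simp
    show "?q n \<in> borel_measurable lborel" for n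
      using borel_measurable_integrable[OF T(1)] borel_measurable_integrable[OF Fint] by measurable
    show "AE x in lborel. (\<lambda>n. ?q n x) \<longlonglongrightarrow> ?D x"
    proof (rule AE_I2)
      fix x
      let ?f = "\<lambda>s. F (x + s *\<^sub>R e)"
      have L: "((\<lambda>h. (1 / norm (h - 0)) *\<^sub>R (?f h - (?f 0 + (h - 0) *\<^sub>R ?D x))) \<longlongrightarrow> 0) (at 0)"
        using line[of x 0] unfolding has_derivative_within by simp
      have "((\<lambda>h. norm ((1 / h) *\<^sub>R (?f h - ?f 0) - ?D x)) \<longlongrightarrow> 0) (at 0)"
      proof (rule Lim_transform_eventually[OF tendsto_norm_zero[OF L]])
        have "norm ((1 / norm (h - 0)) *\<^sub>R (?f h - (?f 0 + (h - 0) *\<^sub>R ?D x)))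
            = norm ((1 / h) *\<^sub>R (?f h - ?f 0) - ?D x)" if "h \<noteq> 0" for h
        proof -
          have "(1 / h) *\<^sub>R (?f h - ?f 0) - ?D x = (1 / h) *\<^sub>R (?f h - (?f 0 + h *\<^sub>R ?D x))"
            using that by (simp add: scaleR_diff_right scaleR_add_right)
          then show ?thesis by simp
        qed
        then show "\<forall>\<^sub>F h in at 0. norm ((1 / norm (h - 0)) *\<^sub>R (?f h - (?f 0 + (h - 0) *\<^sub>R ?D x)))
            = norm ((1 / h) *\<^sub>R (?f h - ?f 0) - ?D x)"
          by (auto simp: eventually_at_filter)
      qed
      then have "((\<lambda>h. (1 / h) *\<^sub>R (F (x + h *\<^sub>R e) - F x)) \<longlongrightarrow> ?D x) (at 0)"
        unfolding tendsto_norm_zero_iff by (subst (asm) LIM_zero_iff) simp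
      moreover have "filterlim t (at 0) sequentially"
        using tlim t(1) by (auto simp: filterlim_at less_imp_neq[THEN not_sym])
      ultimately show "(\<lambda>n. ?q n x) \<longlonglongrightarrow> ?D x"
        using filterlim_compose[of "\<lambda>h. (1 / h) *\<^sub>R (F (x + h *\<^sub>R e) - F x)" "nhds (?D x)" "at 0" t sequentially]
        by (simp add: divide_inverse)
    qed
    show "AE x in lborel. norm (?q n x) \<le> indicator (cball (0::'a) (r + norm e)) x *\<^sub>R B" for n
    proof (rule AE_I2)
      fix x
      show "norm (?q n x) \<le> indicator (cball (0::'a) (r + norm e)) x *\<^sub>R B"
      proof (cases "norm x \<le> r + norm e")
        case True
        then show ?thesis using lip[of x "t n"] t[of n] by (simp add: divide_simps)
      next
        case False
        have "norm (t n *\<^sub>R e) \<le> norm e" using t[of n] by (simp add: mult_left_le_one_le)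
        then have "norm (x + t n *\<^sub>R e) > r"
          using False norm_triangle_ineq4[of "x + t n *\<^sub>R e" "t n *\<^sub>R e"] by simp
        moreover have "norm x > r" using False norm_ge_zero[of e] by linarith
        ultimately have "x \<notin> K" "x + t n *\<^sub>R e \<notin> K" using r by force+
        then show ?thesis using K(3) False by simp
      qed
    qed
  qed
  from this[unfolded zero LIMSEQ_const_iff] show ?thesis by simp
qed

text \<open>The Borel sets over which \<open>f\<close> integrates to 0 form a Dynkin system that
  contains the boxes, and boxes are stable under intersection. So all Borel sets have this property,
  in particular the sets where \<open>f\<close> is positive or negative.\<close>

lemma AE_zero_if_box_integrals_zero_real:
  fixes f :: "'a::euclidean_space \<Rightarrow> real"
  assumes f: "integrable lborel f" and zero: "\<And>a b. (\<integral>x. indicator (box a b) x * f x \<partial>lborel) = 0"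
  shows "AE x in lborel. f x = 0"
proof -
  have ii: "integrable lborel (\<lambda>x. indicator A x * f x)" if "A \<in> sets borel" for A
    using integrable_mult_indicator[of A lborel f] f that by simp
  have bm: "f \<in> borel_measurable borel" using borel_measurable_integrable[OF f] by simp
  have UN: "(\<lambda>k. \<integral>x. indicator (\<Union>n\<in>{..<k}. A n) x * f x \<partial>lborel)
      \<longlonglongrightarrow> (\<integral>x. indicator (\<Union>n. A n) x * f x \<partial>lborel)" if "\<And>n. A n \<in> sets borel" for A :: "nat \<Rightarrow> 'a set"
  proof (rule integral_dominated_convergence[where w = "\<lambda>x. norm (f x)"])
    show "AE x in lborel. (\<lambda>k. indicator (\<Union>n\<in>{..<k}. A n) x * f x) \<longlonglongrightarrow> indicator (\<Union>n. A n) x * f x"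
      by (intro AE_I2 tendsto_mult tendsto_const LIMSEQ_indicator_UN)
  qed (use that f bm in \<open>auto intro!: integrable_norm simp: indicator_def\<close>)
  \<comment> \<open>Complements in the Dynkin system need the integral over the whole space,
    obtained from exhausting cubes.\<close>
  have univ: "(\<integral>x. f x \<partial>lborel) = 0"
  proof -
    have "(\<lambda>k. \<integral>x. indicator (box (- (real k *\<^sub>R One)) (real k *\<^sub>R One)) x * f x \<partial>lborel) \<longlonglongrightarrow> (\<integral>x. f x \<partial>lborel)"
    proof (rule integral_dominated_convergence[where w = "\<lambda>x. norm (f x)"])
      show "AE x in lborel. (\<lambda>k. indicator (box (- (real k *\<^sub>R One)) (real k *\<^sub>R One)) x * f x) \<longlonglongrightarrow> f x"
      proof (rule AE_I2)
        fix x :: 'a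
        have "\<exists>k. x \<in> box (- (real k *\<^sub>R One)) (real k *\<^sub>R One)" using UN_box_eq_UNIV by blast
        then obtain k where "x \<in> box (- (real k *\<^sub>R One)) (real k *\<^sub>R One)" ..
        then have "x \<in> box (- (real n *\<^sub>R One)) (real n *\<^sub>R One)" if "n \<ge> k" for n
          using that by (fastforce simp: mem_box)
        then have "\<forall>\<^sub>F n in sequentially. indicator (box (- (real n *\<^sub>R One)) (real n *\<^sub>R One)) x * f x = f x"
          by (auto simp: eventually_sequentially indicator_def)
        then show "(\<lambda>k. indicator (box (- (real k *\<^sub>R One)) (real k *\<^sub>R One)) x * f x) \<longlonglongrightarrow> f x"
          by (rule tendsto_eventually)
      qed
    qed (use f bm in \<open>auto intro!: integrable_norm simp: indicator_def\<close>)
    then show ?thesis using zero by (simp add: LIMSEQ_const_iff)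
  qed
  have all: "(\<integral>x. indicator A x * f x \<partial>lborel) = 0" if "A \<in> sets borel" for A
  proof -
    let ?G = "range (\<lambda>(a, b). box a b :: 'a set)"
    have st: "Int_stable ?G" by (auto simp: Int_stable_def box_Int_box)
    have A: "A \<in> sigma_sets UNIV ?G" using that by (simp add: borel_eq_box)
    have "?G \<subseteq> Pow UNIV" by auto
    from st this A show ?thesis
    proof (induct rule: sigma_sets_induct_disjoint)
      case (basic A) then show ?case using zero by auto
    next
      case empty then show ?case by simp
    next
      case (compl A)
      then have "A \<in> sets borel" by (simp add: borel_eq_box)
      have "(\<lambda>x. indicator (UNIV - A) x * f x) = (\<lambda>x. f x - indicator A x * f x)"
        by (auto simp: indicator_def)
      then show ?case using compl univ f ii[OF \<open>A \<in> sets borel\<close>] by simp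
    next
      case (union A)
      then have s: "A n \<in> sets borel" for n by (auto simp: borel_eq_box)
      have "(\<integral>x. indicator (\<Union>n\<in>{..<k}. A n) x * f x \<partial>lborel) = 0" for k
      proof -
        have "(\<lambda>x. indicator (\<Union>n\<in>{..<k}. A n) x * f x) = (\<lambda>x. \<Sum>n<k. indicator (A n) x * f x)"
          using union(1) by (subst indicator_UN_disjoint)
            (auto simp: sum_distrib_right disjoint_family_on_def)
        then show ?thesis
          by (simp only: Bochner_Integration.integral_sum[OF ii[OF s]] union(3) sum.neutral_const)
      qed
      then show ?case using UN[of A, OF s] by (simp add: LIMSEQ_const_iff)
    qed
  qed
  have pos: "AE x in lborel. f x \<le> 0" if f: "f \<in> borel_measurable borel" "integrable lborel f"
    and all: "\<And>A. A \<in> sets borel \<Longrightarrow> (\<integral>x. indicator A x * f x \<partial>lborel) = 0" for f :: "'a \<Rightarrow> real"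
  proof -
    have m: "{x. f x > 0} \<in> sets borel" using f(1) by measurable
    have "AE x in lborel. indicator {x. f x > 0} x * f x = 0"
      by (subst integral_nonneg_eq_0_iff_AE[symmetric])
        (use all[OF m] integrable_mult_indicator[of "{x. f x > 0}" lborel f] f m in \<open>auto simp: indicator_def\<close>)
    then show ?thesis by eventually_elim (auto simp: indicator_def split: if_splits)
  qed
  have "AE x in lborel. f x \<le> 0" using pos[of f] bm f all by blast
  moreover have "AE x in lborel. - f x \<le> 0" using pos[of "\<lambda>x. - f x"] bm f all by auto
  ultimately show ?thesis by eventually_elim auto
qed

lemma AE_zero_if_box_integrals_zero:
  fixes f :: "'a::euclidean_space \<Rightarrow> complex"
  assumes f: "integrable lborel f" and zero: "\<And>a b. (\<integral>x. indicator (box a b) x * f x \<partial>lborel) = 0"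
  shows "AE x in lborel. f x = 0"
proof -
  have ind: "indicat_real B x *\<^sub>R z = indicator B x * z" for B :: "'a set" and x and z :: complex
    by (simp add: indicator_def)
  have ii: "integrable lborel (\<lambda>x. indicator (box a b) x * f x)" for a b
    using integrable_mult_indicator[of "box a b" lborel f] f ind by simp
  have e: "indicator (box a b) x * Re z = Re (indicator (box a b) x * z)"
      "indicator (box a b) x * Im z = Im (indicator (box a b) x * z)" for a b :: 'a and x z
    by (auto simp: indicator_def)
  have "AE x in lborel. Re (f x) = 0"
    by (rule AE_zero_if_box_integrals_zero_real)
      (use f in \<open>simp_all only: e integral_Re[OF ii] zero zero_complex.sel integrable_Re\<close>)
  moreover have "AE x in lborel. Im (f x) = 0"
    by (rule AE_zero_if_box_integrals_zero_real)
      (use f in \<open>simp_all only: e integral_Im[OF ii] zero zero_complex.sel integrable_Im\<close>)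
  ultimately show ?thesis by eventually_elim (auto simp: complex_eq_iff)
qed

text \<open>For c > 0 the factor exp(-1/(n c)) tends to 1 as n grows, and for c \<le> 0
  \<open>flat\<close> is 0; so the product approximates the indicator of the open box by smooth
  functions.\<close>

definition box_bump :: "nat \<Rightarrow> 'n::finite pt \<Rightarrow> 'n pt \<Rightarrow> 'n pt \<Rightarrow> real" where
  "box_bump n a b v = (\<Prod>i\<in>UNIV. flat 0 (real n * ((v $ i - a $ i) * (b $ i - v $ i))))"

lemma smooth_on_box_bump: "smooth_on S (box_bump n a b)"
  unfolding box_bump_def
proof (intro smooth_on_prod smooth_on_compose[OF smooth_on_flat[of UNIV]] smooth_on_cmult smooth_on_mult)
  fix i
  have "smooth_on S (\<lambda>v. (v::'a pt) $ i)" by (intro smooth_on_linear bounded_linear_vec_nth)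
  from smooth_on_add[OF this smooth_on_const, of "- a $ i"] smooth_on_add[OF smooth_on_cmult[OF this, of "-1"] smooth_on_const, of "b $ i"]
  show "smooth_on S (\<lambda>v. v $ i - a $ i)" "smooth_on S (\<lambda>v. b $ i - v $ i)" by simp_all
qed auto

lemma flat_0_bounds: "0 \<le> flat 0 t" "flat 0 t \<le> 1"
  by (auto simp: flat_def)

lemma box_bump_bounds: "0 \<le> box_bump n a b v" "box_bump n a b v \<le> 1"
  unfolding box_bump_def by (auto intro!: prod_nonneg prod_le_1 flat_0_bounds)

text \<open>If \<open>b $ i < a $ i\<close>, the product of the two differences is positive strictly
  between them although the box is empty; hence the assumption on the corners.\<close>

lemma box_bump_outside:
  assumes "\<And>i. a $ i < b $ i" "v \<notin> box a b"
  shows "box_bump n a b v = 0"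
proof -
  obtain i where "\<not> (a $ i < v $ i \<and> v $ i < b $ i)" using assms(2) by (auto simp: mem_box_cart)
  then have "(v $ i - a $ i) * (b $ i - v $ i) \<le> 0" using assms(1)[of i] by (auto simp: mult_le_0_iff)
  then have "real n * ((v $ i - a $ i) * (b $ i - v $ i)) \<le> 0" by (simp add: mult_nonneg_nonpos)
  then have "flat 0 (real n * ((v $ i - a $ i) * (b $ i - v $ i))) = 0" by (simp add: flat_def)
  then show ?thesis unfolding box_bump_def by (meson UNIV_I finite prod_zero)
qed

lemma box_bump_tendsto:
  assumes "\<And>i. a $ i < b $ i"
  shows "(\<lambda>n. box_bump n a b v) \<longlonglongrightarrow> indicator (box a b) v"
proof (cases "v \<in> box a b")
  case True
  have "(\<lambda>n. box_bump n a b v) \<longlonglongrightarrow> (\<Prod>i\<in>(UNIV :: 'a set). 1)"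
    unfolding box_bump_def
  proof (rule tendsto_prod)
    fix i
    define c where "c = (v $ i - a $ i) * (b $ i - v $ i)"
    have c: "c > 0" using True by (auto simp: c_def mem_box_cart)
    have "filterlim (\<lambda>n. real n * c) at_top sequentially"
      using c by (intro filterlim_at_top_mult_tendsto_pos[OF tendsto_const] filterlim_real_sequentially)
    then have "(\<lambda>n. exp (- inverse (real n * c))) \<longlonglongrightarrow> exp (- 0)"
      by (intro tendsto_exp tendsto_minus tendsto_inverse_0_at_top)
    then have "(\<lambda>n. exp (- inverse (real n * c))) \<longlonglongrightarrow> 1" by simp
    moreover have "\<forall>\<^sub>F n in sequentially. exp (- inverse (real n * c)) = flat 0 (real n * c)"
      using eventually_gt_at_top[of "0::nat"] by eventually_elim (use c in \<open>simp add: flat_def\<close>)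
    ultimately show "(\<lambda>n. flat 0 (real n * ((v $ i - a $ i) * (b $ i - v $ i)))) \<longlonglongrightarrow> 1"
      unfolding c_def[symmetric] by (rule Lim_transform_eventually)
  qed
  with True show ?thesis by simp
next
  case False
  then show ?thesis using box_bump_outside[OF assms] by simp
qed

text \<open>The functions \<open>box_bump\<close> tend to indicators of boxes, so the integrals of
  \<open>F\<close> over boxes with closure in \<open>V\<close> vanish. On each closed box
  \<open>F\<close> is then treated as a globally integrable function, and countably many closed
  boxes exhaust \<open>V\<close>.\<close>

lemma du_Bois_Reymond:
  fixes F :: "'n::finite pt \<Rightarrow> complex"
  assumes V: "open V"
    and int: "\<And>a b. cbox a b \<subseteq> V \<Longrightarrow> integrable lborel (\<lambda>x. indicator (cbox a b) x *\<^sub>R F x)"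
    and zero: "\<And>h :: 'n pt \<Rightarrow> real. cpt_smooth V h \<Longrightarrow> (\<integral>x. h x *\<^sub>R F x \<partial>lborel) = 0"
  shows "AE x in lborel. x \<in> V \<longrightarrow> F x = 0"
proof -
  have box: "(\<integral>x. indicator (box a b) x *\<^sub>R F x \<partial>lborel) = 0" if ab: "cbox a b \<subseteq> V" for a b
  proof (cases "\<forall>i. a $ i < b $ i")
    case True
    have cpt: "cpt_smooth V (box_bump n a b)" for n
      using box_bump_outside[of a b _ n] True box_subset_cbox[of a b]
      by (intro cpt_smoothI[OF V smooth_on_box_bump compact_cbox ab]) blast
    let ?F = "\<lambda>x. indicator (cbox a b) x *\<^sub>R F x"
    have eq: "box_bump n a b x *\<^sub>R ?F x = box_bump n a b x *\<^sub>R F x" for n x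
      using box_bump_outside[of a b x n] True box_subset_cbox[of a b] by (auto simp: indicator_def)
    have "(\<lambda>n. \<integral>x. box_bump n a b x *\<^sub>R ?F x \<partial>lborel) \<longlonglongrightarrow> (\<integral>x. indicator (box a b) x *\<^sub>R ?F x \<partial>lborel)"
    proof (rule integral_dominated_convergence)
      show "integrable lborel (\<lambda>x. norm (?F x))" using int[OF ab] by (rule integrable_norm)
      have [measurable]: "?F \<in> borel_measurable lborel" "\<And>n. box_bump n a b \<in> borel_measurable lborel"
        using int[OF ab] borel_measurable_continuous_onI[OF smooth_on_continuous[OF smooth_on_box_bump]] by auto
      show "(\<lambda>x. indicator (box a b) x *\<^sub>R ?F x) \<in> borel_measurable lborel"
        "(\<lambda>x. box_bump n a b x *\<^sub>R ?F x) \<in> borel_measurable lborel" for n by measurable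
      show "AE x in lborel. (\<lambda>n. box_bump n a b x *\<^sub>R ?F x) \<longlonglongrightarrow> indicator (box a b) x *\<^sub>R ?F x"
        using True by (intro AE_I2 tendsto_scaleR box_bump_tendsto tendsto_const) auto
      show "AE x in lborel. norm (box_bump n a b x *\<^sub>R ?F x) \<le> norm (?F x)" for n
        using box_bump_bounds[of n a b] by (intro AE_I2) (auto simp: abs_of_nonneg indicator_def intro: mult_left_le_one_le)
    qed
    moreover have ind: "indicator (box a b) x *\<^sub>R ?F x = indicator (box a b) x *\<^sub>R F x" for x
      using box_subset_cbox[of a b] by (auto simp: indicator_def)
    ultimately show ?thesis by (simp only: eq ind zero[OF cpt] LIMSEQ_const_iff)
  next
    case False
    then obtain i where i: "b $ i \<le> a $ i" by (auto simp: not_less)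
    have "x \<notin> box a b" for x
    proof
      assume "x \<in> box a b"
      then have "a $ i < x $ i" "x $ i < b $ i" by (auto simp: mem_box_cart)
      with i show False by linarith
    qed
    then have "box a b = {}" by blast
    then show ?thesis by simp
  qed
  have c: "AE x in lborel. x \<in> cbox c d \<longrightarrow> F x = 0" if cd: "cbox c d \<subseteq> V" for c d
  \<comment> \<open>A closed box with empty interior is a null set; otherwise its faces are.\<close>
  proof (cases "box c d = {}")
    case True
    then obtain b where b: "b \<in> Basis" "d \<bullet> b \<le> c \<bullet> b" by (auto simp: box_eq_empty)
    have P: "(\<Prod>b\<in>Basis. (d - c) \<bullet> b) = 0" if "\<forall>b\<in>Basis. c \<bullet> b \<le> d \<bullet> b"
      using b that by (intro prod_zero bexI[OF _ b(1)]) (auto simp: inner_diff_left intro: antisym)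
    have "emeasure lborel (cbox c d) = 0"
      by (cases "\<forall>b\<in>Basis. c \<bullet> b \<le> d \<bullet> b", simp_all only: emeasure_lborel_cbox_eq P) simp_all
    then have "AE x in lborel. x \<notin> cbox c d" by (subst AE_iff_measurable[OF _ refl]) auto
    then show ?thesis by eventually_elim auto
  next
    case False
    have sub: "indicator (box c d) x *\<^sub>R (indicator (cbox c d) x *\<^sub>R F x) = indicator (box c d) x *\<^sub>R F x" for x
      using box_subset_cbox[of c d] by (auto simp: indicator_def)
    have i: "integrable lborel (\<lambda>x. indicator (box c d) x *\<^sub>R F x)"
      using integrable_mult_indicator[OF _ int[OF cd], of "box c d", unfolded sub] by simp
    have "AE x in lborel. indicator (box c d) x *\<^sub>R F x = 0"
    proof (rule AE_zero_if_box_integrals_zero[OF i])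
      fix a b
      obtain p q where pq: "box a b \<inter> box c d = box p q" using box_Int_box by blast
      have "(\<lambda>x. indicator (box a b) x * (indicator (box c d) x *\<^sub>R F x)) = (\<lambda>x. indicator (box p q) x *\<^sub>R F x)"
        unfolding pq[symmetric] by (auto simp: indicator_def)
      moreover have "(\<integral>x. indicator (box p q) x *\<^sub>R F x \<partial>lborel) = 0"
      \<comment> \<open>The intersection of the two boxes is again a box, and if it is nonempty its
        closure stays inside \<open>cbox c d\<close>, hence in \<open>V\<close>, so the first step
        applies to it.\<close>
      proof (cases "box p q = {}")
        case False
        then have "cbox p q \<subseteq> cbox c d"
          using closure_box[OF False] closure_mono[of "box p q" "box c d"] closure_box[OF \<open>box c d \<noteq> {}\<close>] pq by blast
        then show ?thesis using box cd by blast
      qed simp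
      ultimately show "(\<integral>x. indicator (box a b) x * (indicator (box c d) x *\<^sub>R F x) \<partial>lborel) = 0" by simp
    qed
    moreover have "AE x in lborel. x \<notin> cbox c d - box c d"
    proof -
      have "emeasure lborel (cbox c d - box c d) = 0"
        using False by (subst emeasure_Diff)
          (auto simp: emeasure_lborel_cbox_eq emeasure_lborel_box_eq box_subset_cbox box_eq_empty not_le less_imp_le)
      then show ?thesis by (intro AE_not_in) (auto simp: null_sets_def)
    qed
    ultimately show ?thesis by eventually_elim (auto simp: indicator_def split: if_splits)
  qed
  obtain \<D> where D: "countable \<D>" "\<D> \<subseteq> Pow V" "\<And>X. X \<in> \<D> \<Longrightarrow> \<exists>a b. X = cbox a b" "\<Union>\<D> = V"
    using open_countable_Union_open_cbox[OF V] by metis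
  have "AE x in lborel. \<forall>X\<in>\<D>. x \<in> X \<longrightarrow> F x = 0"
    using D c by (subst AE_ball_countable[OF D(1)]) (metis PowD subsetD)
  then show ?thesis by eventually_elim (use D(4) in blast)
qed

section \<open>Differential operators in coordinates\<close>

text \<open>Bilinear rather than Hermitian: the transpose of a matrix or of a derivative then
  involves no conjugation, and complex conjugates are confined to the second argument by
  \<open>cnjv\<close>.\<close>

definition pair :: "(complex, 'r::finite) vec \<Rightarrow> (complex, 'r) vec \<Rightarrow> complex" where
  "pair x y = (\<Sum>l\<in>UNIV. x $ l * y $ l)"

lemma bounded_bilinear_pair: "bounded_bilinear pair"
  unfolding bilinear_conv_bounded_bilinear[symmetric] bilinear_def pair_def
  by (auto intro!: linearI simp: algebra_simps sum.distrib scaleR_sum_right)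

lemma bounded_bilinear_smult:
  "bounded_bilinear ((*s) :: complex \<Rightarrow> (complex, 'r::finite) vec \<Rightarrow> _)"
  unfolding bilinear_conv_bounded_bilinear[symmetric] bilinear_def
  by (auto intro!: linearI simp: vec_eq_iff algebra_simps)

lemma bounded_bilinear_matrix_vector:
  "bounded_bilinear ((*v) :: ('r::finite) cmat \<Rightarrow> 'r cvec \<Rightarrow> _)"
  unfolding bilinear_conv_bounded_bilinear[symmetric] bilinear_def
  by (auto intro!: linearI simp: vec_eq_iff matrix_vector_mult_def algebra_simps sum.distrib scaleR_sum_right)

lemmas smooth_on_pair = smooth_on_bilinear[OF bounded_bilinear_pair]
  and smooth_on_smult = smooth_on_bilinear[OF bounded_bilinear_smult]
  and smooth_on_matrix_vector = smooth_on_bilinear[OF bounded_bilinear_matrix_vector]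

lemma pair_zero [simp]: "pair x 0 = 0" "pair 0 x = 0"
  by (auto simp: pair_def)

text \<open>The factor \<open>g\<close> is smooth on \<open>V\<close> and arbitrary elsewhere; the
  support of \<open>Q\<close> hides this.\<close>

lemma cpt_smooth_bilinear:
  assumes "bounded_bilinear h" "open V" "smooth_on V g" "cpt_smooth V Q"
  shows "cpt_smooth V (\<lambda>v. h (g v) (Q v))"
proof -
  obtain K where K: "smooth_on UNIV Q" "compact K" "K \<subseteq> V" "\<And>x. x \<notin> K \<Longrightarrow> Q x = 0"
    using assms(4) unfolding cpt_smooth_def by blast
  show ?thesis
  proof (rule cpt_smoothI[OF assms(2) _ K(2,3)])
    show "smooth_on V (\<lambda>v. h (g v) (Q v))"
      using smooth_on_bilinear[OF assms(1,3)] smooth_on_subset[OF K(1)] by blast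
  qed (use K(4) bounded_bilinear.zero_right[OF assms(1)] in auto)
qed

lemmas cpt_smooth_pair = cpt_smooth_bilinear[OF bounded_bilinear_pair]
  and cpt_smooth_smult = cpt_smooth_bilinear[OF bounded_bilinear_smult]
  and cpt_smooth_matrix_vector = cpt_smooth_bilinear[OF bounded_bilinear_matrix_vector]

lemma cpt_smooth_sum:
  fixes f :: "'i \<Rightarrow> 'c::euclidean_space \<Rightarrow> 'd::real_normed_vector"
  assumes "finite I" "\<And>i. i \<in> I \<Longrightarrow> cpt_smooth V (f i)"
  shows "cpt_smooth V (\<lambda>v. \<Sum>i\<in>I. f i v)"
proof -
  have "\<forall>i. \<exists>K. i \<in> I \<longrightarrow> smooth_on UNIV (f i) \<and> compact K \<and> K \<subseteq> V \<and> (\<forall>x. x \<notin> K \<longrightarrow> f i x = 0)"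
    using assms(2) unfolding cpt_smooth_def by blast
  then obtain K where K: "\<And>i. i \<in> I \<Longrightarrow> smooth_on UNIV (f i) \<and> compact (K i) \<and> K i \<subseteq> V \<and> (\<forall>x. x \<notin> K i \<longrightarrow> f i x = 0)"
    by metis
  show ?thesis unfolding cpt_smooth_def
    by (intro conjI smooth_on_sum exI[of _ "\<Union>i\<in>I. K i"])
      (use K assms(1) in \<open>auto intro!: compact_UN sum.neutral\<close>)
qed

lemma cpt_smooth_derivative:
  fixes Q :: "'c::euclidean_space \<Rightarrow> 'd::real_normed_vector"
  assumes "cpt_smooth V Q"
  shows "cpt_smooth V (\<lambda>v. frechet_derivative Q (at v) e)"
proof -
  obtain K where K: "smooth_on UNIV Q" "compact K" "K \<subseteq> V" "\<And>x. x \<notin> K \<Longrightarrow> Q x = 0"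
    using assms unfolding cpt_smooth_def by blast
  have "frechet_derivative Q (at x) e = 0" if "x \<notin> K" for x
  proof -
    have "(Q has_derivative (\<lambda>h. 0)) (at x)"
      by (rule has_derivative_transform_within_open[where f = "\<lambda>x. 0" and s = "- K"])
        (use that K in \<open>auto simp: open_Compl compact_imp_closed\<close>)
    then show ?thesis using frechet_derivative_at by (metis (no_types, lifting))
  qed
  then show ?thesis
    unfolding cpt_smooth_def using K smooth_on_frechet_derivative(1)[OF open_UNIV K(1)] by blast
qed

text \<open>Only these properties of differential operators are needed, so no coefficients are recorded; the
  last one is the existence of a transpose with respect to the complex bilinear \<^const>\<open>pair\<close>.\<close>

definition diffop :: "('n::finite) pt set \<Rightarrow> (('n pt \<Rightarrow> ('r::finite) cvec) \<Rightarrow> 'n pt \<Rightarrow> 'r cvec) \<Rightarrow> bool" where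
  "diffop V P \<longleftrightarrow>
     (\<forall>g. smooth_on V g \<longrightarrow> smooth_on V (P g)) \<and>
     (\<forall>g h W. smooth_on V g \<and> smooth_on V h \<and> open W \<and> W \<subseteq> V \<and> (\<forall>v\<in>W. g v = h v) \<longrightarrow> (\<forall>v\<in>W. P g v = P h v)) \<and>
     (\<forall>g h. smooth_on V g \<and> smooth_on V h \<longrightarrow> (\<forall>v\<in>V. P (\<lambda>v. g v + h v) v = P g v + P h v)) \<and>
     (\<forall>c g. smooth_on V g \<longrightarrow> (\<forall>v\<in>V. P (\<lambda>v. c *s g v) v = c *s P g v)) \<and>
     (\<forall>Q. cpt_smooth V Q \<longrightarrow> (\<exists>Q'. cpt_smooth V Q' \<and>
        (\<forall>g. smooth_on V g \<longrightarrow> (\<integral>v. pair (P g v) (Q v) \<partial>lborel) = (\<integral>v. pair (g v) (Q' v) \<partial>lborel))))"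

lemma diffopI:
  fixes V :: "'a::finite pt set" and P :: "('a pt \<Rightarrow> 'b::finite cvec) \<Rightarrow> 'a pt \<Rightarrow> 'b cvec"
  assumes "\<And>g. smooth_on V g \<Longrightarrow> smooth_on V (P g)"
    and "\<And>g h W v. smooth_on V g \<Longrightarrow> smooth_on V h \<Longrightarrow> open W \<Longrightarrow> W \<subseteq> V \<Longrightarrow> (\<And>v. v \<in> W \<Longrightarrow> g v = h v) \<Longrightarrow>
      v \<in> W \<Longrightarrow> P g v = P h v"
    and "\<And>g h v. smooth_on V g \<Longrightarrow> smooth_on V h \<Longrightarrow> v \<in> V \<Longrightarrow> P (\<lambda>v. g v + h v) v = P g v + P h v"
    and "\<And>c g v. smooth_on V g \<Longrightarrow> v \<in> V \<Longrightarrow> P (\<lambda>v. c *s g v) v = c *s P g v"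
    and "\<And>Q. cpt_smooth V Q \<Longrightarrow> \<exists>Q'. cpt_smooth V Q' \<and>
        (\<forall>g. smooth_on V g \<longrightarrow> (\<integral>v. pair (P g v) (Q v) \<partial>lborel) = (\<integral>v. pair (g v) (Q' v) \<partial>lborel))"
  shows "diffop V P"
  unfolding diffop_def
proof (intro conjI allI impI ballI)
  fix g h :: "'a pt \<Rightarrow> 'b cvec" and W v
  assume "smooth_on V g \<and> smooth_on V h \<and> open W \<and> W \<subseteq> V \<and> (\<forall>v\<in>W. g v = h v)" "v \<in> W"
  then show "P g v = P h v" by (intro assms(2)[of g h W v]) auto
qed (use assms(1,3,4,5) in auto)

lemma diffopD:
  fixes V :: "'a::finite pt set" and P :: "('a pt \<Rightarrow> 'b::finite cvec) \<Rightarrow> 'a pt \<Rightarrow> 'b cvec"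
  assumes "diffop V P"
  shows "\<And>g. smooth_on V g \<Longrightarrow> smooth_on V (P g)"
    and "\<And>g h W v. smooth_on V g \<Longrightarrow> smooth_on V h \<Longrightarrow> open W \<Longrightarrow> W \<subseteq> V \<Longrightarrow> (\<And>v. v \<in> W \<Longrightarrow> g v = h v) \<Longrightarrow>
      v \<in> W \<Longrightarrow> P g v = P h v"
    and "\<And>g h v. smooth_on V g \<Longrightarrow> smooth_on V h \<Longrightarrow> v \<in> V \<Longrightarrow> P (\<lambda>v. g v + h v) v = P g v + P h v"
    and "\<And>c g v. smooth_on V g \<Longrightarrow> v \<in> V \<Longrightarrow> P (\<lambda>v. c *s g v) v = c *s P g v"
    and "\<And>Q. cpt_smooth V Q \<Longrightarrow> \<exists>Q'. cpt_smooth V Q' \<and>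
        (\<forall>g. smooth_on V g \<longrightarrow> (\<integral>v. pair (P g v) (Q v) \<partial>lborel) = (\<integral>v. pair (g v) (Q' v) \<partial>lborel))"
proof -
  note D = assms[unfolded diffop_def]
  show "P g v = P h v" if "smooth_on V g" "smooth_on V h" "open W" "W \<subseteq> V" "\<And>v. v \<in> W \<Longrightarrow> g v = h v" "v \<in> W"
    for g h :: "'a pt \<Rightarrow> 'b cvec" and W v
    using D[THEN conjunct2, THEN conjunct1, rule_format, of g h W v] that by blast
qed (use assms in \<open>simp_all add: diffop_def\<close>)

text \<open>Local representations are functions on the whole coordinate space with arbitrary values
  outside \<open>V\<close>; an operator must not see the difference.\<close>

lemma diffop_cong_point:
  assumes "diffop V P" "open V" "smooth_on V g" "smooth_on V h" "\<And>v. v \<in> V \<Longrightarrow> g v = h v" "v \<in> V"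
  shows "P g v = P h v"
  using diffopD(2)[OF assms(1,3,4,2) order_refl assms(5,6)] .

lemma diffop_id: "diffop V (\<lambda>g. g)"
  by (rule diffopI) auto

lemma diffop_compose:
  fixes V :: "'a::finite pt set" and P R :: "('a pt \<Rightarrow> 'b::finite cvec) \<Rightarrow> 'a pt \<Rightarrow> 'b cvec"
  assumes V: "open V" and P: "diffop V P" and R: "diffop V R"
  shows "diffop V (\<lambda>g. P (R g))"
proof (rule diffopI)
  show "smooth_on V (P (R g))" if "smooth_on V g" for g :: "'a pt \<Rightarrow> 'b cvec"
    using that diffopD(1)[OF P] diffopD(1)[OF R] by blast
next
  fix g h :: "'a pt \<Rightarrow> 'b cvec" and W v
  assume a: "smooth_on V g" "smooth_on V h" "open W" "W \<subseteq> V" "\<And>v. v \<in> W \<Longrightarrow> g v = h v" "v \<in> W"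
  show "P (R g) v = P (R h) v"
    by (rule diffopD(2)[OF P diffopD(1)[OF R a(1)] diffopD(1)[OF R a(2)] a(3,4)
          diffopD(2)[OF R a(1,2,3,4,5)] a(6)])
next
  fix g h :: "'a pt \<Rightarrow> 'b cvec" and v assume a: "smooth_on V g" "smooth_on V h" "v \<in> V"
  note s = diffopD(1)[OF R a(1)] diffopD(1)[OF R a(2)]
  have "P (R (\<lambda>v. g v + h v)) v = P (\<lambda>v. R g v + R h v) v"
    by (rule diffop_cong_point[OF P V _ _ _ a(3)])
      (use a s diffopD(1)[OF R] diffopD(3)[OF R] in \<open>auto intro: smooth_on_add\<close>)
  then show "P (R (\<lambda>v. g v + h v)) v = P (R g) v + P (R h) v"
    using diffopD(3)[OF P s a(3)] by simp
next
  fix c and g :: "'a pt \<Rightarrow> 'b cvec" and v assume a: "smooth_on V g" "v \<in> V"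
  note s = diffopD(1)[OF R a(1)]
  have "P (R (\<lambda>v. c *s g v)) v = P (\<lambda>v. c *s R g v) v"
    by (rule diffop_cong_point[OF P V _ _ _ a(2)])
      (use a s diffopD(1)[OF R] diffopD(4)[OF R] in \<open>auto intro!: smooth_on_smult smooth_on_const\<close>)
  then show "P (R (\<lambda>v. c *s g v)) v = c *s P (R g) v"
    using diffopD(4)[OF P s a(2)] by simp
next
  fix Q :: "'a pt \<Rightarrow> 'b cvec" assume "cpt_smooth V Q"
  then obtain Q1 where 1: "cpt_smooth V Q1"
      "\<forall>g. smooth_on V g \<longrightarrow> (\<integral>v. pair (P g v) (Q v) \<partial>lborel) = (\<integral>v. pair (g v) (Q1 v) \<partial>lborel)"
    using diffopD(5)[OF P] by blast
  then obtain Q2 where 2: "cpt_smooth V Q2"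
      "\<forall>g. smooth_on V g \<longrightarrow> (\<integral>v. pair (R g v) (Q1 v) \<partial>lborel) = (\<integral>v. pair (g v) (Q2 v) \<partial>lborel)"
    using diffopD(5)[OF R] by blast
  show "\<exists>Q'. cpt_smooth V Q' \<and> (\<forall>g. smooth_on V g \<longrightarrow>
      (\<integral>v. pair (P (R g) v) (Q v) \<partial>lborel) = (\<integral>v. pair (g v) (Q' v) \<partial>lborel))"
    by (rule exI[of _ Q2]) (use 1 2 diffopD(1)[OF R] in simp)
qed

lemma diffop_sum:
  fixes V :: "'a::finite pt set" and P :: "'i \<Rightarrow> ('a pt \<Rightarrow> 'b::finite cvec) \<Rightarrow> 'a pt \<Rightarrow> 'b cvec"
  assumes V: "open V" and I: "finite I" and P: "\<And>i. i \<in> I \<Longrightarrow> diffop V (P i)"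
  shows "diffop V (\<lambda>g v. \<Sum>i\<in>I. P i g v)"
proof (rule diffopI)
  show "smooth_on V (\<lambda>v. \<Sum>i\<in>I. P i g v)" if "smooth_on V g" for g :: "'a pt \<Rightarrow> 'b cvec"
    using that diffopD(1)[OF P] by (intro smooth_on_sum) blast
next
  fix g h :: "'a pt \<Rightarrow> 'b cvec" and W v
  assume a: "smooth_on V g" "smooth_on V h" "open W" "W \<subseteq> V" "\<And>v. v \<in> W \<Longrightarrow> g v = h v" "v \<in> W"
  show "(\<Sum>i\<in>I. P i g v) = (\<Sum>i\<in>I. P i h v)"
    by (rule sum.cong[OF refl]) (rule diffopD(2)[OF P a])
next
  fix g h :: "'a pt \<Rightarrow> 'b cvec" and v assume a: "smooth_on V g" "smooth_on V h" "v \<in> V"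
  show "(\<Sum>i\<in>I. P i (\<lambda>v. g v + h v) v) = (\<Sum>i\<in>I. P i g v) + (\<Sum>i\<in>I. P i h v)"
    using diffopD(3)[OF P a] by (simp add: sum.distrib)
next
  fix c and g :: "'a pt \<Rightarrow> 'b cvec" and v assume a: "smooth_on V g" "v \<in> V"
  show "(\<Sum>i\<in>I. P i (\<lambda>v. c *s g v) v) = c *s (\<Sum>i\<in>I. P i g v)"
    using diffopD(4)[OF P a] by (simp add: vec.scale_sum_right)
next
  fix Q :: "'a pt \<Rightarrow> 'b cvec" assume Q: "cpt_smooth V Q"
  have "\<forall>i. \<exists>Q'. i \<in> I \<longrightarrow> cpt_smooth V Q' \<and> (\<forall>g. smooth_on V g \<longrightarrow>
      (\<integral>v. pair (P i g v) (Q v) \<partial>lborel) = (\<integral>v. pair (g v) (Q' v) \<partial>lborel))"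
    using diffopD(5)[OF P Q] by blast
  then obtain Q' where Q': "\<And>i. i \<in> I \<Longrightarrow> cpt_smooth V (Q' i)"
      "\<And>i g. i \<in> I \<Longrightarrow> smooth_on V g \<Longrightarrow>
        (\<integral>v. pair (P i g v) (Q v) \<partial>lborel) = (\<integral>v. pair (g v) (Q' i v) \<partial>lborel)"
    by metis
  show "\<exists>Q'. cpt_smooth V Q' \<and> (\<forall>g. smooth_on V g \<longrightarrow>
      (\<integral>v. pair (\<Sum>i\<in>I. P i g v) (Q v) \<partial>lborel) = (\<integral>v. pair (g v) (Q' v) \<partial>lborel))"
  proof (intro exI conjI allI impI)
    show "cpt_smooth V (\<lambda>v. \<Sum>i\<in>I. Q' i v)" by (rule cpt_smooth_sum[OF I Q'(1)])
    fix g :: "'a pt \<Rightarrow> 'b cvec" assume g: "smooth_on V g"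
    have "(\<integral>v. pair (\<Sum>i\<in>I. P i g v) (Q v) \<partial>lborel) = (\<integral>v. (\<Sum>i\<in>I. pair (P i g v) (Q v)) \<partial>lborel)"
      by (simp add: bounded_bilinear.sum_left[OF bounded_bilinear_pair])
    also have "\<dots> = (\<Sum>i\<in>I. \<integral>v. pair (P i g v) (Q v) \<partial>lborel)"
      by (intro Bochner_Integration.integral_sum cpt_smooth_integrable[OF cpt_smooth_pair[OF V diffopD(1)[OF P g] Q]])
    also have "\<dots> = (\<Sum>i\<in>I. \<integral>v. pair (g v) (Q' i v) \<partial>lborel)"
      using Q'(2) g by simp
    also have "\<dots> = (\<integral>v. (\<Sum>i\<in>I. pair (g v) (Q' i v)) \<partial>lborel)"
      by (intro Bochner_Integration.integral_sum[symmetric] cpt_smooth_integrable[OF cpt_smooth_pair[OF V g Q'(1)]])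
    also have "\<dots> = (\<integral>v. pair (g v) (\<Sum>i\<in>I. Q' i v) \<partial>lborel)"
      by (simp add: bounded_bilinear.sum_right[OF bounded_bilinear_pair])
    finally show "(\<integral>v. pair (\<Sum>i\<in>I. P i g v) (Q v) \<partial>lborel) = (\<integral>v. pair (g v) (\<Sum>i\<in>I. Q' i v) \<partial>lborel)" .
  qed
qed

lemma pair_matrix_transpose: "pair (A *v x) y = pair x (transpose A *v y)"
proof -
  have "pair (A *v x) y = (\<Sum>l\<in>UNIV. \<Sum>k\<in>UNIV. A $ l $ k * x $ k * y $ l)"
    by (simp add: pair_def matrix_vector_mult_def sum_distrib_right)
  also have "\<dots> = (\<Sum>k\<in>UNIV. \<Sum>l\<in>UNIV. A $ l $ k * x $ k * y $ l)" by (rule sum.swap)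
  also have "\<dots> = pair x (transpose A *v y)"
    by (simp add: pair_def matrix_vector_mult_def transpose_def sum_distrib_left mult_ac)
  finally show ?thesis .
qed

lemma smooth_on_transpose:
  fixes a :: "'n::finite pt \<Rightarrow> 'r::finite cmat"
  shows "smooth_on V a \<Longrightarrow> smooth_on V (\<lambda>v. transpose (a v))"
  by (intro smooth_on_vecI) (auto simp: transpose_def intro: smooth_on_nth)

lemma diffop_matrix:
  fixes V :: "'a::finite pt set" and a :: "'a pt \<Rightarrow> 'b::finite cmat"
  assumes V: "open V" and a: "smooth_on V a"
  shows "diffop V (\<lambda>g v. a v *v g v)"
proof (rule diffopI)
  show "smooth_on V (\<lambda>v. a v *v g v)" if "smooth_on V g" for g
    using smooth_on_matrix_vector[OF a that] .
next
  fix Q :: "'a pt \<Rightarrow> 'b cvec" assume Q: "cpt_smooth V Q"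
  show "\<exists>Q'. cpt_smooth V Q' \<and> (\<forall>g. smooth_on V g \<longrightarrow>
      (\<integral>v. pair (a v *v g v) (Q v) \<partial>lborel) = (\<integral>v. pair (g v) (Q' v) \<partial>lborel))"
    by (rule exI[of _ "\<lambda>v. transpose (a v) *v Q v"])
      (simp add: cpt_smooth_matrix_vector[OF V smooth_on_transpose[OF a] Q] pair_matrix_transpose
        del: transpose_matrix_vector)
qed (auto simp: matrix_vector_right_distrib vector_scalar_commute)

lemma diffop_smult:
  fixes V :: "'a::finite pt set"
  assumes V: "open V" and a: "smooth_on V a"
  shows "diffop V (\<lambda>(g :: 'a pt \<Rightarrow> 'b::finite cvec) v. a v *s g v)"
proof (rule diffopI)
  show "smooth_on V (\<lambda>v. a v *s g v)" if "smooth_on V g" for g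
    using smooth_on_smult[OF a that] .
next
  fix Q :: "'a pt \<Rightarrow> 'b cvec" assume Q: "cpt_smooth V Q"
  have "pair (c *s x) y = pair x (c *s y)" for c and x y :: "'b cvec" by (simp add: pair_def mult_ac)
  then show "\<exists>Q'. cpt_smooth V Q' \<and> (\<forall>g. smooth_on V g \<longrightarrow>
      (\<integral>v. pair (a v *s g v) (Q v) \<partial>lborel) = (\<integral>v. pair (g v) (Q' v) \<partial>lborel))"
    by (intro exI[of _ "\<lambda>v. a v *s Q v"]) (simp add: cpt_smooth_smult[OF V a Q])
qed (auto simp: vec_eq_iff algebra_simps)

lemma Dpart_eq_derivative:
  assumes "(g has_derivative g') (at v)"
  shows "Dpart i g v = (- \<i>) *s g' (axis i 1)"
proof -
  have "((\<lambda>t::real. v + t *\<^sub>R axis i 1) has_derivative (\<lambda>h. h *\<^sub>R axis i 1)) (at 0)"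
    by (auto intro!: derivative_eq_intros)
  from has_derivative_compose[OF this, of g g'] assms
  have "((\<lambda>t. g (v + t *\<^sub>R axis i 1)) has_derivative (\<lambda>h. g' (h *\<^sub>R axis i 1))) (at 0)" by simp
  then have "((\<lambda>t. g (v + t *\<^sub>R axis i 1)) has_vector_derivative g' (axis i 1)) (at 0)"
    unfolding has_vector_derivative_def using linear_scale[OF has_derivative_linear[OF assms]] by simp
  then show ?thesis unfolding Dpart_def by (simp add: vector_derivative_at)
qed

text \<open>The transpose of D_i is -D_i: the derivative of the compactly supported function
  \<open>pair (g v) (Q v)\<close> has integral 0, and the product rule splits it into the two
  sides.\<close>

lemma diffop_Dpart:
  fixes V :: "'n::finite pt set"
  assumes V: "open V"
  shows "diffop V (Dpart i :: ('n pt \<Rightarrow> 'r::finite cvec) \<Rightarrow> _)"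
proof -
  have D: "Dpart i g v = (- \<i>) *s frechet_derivative g (at v) (axis i 1)"
    if "smooth_on V g" "v \<in> V" for g :: "'n pt \<Rightarrow> 'r cvec" and v
    by (rule Dpart_eq_derivative[OF smooth_on_frechet_derivative(2)[OF V that]])
  show ?thesis
  proof (rule diffopI)
    fix g :: "'n pt \<Rightarrow> 'r cvec" assume g: "smooth_on V g"
    show "smooth_on V (Dpart i g)"
      by (rule smooth_on_cong[OF D[OF g], THEN iffD2,
            OF _ smooth_on_smult[OF smooth_on_const smooth_on_frechet_derivative(1)[OF V g]]])
  next
    fix g h :: "'n pt \<Rightarrow> 'r cvec" and W v
    assume a: "smooth_on V g" "smooth_on V h" "open W" "W \<subseteq> V" "\<And>v. v \<in> W \<Longrightarrow> g v = h v" "v \<in> W"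
    then have "(h has_derivative frechet_derivative g (at v)) (at v)"
      using has_derivative_transform_within_open[OF smooth_on_frechet_derivative(2)[OF V a(1)] a(3,6) a(5)]
      by blast
    from Dpart_eq_derivative[OF this] show "Dpart i g v = Dpart i h v"
      using D[OF a(1)] a(4,6) by (metis subsetD)
  next
    fix g h :: "'n pt \<Rightarrow> 'r cvec" and v assume a: "smooth_on V g" "smooth_on V h" "v \<in> V"
    from Dpart_eq_derivative[OF has_derivative_add[OF smooth_on_frechet_derivative(2)[OF V a(1,3)]
          smooth_on_frechet_derivative(2)[OF V a(2,3)]], of i]
    show "Dpart i (\<lambda>v. g v + h v) v = Dpart i g v + Dpart i h v"
      by (simp add: D a vec_eq_iff algebra_simps)
  next
    fix c and g :: "'n pt \<Rightarrow> 'r cvec" and v assume a: "smooth_on V g" "v \<in> V"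
    have "((\<lambda>v. c *s g v) has_derivative (\<lambda>h. c *s frechet_derivative g (at v) h)) (at v)"
      using bounded_bilinear.FDERIV[OF bounded_bilinear_smult has_derivative_const[of c "at v"]
          smooth_on_frechet_derivative(2)[OF V a]] by simp
    from Dpart_eq_derivative[OF this, of i] show "Dpart i (\<lambda>v. c *s g v) v = c *s Dpart i g v"
      by (simp add: D a vec_eq_iff algebra_simps)
  next
    fix Q :: "'n pt \<Rightarrow> 'r cvec" assume Q: "cpt_smooth V Q"
    then obtain K where K: "smooth_on UNIV Q" "compact K" "K \<subseteq> V" "\<And>x. x \<notin> K \<Longrightarrow> Q x = 0"
      unfolding cpt_smooth_def by blast
    let ?e = "axis i 1 :: 'n pt"
    let ?Q' = "\<lambda>v. \<i> *s frechet_derivative Q (at v) ?e"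
    have cQ': "cpt_smooth V (\<lambda>v. frechet_derivative Q (at v) ?e)" by (rule cpt_smooth_derivative[OF Q])
    show "\<exists>Q'. cpt_smooth V Q' \<and> (\<forall>g. smooth_on V g \<longrightarrow>
        (\<integral>v. pair (Dpart i g v) (Q v) \<partial>lborel) = (\<integral>v. pair (g v) (Q' v) \<partial>lborel))"
    proof (intro exI conjI allI impI)
      show "cpt_smooth V ?Q'" by (rule cpt_smooth_smult[OF V smooth_on_const cQ'])
      fix g :: "'n pt \<Rightarrow> 'r cvec" assume g: "smooth_on V g"
      let ?F = "\<lambda>v. pair (g v) (Q v)"
      let ?A = "\<lambda>v. pair (g v) (frechet_derivative Q (at v) ?e)"
      let ?B = "\<lambda>v. pair (frechet_derivative g (at v) ?e) (Q v)"
      have F: "cpt_smooth V ?F" by (rule cpt_smooth_pair[OF V g Q])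
      have A: "integrable lborel ?A" by (rule cpt_smooth_integrable[OF cpt_smooth_pair[OF V g cQ']])
      have B: "integrable lborel ?B"
        by (rule cpt_smooth_integrable[OF cpt_smooth_pair[OF V smooth_on_frechet_derivative(1)[OF V g] Q]])
      have "frechet_derivative ?F (at v) ?e = ?A v + ?B v" for v
      proof (cases "v \<in> V")
        case True
        from bounded_bilinear.FDERIV[OF bounded_bilinear_pair smooth_on_frechet_derivative(2)[OF V g True]
            smooth_on_frechet_derivative(2)[OF open_UNIV K(1) UNIV_I]]
        show ?thesis using frechet_derivative_at by (metis (no_types, lifting))
      next
        \<comment> \<open>Outside \<open>V\<close> the function \<open>g\<close> need not be
          differentiable, but near such a point \<open>Q\<close> vanishes identically because its
          support \<open>K\<close> is closed.\<close>
        case False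
        then have v: "v \<in> - K" using K(3) by blast
        have o: "open (- K)" using K(2) by (simp add: open_Compl compact_imp_closed)
        have "(?F has_derivative (\<lambda>h. 0)) (at v)" "(Q has_derivative (\<lambda>h. 0)) (at v)"
          by (rule has_derivative_transform_within_open[OF has_derivative_const o v], use K(4) in simp)+
        then have "frechet_derivative ?F (at v) = (\<lambda>h. 0)" "frechet_derivative Q (at v) = (\<lambda>h. 0)"
          by (metis frechet_derivative_at)+
        then show ?thesis using v K(4) by simp
      qed
      then have "(\<integral>v. ?A v + ?B v \<partial>lborel) = 0" using integral_derivative_zero[OF F, of ?e] by simp
      then have s: "(\<integral>v. ?B v \<partial>lborel) = - (\<integral>v. ?A v \<partial>lborel)"
        by (simp only: Bochner_Integration.integral_add[OF A B] add_eq_0_iff)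
      have 1: "pair (c *s x) y = c * pair x y" "pair x (c *s y) = c * pair x y" for c and x y :: "'r cvec"
        by (simp_all add: pair_def sum_distrib_left mult_ac)
      have "pair (Dpart i g v) (Q v) = (- \<i>) * ?B v" for v
      proof (cases "v \<in> V")
        case True
        show ?thesis unfolding D[OF g True] 1 ..
      next
        case False
        then have "Q v = 0" using K(3,4) by blast
        then show ?thesis by simp
      qed
      then have "(\<integral>v. pair (Dpart i g v) (Q v) \<partial>lborel) = (\<integral>v. (- \<i>) * ?B v \<partial>lborel)" by (simp only:)
      also have "\<dots> = (\<integral>v. \<i> * ?A v \<partial>lborel)" using s by simp
      finally show "(\<integral>v. pair (Dpart i g v) (Q v) \<partial>lborel) = (\<integral>v. pair (g v) (?Q' v) \<partial>lborel)"
        by (simp add: 1)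
    qed
  qed
qed

subsection \<open>Operators invariant under dilations of the first coordinate\<close>

lemma scaleR_eq_smult: "r *\<^sub>R (x :: 'r::finite cvec) = complex_of_real r *s x"
  by (auto simp: vec_eq_iff complex_eq_iff)

definition dil :: "real \<Rightarrow> 'n::{finite,linorder} pt \<Rightarrow> 'n pt" where
  "dil s v = v + ((s - 1) * v $ xi) *\<^sub>R axis xi 1"

lemma dil_nth: "dil s v $ i = (if i = xi then s * v $ xi else v $ i)"
  by (simp add: dil_def axis_def algebra_simps)

lemma bounded_linear_dil: "bounded_linear (dil s)"
  unfolding linear_conv_bounded_linear[symmetric]
  by (rule linearI) (simp_all add: vec_eq_iff dil_nth algebra_simps)

text \<open>Invariance under dilations of x is the property of x^m times the model operator from
  which its homogeneity under \<open>kappa\<close> follows.\<close>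

definition cone_op :: "('n::{finite,linorder}) pt set \<Rightarrow> (('n pt \<Rightarrow> ('r::finite) cvec) \<Rightarrow> 'n pt \<Rightarrow> 'r cvec) \<Rightarrow> bool" where
  "cone_op V P \<longleftrightarrow> diffop V P \<and>
     (\<forall>s>0. \<forall>g. smooth_on V g \<longrightarrow> (\<forall>v\<in>V. P (\<lambda>v. g (dil s v)) v = P g (dil s v)))"

context
  fixes V :: "'n::{finite,linorder} pt set"
  assumes V: "open V" and dil_V: "\<And>s v. s > 0 \<Longrightarrow> v \<in> V \<Longrightarrow> dil s v \<in> V"
begin

lemma smooth_on_dil: "s > 0 \<Longrightarrow> smooth_on V g \<Longrightarrow> smooth_on V (\<lambda>v. g (dil s v))"
  by (rule smooth_on_compose[OF _ smooth_on_linear[OF bounded_linear_dil]]) (auto intro: dil_V)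

lemma cone_op_id: "cone_op V (\<lambda>g. g)"
  by (simp add: cone_op_def diffop_id)

lemma cone_op_compose:
  assumes "cone_op V P" "cone_op V R"
  shows "cone_op V (\<lambda>g. P (R g))"
  unfolding cone_op_def
proof (intro conjI allI impI ballI)
  have P: "diffop V P" and R: "diffop V R" using assms by (auto simp: cone_op_def)
  show "diffop V (\<lambda>g. P (R g))" by (rule diffop_compose[OF V P R])
  fix s :: real and g :: "'n pt \<Rightarrow> 'a cvec" and v assume a: "s > 0" "smooth_on V g" "v \<in> V"
  have "P (R (\<lambda>v. g (dil s v))) v = P (\<lambda>v. R g (dil s v)) v"
    by (rule diffop_cong_point[OF P V _ _ _ a(3)])
      (use a assms(2) diffopD(1)[OF R] smooth_on_dil in \<open>auto simp: cone_op_def\<close>)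
  also have "\<dots> = P (R g) (dil s v)"
    using a assms(1) diffopD(1)[OF R] by (auto simp: cone_op_def)
  finally show "P (R (\<lambda>v. g (dil s v))) v = P (R g) (dil s v)" .
qed

lemma cone_op_power: "cone_op V P \<Longrightarrow> cone_op V (P ^^ k)"
proof (induction k)
  case 0
  then show ?case using cone_op_id by (simp add: id_def)
next
  case (Suc k)
  then show ?case using cone_op_compose[of P "P ^^ k"] by (simp add: o_def)
qed

lemma cone_op_sum:
  assumes "finite I" "\<And>i. i \<in> I \<Longrightarrow> cone_op V (P i)"
  shows "cone_op V (\<lambda>g v. \<Sum>i\<in>I. P i g v)"
  using assms diffop_sum[OF V assms(1), of P] by (auto simp: cone_op_def)

lemma cone_op_matrix:
  assumes "smooth_on V a" "\<And>s v. s > 0 \<Longrightarrow> v \<in> V \<Longrightarrow> a (dil s v) = a v"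
  shows "cone_op V (\<lambda>g v. a v *v g v)"
  using assms diffop_matrix[OF V assms(1)] by (auto simp: cone_op_def)

lemma Dpart_dil:
  fixes g :: "'n pt \<Rightarrow> 'r::finite cvec"
  assumes "s > 0" "smooth_on V g" "v \<in> V"
  shows "Dpart i (\<lambda>v. g (dil s v)) v = (if i = xi then s else 1) *\<^sub>R Dpart i g (dil s v)"
proof -
  note d = smooth_on_frechet_derivative(2)[OF V assms(2) dil_V[OF assms(1,3)]]
  have "((\<lambda>v. g (dil s v)) has_derivative (\<lambda>h. frechet_derivative g (at (dil s v)) (dil s h))) (at v)"
    using has_derivative_compose[OF bounded_linear_imp_has_derivative[OF bounded_linear_dil] d] .
  from Dpart_eq_derivative[OF this, of i] Dpart_eq_derivative[OF d, of i]
  have e: "Dpart i (\<lambda>v. g (dil s v)) v = (- \<i>) *s frechet_derivative g (at (dil s v)) (dil s (axis i 1))"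
    "Dpart i g (dil s v) = (- \<i>) *s frechet_derivative g (at (dil s v)) (axis i 1)" .
  have a: "dil s (axis i 1) = (if i = xi then s else 1) *\<^sub>R (axis i 1 :: 'n pt)"
    by (auto simp: vec_eq_iff dil_nth axis_def)
  show ?thesis
    unfolding e a linear_scale[OF has_derivative_linear[OF d]]
    by (simp add: vec_eq_iff complex_eq_iff)
qed

lemma cone_op_Dpart: "i \<noteq> xi \<Longrightarrow> cone_op V (Dpart i :: ('n pt \<Rightarrow> 'r::finite cvec) \<Rightarrow> _)"
  by (simp add: cone_op_def diffop_Dpart[OF V] Dpart_dil)

text \<open>The chain rule produces a factor \<open>s\<close> from D_x, and the factor x, evaluated
  at the dilated point, absorbs it.\<close>

lemma cone_op_xDx: "cone_op V (xDx :: ('n pt \<Rightarrow> 'r::finite cvec) \<Rightarrow> _)"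
proof -
  have e: "xDx = (\<lambda>g::'n pt \<Rightarrow> 'r cvec. (\<lambda>v. complex_of_real (v $ xi) *s Dpart xi g v))"
    by (simp add: fun_eq_iff xDx_def scaleR_eq_smult)
  have "smooth_on V (\<lambda>v. complex_of_real (v $ xi))"
    by (intro smooth_on_of_real smooth_on_linear bounded_linear_vec_nth)
  from diffop_compose[OF V diffop_smult[OF V this] diffop_Dpart[OF V]]
  have "diffop V (xDx :: ('n pt \<Rightarrow> 'r cvec) \<Rightarrow> _)" unfolding e .
  then show ?thesis by (simp add: cone_op_def xDx_def dil_nth Dpart_dil mult.commute)
qed

text \<open>The entry of the multi-index at \<open>xi\<close> is set to 0 in the outer factor, so
  D_x occurs only in the invariant combination x D_x.\<close>

lemma cone_op_bDmulti: "cone_op V (bDmulti \<alpha> :: ('n pt \<Rightarrow> 'r::finite cvec) \<Rightarrow> _)"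
proof -
  have "cone_op V (foldr (\<lambda>i. Dpart i ^^ (\<alpha>(xi := 0)) i) is :: ('n pt \<Rightarrow> 'r cvec) \<Rightarrow> _)" for "is"
  proof (induction "is")
    case Nil
    then show ?case using cone_op_id by (simp add: id_def)
  next
    case (Cons i "is")
    have "cone_op V (Dpart i ^^ (\<alpha>(xi := 0)) i :: ('n pt \<Rightarrow> 'r cvec) \<Rightarrow> _)"
      using cone_op_power[OF cone_op_Dpart, of i "\<alpha> i"] cone_op_id by (cases "i = xi") (auto simp: id_def)
    from cone_op_compose[OF this Cons] show ?case by (simp add: o_def)
  qed
  from cone_op_compose[OF this cone_op_power[OF cone_op_xDx]] show ?thesis
    by (simp add: bDmulti_def[abs_def] Dmulti_def)
qed

end

section \<open>Charts and frames on the cone\<close>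

lemma base_pt_nth: "base_pt v $ i = (if i = xi then 0 else v $ i)"
  by (simp add: base_pt_def axis_def)

lemma bounded_linear_base_pt: "bounded_linear base_pt"
  unfolding linear_conv_bounded_linear[symmetric]
  by (rule linearI) (simp_all add: vec_eq_iff base_pt_nth algebra_simps)

lemma base_pt_dil: "base_pt (dil s v) = base_pt v"
  by (simp add: vec_eq_iff base_pt_nth dil_nth)

lemma cyl_nth: "\<phi> y $ xi = 0 \<Longrightarrow> cyl \<phi> (t, y) $ i = (if i = xi then t else \<phi> y $ i)"
  by (simp add: cyl_def axis_def)

text \<open>\<open>H\<close> is a left inverse of \<open>F\<close> near \<open>x\<close>, so the
  derivative of \<open>F\<close> is injective and, the dimensions being equal, onto. But a component
  with a local minimum has derivative 0, so the derivative misses the corresponding axis.\<close>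

lemma differentiable_constrained_not_invertible:
  fixes F H :: "'n::finite pt \<Rightarrow> 'n pt"
  assumes N: "open N" "x \<in> N" and F: "(F has_derivative F') (at x)"
    and H: "(H has_derivative H') (at (F x))"
    and inv: "\<And>v. v \<in> N \<Longrightarrow> H (F v) = v" and pos: "\<And>v. v \<in> N \<Longrightarrow> F x $ i \<le> F v $ i"
  shows False
proof -
  have "((\<lambda>v. H (F v)) has_derivative (\<lambda>h. H' (F' h))) (at x)"
    using has_derivative_compose[OF F H] .
  moreover have "((\<lambda>v. H (F v)) has_derivative (\<lambda>h. h)) (at x)"
    by (rule has_derivative_transform_within_open[OF has_derivative_ident N]) (simp add: inv)
  ultimately have "H' (F' h) = h" for h using has_derivative_unique by metis
  then have "inj F'" by (metis injI)
  then have "surj F'" using linear_injective_imp_surjective[OF has_derivative_linear[OF F]] by blast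
  then obtain h where h: "F' h = axis i 1" by (metis surjD)
  have "((\<lambda>v. F v $ i) has_derivative (\<lambda>h. F' h $ i)) (at x)"
    using bounded_linear.has_derivative[OF bounded_linear_vec_nth F] .
  then have "(\<lambda>h. F' h $ i) = (\<lambda>v. 0)"
    using differential_zero_maxmin[OF N(2,1)] pos by blast
  then have "F' h $ i = 0" by meson
  then show False using h by simp
qed

text \<open>A point \<open>base_pt v\<close> has first coordinate 0, so only boundary points of the
  chart contribute although \<open>bd\<close> is not mentioned. In this form openness and dilation
  invariance are visible; \<open>cdom_eq\<close> is the description as a cylinder over the
  boundary.\<close>

definition cdom :: "'a set \<Rightarrow> ('a \<Rightarrow> ('n::{finite,linorder}) pt) \<Rightarrow> 'a set \<Rightarrow> 'n pt set" where
  "cdom U \<phi> W = {v. v $ xi > 0 \<and> base_pt v \<in> \<phi> ` (U \<inter> W)}"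

lemma dil_cdom: "s > 0 \<Longrightarrow> v \<in> cdom U \<phi> W \<Longrightarrow> dil s v \<in> cdom U \<phi> W"
  by (simp add: cdom_def base_pt_dil dil_nth)

locale cone_geom =
  fixes G :: "('a::{t2_space,second_countable_topology}, 'n::{finite,linorder}, 'f::ab_group_add, 'r::finite) cone_data"
  assumes geo: "cone_geometry G"
begin

section \<open>Charts at the boundary and cylindrical coordinates\<close>

lemma chartD:
  assumes "(U, \<phi>) \<in> charts G"
  shows "open U" "openin (top_of_set halfspace) (\<phi> ` U)" "homeomorphism U (\<phi> ` U) \<phi> (inv_into U \<phi>)"
    "inj_on \<phi> U"
proof -
  have *: "open U \<and> openin (top_of_set halfspace) (\<phi> ` U) \<and> (\<exists>\<psi>. homeomorphism U (\<phi> ` U) \<phi> \<psi>)"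
    using geo assms unfolding cone_geometry_def compact_manifold_with_boundary_def by fast
  then show "open U" "openin (top_of_set halfspace) (\<phi> ` U)" by auto
  from * obtain \<psi> where h: "homeomorphism U (\<phi> ` U) \<phi> \<psi>" by auto
  then show i: "inj_on \<phi> U" by (metis homeomorphism_apply1 inj_onI)
  have "inv_into U \<phi> v = \<psi> v" if "v \<in> \<phi> ` U" for v
    using h that i by (metis homeomorphism_apply1 imageE inv_into_f_f)
  then show "homeomorphism U (\<phi> ` U) \<phi> (inv_into U \<phi>)"
    using homeomorphism_cong[OF h] by metis
qed

lemma transition:
  assumes "(U, \<phi>) \<in> charts G" "(V, \<psi>) \<in> charts G"
  shows "smooth_on (\<phi> ` (U \<inter> V)) (\<lambda>v. \<psi> (inv_into U \<phi> v))"
  using geo assms unfolding cone_geometry_def compact_manifold_with_boundary_def by fast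

lemma charts_cover: "\<exists>U \<phi>. (U, \<phi>) \<in> charts G \<and> p \<in> U"
  using geo unfolding cone_geometry_def compact_manifold_with_boundary_def by force

lemma chart_open_image:
  assumes "(U, \<phi>) \<in> charts G" "open W"
  obtains T where "open T" "\<phi> ` (U \<inter> W) = halfspace \<inter> T"
proof -
  have "openin (top_of_set U) (U \<inter> W)" using assms(2) by (simp add: openin_open_Int)
  from homeomorphism_imp_open_map[OF chartD(3)[OF assms(1)] this]
  have "openin (top_of_set halfspace) (\<phi> ` (U \<inter> W))"
    using openin_trans[OF _ chartD(2)[OF assms(1)]] by blast
  then show ?thesis using that unfolding openin_open by blast
qed

lemma chart_halfspace: "(U, \<phi>) \<in> charts G \<Longrightarrow> p \<in> U \<Longrightarrow> \<phi> p $ xi \<ge> 0"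
  using openin_imp_subset[OF chartD(2)] by (force simp: halfspace_def)

text \<open>The derivative of a transition map at a boundary point of one chart is singular if the point
  is an interior point of the other chart.\<close>

lemma bd_chart:
  assumes C: "(U, \<phi>) \<in> charts G" and p: "p \<in> U" "p \<in> bd G"
  shows "\<phi> p $ xi = 0"
proof (rule ccontr)
  assume "\<phi> p $ xi \<noteq> 0"
  then have pos: "\<phi> p $ xi > 0" using chart_halfspace[OF C p(1)] by linarith
  obtain V \<psi> where C': "(V, \<psi>) \<in> charts G" and q: "p \<in> V" "\<psi> p $ xi = 0"
    using p(2) unfolding bd_def by auto
  obtain T where T: "open T" "\<phi> ` (U \<inter> V) = halfspace \<inter> T"
    using chart_open_image[OF C chartD(1)[OF C']] by blast
  \<comment> \<open>Away from the boundary hyperplane the image of the chart is open in the full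
    space, so the transition map can be differentiated at \<open>\<phi> p\<close> itself.\<close>
  define N0 where "N0 = T \<inter> {v. v $ xi > 0}"
  have "\<phi> p \<in> \<phi> ` (U \<inter> V)" using p q by blast
  then have N0: "open N0" "\<phi> p \<in> N0" "N0 \<subseteq> \<phi> ` (U \<inter> V)"
    using T pos by (auto simp: N0_def halfspace_def intro!: open_Int open_Collect_less continuous_intros)
  define F where "F = (\<lambda>v. \<psi> (inv_into U \<phi> v))"
  have sF: "smooth_on N0 F" using smooth_on_subset[OF transition[OF C C'] N0(3)] by (simp add: F_def)
  have Fp: "F (\<phi> p) = \<psi> p" using chartD(4)[OF C] p by (simp add: F_def)
  \<comment> \<open>At the boundary point the inverse transition is known only through a smooth
    extension \<open>H\<close> to an open set; it inverts \<open>F\<close> on the part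
    \<open>N\<close> of \<open>N0\<close> that \<open>F\<close> maps into that set.\<close>
  have "\<psi> p \<in> \<psi> ` (V \<inter> U)" using p q by blast
  then obtain W H where W: "open W" "\<psi> p \<in> W" "Ck (Suc 0) W H"
      "\<forall>x\<in>W \<inter> \<psi> ` (V \<inter> U). H x = \<phi> (inv_into V \<psi> x)"
    using transition[OF C' C] unfolding smooth_on_def by blast
  define N where "N = N0 \<inter> F -` W"
  have "open (F -` W \<inter> N0)"
    using smooth_on_continuous[OF sF] W(1) unfolding continuous_on_open_vimage[OF N0(1)] by blast
  then have "open N" by (simp add: N_def Int_commute)
  moreover have "\<phi> p \<in> N" using N0 W Fp by (simp add: N_def)
  moreover note smooth_on_frechet_derivative(2)[OF N0(1) sF N0(2)]
  moreover have "(H has_derivative frechet_derivative H (at (F (\<phi> p)))) (at (F (\<phi> p)))"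
    using Ck_SucD[OF W(3,2)] Fp by simp
  moreover have "H (F v) = v \<and> F (\<phi> p) $ xi \<le> F v $ xi" if "v \<in> N" for v
  proof -
    have "v \<in> \<phi> ` (U \<inter> V)" using that N0(3) by (auto simp: N_def)
    then obtain r where r: "r \<in> U" "r \<in> V" "v = \<phi> r" by blast
    then have Fv: "F v = \<psi> r" using chartD(4)[OF C] by (simp add: F_def)
    have "H (\<psi> r) = \<phi> (inv_into V \<psi> (\<psi> r))" using W(4) that r Fv by (auto simp: N_def)
    then have "H (F v) = v" using r chartD(4)[OF C'] Fv by simp
    moreover have "F (\<phi> p) $ xi \<le> F v $ xi" using Fp q(2) Fv chart_halfspace[OF C' r(2)] by simp
    ultimately show ?thesis by blast
  qed
  ultimately show False
    using differentiable_constrained_not_invertible[of N "\<phi> p" F _ H _ xi] by blast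
qed

lemma chart_bd_iff: "(U, \<phi>) \<in> charts G \<Longrightarrow> p \<in> U \<Longrightarrow> p \<in> bd G \<longleftrightarrow> \<phi> p $ xi = 0"
  using bd_chart unfolding bd_def by blast

lemma cdom_eq:
  assumes C: "(U, \<phi>) \<in> charts G"
  shows "cyl \<phi> ` ({0<..} \<times> (U \<inter> W \<inter> bd G)) = cdom U \<phi> W"
proof (intro set_eqI iffI)
  fix v assume "v \<in> cyl \<phi> ` ({0<..} \<times> (U \<inter> W \<inter> bd G))"
  then obtain t y where y: "t > 0" "y \<in> U" "y \<in> W" "y \<in> bd G" "v = cyl \<phi> (t, y)" by auto
  note n = cyl_nth[of \<phi> y, OF bd_chart[OF C y(2,4)]]
  have "base_pt v = \<phi> y" using n bd_chart[OF C y(2,4)] y(5) by (simp add: vec_eq_iff base_pt_nth)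
  then show "v \<in> cdom U \<phi> W" using n y by (auto simp: cdom_def)
next
  fix v assume v: "v \<in> cdom U \<phi> W"
  then obtain y where y: "y \<in> U" "y \<in> W" "base_pt v = \<phi> y" "v $ xi > 0" by (auto simp: cdom_def)
  have z: "\<phi> y $ xi = 0" unfolding y(3)[symmetric] by (simp add: base_pt_nth)
  then have "y \<in> bd G" using chart_bd_iff[OF C y(1)] by simp
  moreover have "v = cyl \<phi> (v $ xi, y)"
    by (simp add: vec_eq_iff cyl_nth[of \<phi> y, OF z] y(3)[symmetric] base_pt_nth)
  ultimately show "v \<in> cyl \<phi> ` ({0<..} \<times> (U \<inter> W \<inter> bd G))" using y by blast
qed

lemma cyl_inv_cyl:
  assumes C: "(U, \<phi>) \<in> charts G" and y: "y \<in> U" "y \<in> bd G"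
  shows "cyl_inv G U \<phi> (cyl \<phi> (t, y)) = (t, y)" "base_pt (cyl \<phi> (t, y)) = \<phi> y" "cyl \<phi> (t, y) $ xi = t"
proof -
  note n = cyl_nth[of \<phi> y, OF bd_chart[OF C y]]
  show b: "base_pt (cyl \<phi> (t, y)) = \<phi> y"
    using n bd_chart[OF C y] by (simp add: vec_eq_iff base_pt_nth)
  show x: "cyl \<phi> (t, y) $ xi = t" using n by simp
  have "inv_into (U \<inter> bd G) \<phi> (\<phi> y) = y"
    using y inj_on_subset[OF chartD(4)[OF C], of "U \<inter> bd G"] by (intro inv_into_f_f) auto
  then show "cyl_inv G U \<phi> (cyl \<phi> (t, y)) = (t, y)" by (simp add: cyl_inv_def b x)
qed

lemma cdomE:
  assumes C: "(U, \<phi>) \<in> charts G" and "v \<in> cdom U \<phi> W"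
  obtains t y where "t > 0" "y \<in> U" "y \<in> W" "y \<in> bd G" "v = cyl \<phi> (t, y)" "cyl_inv G U \<phi> v = (t, y)"
    "base_pt v = \<phi> y" "v $ xi = t"
proof -
  from assms(2) obtain t y where y: "t > 0" "y \<in> U" "y \<in> W" "y \<in> bd G" "v = cyl \<phi> (t, y)"
    unfolding cdom_eq[OF C, symmetric] by auto
  show thesis
    by (rule that[OF y]) (use cyl_inv_cyl[OF C y(2,4)] y in auto)
qed

lemma cyl_in_cdom:
  assumes C: "(U, \<phi>) \<in> charts G" and y: "t > 0" "y \<in> U" "y \<in> W" "y \<in> bd G"
  shows "cyl \<phi> (t, y) \<in> cdom U \<phi> W"
  unfolding cdom_eq[OF C, symmetric] using y by auto

lemma open_cdom:
  assumes C: "(U, \<phi>) \<in> charts G" and W: "open W"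
  shows "open (cdom U \<phi> W)"
proof -
  obtain T where T: "open T" "\<phi> ` (U \<inter> W) = halfspace \<inter> T" using chart_open_image[OF C W] .
  have "cdom U \<phi> W = {v. v $ xi > 0} \<inter> base_pt -` T"
    by (auto simp: cdom_def T(2) halfspace_def base_pt_nth)
  moreover have "open (base_pt -` T :: 'n pt set)"
    by (rule open_vimage[OF T(1) linear_continuous_on[OF bounded_linear_base_pt]])
  ultimately show ?thesis by (auto intro!: open_Int open_Collect_less continuous_intros)
qed

lemma smooth_fun_cdom:
  fixes f :: "'a \<Rightarrow> 'b::real_normed_vector"
  assumes C: "(U, \<phi>) \<in> charts G" and f: "smooth_fun G W f"
  shows "smooth_on (cdom U \<phi> W) (\<lambda>v. f (snd (cyl_inv G U \<phi> v)))"
proof -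
  have "smooth_on (\<phi> ` (U \<inter> W)) (\<lambda>v. f (inv_into U \<phi> v))"
    using f C unfolding smooth_fun_def by fast
  from smooth_on_compose[OF this smooth_on_linear[OF bounded_linear_base_pt], of "cdom U \<phi> W"]
  have "smooth_on (cdom U \<phi> W) (\<lambda>v. f (inv_into U \<phi> (base_pt v)))" by (auto simp: cdom_def)
  moreover have "f (snd (cyl_inv G U \<phi> v)) = f (inv_into U \<phi> (base_pt v))" if "v \<in> cdom U \<phi> W" for v
    using that by (elim cdomE[OF C]) (simp add: chartD(4)[OF C])
  ultimately show ?thesis using smooth_on_cong by (metis (no_types, lifting))
qed

lemma smooth_cyl_transition:
  assumes C: "(U, \<phi>) \<in> charts G" and C': "(V, \<psi>) \<in> charts G"
  shows "smooth_on (cdom U \<phi> V) (\<lambda>v. cyl \<psi> (cyl_inv G U \<phi> v))"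
proof -
  have "smooth_on (cdom U \<phi> V) (\<lambda>v. \<psi> (inv_into U \<phi> (base_pt v)))"
    by (rule smooth_on_compose[OF transition[OF C C'] smooth_on_linear[OF bounded_linear_base_pt]])
      (auto simp: cdom_def)
  moreover have "smooth_on (cdom U \<phi> V) (\<lambda>v. v $ xi *\<^sub>R axis xi 1 :: 'n pt)"
    by (intro smooth_on_scaleR smooth_on_const smooth_on_linear bounded_linear_vec_nth)
  ultimately have "smooth_on (cdom U \<phi> V) (\<lambda>v. \<psi> (inv_into U \<phi> (base_pt v)) + v $ xi *\<^sub>R axis xi 1)"
    by (rule smooth_on_add)
  moreover have "cyl \<psi> (cyl_inv G U \<phi> v) = \<psi> (inv_into U \<phi> (base_pt v)) + v $ xi *\<^sub>R axis xi 1"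
    if "v \<in> cdom U \<phi> V" for v
    using that by (elim cdomE[OF C]) (simp add: chartD(4)[OF C] cyl_def)
  ultimately show ?thesis using smooth_on_cong by (metis (no_types, lifting))
qed

lemma continuous_cyl_inv:
  assumes C: "(U, \<phi>) \<in> charts G"
  shows "continuous_on (cdom U \<phi> W) (cyl_inv G U \<phi>)"
proof -
  have "continuous_on (\<phi> ` U) (inv_into U \<phi>)" using chartD(3)[OF C] by (simp add: homeomorphism_def)
  then have "continuous_on (cdom U \<phi> W) (\<lambda>v. inv_into U \<phi> (base_pt v))"
    by (rule continuous_on_compose2[OF _ linear_continuous_on[OF bounded_linear_base_pt]]) (auto simp: cdom_def)
  then have "continuous_on (cdom U \<phi> W) (\<lambda>v. (v $ xi, inv_into U \<phi> (base_pt v)))"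
    by (intro continuous_intros)
  moreover have "cyl_inv G U \<phi> v = (v $ xi, inv_into U \<phi> (base_pt v))" if "v \<in> cdom U \<phi> W" for v
    using that by (elim cdomE[OF C]) (simp add: chartD(4)[OF C])
  ultimately show ?thesis using continuous_on_cong by (metis (no_types, lifting))
qed

lemma continuous_cyl:
  assumes C: "(U, \<phi>) \<in> charts G"
  shows "continuous_on (UNIV \<times> U) (cyl \<phi>)"
proof -
  have "continuous_on U \<phi>" using chartD(3)[OF C] by (simp add: homeomorphism_def)
  then have "continuous_on (UNIV \<times> U) (\<lambda>z. \<phi> (snd z))"
    by (rule continuous_on_compose2[OF _ continuous_on_snd[OF continuous_on_id]]) auto
  then show ?thesis unfolding cyl_def[abs_def] by (intro continuous_intros)
qed

subsection \<open>Frames\<close>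

lemma vs: "vector_space (scl G)"
  using geo unfolding cone_geometry_def hermitian_bundle_def by blast

lemma herm_bundle: "hermitian_bundle G"
  using geo unfolding cone_geometry_def by blast

lemma frames_cover: "\<exists>W e. (W, e) \<in> frames G \<and> p \<in> W"
proof -
  have "(\<Union>(fst ` frames G)) = UNIV"
    using herm_bundle unfolding hermitian_bundle_def by (elim conjE)
  then have "p \<in> (\<Union>(fst ` frames G))" by simp
  then show ?thesis by auto
qed

lemma frameD:
  assumes "(W, e) \<in> frames G"
  shows "open W" "\<And>p. p \<in> W \<Longrightarrow> bij_betw (frame_map G e p) UNIV (fib G p)"
proof -
  have "\<forall>(W, e)\<in>frames G. open W \<and> (\<forall>p\<in>W. bij_betw (frame_map G e p) UNIV (fib G p))"
    using herm_bundle unfolding hermitian_bundle_def by (elim conjE)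
  from bspec[OF this assms] show "open W" "\<And>p. p \<in> W \<Longrightarrow> bij_betw (frame_map G e p) UNIV (fib G p)"
    by simp_all
qed

lemma frame_transition:
  assumes "(W, e) \<in> frames G" "(W', e') \<in> frames G"
  shows "smooth_fun G (W \<inter> W') (\<lambda>p. coords G e' p (e j p))"
proof -
  have "\<forall>(W, e)\<in>frames G. \<forall>(W', e')\<in>frames G. \<forall>j. smooth_fun G (W \<inter> W') (\<lambda>p. coords G e' p (e j p))"
    using herm_bundle unfolding hermitian_bundle_def by (elim conjE)
  from bspec[OF this assms(1)] have "\<forall>(W', e')\<in>frames G. \<forall>j. smooth_fun G (W \<inter> W') (\<lambda>p. coords G e' p (e j p))"
    by simp
  from bspec[OF this assms(2)] show ?thesis by simp
qed

lemma frame_herm_smooth: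
  assumes "(W, e) \<in> frames G"
  shows "smooth_fun G W (\<lambda>p. herm G p (e j p) (e k p))"
proof -
  have "\<forall>(W, e)\<in>frames G. \<forall>j k. smooth_fun G W (\<lambda>p. herm G p (e j p) (e k p))"
    using herm_bundle unfolding hermitian_bundle_def by (elim conjE)
  from bspec[OF this assms(1)] show ?thesis by simp
qed

interpretation vs: vector_space "scl G" by (rule vs)

lemma frame_map_add: "frame_map G e p (c + d) = frame_map G e p c + frame_map G e p d"
  by (simp add: frame_map_def vs.scale_left_distrib sum.distrib)

lemma frame_map_smult: "frame_map G e p (c *s d) = scl G c (frame_map G e p d)"
  by (simp add: frame_map_def vs.scale_sum_right)

lemma frame_map_zero [simp]: "frame_map G e p 0 = 0"
  by (simp add: frame_map_def)

lemma frame_map_axis: "frame_map G e p (axis j 1) = e j p"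
proof -
  have "frame_map G e p (axis j 1) = (\<Sum>k\<in>UNIV. if k = j then e k p else 0)"
    unfolding frame_map_def by (intro sum.cong) (auto simp: axis_def)
  then show ?thesis by simp
qed

lemma frame_map_fib: "(W, e) \<in> frames G \<Longrightarrow> p \<in> W \<Longrightarrow> frame_map G e p c \<in> fib G p"
  using frameD(2) bij_betwE by blast

lemma coords_frame_map: "(W, e) \<in> frames G \<Longrightarrow> p \<in> W \<Longrightarrow> coords G e p (frame_map G e p c) = c"
  unfolding coords_def using frameD(2) by (metis bij_betw_imp_inj_on inv_f_f)

lemma frame_map_coords:
  "(W, e) \<in> frames G \<Longrightarrow> p \<in> W \<Longrightarrow> v \<in> fib G p \<Longrightarrow> frame_map G e p (coords G e p v) = v"
  unfolding coords_def using frameD(2) by (metis bij_betw_imp_surj_on f_inv_into_f)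

lemma fibE:
  assumes "(W, e) \<in> frames G" "p \<in> W" "v \<in> fib G p"
  obtains c where "v = frame_map G e p c" "coords G e p v = c"
  using frame_map_coords[OF assms] by metis

lemma fib_zero: "0 \<in> fib G p" and fib_add: "v \<in> fib G p \<Longrightarrow> w \<in> fib G p \<Longrightarrow> v + w \<in> fib G p"
  and fib_scl: "v \<in> fib G p \<Longrightarrow> scl G c v \<in> fib G p"
proof -
  obtain W e where F: "(W, e) \<in> frames G" "p \<in> W" using frames_cover by blast
  show "0 \<in> fib G p" using frame_map_fib[OF F, of 0] by simp
  show "v + w \<in> fib G p" if "v \<in> fib G p" "w \<in> fib G p"
    using that frame_map_fib[OF F] frame_map_add by (metis F fibE)
  show "scl G c v \<in> fib G p" if "v \<in> fib G p"
    using that frame_map_fib[OF F] frame_map_smult by (metis F fibE)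
qed

lemma fib_minus: "v \<in> fib G p \<Longrightarrow> w \<in> fib G p \<Longrightarrow> v - w \<in> fib G p"
  using fib_add[of v p "scl G (-1) w"] fib_scl[of w p "-1"] by simp

lemma coords_add: "(W, e) \<in> frames G \<Longrightarrow> p \<in> W \<Longrightarrow> v \<in> fib G p \<Longrightarrow> w \<in> fib G p \<Longrightarrow>
    coords G e p (v + w) = coords G e p v + coords G e p w"
  by (metis coords_frame_map fibE frame_map_add)

lemma coords_scl: "(W, e) \<in> frames G \<Longrightarrow> p \<in> W \<Longrightarrow> v \<in> fib G p \<Longrightarrow>
    coords G e p (scl G c v) = c *s coords G e p v"
  by (metis coords_frame_map fibE frame_map_smult)

lemma coords_zero: "(W, e) \<in> frames G \<Longrightarrow> p \<in> W \<Longrightarrow> coords G e p 0 = 0"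
  by (metis coords_frame_map frame_map_zero)

lemma coords_inject: "(W, e) \<in> frames G \<Longrightarrow> p \<in> W \<Longrightarrow> v \<in> fib G p \<Longrightarrow> w \<in> fib G p \<Longrightarrow>
    coords G e p v = coords G e p w \<Longrightarrow> v = w"
  by (metis frame_map_coords)

text \<open>Coordinates change linearly, with columns \<open>coords G e' p (e j p)\<close> that are
  smooth by \<open>frame_transition\<close>; this carries both smoothness and limits from one frame
  to another.\<close>

lemma coords_frame_change:
  assumes F: "(W, e) \<in> frames G" and F': "(W', e') \<in> frames G" and p: "p \<in> W" "p \<in> W'"
  shows "coords G e' p (frame_map G e p c) = (\<Sum>j\<in>UNIV. c $ j *s coords G e' p (e j p))"
proof -
  have ej: "e j p \<in> fib G p" for j using frame_map_fib[OF F p(1), of "axis j 1"] by (simp add: frame_map_axis)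
  have "frame_map G e' p (\<Sum>j\<in>J. c $ j *s coords G e' p (e j p)) = (\<Sum>j\<in>J. scl G (c $ j) (e j p))"
    if "finite J" for J
    using that by (induction J) (simp_all add: frame_map_add frame_map_smult frame_map_coords[OF F' p(2) ej])
  from this[of UNIV] have "frame_map G e p c = frame_map G e' p (\<Sum>j\<in>UNIV. c $ j *s coords G e' p (e j p))"
    by (simp add: frame_map_def[of G e p c])
  then show ?thesis by (simp only: coords_frame_map[OF F' p(2)])
qed

subsection \<open>Smooth sections over the cone\<close>

lemma cone_smooth_iff:
  "u \<in> cone_smooth_sections G \<longleftrightarrow> (\<forall>t>0. \<forall>y\<in>bd G. u (t, y) \<in> fib G y) \<and>
     (\<forall>U \<phi> W e. (U, \<phi>) \<in> charts G \<longrightarrow> (W, e) \<in> frames G \<longrightarrow> smooth_on (cdom U \<phi> W) (cyl_rep G (U, \<phi>) e u))"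
  (is "_ \<longleftrightarrow> ?A \<and> ?B")
proof -
  have "(\<forall>(U, \<phi>)\<in>charts G. \<forall>(W, e)\<in>frames G.
      smooth_on (cyl \<phi> ` ({0<..} \<times> (U \<inter> W \<inter> bd G))) (cyl_rep G (U, \<phi>) e u)) \<longleftrightarrow> ?B"
  proof (intro iffI allI impI ballI)
    fix U \<phi> W e
    assume a: "\<forall>(U, \<phi>)\<in>charts G. \<forall>(W, e)\<in>frames G.
        smooth_on (cyl \<phi> ` ({0<..} \<times> (U \<inter> W \<inter> bd G))) (cyl_rep G (U, \<phi>) e u)"
      and C: "(U, \<phi>) \<in> charts G" and F: "(W, e) \<in> frames G"
    from bspec[OF a C] have "\<forall>(W, e)\<in>frames G.
        smooth_on (cyl \<phi> ` ({0<..} \<times> (U \<inter> W \<inter> bd G))) (cyl_rep G (U, \<phi>) e u)" by simp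
    from bspec[OF this F] show "smooth_on (cdom U \<phi> W) (cyl_rep G (U, \<phi>) e u)"
      by (simp add: cdom_eq[OF C])
  next
    fix C assume a: ?B and "C \<in> charts G"
    then show "case C of (U, \<phi>) \<Rightarrow> \<forall>(W, e)\<in>frames G.
        smooth_on (cyl \<phi> ` ({0<..} \<times> (U \<inter> W \<inter> bd G))) (cyl_rep G (U, \<phi>) e u)"
      by (cases C) (simp add: cdom_eq split_beta)
  qed
  then show ?thesis unfolding cone_smooth_sections_def by simp
qed

lemma cone_smoothD:
  assumes "u \<in> cone_smooth_sections G"
  shows "t > 0 \<Longrightarrow> y \<in> bd G \<Longrightarrow> u (t, y) \<in> fib G y"
    and "(U, \<phi>) \<in> charts G \<Longrightarrow> (W, e) \<in> frames G \<Longrightarrow> smooth_on (cdom U \<phi> W) (cyl_rep G (U, \<phi>) e u)"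
  using assms unfolding cone_smooth_iff by simp_all

lemma cone_smoothI:
  assumes "\<And>t y. t > 0 \<Longrightarrow> y \<in> bd G \<Longrightarrow> u (t, y) \<in> fib G y"
    and "\<And>U \<phi> W e. (U, \<phi>) \<in> charts G \<Longrightarrow> (W, e) \<in> frames G \<Longrightarrow> smooth_on (cdom U \<phi> W) (cyl_rep G (U, \<phi>) e u)"
  shows "u \<in> cone_smooth_sections G"
  using assms unfolding cone_smooth_iff by simp

lemma cyl_rep_cyl: "(U, \<phi>) \<in> charts G \<Longrightarrow> y \<in> U \<Longrightarrow> y \<in> bd G \<Longrightarrow>
    cyl_rep G (U, \<phi>) e u (cyl \<phi> (t, y)) = coords G e y (u (t, y))"
  by (simp add: cyl_rep_def cyl_inv_cyl)

lemma cyl_rep_add: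
  assumes "(U, \<phi>) \<in> charts G" "(W, e) \<in> frames G" "v \<in> cdom U \<phi> W"
    "\<And>t y. t > 0 \<Longrightarrow> y \<in> bd G \<Longrightarrow> u (t, y) \<in> fib G y" "\<And>t y. t > 0 \<Longrightarrow> y \<in> bd G \<Longrightarrow> w (t, y) \<in> fib G y"
  shows "cyl_rep G (U, \<phi>) e (u + w) v = cyl_rep G (U, \<phi>) e u v + cyl_rep G (U, \<phi>) e w v"
  using assms(3) by (elim cdomE[OF assms(1)]) (simp add: cyl_rep_cyl[OF assms(1)] coords_add[OF assms(2)] assms(4,5))

lemma cyl_rep_sscl:
  assumes "(U, \<phi>) \<in> charts G" "(W, e) \<in> frames G" "v \<in> cdom U \<phi> W"
    "\<And>t y. t > 0 \<Longrightarrow> y \<in> bd G \<Longrightarrow> u (t, y) \<in> fib G y"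
  shows "cyl_rep G (U, \<phi>) e (sscl G c u) v = c *s cyl_rep G (U, \<phi>) e u v"
  using assms(3)
  by (elim cdomE[OF assms(1)]) (simp add: cyl_rep_cyl[OF assms(1)] coords_scl[OF assms(2)] assms(4) sscl_def)

lemma cyl_rep_kappa:
  assumes "(U, \<phi>) \<in> charts G" "(W, e) \<in> frames G" "v \<in> cdom U \<phi> W" "\<rho> > 0"
    "\<And>t y. t > 0 \<Longrightarrow> y \<in> bd G \<Longrightarrow> u (t, y) \<in> fib G y"
  shows "cyl_rep G (U, \<phi>) e (kappa G m \<rho> u) v = of_real (\<rho> powr (real m / 2)) *s cyl_rep G (U, \<phi>) e u (dil \<rho> v)"
proof -
  from assms(3) obtain t y where y: "t > 0" "y \<in> U" "y \<in> W" "y \<in> bd G" "v = cyl \<phi> (t, y)"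
    by (elim cdomE[OF assms(1)])
  note n = cyl_nth[of \<phi> y, OF bd_chart[OF assms(1) y(2,4)]]
  have "dil \<rho> v = cyl \<phi> (\<rho> * t, y)" by (simp add: vec_eq_iff dil_nth y(5) n)
  then show ?thesis
    using y assms(4) by (simp add: cyl_rep_cyl[OF assms(1)] kappa_def coords_scl[OF assms(2)] assms(5))
qed

lemma cone_smooth_add: "u \<in> cone_smooth_sections G \<Longrightarrow> w \<in> cone_smooth_sections G \<Longrightarrow> u + w \<in> cone_smooth_sections G"
proof (rule cone_smoothI)
  fix U \<phi> W e
  assume a: "u \<in> cone_smooth_sections G" "w \<in> cone_smooth_sections G" "(U, \<phi>) \<in> charts G" "(W, e) \<in> frames G"
  show "smooth_on (cdom U \<phi> W) (cyl_rep G (U, \<phi>) e (u + w))"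
    by (rule smooth_on_cong[THEN iffD2, OF cyl_rep_add[OF a(3,4) _ cone_smoothD(1)[OF a(1)] cone_smoothD(1)[OF a(2)]]
          smooth_on_add[OF cone_smoothD(2)[OF a(1,3,4)] cone_smoothD(2)[OF a(2,3,4)]]])
qed (simp add: fib_add cone_smoothD(1))

lemma cone_smooth_sscl: "u \<in> cone_smooth_sections G \<Longrightarrow> sscl G c u \<in> cone_smooth_sections G"
proof (rule cone_smoothI)
  fix U \<phi> W e
  assume a: "u \<in> cone_smooth_sections G" "(U, \<phi>) \<in> charts G" "(W, e) \<in> frames G"
  show "smooth_on (cdom U \<phi> W) (cyl_rep G (U, \<phi>) e (sscl G c u))"
    by (rule smooth_on_cong[THEN iffD2, OF cyl_rep_sscl[OF a(2,3) _ cone_smoothD(1)[OF a(1)]]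
          smooth_on_smult[OF smooth_on_const cone_smoothD(2)[OF a]]])
qed (simp add: fib_scl cone_smoothD(1) sscl_def)

lemma cone_smooth_kappa: "\<rho> > 0 \<Longrightarrow> u \<in> cone_smooth_sections G \<Longrightarrow> kappa G m \<rho> u \<in> cone_smooth_sections G"
proof (rule cone_smoothI)
  fix U \<phi> W e
  assume a: "u \<in> cone_smooth_sections G" "(U, \<phi>) \<in> charts G" "(W, e) \<in> frames G" "\<rho> > 0"
  show "smooth_on (cdom U \<phi> W) (cyl_rep G (U, \<phi>) e (kappa G m \<rho> u))"
    by (rule smooth_on_cong[THEN iffD2, OF cyl_rep_kappa[OF a(2,3) _ a(4) cone_smoothD(1)[OF a(1)]]
          smooth_on_smult[OF smooth_on_const smooth_on_dil[OF open_cdom[OF a(2) frameD(1)[OF a(3)]] dil_cdom a(4) cone_smoothD(2)[OF a(1,2,3)]]]])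
qed (simp add: fib_scl cone_smoothD(1) kappa_def)

lemma cone_testI:
  assumes "u \<in> cone_smooth_sections G" "compact K" "K \<subseteq> {0<..} \<times> bd G"
    "\<And>t y. t > 0 \<Longrightarrow> y \<in> bd G \<Longrightarrow> (t, y) \<notin> K \<Longrightarrow> u (t, y) = 0"
  shows "u \<in> cone_test_sections G"
  unfolding cone_test_sections_def mem_Collect_eq
  by (intro conjI exI[of _ K] assms(1-3)) (use assms(4) in auto)

lemma cone_test_zero: "0 \<in> cone_test_sections G"
proof (rule cone_testI[of _ "{}"])
  show "0 \<in> cone_smooth_sections G"
  proof (rule cone_smoothI)
    fix U \<phi> W e assume a: "(U, \<phi>) \<in> charts G" "(W, e) \<in> frames G"
    have "cyl_rep G (U, \<phi>) e 0 v = 0" if "v \<in> cdom U \<phi> W" for v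
      using that by (elim cdomE[OF a(1)]) (simp add: cyl_rep_cyl[OF a(1)] coords_zero[OF a(2)])
    then show "smooth_on (cdom U \<phi> W) (cyl_rep G (U, \<phi>) e 0)"
      using smooth_on_const smooth_on_cong by (metis (no_types, lifting))
  qed (simp add: fib_zero)
qed auto

lemma cone_test_add: "u \<in> cone_test_sections G \<Longrightarrow> w \<in> cone_test_sections G \<Longrightarrow> u + w \<in> cone_test_sections G"
proof -
  assume u: "u \<in> cone_test_sections G" and w: "w \<in> cone_test_sections G"
  from u obtain K where K: "u \<in> cone_smooth_sections G" "compact K" "K \<subseteq> {0<..} \<times> bd G"
    "\<forall>z\<in>({0<..} \<times> bd G) - K. u z = 0" unfolding cone_test_sections_def by blast
  from w obtain L where L: "w \<in> cone_smooth_sections G" "compact L" "L \<subseteq> {0<..} \<times> bd G"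
    "\<forall>z\<in>({0<..} \<times> bd G) - L. w z = 0" unfolding cone_test_sections_def by blast
  show ?thesis
    by (rule cone_testI[of _ "K \<union> L"]) (use K L in \<open>auto intro: cone_smooth_add\<close>)
qed

lemma cone_test_sscl: "u \<in> cone_test_sections G \<Longrightarrow> sscl G c u \<in> cone_test_sections G"
proof -
  assume "u \<in> cone_test_sections G"
  then obtain K where K: "u \<in> cone_smooth_sections G" "compact K" "K \<subseteq> {0<..} \<times> bd G"
    "\<forall>z\<in>({0<..} \<times> bd G) - K. u z = 0" unfolding cone_test_sections_def by blast
  show ?thesis
    by (rule cone_testI[OF cone_smooth_sscl[OF K(1)] K(2,3)]) (use K(4) in \<open>simp add: sscl_def\<close>)
qed

lemma cone_test_kappa:
  assumes "\<rho> > 0" "u \<in> cone_test_sections G"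
  shows "kappa G m \<rho> u \<in> cone_test_sections G"
proof -
  from assms(2) obtain K where K: "u \<in> cone_smooth_sections G" "compact K" "K \<subseteq> {0<..} \<times> bd G"
    "\<forall>z\<in>({0<..} \<times> bd G) - K. u z = 0" unfolding cone_test_sections_def by blast
  let ?f = "\<lambda>z :: real \<times> 'a. (fst z / \<rho>, snd z)"
  show ?thesis
  proof (rule cone_testI[of _ "?f ` K"])
    show "compact (?f ` K)" by (intro compact_continuous_image K) (auto intro!: continuous_intros simp: assms(1) less_imp_neq[THEN not_sym])
    show "?f ` K \<subseteq> {0<..} \<times> bd G" using K(3) assms(1) by force
    fix t y assume "t > 0" "y \<in> bd G" "(t, y) \<notin> ?f ` K"
    then have "(\<rho> * t, y) \<notin> K" using assms(1) by (force simp: image_iff)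
    then show "kappa G m \<rho> u (t, y) = 0" using K(4)[rule_format, of "(\<rho> * t, y)"] \<open>t > 0\<close> \<open>y \<in> bd G\<close> assms(1) by (simp add: kappa_def)
  qed (rule cone_smooth_kappa[OF assms(1) K(1)])
qed

definition sect :: "'a set \<Rightarrow> ('a \<Rightarrow> 'n pt) \<Rightarrow> 'a set \<Rightarrow> ('r \<Rightarrow> 'a \<Rightarrow> 'f) \<Rightarrow> ('n pt \<Rightarrow> 'r cvec) \<Rightarrow> ('a, 'f) csec" where
  "sect U \<phi> W e g = (\<lambda>(t, y). if t > 0 \<and> y \<in> U \<inter> W \<inter> bd G then frame_map G e y (g (cyl \<phi> (t, y))) else 0)"

text \<open>Read in another chart and frame, the section is a smooth transform of \<open>g\<close>
  near the image \<open>K\<close> of the support, and it is zero off \<open>K\<close>. As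
  \<open>K\<close> is compact, hence closed, both regions are open and smoothness can be checked on
  each.\<close>

lemma sect_test:
  assumes C: "(U, \<phi>) \<in> charts G" and F: "(W, e) \<in> frames G" and g: "cpt_smooth (cdom U \<phi> W) g"
  shows "sect U \<phi> W e g \<in> cone_test_sections G"
proof -
  obtain L where L: "smooth_on UNIV g" "compact L" "L \<subseteq> cdom U \<phi> W" "\<And>v. v \<notin> L \<Longrightarrow> g v = 0"
    using g unfolding cpt_smooth_def by blast
  define K where "K = cyl_inv G U \<phi> ` L"
  have K: "compact K"
    unfolding K_def using continuous_on_subset[OF continuous_cyl_inv[OF C] L(3)] L(2) by (rule compact_continuous_image)
  have KS: "t > 0 \<and> y \<in> U \<and> y \<in> W \<and> y \<in> bd G" if "(t, y) \<in> K" for t y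
  proof -
    from that obtain v where "v \<in> L" "cyl_inv G U \<phi> v = (t, y)" by (auto simp: K_def)
    then show ?thesis using L(3) by (auto elim!: cdomE[OF C])
  qed
  have zero: "sect U \<phi> W e g (t, y) = 0" if "(t, y) \<notin> K" for t y
  proof (cases "t > 0 \<and> y \<in> U \<inter> W \<inter> bd G")
    case True
    then have "cyl \<phi> (t, y) \<notin> L" using that cyl_inv_cyl(1)[OF C, of y t] by (force simp: K_def image_iff)
    then show ?thesis using L(4) by (simp add: sect_def)
  next
    case False
    then show ?thesis by (auto simp: sect_def)
  qed
  have "sect U \<phi> W e g \<in> cone_smooth_sections G"
  proof (rule cone_smoothI)
    show "sect U \<phi> W e g (t, y) \<in> fib G y" for t y
      using frame_map_fib[OF F] fib_zero by (auto simp: sect_def)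
    fix V \<psi> W' e' assume C': "(V, \<psi>) \<in> charts G" and F': "(W', e') \<in> frames G"
    let ?O = "cdom V \<psi> W'"
    have oO: "open ?O" by (rule open_cdom[OF C' frameD(1)[OF F']])
    show "smooth_on ?O (cyl_rep G (V, \<psi>) e' (sect U \<phi> W e g))"
    proof (rule smooth_on_local)
      fix q assume q: "q \<in> ?O"
      then obtain t y where y: "t > 0" "y \<in> V" "y \<in> W'" "y \<in> bd G" "q = cyl \<psi> (t, y)" "cyl_inv G V \<psi> q = (t, y)"
        by (elim cdomE[OF C'])
      show "\<exists>X. open X \<and> q \<in> X \<and> smooth_on (X \<inter> ?O) (cyl_rep G (V, \<psi>) e' (sect U \<phi> W e g))"
      proof (cases "(t, y) \<in> K")
        case True
        let ?X = "cdom V \<psi> (W' \<inter> U \<inter> W)"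
        have "q \<in> ?X" unfolding y(5) by (rule cyl_in_cdom[OF C']) (use y KS[OF True] in auto)
        moreover have "open ?X" by (rule open_cdom[OF C']) (use frameD(1) F F' chartD(1)[OF C] in blast)
        moreover have "smooth_on (?X \<inter> ?O) (cyl_rep G (V, \<psi>) e' (sect U \<phi> W e g))"
        proof -
          have X: "?X \<subseteq> cdom V \<psi> (W \<inter> W')" "?X \<subseteq> cdom V \<psi> U" by (auto simp: cdom_def)
          have "smooth_on ?X (\<lambda>v. \<Sum>j\<in>UNIV. g (cyl \<phi> (cyl_inv G V \<psi> v)) $ j *s
              coords G e' (snd (cyl_inv G V \<psi> v)) (e j (snd (cyl_inv G V \<psi> v))))"
            by (intro smooth_on_sum smooth_on_smult smooth_on_nth
                smooth_on_compose[OF L(1) smooth_on_subset[OF smooth_cyl_transition[OF C' C] X(2)]]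
                smooth_on_subset[OF smooth_fun_cdom[OF C' frame_transition[OF F F']] X(1)]) auto
          moreover have "cyl_rep G (V, \<psi>) e' (sect U \<phi> W e g) v = (\<Sum>j\<in>UNIV. g (cyl \<phi> (cyl_inv G V \<psi> v)) $ j *s
              coords G e' (snd (cyl_inv G V \<psi> v)) (e j (snd (cyl_inv G V \<psi> v))))" if "v \<in> ?X" for v
            using that by (elim cdomE[OF C'])
              (auto simp: cyl_rep_cyl[OF C'] sect_def cyl_inv_cyl[OF C'] coords_frame_change[OF F F'])
          ultimately have "smooth_on ?X (cyl_rep G (V, \<psi>) e' (sect U \<phi> W e g))"
            using smooth_on_cong by (metis (no_types, lifting))
          then show ?thesis using smooth_on_subset by blast
        qed
        ultimately show ?thesis by blast
      next
        case False
        have "closed K" using K by (rule compact_imp_closed)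
        let ?X = "?O \<inter> cyl_inv G V \<psi> -` (- K)"
        have "open ?X" using continuous_on_open_vimage[OF oO] continuous_cyl_inv[OF C'] \<open>closed K\<close>
          by (metis Int_commute open_Compl)
        moreover have "q \<in> ?X" using q y(6) False by simp
        moreover have "smooth_on (?X \<inter> ?O) (cyl_rep G (V, \<psi>) e' (sect U \<phi> W e g))"
        proof (rule smooth_on_cong[THEN iffD2, OF _ smooth_on_const])
          fix v assume "v \<in> ?X \<inter> ?O"
          then have v: "v \<in> ?O" "cyl_inv G V \<psi> v \<notin> K" by auto
          from v(1) obtain t y where y: "y \<in> V" "y \<in> W'" "y \<in> bd G" "v = cyl \<psi> (t, y)" "cyl_inv G V \<psi> v = (t, y)"
            by (elim cdomE[OF C'])
          have "sect U \<phi> W e g (t, y) = 0" using zero v(2) y(5) by simp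
          then show "cyl_rep G (V, \<psi>) e' (sect U \<phi> W e g) v = 0"
            unfolding y(4) by (simp add: cyl_rep_cyl[OF C' y(1,3)] coords_zero[OF F' y(2)])
        qed
        ultimately show ?thesis by blast
      qed
    qed
  qed
  then show ?thesis
    by (rule cone_testI[OF _ K]) (use KS zero in auto)
qed

end

section \<open>Square integrable sections\<close>

lemma nn_integral_lborel_dil:
  fixes f :: "'n::{finite,linorder} pt \<Rightarrow> ennreal"
  assumes f: "f \<in> borel_measurable borel" and s: "s > 0"
  shows "(\<integral>\<^sup>+v. f v \<partial>lborel) = ennreal s * (\<integral>\<^sup>+v. f (t + dil s v) \<partial>lborel)"
proof -
  define c where "c = (\<lambda>j :: 'n pt. if j = axis xi 1 then s else 1)"
  let ?T = "\<lambda>v. t + (\<Sum>j\<in>Basis. (c j * (v \<bullet> j)) *\<^sub>R j)"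
  have ax: "axis xi 1 \<in> (Basis :: 'n pt set)" by simp
  have T: "?T v = t + dil s v" for v
  proof -
    have "(\<Sum>j\<in>Basis. (c j * (v \<bullet> j)) *\<^sub>R j)
        = (\<Sum>j\<in>Basis. (v \<bullet> j) *\<^sub>R j + (if j = axis xi 1 then ((s - 1) * (v \<bullet> j)) *\<^sub>R j else 0))"
      by (intro sum.cong) (auto simp: c_def algebra_simps)
    also have "\<dots> = dil s v"
      unfolding sum.distrib using ax by (simp add: euclidean_representation dil_def inner_axis)
    finally show ?thesis by simp
  qed
  have Tm: "(\<lambda>v. t + dil s v) \<in> borel_measurable borel"
    by (intro borel_measurable_add borel_measurable_const borel_measurable_continuous_onI linear_continuous_on bounded_linear_dil)
  have "lborel = density (distr lborel borel ?T) (\<lambda>_. (\<Prod>j\<in>Basis. \<bar>c j\<bar>))"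
    by (rule lborel_affine_euclidean) (use s in \<open>auto simp: c_def\<close>)
  also have "(\<Prod>j\<in>(Basis :: 'n pt set). \<bar>c j\<bar>) = s"
    using ax s by (simp add: c_def if_distrib[of abs] prod.delta cong: if_cong)
  finally have "lborel = density (distr lborel borel (\<lambda>v. t + dil s v)) (\<lambda>_. ennreal s)" by (simp add: T)
  then have "(\<integral>\<^sup>+v. f v \<partial>lborel) = (\<integral>\<^sup>+v. f v \<partial>density (distr lborel borel (\<lambda>v. t + dil s v)) (\<lambda>_. ennreal s))"
    by simp
  also have "\<dots> = ennreal s * (\<integral>\<^sup>+v. f (t + dil s v) \<partial>lborel)"
    using f Tm by (simp add: nn_integral_density nn_integral_distr nn_integral_cmult)
  finally show ?thesis .
qed

context cone_geom
begin

section \<open>The boundary and its density in charts\<close>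

lemma bd_closed: "closed (bd G)"
proof -
  have "open (- bd G)"
  proof (subst open_subopen, intro ballI)
    fix p assume p: "p \<in> - bd G"
    obtain U \<phi> where C: "(U, \<phi>) \<in> charts G" "p \<in> U" using charts_cover by blast
    let ?T = "U \<inter> \<phi> -` {v. v $ xi > 0}"
    have "open {v :: 'n pt. v $ xi > 0}" by (auto intro!: open_Collect_less continuous_intros)
    moreover have "continuous_on U \<phi>" using chartD(3)[OF C(1)] by (simp add: homeomorphism_def)
    ultimately have "open (\<phi> -` {v. v $ xi > 0} \<inter> U)"
      using continuous_on_open_vimage[OF chartD(1)[OF C(1)]] by blast
    then have "open ?T" by (simp add: Int_commute)
    moreover have "\<phi> p $ xi \<noteq> 0" using p chart_bd_iff[OF C] by simp
    then have "p \<in> ?T" using C(2) chart_halfspace[OF C] by simp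
    moreover have "?T \<subseteq> - bd G" using chart_bd_iff[OF C(1)] by auto
    ultimately show "\<exists>T. open T \<and> p \<in> T \<and> T \<subseteq> - bd G" by blast
  qed
  then show ?thesis by (simp add: closed_def)
qed

lemma bd_borel: "bd G \<in> sets borel"
  using bd_closed by simp

lemma bd_nonempty: "bd G \<noteq> {}"
  using geo unfolding cone_geometry_def compact_manifold_with_boundary_def by (elim conjE)

lemma densities: "densities G"
  using geo unfolding cone_geometry_def by (elim conjE)

lemma sets_densY: "B \<in> sets (densY G) \<longleftrightarrow> B \<in> sets borel \<and> B \<subseteq> bd G"
proof -
  have "sets (densY G) = sets (restrict_space borel (bd G))"
    using densities unfolding densities_def by (elim conjE)
  then show ?thesis using bd_borel by (simp add: sets_restrict_space_iff conj_commute)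
qed

lemma space_densY: "space (densY G) = bd G"
proof -
  have "sets (densY G) = sets (restrict_space borel (bd G))"
    using densities unfolding densities_def by (elim conjE)
  from sets_eq_imp_space_eq[OF this] show ?thesis by (simp add: space_restrict_space)
qed

definition chart_dens :: "'a set \<Rightarrow> ('a \<Rightarrow> 'n pt) \<Rightarrow> ('n pt \<Rightarrow> real) \<Rightarrow> bool" where
  "chart_dens U \<phi> \<rho> \<longleftrightarrow> smooth_on (\<phi> ` (U \<inter> bd G)) \<rho> \<and> (\<forall>v\<in>\<phi> ` (U \<inter> bd G). \<rho> v > 0) \<and>
     (\<forall>B\<in>sets borel. B \<subseteq> U \<inter> bd G \<longrightarrow>
        emeasure (densY G) B =
          (\<integral>\<^sup>+v\<in>{v. v $ xi \<in> {0<..<1} \<and> base_pt v \<in> \<phi> ` B}. ennreal (\<rho> (base_pt v)) \<partial>lborel))"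

lemma chart_densD:
  assumes "chart_dens U \<phi> \<rho>"
  shows "smooth_on (\<phi> ` (U \<inter> bd G)) \<rho>"
    and "v \<in> \<phi> ` (U \<inter> bd G) \<Longrightarrow> \<rho> v > 0"
    and "B \<in> sets borel \<Longrightarrow> B \<subseteq> U \<inter> bd G \<Longrightarrow> emeasure (densY G) B =
          (\<integral>\<^sup>+v\<in>{v. v $ xi \<in> {0<..<1} \<and> base_pt v \<in> \<phi> ` B}. ennreal (\<rho> (base_pt v)) \<partial>lborel)"
  using assms unfolding chart_dens_def by (elim conjE, auto)+

lemma chart_dens_exists: "(U, \<phi>) \<in> charts G \<Longrightarrow> \<exists>\<rho>. chart_dens U \<phi> \<rho>"
proof -
  assume C: "(U, \<phi>) \<in> charts G"
  have "\<forall>(U, \<phi>)\<in>charts G. \<exists>\<rho>. chart_dens U \<phi> \<rho>"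
    using densities unfolding densities_def chart_dens_def by (elim conjE)
  from bspec[OF this C] show ?thesis by simp
qed

lemma chart_image_borel:
  assumes C: "(U, \<phi>) \<in> charts G" and B: "B \<in> sets borel" "B \<subseteq> U"
  shows "\<phi> ` B \<in> sets borel"
proof -
  obtain T where T: "open T" "\<phi> ` (U \<inter> UNIV) = halfspace \<inter> T" using chart_open_image[OF C open_UNIV] .
  have "closed (halfspace :: 'n pt set)"
    unfolding halfspace_def by (intro closed_Collect_le continuous_intros)
  then have U: "\<phi> ` U \<in> sets borel" using T by auto
  have "inv_into U \<phi> \<in> borel_measurable (restrict_space borel (\<phi> ` U))"
    by (rule borel_measurable_continuous_on_restrict) (use chartD(3)[OF C] in \<open>simp add: homeomorphism_def\<close>)
  from measurable_sets[OF this B(1)] U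
  have "inv_into U \<phi> -` B \<inter> \<phi> ` U \<in> sets borel"
    by (auto simp: space_restrict_space sets_restrict_space_iff)
  moreover have "inv_into U \<phi> -` B \<inter> \<phi> ` U = \<phi> ` B"
    using B(2) chartD(4)[OF C] by (force simp: image_iff)
  ultimately show ?thesis by simp
qed

text \<open>Lebesgue measure with this density is, in coordinates, the product of dx and
  \<open>densY\<close> restricted to \<open>B\<close>: it does not depend on the first
  coordinate.\<close>

definition hdens :: "('a \<Rightarrow> 'n pt) \<Rightarrow> ('n pt \<Rightarrow> real) \<Rightarrow> 'a set \<Rightarrow> 'n pt \<Rightarrow> real" where
  "hdens \<phi> \<rho> B v = indicator (\<phi> ` B) (base_pt v) * \<rho> (base_pt v)"

lemma base_pt_measurable: "base_pt \<in> borel_measurable borel"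
  by (intro borel_measurable_continuous_onI linear_continuous_on bounded_linear_base_pt)

lemma hdens_measurable:
  assumes C: "(U, \<phi>) \<in> charts G" and \<rho>: "chart_dens U \<phi> \<rho>" and B: "B \<in> sets borel" "B \<subseteq> U \<inter> bd G"
  shows "hdens \<phi> \<rho> B \<in> borel_measurable borel"
proof -
  have "continuous_on (\<phi> ` (U \<inter> bd G)) \<rho>" using chart_densD(1)[OF \<rho>] by (rule smooth_on_continuous)
  then have "continuous_on (\<phi> ` B) \<rho>" by (rule continuous_on_subset) (use B in auto)
  then have "(\<lambda>v. indicator (\<phi> ` B) v *\<^sub>R \<rho> v) \<in> borel_measurable borel"
    by (rule borel_measurable_continuous_on_indicator[rotated]) (use chart_image_borel[OF C B(1)] B(2) in auto)
  from measurable_compose[OF base_pt_measurable this] show ?thesis by (simp add: hdens_def[abs_def])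
qed

lemma hdens_nonneg:
  assumes "chart_dens U \<phi> \<rho>" "B \<subseteq> U \<inter> bd G"
  shows "hdens \<phi> \<rho> B v \<ge> 0"
proof (cases "base_pt v \<in> \<phi> ` B")
  case True
  then have "base_pt v \<in> \<phi> ` (U \<inter> bd G)" using assms(2) by blast
  from chart_densD(2)[OF assms(1) this] show ?thesis by (simp add: hdens_def)
qed (simp add: hdens_def)

text \<open>In \<open>densities\<close> the measure of \<open>B\<close> is an integral over a
  cylinder of height 1; an affine map in the first coordinate stretches that cylinder to any
  interval.\<close>

lemma hdens_interval:
  assumes C: "(U, \<phi>) \<in> charts G" and \<rho>: "chart_dens U \<phi> \<rho>" and B: "B \<in> sets borel" "B \<subseteq> U \<inter> bd G"
    and lu: "l \<le> u"
  shows "(\<integral>\<^sup>+v. ennreal (hdens \<phi> \<rho> B v) * indicator {l<..<u} (v $ xi) \<partial>lborel) = ennreal (u - l) * emeasure (densY G) B"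
proof (cases "l = u")
  case False
  then have s: "u - l > 0" using lu by simp
  have [measurable]: "hdens \<phi> \<rho> B \<in> borel_measurable borel" by (rule hdens_measurable[OF C \<rho> B])
  have "(\<lambda>v::'n pt. v $ xi) \<in> borel_measurable borel"
    by (intro borel_measurable_continuous_onI continuous_intros)
  then have m: "(\<lambda>v. ennreal (hdens \<phi> \<rho> B v) * indicator {l<..<u} (v $ xi)) \<in> borel_measurable borel"
    by measurable
  have e: "hdens \<phi> \<rho> B (l *\<^sub>R axis xi 1 + dil (u - l) v) = hdens \<phi> \<rho> B v" for v
  proof -
    have "base_pt (l *\<^sub>R axis xi 1 + dil (u - l) v) = base_pt v"
      by (simp add: vec_eq_iff base_pt_nth dil_nth axis_def)
    then show ?thesis by (simp add: hdens_def)
  qed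
  have i: "indicator {l<..<u} ((l *\<^sub>R axis xi 1 + dil (u - l) v) $ xi) = (indicator {0<..<1} (v $ xi) :: ennreal)" for v :: "'n pt"
  proof -
    have "l < l + (u - l) * v $ xi \<longleftrightarrow> 0 < v $ xi" using s by (simp add: zero_less_mult_iff)
    moreover have "l + (u - l) * v $ xi < u \<longleftrightarrow> (u - l) * v $ xi < (u - l) * 1"
      by (simp only: mult_1_right less_diff_eq add.commute)
    moreover have "\<dots> \<longleftrightarrow> v $ xi < 1" by (rule mult_less_cancel_left_pos[OF s])
    ultimately have "l + (u - l) * v $ xi \<in> {l<..<u} \<longleftrightarrow> v $ xi \<in> {0<..<1}"
      unfolding greaterThanLessThan_iff by blast
    then show ?thesis by (simp add: dil_nth indicator_def)
  qed
  have "(\<integral>\<^sup>+v. ennreal (hdens \<phi> \<rho> B v) * indicator {l<..<u} (v $ xi) \<partial>lborel)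
      = ennreal (u - l) * (\<integral>\<^sup>+v. ennreal (hdens \<phi> \<rho> B v) * indicator {0<..<1} (v $ xi) \<partial>lborel)"
    unfolding nn_integral_lborel_dil[OF m s, of "l *\<^sub>R axis xi 1"] e i ..
  also have "(\<integral>\<^sup>+v. ennreal (hdens \<phi> \<rho> B v) * indicator {0<..<1} (v $ xi) \<partial>lborel)
      = (\<integral>\<^sup>+v\<in>{v. v $ xi \<in> {0<..<1} \<and> base_pt v \<in> \<phi> ` B}. ennreal (\<rho> (base_pt v)) \<partial>lborel)"
    by (intro nn_integral_cong) (auto simp: hdens_def indicator_def)
  also have "\<dots> = emeasure (densY G) B" by (rule chart_densD(3)[OF \<rho> B, symmetric])
  finally show ?thesis .
qed simp

lemma xi_measurable [measurable]: "(\<lambda>v::'n pt. v $ xi) \<in> borel_measurable borel"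
  by (intro borel_measurable_continuous_onI continuous_intros)

text \<open>The push-forward under the first coordinate agrees with a multiple of Lebesgue measure
  on intervals, which generate the Borel sets. Finiteness on \<open>B\<close> makes the exhausting
  intervals have finite measure, as uniqueness of measures requires.\<close>

lemma hdens_Fubini_finite:
  assumes C: "(U, \<phi>) \<in> charts G" and \<rho>: "chart_dens U \<phi> \<rho>" and B: "B \<in> sets borel" "B \<subseteq> U \<inter> bd G"
    and fin: "emeasure (densY G) B < \<infinity>" and g: "g \<in> borel_measurable borel"
  shows "(\<integral>\<^sup>+v. ennreal (hdens \<phi> \<rho> B v) * g (v $ xi) \<partial>lborel) = emeasure (densY G) B * (\<integral>\<^sup>+x. g x \<partial>lborel)"
proof -
  let ?b = "emeasure (densY G) B"
  have hm [measurable]: "hdens \<phi> \<rho> B \<in> borel_measurable borel" by (rule hdens_measurable[OF C \<rho> B])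
  let ?N = "distr (density lborel (\<lambda>v. ennreal (hdens \<phi> \<rho> B v))) borel (\<lambda>v. v $ xi)"
  let ?M = "density lborel (\<lambda>x::real. ?b)"
  let ?E = "range (\<lambda>(a, b). box a b :: real set)"
  have eq: "emeasure ?N (box l u) = emeasure ?M (box l u)" for l u :: real
  proof (cases "l \<le> u")
    case True
    have "emeasure ?N (box l u) = (\<integral>\<^sup>+v. ennreal (hdens \<phi> \<rho> B v) * indicator {l<..<u} (v $ xi) \<partial>lborel)"
      using measurable_sets[OF xi_measurable, of "{l<..<u}"]
      by (subst emeasure_distr) (auto simp: emeasure_density box_real indicator_def intro!: nn_integral_cong)
    also have "\<dots> = ?b * ennreal (u - l)" using hdens_interval[OF C \<rho> B True] by (simp add: mult.commute)
    also have "\<dots> = emeasure ?M (box l u)" using True by (simp add: emeasure_density box_real nn_integral_cmult_indicator)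
    finally show ?thesis .
  next
    case False
    then have "box l u = {}" by (simp add: box_real)
    then show ?thesis by (simp only: emeasure_empty)
  qed
  have "?N = ?M"
  proof (rule measure_eqI_generator_eq)
    show "Int_stable ?E" by (auto simp: Int_stable_def box_Int_box)
    show "?E \<subseteq> Pow UNIV" "sets ?N = sigma_sets UNIV ?E" "sets ?M = sigma_sets UNIV ?E"
      by (simp_all add: borel_eq_box)
    let ?A = "\<lambda>n::nat. box (- (real n *\<^sub>R One)) (real n *\<^sub>R One) :: real set"
    show "range ?A \<subseteq> ?E" "(\<Union>i. ?A i) = UNIV" unfolding UN_box_eq_UNIV by auto
    show "emeasure ?N (?A i) \<noteq> \<infinity>" for i
      unfolding eq using fin by (auto simp: emeasure_density nn_integral_cmult_indicator box_real ennreal_mult_eq_top_iff)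
    show "emeasure ?N X = emeasure ?M X" if "X \<in> ?E" for X using that eq by auto
  qed
  then have "(\<integral>\<^sup>+x. g x \<partial>?N) = (\<integral>\<^sup>+x. g x \<partial>?M)" by simp
  then show ?thesis using g by (simp add: nn_integral_distr nn_integral_density nn_integral_cmult)
qed

text \<open>Near \<open>p\<close> the chart map and the density are bounded by some
  \<open>k\<close>, so the cylinder in which the measure is computed lies in a ball of radius
  \<open>k + 1\<close> and carries a bounded integrand.\<close>

lemma densY_locally_finite:
  assumes p: "p \<in> bd G"
  shows "\<exists>T. open T \<and> p \<in> T \<and> emeasure (densY G) (T \<inter> bd G) < \<infinity>"
proof -
  obtain U \<phi> where C: "(U, \<phi>) \<in> charts G" "p \<in> U" using charts_cover by blast
  obtain \<rho> where \<rho>: "chart_dens U \<phi> \<rho>" using chart_dens_exists[OF C(1)] by blast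
  let ?S = "U \<inter> bd G"
  have c\<phi>: "continuous_on ?S \<phi>"
    using continuous_on_subset[of U \<phi> ?S] chartD(3)[OF C(1)] by (simp add: homeomorphism_def)
  have "continuous_on (\<phi> ` ?S) \<rho>" using chart_densD(1)[OF \<rho>] by (rule smooth_on_continuous)
  then have c\<rho>: "continuous_on ?S (\<lambda>p. \<rho> (\<phi> p))" using c\<phi> by (rule continuous_on_compose2) simp
  define f where "f p = max (norm (\<phi> p)) (\<rho> (\<phi> p))" for p
  have cf: "continuous_on ?S f" unfolding f_def by (intro continuous_intros c\<phi> c\<rho>)
  obtain k :: nat where k: "f p < real k" using reals_Archimedean2 by blast
  from cf have "openin (top_of_set ?S) (?S \<inter> f -` {..<real k})"
    by (rule continuous_openin_preimage_gen) simp
  then obtain T0 where T0: "open T0" "?S \<inter> f -` {..<real k} = ?S \<inter> T0" unfolding openin_open by blast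
  define T where "T = T0 \<inter> U"
  have T: "open T" "p \<in> T" "T \<inter> bd G \<subseteq> ?S" "\<And>q. q \<in> T \<inter> bd G \<Longrightarrow> f q < real k"
    using T0 C chartD(1)[OF C(1)] p k by (auto simp: T_def)
  have TB: "T \<inter> bd G \<in> sets borel" by (intro sets.Int bd_borel borel_open T(1))
  have "emeasure (densY G) (T \<inter> bd G) =
      (\<integral>\<^sup>+v\<in>{v. v $ xi \<in> {0<..<1} \<and> base_pt v \<in> \<phi> ` (T \<inter> bd G)}. ennreal (\<rho> (base_pt v)) \<partial>lborel)"
    by (rule chart_densD(3)[OF \<rho> TB T(3)])
  also have "\<dots> \<le> (\<integral>\<^sup>+v. ennreal (real k) * indicator (cball (0 :: 'n pt) (real k + 1)) v \<partial>lborel)"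
  proof (rule nn_integral_mono)
    fix v :: "'n pt"
    show "ennreal (\<rho> (base_pt v)) * indicator {v. v $ xi \<in> {0<..<1} \<and> base_pt v \<in> \<phi> ` (T \<inter> bd G)} v
        \<le> ennreal (real k) * indicator (cball 0 (real k + 1)) v"
    proof (cases "v $ xi \<in> {0<..<1} \<and> base_pt v \<in> \<phi> ` (T \<inter> bd G)")
      case True
      then obtain q where q: "q \<in> T \<inter> bd G" "base_pt v = \<phi> q" by blast
      then have b: "norm (base_pt v) \<le> real k" "\<rho> (base_pt v) \<le> real k" using T(4)[OF q(1)] by (auto simp: f_def)
      have "v = base_pt v + (v $ xi) *\<^sub>R axis xi 1" by (simp add: base_pt_def)
      then have "norm v \<le> norm (base_pt v) + norm ((v $ xi) *\<^sub>R (axis xi 1 :: 'n pt))"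
        by (metis norm_triangle_ineq)
      then have "v \<in> cball 0 (real k + 1)" using True b by (simp add: norm_axis_1)
      then show ?thesis using b by (auto simp: indicator_def intro: ennreal_leI)
    qed simp
  qed
  also have "\<dots> = ennreal (real k) * emeasure lborel (cball (0 :: 'n pt) (real k + 1))"
    by (rule nn_integral_cmult_indicator) simp
  also have "\<dots> < \<infinity>"
    using emeasure_lborel_cball_finite[of "0 :: 'n pt" "real k + 1"] by (simp add: ennreal_mult_less_top)
  finally show ?thesis using T(1,2) by blast
qed

lemma compact_M: "compact (UNIV :: 'a set)"
  using geo unfolding cone_geometry_def compact_manifold_with_boundary_def by (elim conjE)

lemma finite_densY: "emeasure (densY G) (bd G) < \<infinity>"
proof -
  have "compact (bd G)" using compact_Int_closed[OF compact_M bd_closed] by simp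
  obtain T where T: "\<And>p. p \<in> bd G \<Longrightarrow> open (T p)" "\<And>p. p \<in> bd G \<Longrightarrow> p \<in> T p"
      "\<And>p. p \<in> bd G \<Longrightarrow> emeasure (densY G) (T p \<inter> bd G) < \<infinity>"
    using densY_locally_finite by metis
  have "bd G \<subseteq> (\<Union>p\<in>bd G. T p)" using T(2) by blast
  from compactE_image[OF \<open>compact (bd G)\<close> T(1) this] obtain F where F: "F \<subseteq> bd G" "finite F" "bd G \<subseteq> (\<Union>p\<in>F. T p)"
    by blast
  have s: "T p \<inter> bd G \<in> sets (densY G)" if "p \<in> F" for p
    using T(1)[of p] F(1) that by (auto simp: sets_densY intro!: sets.Int bd_borel)
  have "(\<Union>p\<in>F. T p \<inter> bd G) = bd G" using F(3) by blast
  then have "emeasure (densY G) (bd G) = emeasure (densY G) (\<Union>p\<in>F. T p \<inter> bd G)" by simp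
  also have "\<dots> \<le> (\<Sum>p\<in>F. emeasure (densY G) (T p \<inter> bd G))"
    by (rule emeasure_subadditive_finite) (use F(2) s in auto)
  also have "\<dots> < \<infinity>" using F(2,1) T(3) by (induction F rule: finite_induct) auto
  finally show ?thesis .
qed

lemma finite_measure_densY: "finite_measure (densY G)"
  by (rule finite_measureI) (use finite_densY in \<open>simp add: space_densY\<close>)

lemma hdens_Fubini:
  assumes C: "(U, \<phi>) \<in> charts G" and \<rho>: "chart_dens U \<phi> \<rho>" and B: "B \<in> sets borel" "B \<subseteq> U \<inter> bd G"
    and g: "g \<in> borel_measurable borel"
  shows "(\<integral>\<^sup>+v. ennreal (hdens \<phi> \<rho> B v) * g (v $ xi) \<partial>lborel) = emeasure (densY G) B * (\<integral>\<^sup>+x. g x \<partial>lborel)"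
proof (rule hdens_Fubini_finite[OF C \<rho> B _ g])
  have "emeasure (densY G) B \<le> emeasure (densY G) (bd G)"
    using B bd_borel by (intro emeasure_mono) (auto simp: sets_densY)
  then show "emeasure (densY G) B < \<infinity>" using finite_densY by (rule le_less_trans)
qed

lemma sigma_finite_densY: "sigma_finite_measure (densY G)"
  using finite_measure_densY by (simp add: finite_measure_def)

end

section \<open>The cone measure in coordinates\<close>

definition rad :: "nat \<Rightarrow> real measure" where
  "rad m = density (restrict_space lborel {0<..}) (\<lambda>x. ennreal (x ^ m * (1 / x)))"

lemma sets_rad: "A \<in> sets (rad m) \<longleftrightarrow> A \<in> sets borel \<and> A \<subseteq> {0<..}"
  by (auto simp: rad_def sets_restrict_space_iff)

lemma space_rad: "space (rad m) = {0<..}"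
  by (simp add: rad_def space_restrict_space)

lemma rad_measurable: "(\<lambda>x. ennreal (x ^ m * (1 / x))) \<in> borel_measurable (restrict_space lborel {0<..})"
  by (intro measurable_restrict_space1) simp

lemma sigma_finite_rad: "sigma_finite_measure (rad m)"
proof -
  interpret sigma_finite_measure "restrict_space lborel {0::real<..}"
    by (rule sigma_finite_measure_restrict_space[OF sigma_finite_lborel]) simp
  show ?thesis unfolding rad_def using sigma_finite_iff_density_finite[OF rad_measurable] by simp
qed

lemma nn_integral_rad:
  assumes "f \<in> borel_measurable borel"
  shows "(\<integral>\<^sup>+x. f x \<partial>rad m) = (\<integral>\<^sup>+x. ennreal (x ^ m * (1 / x)) * f x * indicator {0<..} x \<partial>lborel)"
  unfolding rad_def using assms rad_measurable
  by (subst nn_integral_density) (auto simp: nn_integral_restrict_space intro!: measurable_restrict_space1)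

context cone_geom
begin

lemma cone_measure_eq: "cone_measure G m = rad m \<Otimes>\<^sub>M densY G"
  by (simp add: cone_measure_def rad_def)

lemma space_cone_measure: "space (cone_measure G m) = {0<..} \<times> bd G"
  by (simp add: cone_measure_eq space_pair_measure space_rad space_densY)

definition chart_wt :: "nat \<Rightarrow> ('a \<Rightarrow> 'n pt) \<Rightarrow> ('n pt \<Rightarrow> real) \<Rightarrow> 'a set \<Rightarrow> 'n pt \<Rightarrow> real" where
  "chart_wt m \<phi> \<rho> B v = hdens \<phi> \<rho> B v * (v $ xi ^ m * (1 / v $ xi)) * indicator {0<..} (v $ xi)"

text \<open>Outside the domain the map takes an arbitrary value in the cone, so that it is
  measurable into the cone as a whole; the weight \<open>chart_wt\<close> vanishes there.\<close>

definition chart_map :: "'a set \<Rightarrow> ('a \<Rightarrow> 'n pt) \<Rightarrow> 'a set \<Rightarrow> 'n pt \<Rightarrow> real \<times> 'a" where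
  "chart_map U \<phi> B v = (if v \<in> cdom U \<phi> B then cyl_inv G U \<phi> v else (1, SOME y. y \<in> bd G))"

lemma chart_map_cdom:
  assumes C: "(U, \<phi>) \<in> charts G" and v: "v \<in> cdom U \<phi> B"
  shows "chart_map U \<phi> B v = cyl_inv G U \<phi> v"
  using v by (simp add: chart_map_def)

lemma cdom_borel:
  assumes C: "(U, \<phi>) \<in> charts G" and B: "B \<in> sets borel"
  shows "cdom U \<phi> B \<in> sets borel"
proof -
  have "\<phi> ` (U \<inter> B) \<in> sets borel" by (rule chart_image_borel[OF C]) (use chartD(1)[OF C] B in auto)
  from measurable_sets[OF base_pt_measurable this] measurable_sets[OF xi_measurable, of "{0<..}"]
  have "base_pt -` \<phi> ` (U \<inter> B) \<inter> (\<lambda>v. v $ xi) -` {0<..} \<in> sets borel" by simp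
  moreover have "cdom U \<phi> B = base_pt -` \<phi> ` (U \<inter> B) \<inter> (\<lambda>v. v $ xi) -` {0<..}" by (auto simp: cdom_def)
  ultimately show ?thesis by simp
qed

lemma chart_map_measurable:
  assumes C: "(U, \<phi>) \<in> charts G" and B: "B \<in> sets borel" "B \<subseteq> U \<inter> bd G"
  shows "chart_map U \<phi> B \<in> measurable lborel (cone_measure G m)"
proof -
  have y0: "(SOME y. y \<in> bd G) \<in> bd G" using bd_nonempty by (simp add: some_in_eq)
  have O: "cdom U \<phi> B \<in> sets borel" by (rule cdom_borel[OF C B(1)])
  have f: "(\<lambda>v. fst (chart_map U \<phi> B v)) = (\<lambda>v. if v \<in> cdom U \<phi> B then v $ xi else 1)"
    by (auto simp: chart_map_def cyl_inv_def)
  have fm: "(\<lambda>v. fst (chart_map U \<phi> B v)) \<in> borel_measurable borel"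
    unfolding f using O by measurable
  have 1: "(\<lambda>v. fst (chart_map U \<phi> B v)) \<in> measurable lborel (rad m)"
  proof (rule measurableI)
    show "fst (chart_map U \<phi> B v) \<in> space (rad m)" for v
      by (simp add: space_rad chart_map_def cyl_inv_def cdom_def)
    show "(\<lambda>v. fst (chart_map U \<phi> B v)) -` X \<inter> space lborel \<in> sets lborel" if "X \<in> sets (rad m)" for X
      using measurable_sets[OF fm, of X] that by (simp add: sets_rad)
  qed
  have 2: "(\<lambda>v. snd (chart_map U \<phi> B v)) \<in> measurable lborel (densY G)"
  proof (rule measurableI)
    fix v :: "'n pt"
    show "snd (chart_map U \<phi> B v) \<in> space (densY G)"
      using y0 by (auto simp: chart_map_def space_densY elim!: cdomE[OF C])
  next
    fix X assume "X \<in> sets (densY G)"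
    then have X: "X \<in> sets borel" "X \<subseteq> bd G" by (auto simp: sets_densY)
    have "cdom U \<phi> (B \<inter> X) \<in> sets borel" using X B by (intro cdom_borel[OF C]) auto
    moreover have "(\<lambda>v. snd (chart_map U \<phi> B v)) -` X =
        cdom U \<phi> (B \<inter> X) \<union> (if (SOME y. y \<in> bd G) \<in> X then - cdom U \<phi> B else {})"
    proof (rule set_eqI)
      fix v
      show "v \<in> (\<lambda>v. snd (chart_map U \<phi> B v)) -` X \<longleftrightarrow>
          v \<in> cdom U \<phi> (B \<inter> X) \<union> (if (SOME y. y \<in> bd G) \<in> X then - cdom U \<phi> B else {})"
      proof (cases "v \<in> cdom U \<phi> B")
        case True
        then obtain t y where y: "t > 0" "y \<in> U" "y \<in> B" "y \<in> bd G" "cyl_inv G U \<phi> v = (t, y)" "base_pt v = \<phi> y" "v $ xi = t"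
          by (elim cdomE[OF C])
        have "v \<in> cdom U \<phi> (B \<inter> X) \<longleftrightarrow> y \<in> X"
          using y chartD(4)[OF C] by (auto simp: cdom_def inj_on_def)
        then show ?thesis using True y by (simp add: chart_map_def)
      next
        case False
        moreover have "v \<notin> cdom U \<phi> (B \<inter> X)" using False by (auto simp: cdom_def)
        ultimately show ?thesis by (simp add: chart_map_def)
      qed
    qed
    ultimately show "(\<lambda>v. snd (chart_map U \<phi> B v)) -` X \<inter> space lborel \<in> sets lborel"
      using O by auto
  qed
  from measurable_Pair[OF 1 2] show ?thesis by (simp add: cone_measure_eq)
qed

lemma chart_wt_measurable:
  assumes C: "(U, \<phi>) \<in> charts G" and \<rho>: "chart_dens U \<phi> \<rho>" and B: "B \<in> sets borel" "B \<subseteq> U \<inter> bd G"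
  shows "chart_wt m \<phi> \<rho> B \<in> borel_measurable borel"
  unfolding chart_wt_def[abs_def] using hdens_measurable[OF assms] by measurable

lemma chart_wt_nonneg: "chart_dens U \<phi> \<rho> \<Longrightarrow> B \<subseteq> U \<inter> bd G \<Longrightarrow> chart_wt m \<phi> \<rho> B v \<ge> 0"
  unfolding chart_wt_def using hdens_nonneg by (auto simp: indicator_def intro!: mult_nonneg_nonneg)

lemma chart_wt_outside:
  assumes "B \<subseteq> U" "v \<notin> cdom U \<phi> B"
  shows "chart_wt m \<phi> \<rho> B v = 0"
proof -
  have "U \<inter> B = B" using assms(1) by blast
  then show ?thesis using assms(2) by (auto simp: chart_wt_def hdens_def cdom_def indicator_def)
qed

text \<open>Both sides are determined by rectangles \<open>A \<times> X\<close>; there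
  \<open>hdens_Fubini\<close>, applied to \<open>B \<inter> X\<close>, separates the radial integral
  from the measure on the boundary.\<close>

lemma chart_measure:
  assumes C: "(U, \<phi>) \<in> charts G" and \<rho>: "chart_dens U \<phi> \<rho>" and B: "B \<in> sets borel" "B \<subseteq> U \<inter> bd G"
  shows "density (cone_measure G m) (indicator (UNIV \<times> B))
    = distr (density lborel (\<lambda>v. ennreal (chart_wt m \<phi> \<rho> B v))) (cone_measure G m) (chart_map U \<phi> B)"
    (is "_ = ?R")
proof -
  interpret Y: sigma_finite_measure "densY G" by (rule sigma_finite_densY)
  interpret R: sigma_finite_measure "rad m" by (rule sigma_finite_rad)
  have BY: "B \<in> sets (densY G)" using B by (simp add: sets_densY)
  have sfB: "sigma_finite_measure (density (densY G) (indicator B))"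
    using BY by (subst Y.sigma_finite_iff_density_finite) (auto simp: indicator_def)
  have "(\<lambda>z. indicator B (snd z) :: ennreal) \<in> borel_measurable (rad m \<Otimes>\<^sub>M densY G)"
    by (rule measurable_compose[OF measurable_snd]) (use BY in simp)
  moreover have "(indicator (UNIV \<times> B) :: real \<times> 'a \<Rightarrow> ennreal) = (\<lambda>z. indicator B (snd z))"
    by (auto simp: indicator_def fun_eq_iff)
  ultimately have im: "(indicator (UNIV \<times> B) :: _ \<Rightarrow> ennreal) \<in> borel_measurable (rad m \<Otimes>\<^sub>M densY G)"
    by simp
  have "density (cone_measure G m) (indicator (UNIV \<times> B)) = density (rad m) (\<lambda>_. 1) \<Otimes>\<^sub>M density (densY G) (indicator B)"
    unfolding cone_measure_eq
    by (subst pair_measure_density) (use BY im sfB Y.sigma_finite_measure_axioms in \<open>auto simp: density_1 indicator_times intro!: density_cong\<close>)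
  also have "\<dots> = rad m \<Otimes>\<^sub>M density (densY G) (indicator B)" by (simp add: density_1)
  also have "\<dots> = ?R"
  proof (rule pair_measure_eqI[OF sigma_finite_rad sfB])
    show "sets (rad m \<Otimes>\<^sub>M density (densY G) (indicator B)) = sets ?R"
      by (simp add: cone_measure_eq cong: sets_pair_measure_cong)
    fix A X assume A: "A \<in> sets (rad m)" and "X \<in> sets (density (densY G) (indicator B))"
    then have X: "X \<in> sets (densY G)" by simp
    then have BX: "B \<inter> X \<in> sets borel" "B \<inter> X \<subseteq> U \<inter> bd G" using B by (auto simp: sets_densY)
    have A': "A \<in> sets borel" "A \<subseteq> {0<..}" using A by (auto simp: sets_rad)
    have AX: "A \<times> X \<in> sets (cone_measure G m)" using A X by (simp add: cone_measure_eq)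
    let ?g = "\<lambda>x::real. ennreal (x ^ m * (1 / x)) * indicator A x * indicator {0<..} x"
    have g: "?g \<in> borel_measurable borel" using A' by measurable
    have "emeasure (rad m) A * emeasure (density (densY G) (indicator B)) X
        = (\<integral>\<^sup>+x. ?g x \<partial>lborel) * emeasure (densY G) (B \<inter> X)"
    proof -
      have "emeasure (rad m) A = (\<integral>\<^sup>+x. indicator A x \<partial>rad m)" using A by simp
      also have "\<dots> = (\<integral>\<^sup>+x. ?g x \<partial>lborel)" by (rule nn_integral_rad) (use A' in simp)
      finally show ?thesis by (simp only: emeasure_restricted[OF BY X])
    qed
    also have "\<dots> = (\<integral>\<^sup>+v. ennreal (hdens \<phi> \<rho> (B \<inter> X) v) * ?g (v $ xi) \<partial>lborel)"
      using hdens_Fubini[OF C \<rho> BX g] by (simp add: mult.commute)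
    also have "\<dots> = (\<integral>\<^sup>+v. ennreal (chart_wt m \<phi> \<rho> B v) * indicator (chart_map U \<phi> B -` (A \<times> X)) v \<partial>lborel)"
    proof (rule nn_integral_cong)
      fix v :: "'n pt"
      show "ennreal (hdens \<phi> \<rho> (B \<inter> X) v) * ?g (v $ xi) = ennreal (chart_wt m \<phi> \<rho> B v) * indicator (chart_map U \<phi> B -` (A \<times> X)) v"
      proof (cases "v \<in> cdom U \<phi> B")
        case True
        then obtain t y where y: "t > 0" "y \<in> U" "y \<in> B" "y \<in> bd G" "cyl_inv G U \<phi> v = (t, y)" "base_pt v = \<phi> y" "v $ xi = t"
          by (elim cdomE[OF C])
        have "base_pt v \<in> \<phi> ` (B \<inter> X) \<longleftrightarrow> y \<in> X"
          using y B(2) chartD(4)[OF C] by (auto simp: inj_on_def)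
        then have h: "hdens \<phi> \<rho> (B \<inter> X) v = (if y \<in> X then \<rho> (\<phi> y) else 0)"
          using y by (simp add: hdens_def indicator_def)
        define a where "a = t ^ m * (1 / t)"
        have w: "chart_wt m \<phi> \<rho> B v = \<rho> (\<phi> y) * a"
          using y by (simp add: chart_wt_def hdens_def a_def)
        have "\<rho> (\<phi> y) > 0" using chart_densD(2)[OF \<rho>, of "\<phi> y"] y by blast
        moreover have "a \<ge> 0" using y(1) by (simp add: a_def)
        ultimately have "ennreal (\<rho> (\<phi> y) * a) = ennreal (\<rho> (\<phi> y)) * ennreal a"
          by (intro ennreal_mult) auto
        then show ?thesis
          unfolding h w y(7) a_def[symmetric] using y(1,5) True
          by (simp add: chart_map_def indicator_def)
      next
        case False
        then have "v \<notin> cdom U \<phi> (B \<inter> X)" by (auto simp: cdom_def)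
        moreover have "U \<inter> (B \<inter> X) = B \<inter> X" using B(2) by blast
        ultimately have "hdens \<phi> \<rho> (B \<inter> X) v = 0 \<or> \<not> v $ xi > 0" by (auto simp: cdom_def hdens_def indicator_def)
        then show ?thesis using chart_wt_outside[OF _ False] B(2) by auto
      qed
    qed
    also have "\<dots> = emeasure ?R (A \<times> X)"
      using AX chart_map_measurable[OF C B] chart_wt_measurable[OF C \<rho> B] measurable_sets[OF chart_map_measurable[OF C B] AX]
      by (subst emeasure_distr) (auto simp: emeasure_density)
    finally show "emeasure (rad m) A * emeasure (density (densY G) (indicator B)) X = emeasure ?R (A \<times> X)" .
  qed
  finally show ?thesis .
qed

end

lemma continuous_on_locally:
  assumes "\<And>x. x \<in> S \<Longrightarrow> \<exists>T. open T \<and> x \<in> T \<and> continuous_on (S \<inter> T) f"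
  shows "continuous_on S f"
  unfolding continuous_on_def
proof
  fix x assume x: "x \<in> S"
  from assms[OF this] obtain T where T: "open T" "x \<in> T" "continuous_on (S \<inter> T) f" by blast
  have "(f \<longlongrightarrow> f x) (at x within (S \<inter> T))" using T(2,3) x unfolding continuous_on_def by blast
  moreover have "at x within (S \<inter> T) = at x within S"
    by (rule at_within_nhd[OF T(2,1)]) auto
  ultimately show "(f \<longlongrightarrow> f x) (at x within S)" by simp
qed

context cone_geom
begin

interpretation vs: vector_space "scl G" by (rule vs)

lemma herm_raw:
  assumes "v \<in> fib G p" "w \<in> fib G p"
  shows "(\<forall>u\<in>fib G p. \<forall>c. herm G p (u + v) w = herm G p u w + herm G p v w \<and>
           herm G p (scl G c v) w = c * herm G p v w) \<and> herm G p w v = cnj (herm G p v w)"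
proof -
  have "\<forall>p. \<forall>v\<in>fib G p. \<forall>w\<in>fib G p.
        (\<forall>u\<in>fib G p. \<forall>c. herm G p (u + v) w = herm G p u w + herm G p v w \<and>
           herm G p (scl G c v) w = c * herm G p v w) \<and>
        herm G p w v = cnj (herm G p v w)"
    using herm_bundle unfolding hermitian_bundle_def by (elim conjE)
  from bspec[OF bspec[OF spec[OF this] assms(1)] assms(2)] show ?thesis .
qed

lemma herm_pos: "v \<in> fib G p \<Longrightarrow> v \<noteq> 0 \<Longrightarrow> Re (herm G p v v) > 0"
proof -
  have "\<forall>p. \<forall>v\<in>fib G p. v \<noteq> 0 \<longrightarrow> Re (herm G p v v) > 0"
    using herm_bundle unfolding hermitian_bundle_def by (elim conjE)
  then show "v \<in> fib G p \<Longrightarrow> v \<noteq> 0 \<Longrightarrow> Re (herm G p v v) > 0" by simp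
qed

lemma herm_add_left: "u \<in> fib G p \<Longrightarrow> v \<in> fib G p \<Longrightarrow> w \<in> fib G p \<Longrightarrow> herm G p (u + v) w = herm G p u w + herm G p v w"
  by (rule herm_raw[THEN conjunct1, rule_format, THEN conjunct1])

lemma herm_scl_left: "v \<in> fib G p \<Longrightarrow> w \<in> fib G p \<Longrightarrow> herm G p (scl G c v) w = c * herm G p v w"
  by (rule herm_raw[THEN conjunct1, rule_format, THEN conjunct2])

lemma herm_cnj: "v \<in> fib G p \<Longrightarrow> w \<in> fib G p \<Longrightarrow> herm G p w v = cnj (herm G p v w)"
  by (rule herm_raw[THEN conjunct2])

lemma herm_add_right: "u \<in> fib G p \<Longrightarrow> v \<in> fib G p \<Longrightarrow> w \<in> fib G p \<Longrightarrow> herm G p w (u + v) = herm G p w u + herm G p w v"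
  by (simp add: herm_cnj[of _ p w] herm_add_left fib_add)

lemma herm_scl_right: "v \<in> fib G p \<Longrightarrow> w \<in> fib G p \<Longrightarrow> herm G p w (scl G c v) = cnj c * herm G p w v"
  by (simp add: herm_cnj[of _ p w] herm_scl_left fib_scl)

lemma herm_zero: "v \<in> fib G p \<Longrightarrow> herm G p 0 v = 0" "v \<in> fib G p \<Longrightarrow> herm G p v 0 = 0"
  using herm_scl_left[of 0 p v 0] herm_scl_right[of 0 p v 0] fib_zero by auto

lemma herm_minus_left: "u \<in> fib G p \<Longrightarrow> v \<in> fib G p \<Longrightarrow> w \<in> fib G p \<Longrightarrow> herm G p (u - v) w = herm G p u w - herm G p v w"
  using herm_add_left[of u p "scl G (-1) v" w] herm_scl_left[of v p w "-1"] fib_scl[of v p "-1"] by simp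

lemma herm_minus_right: "u \<in> fib G p \<Longrightarrow> v \<in> fib G p \<Longrightarrow> w \<in> fib G p \<Longrightarrow> herm G p w (u - v) = herm G p w u - herm G p w v"
  using herm_add_right[of u p "scl G (-1) v" w] herm_scl_right[of v p w "-1"] fib_scl[of v p "-1"] by simp

lemma herm_sum_left:
  assumes "finite J" "\<And>j. j \<in> J \<Longrightarrow> f j \<in> fib G p" "w \<in> fib G p"
  shows "herm G p (\<Sum>j\<in>J. f j) w = (\<Sum>j\<in>J. herm G p (f j) w) \<and> (\<Sum>j\<in>J. f j) \<in> fib G p"
  using assms by (induction J rule: finite_induct) (auto simp: herm_zero fib_zero herm_add_left fib_add)

lemma herm_sum_right:
  assumes "finite J" "\<And>j. j \<in> J \<Longrightarrow> f j \<in> fib G p" "w \<in> fib G p"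
  shows "herm G p w (\<Sum>j\<in>J. f j) = (\<Sum>j\<in>J. herm G p w (f j))"
  using assms herm_sum_left[OF assms] herm_sum_left[OF assms(1,2), THEN conjunct1]
  by (simp add: herm_cnj[of _ p w])

lemma frame_fib: "(W, e) \<in> frames G \<Longrightarrow> p \<in> W \<Longrightarrow> e j p \<in> fib G p"
  using frame_map_fib[of W e p "axis j 1"] by (simp add: frame_map_axis)

lemma herm_frame:
  assumes F: "(W, e) \<in> frames G" "p \<in> W"
  shows "herm G p (frame_map G e p c) (frame_map G e p d)
    = (\<Sum>j\<in>UNIV. \<Sum>k\<in>UNIV. c $ j * cnj (d $ k) * herm G p (e j p) (e k p))"
proof -
  have "herm G p (frame_map G e p c) (frame_map G e p d) = (\<Sum>j\<in>UNIV. herm G p (scl G (c $ j) (e j p)) (frame_map G e p d))"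
    using herm_sum_left[of UNIV "\<lambda>j. scl G (c $ j) (e j p)" p "frame_map G e p d"] frame_map_fib[OF F]
      fib_scl[OF frame_fib[OF F]] by (simp add: frame_map_def[of G e p c])
  also have "\<dots> = (\<Sum>j\<in>UNIV. c $ j * (\<Sum>k\<in>UNIV. cnj (d $ k) * herm G p (e j p) (e k p)))"
  proof (rule sum.cong[OF refl])
    fix j :: 'r
    have "herm G p (e j p) (frame_map G e p d) = (\<Sum>k\<in>UNIV. cnj (d $ k) * herm G p (e j p) (e k p))"
      using herm_sum_right[of UNIV "\<lambda>k. scl G (d $ k) (e k p)" p "e j p"] fib_scl[OF frame_fib[OF F]] frame_fib[OF F]
      by (simp add: frame_map_def[of G e p d] herm_scl_right)
    then show "herm G p (scl G (c $ j) (e j p)) (frame_map G e p d) = c $ j * (\<Sum>k\<in>UNIV. cnj (d $ k) * herm G p (e j p) (e k p))"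
      using herm_scl_left[OF frame_fib[OF F] frame_map_fib[OF F]] by simp
  qed
  finally show ?thesis by (simp add: sum_distrib_left mult.assoc)
qed

lemma herm_coords:
  assumes F: "(W, e) \<in> frames G" "p \<in> W" and "v \<in> fib G p" "w \<in> fib G p"
  shows "herm G p v w = (\<Sum>j\<in>UNIV. \<Sum>k\<in>UNIV. coords G e p v $ j * cnj (coords G e p w $ k) * herm G p (e j p) (e k p))"
  using herm_frame[OF F, of "coords G e p v" "coords G e p w"] frame_map_coords[OF F] assms(3,4) by simp

definition q :: "'a \<Rightarrow> 'f \<Rightarrow> real" where
  "q p v = Re (herm G p v v)"

lemma herm_self: "v \<in> fib G p \<Longrightarrow> herm G p v v = of_real (q p v)"
  using herm_cnj[of v p v] by (simp add: q_def complex_eq_iff)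

lemma q_nonneg: "v \<in> fib G p \<Longrightarrow> q p v \<ge> 0"
  using herm_pos[of v p] herm_zero[OF fib_zero] by (cases "v = 0") (auto simp: q_def)

lemma q_zero_iff: "v \<in> fib G p \<Longrightarrow> q p v = 0 \<longleftrightarrow> v = 0"
  using herm_pos[of v p] herm_zero[OF fib_zero] by (cases "v = 0") (auto simp: q_def)

lemma q_scl: "v \<in> fib G p \<Longrightarrow> q p (scl G c v) = (cmod c)\<^sup>2 * q p v"
proof -
  assume v: "v \<in> fib G p"
  have "herm G p (scl G c v) (scl G c v) = (c * cnj c) * herm G p v v"
    using v by (simp add: herm_scl_left herm_scl_right fib_scl)
  then show ?thesis using v by (simp add: q_def[of p "scl G c v"] complex_norm_square[symmetric] herm_self)
qed

lemma q_add_sub: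
  assumes "v \<in> fib G p" "w \<in> fib G p"
  shows "q p (v + w) = q p v + q p w + 2 * Re (herm G p v w)" "q p (v - w) = q p v + q p w - 2 * Re (herm G p v w)"
  using assms herm_cnj[OF assms]
  by (auto simp: q_def herm_add_left herm_add_right herm_minus_left herm_minus_right fib_add fib_minus)

lemma q_add_le: "v \<in> fib G p \<Longrightarrow> w \<in> fib G p \<Longrightarrow> q p (v + w) \<le> 2 * q p v + 2 * q p w"
  using q_add_sub[of v p w] q_nonneg[OF fib_minus, of v p w] by simp

text \<open>Expanding the squared norms of v + w and v - w bounds the real part; replacing w by \<i>
  w bounds the imaginary part. This is weaker than Cauchy-Schwarz but linear in the squared norms,
  which is what integrability asks for.\<close>

lemma herm_bound:
  assumes "v \<in> fib G p" "w \<in> fib G p"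
  shows "cmod (herm G p v w) \<le> q p v + q p w"
proof -
  have *: "2 * \<bar>Re (herm G p v w)\<bar> \<le> q p v + q p w" if "w \<in> fib G p" for w
    using q_add_sub[OF assms(1) that] q_nonneg[OF fib_minus[OF assms(1) that]] q_nonneg[OF fib_add[OF assms(1) that]]
    by linarith
  have "herm G p v (scl G \<i> w) = - \<i> * herm G p v w" using assms by (simp add: herm_scl_right)
  then have "2 * \<bar>Im (herm G p v w)\<bar> \<le> q p v + q p w"
    using *[OF fib_scl[OF assms(2)], of \<i>] q_scl[OF assms(2), of \<i>] by simp
  with *[OF assms(2)] cmod_le[of "herm G p v w"] show ?thesis by linarith
qed

subsection \<open>Measurability\<close>

definition cpart :: "'a set \<Rightarrow> (real \<times> 'a) set" where
  "cpart W = {0<..} \<times> (W \<inter> bd G)"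

lemma cpart_sets: "open W \<Longrightarrow> cpart W \<in> sets (cone_measure G m)"
  unfolding cpart_def cone_measure_eq
  by (intro pair_measureI) (auto simp: sets_rad sets_densY intro!: sets.Int bd_borel)

lemma id_borel: "(\<lambda>z. z) \<in> measurable (cone_measure G m) borel"
proof -
  have f: "fst \<in> measurable (cone_measure G m) (rad m)" "snd \<in> measurable (cone_measure G m) (densY G)"
    by (simp_all add: cone_measure_eq)
  have 1: "(\<lambda>x. x) \<in> measurable (rad m) borel"
  proof (rule measurableI)
    fix A :: "real set" assume "A \<in> sets borel"
    then show "(\<lambda>x. x) -` A \<inter> space (rad m) \<in> sets (rad m)" by (auto simp: sets_rad space_rad)
  qed simp
  have 2: "(\<lambda>x. x) \<in> measurable (densY G) borel"
  proof (rule measurableI)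
    fix A :: "'a set" assume "A \<in> sets borel"
    then show "(\<lambda>x. x) -` A \<inter> space (densY G) \<in> sets (densY G)" using bd_borel by (auto simp: sets_densY space_densY)
  qed simp
  have "fst \<in> borel_measurable (cone_measure G m)" "snd \<in> borel_measurable (cone_measure G m)"
    using measurable_compose[OF f(1) 1] measurable_compose[OF f(2) 2] by simp_all
  then have "(\<lambda>z. (fst z, snd z)) \<in> measurable (cone_measure G m) (borel \<Otimes>\<^sub>M borel)" by (rule measurable_Pair)
  then show ?thesis by (simp add: borel_prod)
qed

lemma continuous_cpart_measurable:
  fixes f :: "real \<times> 'a \<Rightarrow> 'b::topological_space"
  assumes "continuous_on (cpart W) f"
  shows "f \<in> borel_measurable (restrict_space (cone_measure G m) (cpart W))"
proof -
  have "(\<lambda>z. z) \<in> measurable (restrict_space (cone_measure G m) (cpart W)) (restrict_space borel (cpart W))"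
    by (rule measurable_restrict_space3[OF id_borel]) auto
  from measurable_compose[OF this borel_measurable_continuous_on_restrict[OF assms]] show ?thesis by simp
qed

lemma finite_frame_cover: "\<exists>\<F>\<subseteq>frames G. finite \<F> \<and> (\<Union>F\<in>\<F>. fst F) = UNIV"
proof -
  have "open (fst F)" if "F \<in> frames G" for F using frameD(1)[of "fst F" "snd F"] that by simp
  moreover have "UNIV \<subseteq> (\<Union>F\<in>frames G. fst F)"
  proof
    fix p :: 'a
    obtain W e where "(W, e) \<in> frames G" "p \<in> W" using frames_cover by blast
    then show "p \<in> (\<Union>F\<in>frames G. fst F)" by (metis UN_I fst_conv)
  qed
  ultimately obtain \<F> where "\<F> \<subseteq> frames G" "finite \<F>" "UNIV \<subseteq> (\<Union>F\<in>\<F>. fst F)"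
    using compactE_image[OF compact_M, of "frames G" fst] by metis
  then show ?thesis by (intro exI[of _ \<F>]) auto
qed

text \<open>Compactness of the manifold leaves finitely many frames, whose domains cut the cone into
  measurable pieces.\<close>

lemma measurable_frames:
  assumes "\<And>W e. (W, e) \<in> frames G \<Longrightarrow> f \<in> measurable (restrict_space (cone_measure G m) (cpart W)) N"
  shows "f \<in> measurable (cone_measure G m) N"
proof -
  obtain \<F> where \<F>: "\<F> \<subseteq> frames G" "finite \<F>" "(\<Union>F\<in>\<F>. fst F) = UNIV" using finite_frame_cover by blast
  show ?thesis
  proof (rule measurable_piecewise_restrict[where C = "(\<lambda>F. cpart (fst F)) ` \<F>"])
    show "countable ((\<lambda>F. cpart (fst F)) ` \<F>)" using \<F>(2) by (simp add: countable_finite)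
    show "space (cone_measure G m) \<subseteq> \<Union> ((\<lambda>F. cpart (fst F)) ` \<F>)"
    proof
      fix z assume "z \<in> space (cone_measure G m)"
      moreover obtain F where "F \<in> \<F>" "snd z \<in> fst F" using \<F>(3) by blast
      ultimately show "z \<in> \<Union> ((\<lambda>F. cpart (fst F)) ` \<F>)"
        by (auto simp: space_cone_measure cpart_def intro!: bexI[of _ F])
    qed
    fix \<Omega> assume "\<Omega> \<in> (\<lambda>F. cpart (fst F)) ` \<F>"
    then obtain F where F: "F \<in> frames G" "\<Omega> = cpart (fst F)" using \<F>(1) by blast
    then show "\<Omega> \<inter> space (cone_measure G m) \<in> sets (cone_measure G m)"
      using cpart_sets frameD(1)[of "fst F" "snd F"] by (intro sets.Int) auto
    show "f \<in> measurable (restrict_space (cone_measure G m) \<Omega>) N"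
      using assms[of "fst F" "snd F"] F by simp
  qed
qed

text \<open>The measurability half of \<open>L2\<close>, kept apart because limits and smooth
  sections are shown to be measurable before they are known to be square integrable.\<close>

definition msec :: "nat \<Rightarrow> ('a, 'f) csec \<Rightarrow> bool" where
  "msec m u \<longleftrightarrow> (\<forall>t>0. \<forall>y\<in>bd G. u (t, y) \<in> fib G y) \<and>
     (\<forall>(W, e)\<in>frames G. (\<lambda>z. coords G e (snd z) (u z)) \<in> borel_measurable (restrict_space (cone_measure G m) (cpart W)))"

lemma L2_iff: "u \<in> L2 G m \<longleftrightarrow> msec m u \<and> integrable (cone_measure G m) (\<lambda>z. q (snd z) (u z))"
  by (simp add: L2_def msec_def cpart_def q_def)

lemma msecD:
  assumes "msec m u"
  shows "z \<in> space (cone_measure G m) \<Longrightarrow> u z \<in> fib G (snd z)"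
    and "(W, e) \<in> frames G \<Longrightarrow> (\<lambda>z. coords G e (snd z) (u z)) \<in> borel_measurable (restrict_space (cone_measure G m) (cpart W))"
proof -
  show "z \<in> space (cone_measure G m) \<Longrightarrow> u z \<in> fib G (snd z)"
    using assms by (cases z) (simp add: msec_def space_cone_measure)
  have "\<forall>(W, e)\<in>frames G. (\<lambda>z. coords G e (snd z) (u z)) \<in> borel_measurable (restrict_space (cone_measure G m) (cpart W))"
    using assms unfolding msec_def by (elim conjE)
  from bspec[OF this, of "(W, e)"]
  show "(W, e) \<in> frames G \<Longrightarrow> (\<lambda>z. coords G e (snd z) (u z)) \<in> borel_measurable (restrict_space (cone_measure G m) (cpart W))"
    by simp
qed

lemma msecI:
  assumes "\<And>z. z \<in> space (cone_measure G m) \<Longrightarrow> u z \<in> fib G (snd z)"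
    and "\<And>W e. (W, e) \<in> frames G \<Longrightarrow> (\<lambda>z. coords G e (snd z) (u z)) \<in> borel_measurable (restrict_space (cone_measure G m) (cpart W))"
  shows "msec m u"
  using assms unfolding msec_def by (auto simp: space_cone_measure)

lemma space_cpart: "z \<in> space (restrict_space (cone_measure G m) (cpart W)) \<longleftrightarrow> z \<in> space (cone_measure G m) \<and> snd z \<in> W"
  by (auto simp: space_restrict_space space_cone_measure cpart_def)

lemma msec_add: "msec m u \<Longrightarrow> msec m v \<Longrightarrow> msec m (u + v)"
proof (rule msecI)
  fix W e assume a: "msec m u" "msec m v" and F: "(W, e) \<in> frames G"
  have "(\<lambda>z. coords G e (snd z) (u z) + coords G e (snd z) (v z)) \<in> borel_measurable (restrict_space (cone_measure G m) (cpart W))"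
    using msecD(2)[OF a(1) F] msecD(2)[OF a(2) F] by (rule borel_measurable_add)
  then show "(\<lambda>z. coords G e (snd z) ((u + v) z)) \<in> borel_measurable (restrict_space (cone_measure G m) (cpart W))"
    by (rule measurable_cong[THEN iffD1, rotated]) (simp add: space_cpart coords_add[OF F] msecD(1)[OF a(1)] msecD(1)[OF a(2)])
qed (simp add: fib_add msecD(1))

lemma msec_sscl: "msec m u \<Longrightarrow> msec m (sscl G c u)"
proof (rule msecI)
  fix W e assume a: "msec m u" and F: "(W, e) \<in> frames G"
  have "(\<lambda>z. c *s coords G e (snd z) (u z)) \<in> borel_measurable (restrict_space (cone_measure G m) (cpart W))"
    by (rule measurable_compose[OF msecD(2)[OF a F]])
      (intro borel_measurable_continuous_onI linear_continuous_on bounded_bilinear.bounded_linear_right[OF bounded_bilinear_smult])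
  then show "(\<lambda>z. coords G e (snd z) (sscl G c u z)) \<in> borel_measurable (restrict_space (cone_measure G m) (cpart W))"
    by (rule measurable_cong[THEN iffD1, rotated]) (simp add: space_cpart coords_scl[OF F] msecD(1)[OF a] sscl_def)
qed (simp add: fib_scl msecD(1) sscl_def)

lemma smooth_fun_continuous:
  fixes f :: "'a \<Rightarrow> 'b::real_normed_vector"
  assumes f: "smooth_fun G W f" and W: "open W"
  shows "continuous_on W f"
proof (rule continuous_on_locally)
  fix p assume "p \<in> W"
  obtain U \<phi> where C: "(U, \<phi>) \<in> charts G" "p \<in> U" using charts_cover by blast
  have "\<forall>(U, \<phi>)\<in>charts G. smooth_on (\<phi> ` (U \<inter> W)) (\<lambda>v. f (inv_into U \<phi> v))"
    using f unfolding smooth_fun_def .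
  from bspec[OF this C(1)] have "continuous_on (\<phi> ` (U \<inter> W)) (\<lambda>v. f (inv_into U \<phi> v))"
    using smooth_on_continuous by simp
  moreover have "continuous_on (W \<inter> U) \<phi>"
    using chartD(3)[OF C(1)] continuous_on_subset by (fastforce simp: homeomorphism_def)
  ultimately have "continuous_on (W \<inter> U) (\<lambda>p. f (inv_into U \<phi> (\<phi> p)))"
    by (rule continuous_on_compose2) auto
  then have "continuous_on (W \<inter> U) f"
    by (rule continuous_on_cong[THEN iffD1, rotated 2]) (auto simp: chartD(4)[OF C(1)])
  then show "\<exists>T. open T \<and> p \<in> T \<and> continuous_on (W \<inter> T) f" using C chartD(1)[OF C(1)] by blast
qed

lemma frame_herm_continuous: "(W, e) \<in> frames G \<Longrightarrow> continuous_on W (\<lambda>p. herm G p (e j p) (e k p))"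
  by (rule smooth_fun_continuous[OF frame_herm_smooth frameD(1)])

lemma frame_herm_cpart: "(W, e) \<in> frames G \<Longrightarrow> continuous_on (cpart W) (\<lambda>z. herm G (snd z) (e j (snd z)) (e k (snd z)))"
  by (rule continuous_on_compose2[OF frame_herm_continuous continuous_on_snd[OF continuous_on_id]]) (auto simp: cpart_def)

lemma vec_nth_measurable: "f \<in> borel_measurable M \<Longrightarrow> (\<lambda>z. (f z :: 'r cvec) $ j) \<in> borel_measurable M"
proof -
  assume f: "f \<in> borel_measurable M"
  have "(\<lambda>x :: 'r cvec. x $ j) \<in> borel_measurable borel" by (intro borel_measurable_continuous_onI continuous_intros)
  from measurable_compose[OF f this] show ?thesis .
qed

lemma herm_measurable:
  assumes a: "msec m u" "msec m v"
  shows "(\<lambda>z. herm G (snd z) (u z) (v z)) \<in> borel_measurable (cone_measure G m)"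
proof (rule measurable_frames)
  fix W e assume F: "(W, e) \<in> frames G"
  let ?R = "restrict_space (cone_measure G m) (cpart W)"
  note [measurable] = vec_nth_measurable[OF msecD(2)[OF a(1) F]] vec_nth_measurable[OF msecD(2)[OF a(2) F]]
    continuous_cpart_measurable[OF frame_herm_cpart[OF F]]
  have cnjm: "cnj \<in> borel_measurable borel" by (intro borel_measurable_continuous_onI continuous_intros)
  have [measurable]: "(\<lambda>z. cnj (coords G e (snd z) (v z) $ k)) \<in> borel_measurable ?R" for k
    by (rule measurable_compose[OF vec_nth_measurable[OF msecD(2)[OF a(2) F]] cnjm])
  have "(\<lambda>z. \<Sum>j\<in>UNIV. \<Sum>k\<in>UNIV. coords G e (snd z) (u z) $ j * cnj (coords G e (snd z) (v z) $ k) *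
      herm G (snd z) (e j (snd z)) (e k (snd z))) \<in> borel_measurable ?R"
    by measurable
  then show "(\<lambda>z. herm G (snd z) (u z) (v z)) \<in> borel_measurable ?R"
    by (rule measurable_cong[THEN iffD1, rotated]) (simp add: space_cpart herm_coords[OF F] msecD(1)[OF a(1)] msecD(1)[OF a(2)])
qed

lemma q_measurable: "msec m u \<Longrightarrow> (\<lambda>z. q (snd z) (u z)) \<in> borel_measurable (cone_measure G m)"
  using herm_measurable[of m u u] by (simp add: q_def)

subsection \<open>The Hilbert space structure\<close>

lemma L2D: "u \<in> L2 G m \<Longrightarrow> msec m u" "u \<in> L2 G m \<Longrightarrow> integrable (cone_measure G m) (\<lambda>z. q (snd z) (u z))"
  by (simp_all add: L2_iff)

lemma L2_fib: "u \<in> L2 G m \<Longrightarrow> z \<in> space (cone_measure G m) \<Longrightarrow> u z \<in> fib G (snd z)"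
  using msecD(1)[OF L2D(1)] .

lemma L2_sscl: "u \<in> L2 G m \<Longrightarrow> sscl G c u \<in> L2 G m"
proof -
  assume u: "u \<in> L2 G m"
  have "integrable (cone_measure G m) (\<lambda>z. (cmod c)\<^sup>2 * q (snd z) (u z))" using L2D(2)[OF u] by simp
  then have "integrable (cone_measure G m) (\<lambda>z. q (snd z) (sscl G c u z))"
    by (rule Bochner_Integration.integrable_cong[THEN iffD1, rotated 2]) (simp_all add: sscl_def q_scl L2_fib[OF u])
  then show ?thesis using msec_sscl[OF L2D(1)[OF u]] by (simp add: L2_iff)
qed

lemma L2_add: "u \<in> L2 G m \<Longrightarrow> v \<in> L2 G m \<Longrightarrow> u + v \<in> L2 G m"
proof -
  assume u: "u \<in> L2 G m" and v: "v \<in> L2 G m"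
  note m = msec_add[OF L2D(1)[OF u] L2D(1)[OF v]]
  have "integrable (cone_measure G m) (\<lambda>z. 2 * q (snd z) (u z) + 2 * q (snd z) (v z))"
    using L2D(2)[OF u] L2D(2)[OF v] by simp
  then have "integrable (cone_measure G m) (\<lambda>z. q (snd z) ((u + v) z))"
  proof (rule Bochner_Integration.integrable_bound[OF _ q_measurable[OF m] AE_I2])
    fix z assume "z \<in> space (cone_measure G m)"
    then show "norm (q (snd z) ((u + v) z)) \<le> norm (2 * q (snd z) (u z) + 2 * q (snd z) (v z))"
      using q_add_le[OF L2_fib[OF u] L2_fib[OF v]] q_nonneg[OF L2_fib[OF u]] q_nonneg[OF L2_fib[OF v]] q_nonneg[OF msecD(1)[OF m]] by simp
  qed
  then show ?thesis using m by (simp add: L2_iff)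
qed

lemma sscl_simps: "sscl G (-1) u = - u" "sscl G 0 u = 0" "sscl G 1 u = u"
  by (auto simp: sscl_def fun_eq_iff)

lemma L2_minus: "u \<in> L2 G m \<Longrightarrow> v \<in> L2 G m \<Longrightarrow> u - v \<in> L2 G m"
  using L2_add[of u m "sscl G (-1) v"] L2_sscl[of v m "-1"] by (simp add: sscl_simps)

lemma herm_integrable:
  assumes u: "u \<in> L2 G m" and v: "v \<in> L2 G m"
  shows "integrable (cone_measure G m) (\<lambda>z. herm G (snd z) (u z) (v z))"
proof (rule Bochner_Integration.integrable_bound[OF _ herm_measurable[OF L2D(1)[OF u] L2D(1)[OF v]] AE_I2])
  show "integrable (cone_measure G m) (\<lambda>z. q (snd z) (u z) + q (snd z) (v z))"
    using L2D(2)[OF u] L2D(2)[OF v] by simp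
  fix z assume z: "z \<in> space (cone_measure G m)"
  show "norm (herm G (snd z) (u z) (v z)) \<le> norm (q (snd z) (u z) + q (snd z) (v z))"
    using herm_bound[OF L2_fib[OF u z] L2_fib[OF v z]] by simp
qed

lemma ip_add_left:
  assumes "u \<in> L2 G m" "v \<in> L2 G m" "w \<in> L2 G m"
  shows "ip G m (u + v) w = ip G m u w + ip G m v w"
proof -
  have "ip G m (u + v) w = (\<integral>z. herm G (snd z) (u z) (w z) + herm G (snd z) (v z) (w z) \<partial>cone_measure G m)"
    unfolding ip_def by (rule Bochner_Integration.integral_cong[OF refl]) (simp add: herm_add_left L2_fib[OF assms(1)] L2_fib[OF assms(2)] L2_fib[OF assms(3)])
  also have "\<dots> = ip G m u w + ip G m v w"
    unfolding ip_def by (intro Bochner_Integration.integral_add herm_integrable assms)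
  finally show ?thesis .
qed

lemma ip_sscl_left:
  assumes "u \<in> L2 G m" "w \<in> L2 G m"
  shows "ip G m (sscl G c u) w = c * ip G m u w"
proof -
  have "ip G m (sscl G c u) w = (\<integral>z. c * herm G (snd z) (u z) (w z) \<partial>cone_measure G m)"
    unfolding ip_def sscl_def by (rule Bochner_Integration.integral_cong[OF refl]) (simp add: herm_scl_left L2_fib[OF assms(1)] L2_fib[OF assms(2)])
  then show ?thesis by (simp add: ip_def)
qed

lemma ip_cnj:
  assumes "u \<in> L2 G m" "w \<in> L2 G m"
  shows "ip G m w u = cnj (ip G m u w)"
proof -
  have "ip G m w u = (\<integral>z. cnj (herm G (snd z) (u z) (w z)) \<partial>cone_measure G m)"
    unfolding ip_def by (rule Bochner_Integration.integral_cong[OF refl]) (rule herm_cnj[OF L2_fib[OF assms(1)] L2_fib[OF assms(2)]])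
  then show ?thesis by (simp add: ip_def)
qed

lemma ip_self:
  assumes "u \<in> L2 G m"
  shows "Re (ip G m u u) = (\<integral>z. q (snd z) (u z) \<partial>cone_measure G m)"
  unfolding ip_def q_def by (rule integral_Re[symmetric, OF herm_integrable[OF assms assms]])

lemma ip_self_nonneg: "u \<in> L2 G m \<Longrightarrow> Re (ip G m u u) \<ge> 0"
  unfolding ip_self by (rule Bochner_Integration.integral_nonneg_AE, rule AE_I2, rule q_nonneg, rule L2_fib)

lemma L2norm_zero_iff:
  assumes "u \<in> L2 G m"
  shows "L2norm G m u = 0 \<longleftrightarrow> (AE z in cone_measure G m. u z = 0)"
proof -
  have "L2norm G m u = 0 \<longleftrightarrow> (\<integral>z. q (snd z) (u z) \<partial>cone_measure G m) = 0"
    using ip_self_nonneg[OF assms] by (simp add: L2norm_def ip_self[OF assms])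
  also have "\<dots> \<longleftrightarrow> (AE z in cone_measure G m. q (snd z) (u z) = 0)"
    by (rule integral_nonneg_eq_0_iff_AE[OF L2D(2)[OF assms] AE_I2]) (simp add: q_nonneg L2_fib[OF assms])
  also have "\<dots> \<longleftrightarrow> (AE z in cone_measure G m. u z = 0)"
    by (rule AE_cong) (simp add: q_zero_iff L2_fib[OF assms])
  finally show ?thesis .
qed

lemma eq_ae_iff:
  assumes "u \<in> L2 G m" "v \<in> L2 G m"
  shows "eq_ae G m u v \<longleftrightarrow> L2norm G m (u - v) = 0"
  unfolding L2norm_zero_iff[OF L2_minus[OF assms]] eq_ae_def by simp

subsection \<open>Test sections are square integrable\<close>

lemma smooth_coords_continuous:
  assumes u: "u \<in> cone_smooth_sections G" and F: "(W, e) \<in> frames G"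
  shows "continuous_on (cpart W) (\<lambda>z. coords G e (snd z) (u z))"
proof (rule continuous_on_locally)
  fix z assume "z \<in> cpart W"
  obtain U \<phi> where C: "(U, \<phi>) \<in> charts G" "snd z \<in> U" using charts_cover by blast
  let ?T = "UNIV \<times> U :: (real \<times> 'a) set"
  have "continuous_on (cdom U \<phi> W) (cyl_rep G (U, \<phi>) e u)"
    by (rule smooth_on_continuous[OF cone_smoothD(2)[OF u C(1) F]])
  moreover have "continuous_on (cpart W \<inter> ?T) (cyl \<phi>)"
    by (rule continuous_on_subset[OF continuous_cyl[OF C(1)]]) auto
  ultimately have "continuous_on (cpart W \<inter> ?T) (\<lambda>z. cyl_rep G (U, \<phi>) e u (cyl \<phi> z))"
    by (rule continuous_on_compose2) (auto simp: cpart_def intro!: cyl_in_cdom[OF C(1)])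
  then have "continuous_on (cpart W \<inter> ?T) (\<lambda>z. coords G e (snd z) (u z))"
    by (rule continuous_on_cong[THEN iffD1, rotated 2]) (auto simp: cpart_def cyl_rep_cyl[OF C(1)])
  moreover have "open ?T" using chartD(1)[OF C(1)] by (simp add: open_Times)
  moreover have "z \<in> ?T" using C(2) by (cases z) simp
  ultimately show "\<exists>T. open T \<and> z \<in> T \<and> continuous_on (cpart W \<inter> T) (\<lambda>z. coords G e (snd z) (u z))"
    by (intro exI[of _ ?T]) simp
qed

lemma smooth_msec: "u \<in> cone_smooth_sections G \<Longrightarrow> msec m u"
proof (rule msecI)
  fix W e assume u: "u \<in> cone_smooth_sections G" and F: "(W, e) \<in> frames G"
  show "(\<lambda>z. coords G e (snd z) (u z)) \<in> borel_measurable (restrict_space (cone_measure G m) (cpart W))"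
    by (rule continuous_cpart_measurable[OF smooth_coords_continuous[OF u F]])
next
  fix z assume "u \<in> cone_smooth_sections G" "z \<in> space (cone_measure G m)"
  then show "u z \<in> fib G (snd z)" by (cases z) (simp add: space_cone_measure cone_smoothD(1))
qed

lemma smooth_q_continuous:
  assumes u: "u \<in> cone_smooth_sections G"
  shows "continuous_on ({0<..} \<times> bd G) (\<lambda>z. q (snd z) (u z))"
proof (rule continuous_on_locally)
  fix z :: "real \<times> 'a" assume z: "z \<in> {0<..} \<times> bd G"
  obtain W e where F: "(W, e) \<in> frames G" "snd z \<in> W" using frames_cover by blast
  have "continuous_on (cpart W) (\<lambda>z. Re (\<Sum>j\<in>UNIV. \<Sum>k\<in>UNIV. coords G e (snd z) (u z) $ j *
      cnj (coords G e (snd z) (u z) $ k) * herm G (snd z) (e j (snd z)) (e k (snd z))))"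
    by (intro continuous_intros smooth_coords_continuous[OF u F(1)] frame_herm_cpart[OF F(1)])
  then have "continuous_on (cpart W) (\<lambda>z. q (snd z) (u z))"
  proof (rule continuous_on_cong[THEN iffD1, rotated 2])
    fix z assume "z \<in> cpart W"
    then have "snd z \<in> W" "u z \<in> fib G (snd z)" using cone_smoothD(1)[OF u] by (auto simp: cpart_def)
    then show "Re (\<Sum>j\<in>UNIV. \<Sum>k\<in>UNIV. coords G e (snd z) (u z) $ j *
      cnj (coords G e (snd z) (u z) $ k) * herm G (snd z) (e j (snd z)) (e k (snd z))) = q (snd z) (u z)"
      unfolding q_def by (simp only: herm_coords[OF F(1)])
  qed simp
  moreover have "({0<..} \<times> bd G) \<inter> (UNIV \<times> W) = cpart W" by (auto simp: cpart_def)
  moreover have "open (UNIV \<times> W :: (real \<times> 'a) set)" using frameD(1)[OF F(1)] by (simp add: open_Times)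
  moreover have "z \<in> UNIV \<times> W" using F(2) by (cases z) simp
  ultimately show "\<exists>T. open T \<and> z \<in> T \<and> continuous_on ({0<..} \<times> bd G \<inter> T) (\<lambda>z. q (snd z) (u z))"
    by (intro exI[of _ "UNIV \<times> W"]) simp
qed

lemma rad_interval_finite:
  assumes "0 < a"
  shows "emeasure (rad m) {a..b} < \<infinity>"
proof -
  have s: "{a..b} \<in> sets (rad m)" using assms by (auto simp: sets_rad)
  then have "emeasure (rad m) {a..b} = (\<integral>\<^sup>+x. indicator {a..b} x \<partial>rad m)" by simp
  also have "\<dots> = (\<integral>\<^sup>+x. ennreal (x ^ m * (1 / x)) * indicator {a..b} x * indicator {0<..} x \<partial>lborel)"
    by (rule nn_integral_rad) simp
  also have "\<dots> \<le> (\<integral>\<^sup>+x. ennreal (b ^ m * (1 / a)) * indicator {a..b} x \<partial>lborel)"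
  proof (rule nn_integral_mono)
    fix x :: real
    have "x ^ m * (1 / x) \<le> b ^ m * (1 / a)" if "a \<le> x" "x \<le> b"
      using that assms by (intro mult_mono power_mono divide_left_mono) auto
    then show "ennreal (x ^ m * (1 / x)) * indicator {a..b} x * indicator {0<..} x \<le> ennreal (b ^ m * (1 / a)) * indicator {a..b} x"
      by (auto simp: indicator_def intro: ennreal_leI)
  qed
  also have "\<dots> = ennreal (b ^ m * (1 / a)) * emeasure lborel {a..b}" by (rule nn_integral_cmult_indicator) simp
  also have "\<dots> < \<infinity>" by (simp add: ennreal_mult_less_top emeasure_lborel_Icc_eq)
  finally show ?thesis .
qed

text \<open>The support lies over an interval \<open>{a..b}\<close> with \<open>a > 0\<close>; the
  part of the cone over it has finite measure because \<open>densY\<close> is finite, and the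
  squared fibre norm is bounded on the compact support.\<close>

lemma cone_test_L2: "u \<in> cone_test_sections G \<Longrightarrow> u \<in> L2 G m"
proof -
  assume "u \<in> cone_test_sections G"
  then obtain K where u: "u \<in> cone_smooth_sections G" and K: "compact K" "K \<subseteq> {0<..} \<times> bd G"
    "\<forall>z\<in>({0<..} \<times> bd G) - K. u z = 0" unfolding cone_test_sections_def by blast
  have cK: "compact (fst ` K)" by (intro compact_continuous_image K(1) continuous_intros)
  obtain a b where ab: "0 < a" "\<And>z. z \<in> K \<Longrightarrow> a \<le> fst z \<and> fst z \<le> b"
  proof (cases "K = {}")
    case True
    then show ?thesis using that[of 1 1] by simp
  next
    case False
    then have ne: "fst ` K \<noteq> {}" by simp
    obtain a where a: "a \<in> fst ` K" "\<forall>x\<in>fst ` K. a \<le> x" using compact_attains_inf[OF cK ne] by blast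
    obtain b where b: "\<forall>x\<in>fst ` K. x \<le> b" using compact_attains_sup[OF cK ne] by blast
    show ?thesis by (rule that[of a b]) (use a b K(2) in auto)
  qed
  let ?I = "{a..b} \<times> bd G"
  have Is: "?I \<in> sets (cone_measure G m)"
    unfolding cone_measure_eq using ab(1) bd_borel by (intro pair_measureI) (auto simp: sets_rad sets_densY)
  interpret Y: sigma_finite_measure "densY G" by (rule sigma_finite_densY)
  have "emeasure (cone_measure G m) ?I = emeasure (rad m) {a..b} * emeasure (densY G) (bd G)"
    unfolding cone_measure_eq
    by (rule Y.emeasure_pair_measure_Times) (use ab(1) bd_borel in \<open>auto simp: sets_rad sets_densY\<close>)
  also have "\<dots> < \<infinity>"
    using rad_interval_finite[OF ab(1)] finite_densY by (simp add: ennreal_mult_less_top)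
  finally have fin: "emeasure (cone_measure G m) ?I < \<infinity>" .
  have "compact ((\<lambda>z. q (snd z) (u z)) ` K)"
    by (rule compact_continuous_image[OF continuous_on_subset[OF smooth_q_continuous[OF u] K(2)] K(1)])
  from compact_imp_bounded[OF this] obtain B where "\<forall>x\<in>(\<lambda>z. q (snd z) (u z)) ` K. norm x \<le> B"
    unfolding bounded_iff by (elim exE)
  then have B: "norm (q (snd z) (u z)) \<le> B" if "z \<in> K" for z using that by simp
  have "integrable (cone_measure G m) (\<lambda>z. q (snd z) (u z))"
  proof (rule Bochner_Integration.integrable_bound[OF _ q_measurable[OF smooth_msec[OF u]] AE_I2])
    show "integrable (cone_measure G m) (\<lambda>z. \<bar>B\<bar> * indicator ?I z)"
      using Is fin by (intro integrable_mult_right integrable_real_indicator)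
    fix z assume z: "z \<in> space (cone_measure G m)"
    show "norm (q (snd z) (u z)) \<le> norm (\<bar>B\<bar> * indicator ?I z)"
    proof (cases "z \<in> K")
      case True
      then have "z \<in> ?I" using ab(2) K(2) by (cases z) auto
      then show ?thesis using B[OF True] by simp
    next
      case False
      then have "u z = 0" using z K(3) by (simp add: space_cone_measure)
      moreover have "q (snd z) 0 = 0" using q_zero_iff[OF fib_zero] by simp
      ultimately show ?thesis by simp
    qed
  qed
  then show "u \<in> L2 G m" using smooth_msec[OF u] by (simp add: L2_iff)
qed

section \<open>Dilations of the cone act isometrically\<close>

definition cdil :: "real \<Rightarrow> real \<times> 'a \<Rightarrow> real \<times> 'a" where
  "cdil \<rho> z = (\<rho> * fst z, snd z)"

text \<open>The measure x^m dx/x is homogeneous of degree m: dx/x is invariant under dilations and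
  x^m scales.\<close>

lemma rad_scale:
  assumes \<rho>: "\<rho> > 0" and A: "A \<in> sets (rad m)"
  shows "ennreal (\<rho> ^ m) * emeasure (rad m) ((*) \<rho> -` A) = emeasure (rad m) A"
proof -
  have A': "A \<in> sets borel" "A \<subseteq> {0<..}" using A by (auto simp: sets_rad)
  have "(*) \<rho> \<in> borel_measurable borel" by measurable
  from measurable_sets[OF this A'(1)] have B: "(*) \<rho> -` A \<in> sets borel" by simp
  moreover have "(*) \<rho> -` A \<subseteq> {0<..}" using A'(2) \<rho> by (auto simp: zero_less_mult_iff)
  ultimately have B': "(*) \<rho> -` A \<in> sets (rad m)" by (simp add: sets_rad)
  let ?f = "\<lambda>A x::real. ennreal (x ^ m * (1 / x)) * indicator A x * indicator {0<..} x"
  have em: "emeasure (rad m) X = (\<integral>\<^sup>+x. ?f X x \<partial>lborel)" if "X \<in> sets (rad m)" for X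
  proof -
    have "emeasure (rad m) X = (\<integral>\<^sup>+x. indicator X x \<partial>rad m)" using that by simp
    also have "\<dots> = (\<integral>\<^sup>+x. ?f X x \<partial>lborel)" by (rule nn_integral_rad) (use that in \<open>auto simp: sets_rad\<close>)
    finally show ?thesis .
  qed
  have "emeasure (rad m) A = ennreal \<bar>\<rho>\<bar> * (\<integral>\<^sup>+x. ?f A (0 + \<rho> * x) \<partial>lborel)"
    unfolding em[OF A] by (rule nn_integral_real_affine) (use A' \<rho> in auto)
  also have "\<dots> = ennreal \<rho> * (\<integral>\<^sup>+x. ennreal (\<rho> ^ m * (1 / \<rho>)) * ?f ((*) \<rho> -` A) x \<partial>lborel)"
  proof -
    have "?f A (0 + \<rho> * x) = ennreal (\<rho> ^ m * (1 / \<rho>)) * ?f ((*) \<rho> -` A) x" for x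
    proof (cases "x > 0")
      case True
      have "(\<rho> * x) ^ m * (1 / (\<rho> * x)) = \<rho> ^ m * (1 / \<rho>) * (x ^ m * (1 / x))"
        using \<rho> True by (simp add: power_mult_distrib)
      then have "ennreal ((\<rho> * x) ^ m * (1 / (\<rho> * x))) = ennreal (\<rho> ^ m * (1 / \<rho>)) * ennreal (x ^ m * (1 / x))"
        using \<rho> True ennreal_mult[of "\<rho> ^ m * (1 / \<rho>)" "x ^ m * (1 / x)"] by simp
      then show ?thesis using \<rho> True by (simp add: indicator_def)
    next
      case False
      then have "\<not> \<rho> * x > 0" using \<rho> by (simp add: zero_less_mult_iff)
      then show ?thesis using False by simp
    qed
    then show ?thesis using \<rho> by simp
  qed
  also have "\<dots> = ennreal \<rho> * (ennreal (\<rho> ^ m * (1 / \<rho>)) * emeasure (rad m) ((*) \<rho> -` A))"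
    unfolding em[OF B'] by (subst nn_integral_cmult) (use B in auto)
  also have "\<dots> = ennreal (\<rho> ^ m) * emeasure (rad m) ((*) \<rho> -` A)"
    using \<rho> by (simp add: mult.assoc[symmetric] ennreal_mult[symmetric])
  finally show ?thesis ..
qed

lemma cdil_measurable: "\<rho> > 0 \<Longrightarrow> cdil \<rho> \<in> measurable (cone_measure G m) (cone_measure G m)"
proof -
  assume \<rho>: "\<rho> > 0"
  have "(*) \<rho> \<in> measurable (rad m) (rad m)"
  proof (rule measurableI)
    fix A assume "A \<in> sets (rad m)"
    then have A: "A \<in> sets borel" "A \<subseteq> {0<..}" by (auto simp: sets_rad)
    have "(*) \<rho> \<in> borel_measurable borel" by measurable
    from measurable_sets[OF this A(1)] show "(*) \<rho> -` A \<inter> space (rad m) \<in> sets (rad m)"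
      by (auto simp: sets_rad space_rad)
  qed (use \<rho> in \<open>simp add: space_rad\<close>)
  from measurable_compose[OF measurable_fst this, of "densY G"]
  have "(\<lambda>z. (\<rho> * fst z, snd z)) \<in> measurable (rad m \<Otimes>\<^sub>M densY G) (rad m \<Otimes>\<^sub>M densY G)"
    by (intro measurable_Pair measurable_snd)
  then show ?thesis by (simp add: cone_measure_eq cdil_def[abs_def])
qed

lemma cdil_space: "\<rho> > 0 \<Longrightarrow> z \<in> space (cone_measure G m) \<Longrightarrow> cdil \<rho> z \<in> space (cone_measure G m)"
  by (auto simp: space_cone_measure cdil_def)

lemma cone_measure_cdil:
  assumes \<rho>: "\<rho> > 0"
  shows "distr (cone_measure G m) (cone_measure G m) (cdil \<rho>) = density (cone_measure G m) (\<lambda>_. ennreal (1 / \<rho> ^ m))"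
    (is "?D = _")
proof -
  interpret Y: sigma_finite_measure "densY G" by (rule sigma_finite_densY)
  interpret R: sigma_finite_measure "rad m" by (rule sigma_finite_rad)
  let ?c = "\<lambda>_::real. ennreal (1 / \<rho> ^ m)"
  have sfR: "sigma_finite_measure (density (rad m) ?c)"
    by (subst R.sigma_finite_iff_density_finite) auto
  have "density (cone_measure G m) (\<lambda>_. ennreal (1 / \<rho> ^ m)) = density (rad m) ?c \<Otimes>\<^sub>M density (densY G) (\<lambda>_. 1)"
    unfolding cone_measure_eq
    by (subst pair_measure_density) (use Y.sigma_finite_measure_axioms in \<open>simp_all add: density_1 case_prod_unfold\<close>)
  also have "\<dots> = density (rad m) ?c \<Otimes>\<^sub>M densY G" by (simp add: density_1)
  also have "\<dots> = ?D"
  proof (rule pair_measure_eqI[OF sfR sigma_finite_densY])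
    show "sets (density (rad m) ?c \<Otimes>\<^sub>M densY G) = sets ?D"
      by (simp add: cone_measure_eq cong: sets_pair_measure_cong)
    fix A X assume "A \<in> sets (density (rad m) ?c)" and X: "X \<in> sets (densY G)"
    then have A: "A \<in> sets (rad m)" by simp
    then have A': "A \<in> sets borel" "A \<subseteq> {0<..}" by (auto simp: sets_rad)
    have "(*) \<rho> \<in> borel_measurable borel" by measurable
    from measurable_sets[OF this A'(1)] have "(*) \<rho> -` A \<in> sets borel" by simp
    moreover have "(*) \<rho> -` A \<subseteq> {0<..}" using A'(2) \<rho> by (auto simp: zero_less_mult_iff)
    ultimately have B: "(*) \<rho> -` A \<in> sets (rad m)" by (simp add: sets_rad)
    have AX: "A \<times> X \<in> sets (cone_measure G m)" using A X by (simp add: cone_measure_eq)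
    have "emeasure ?D (A \<times> X) = emeasure (cone_measure G m) (cdil \<rho> -` (A \<times> X) \<inter> space (cone_measure G m))"
      by (rule emeasure_distr[OF cdil_measurable[OF \<rho>] AX])
    also have "cdil \<rho> -` (A \<times> X) \<inter> space (cone_measure G m) = ((*) \<rho> -` A) \<times> X"
    proof -
      have "X \<subseteq> bd G" using X by (simp add: sets_densY)
      then show ?thesis using A'(2) \<rho> by (auto simp: space_cone_measure cdil_def zero_less_mult_iff)
    qed
    also have "emeasure (cone_measure G m) (((*) \<rho> -` A) \<times> X) = emeasure (rad m) ((*) \<rho> -` A) * emeasure (densY G) X"
      unfolding cone_measure_eq by (rule Y.emeasure_pair_measure_Times[OF B X])
    also have "emeasure (rad m) ((*) \<rho> -` A) = ennreal (1 / \<rho> ^ m) * emeasure (rad m) A"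
      unfolding rad_scale[OF \<rho> A, symmetric] using \<rho>
      by (simp add: mult.assoc[symmetric] ennreal_mult[symmetric])
    also have "\<dots> = emeasure (density (rad m) ?c) A"
      using A by (simp add: emeasure_density nn_integral_cmult_indicator)
    finally show "emeasure (density (rad m) ?c) A * emeasure (densY G) X = emeasure ?D (A \<times> X)" ..
  qed
  finally show ?thesis ..
qed

lemma integral_cdil:
  fixes f :: "real \<times> 'a \<Rightarrow> 'b::{banach, second_countable_topology}"
  assumes \<rho>: "\<rho> > 0" and f: "f \<in> borel_measurable (cone_measure G m)"
  shows "(\<integral>z. f (cdil \<rho> z) \<partial>cone_measure G m) = (1 / \<rho> ^ m) *\<^sub>R (\<integral>z. f z \<partial>cone_measure G m)"
    and "integrable (cone_measure G m) f \<Longrightarrow> integrable (cone_measure G m) (\<lambda>z. f (cdil \<rho> z))"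
proof -
  have "(\<integral>z. f (cdil \<rho> z) \<partial>cone_measure G m) = (\<integral>z. f z \<partial>distr (cone_measure G m) (cone_measure G m) (cdil \<rho>))"
    by (rule integral_distr[OF cdil_measurable[OF \<rho>] f, symmetric])
  also have "\<dots> = (\<integral>z. (1 / \<rho> ^ m) *\<^sub>R f z \<partial>cone_measure G m)"
    unfolding cone_measure_cdil[OF \<rho>] by (rule integral_density[OF f]) (use \<rho> in auto)
  finally show "(\<integral>z. f (cdil \<rho> z) \<partial>cone_measure G m) = (1 / \<rho> ^ m) *\<^sub>R (\<integral>z. f z \<partial>cone_measure G m)" by simp
  assume "integrable (cone_measure G m) f"
  then have "integrable (cone_measure G m) (\<lambda>z. (1 / \<rho> ^ m) *\<^sub>R f z)" by simp
  then have "integrable (density (cone_measure G m) (\<lambda>_. ennreal (1 / \<rho> ^ m))) f"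
    by (subst integrable_density) (use \<rho> f in auto)
  then show "integrable (cone_measure G m) (\<lambda>z. f (cdil \<rho> z))"
    unfolding cone_measure_cdil[OF \<rho>, symmetric] by (rule integrable_distr[OF cdil_measurable[OF \<rho>]])
qed

lemma kappa_eq: "kappa G m \<rho> u z = scl G (of_real (\<rho> powr (real m / 2))) (u (cdil \<rho> z))"
  by (cases z) (simp add: kappa_def cdil_def)

lemma powr_half_sq: "\<rho> > 0 \<Longrightarrow> (\<rho> powr (real m / 2)) * (\<rho> powr (real m / 2)) = \<rho> ^ m"
  by (simp add: powr_add[symmetric] powr_realpow)

lemma kappa_L2:
  assumes \<rho>: "\<rho> > 0" and u: "u \<in> L2 G m"
  shows "kappa G m \<rho> u \<in> L2 G m"
  unfolding L2_iff
proof
  let ?k = "of_real (\<rho> powr (real m / 2)) :: complex"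
  show ms: "msec m (kappa G m \<rho> u)"
  proof (rule msecI)
    fix W e assume F: "(W, e) \<in> frames G"
    have "cdil \<rho> \<in> measurable (restrict_space (cone_measure G m) (cpart W)) (restrict_space (cone_measure G m) (cpart W))"
      by (rule measurable_restrict_space3[OF cdil_measurable[OF \<rho>]]) (use \<rho> in \<open>auto simp: cpart_def cdil_def\<close>)
    from measurable_compose[OF this msecD(2)[OF L2D(1)[OF u] F]]
    have m1: "(\<lambda>z. coords G e (snd (cdil \<rho> z)) (u (cdil \<rho> z))) \<in> borel_measurable (restrict_space (cone_measure G m) (cpart W))" .
    have "(\<lambda>x :: 'r cvec. ?k *s x) \<in> borel_measurable borel"
      by (intro borel_measurable_continuous_onI linear_continuous_on bounded_bilinear.bounded_linear_right[OF bounded_bilinear_smult])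
    from measurable_compose[OF m1 this]
    show "(\<lambda>z. coords G e (snd z) (kappa G m \<rho> u z)) \<in> borel_measurable (restrict_space (cone_measure G m) (cpart W))"
    proof (rule measurable_cong[THEN iffD1, rotated])
      fix z assume "z \<in> space (restrict_space (cone_measure G m) (cpart W))"
      then have z: "z \<in> space (cone_measure G m)" "snd z \<in> W" by (simp_all add: space_cpart)
      have "u (cdil \<rho> z) \<in> fib G (snd z)" using L2_fib[OF u cdil_space[OF \<rho> z(1)]] by (simp add: cdil_def)
      from coords_scl[OF F z(2) this]
      show "?k *s coords G e (snd (cdil \<rho> z)) (u (cdil \<rho> z)) = coords G e (snd z) (kappa G m \<rho> u z)"
        by (simp add: kappa_eq) (simp add: cdil_def)
    qed
  next
    fix z assume "z \<in> space (cone_measure G m)"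
    from L2_fib[OF u cdil_space[OF \<rho> this]] show "kappa G m \<rho> u z \<in> fib G (snd z)"
      unfolding kappa_eq by (intro fib_scl) (simp add: cdil_def)
  qed
  have "integrable (cone_measure G m) (\<lambda>z. (cmod ?k)\<^sup>2 * q (snd (cdil \<rho> z)) (u (cdil \<rho> z)))"
    by (rule integrable_mult_right[OF integral_cdil(2)[OF \<rho> q_measurable[OF L2D(1)[OF u]] L2D(2)[OF u]]])
  then show "integrable (cone_measure G m) (\<lambda>z. q (snd z) (kappa G m \<rho> u z))"
  proof (rule Bochner_Integration.integrable_cong[THEN iffD1, OF refl, rotated])
    fix z assume "z \<in> space (cone_measure G m)"
    from q_scl[OF L2_fib[OF u cdil_space[OF \<rho> this]]]
    show "(cmod ?k)\<^sup>2 * q (snd (cdil \<rho> z)) (u (cdil \<rho> z)) = q (snd z) (kappa G m \<rho> u z)"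
      unfolding kappa_eq by (simp add: cdil_def)
  qed
qed

text \<open>The square of the factor \<rho>^(m/2) in \<open>kappa\<close> cancels the factor
  \<rho>^(-m) by which the dilation changes the cone measure.\<close>

lemma ip_kappa:
  assumes \<rho>: "\<rho> > 0" and u: "u \<in> L2 G m" and v: "v \<in> L2 G m"
  shows "ip G m (kappa G m \<rho> u) (kappa G m \<rho> v) = ip G m u v"
proof -
  let ?k = "of_real (\<rho> powr (real m / 2)) :: complex"
  let ?h = "\<lambda>z. herm G (snd z) (u z) (v z)"
  have "ip G m (kappa G m \<rho> u) (kappa G m \<rho> v) = (\<integral>z. of_real (\<rho> ^ m) * ?h (cdil \<rho> z) \<partial>cone_measure G m)"
    unfolding ip_def
  proof (rule Bochner_Integration.integral_cong[OF refl])
    fix z assume z: "z \<in> space (cone_measure G m)"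
    have s: "snd (cdil \<rho> z) = snd z" by (simp add: cdil_def)
    note f = L2_fib[OF u cdil_space[OF \<rho> z], unfolded s] L2_fib[OF v cdil_space[OF \<rho> z], unfolded s]
    have "herm G (snd z) (scl G ?k (u (cdil \<rho> z))) (scl G ?k (v (cdil \<rho> z))) = (?k * cnj ?k) * ?h (cdil \<rho> z)"
      by (simp add: herm_scl_left herm_scl_right f fib_scl s)
    also have "?k * cnj ?k = of_real (\<rho> ^ m)" using powr_half_sq[OF \<rho>, of m] by (simp flip: of_real_mult)
    finally show "herm G (snd z) (kappa G m \<rho> u z) (kappa G m \<rho> v z) = of_real (\<rho> ^ m) * ?h (cdil \<rho> z)"
      unfolding kappa_eq .
  qed
  also have "\<dots> = of_real (\<rho> ^ m) * ((1 / \<rho> ^ m) *\<^sub>R ip G m u v)"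
    unfolding ip_def using integral_cdil(1)[OF \<rho> herm_measurable[OF L2D(1)[OF u] L2D(1)[OF v]]] by simp
  also have "\<dots> = ip G m u v" using \<rho> by (simp add: scaleR_conv_of_real)
  finally show ?thesis .
qed

subsection \<open>Completeness\<close>

lemma coords_minus: "(W, e) \<in> frames G \<Longrightarrow> p \<in> W \<Longrightarrow> v \<in> fib G p \<Longrightarrow> w \<in> fib G p \<Longrightarrow>
    coords G e p (v - w) = coords G e p v - coords G e p w"
  using coords_add[of W e p "v - w" w] by (simp add: fib_minus)

text \<open>On the unit sphere the squared fibre norm attains a minimum, positive because a frame is
  injective; homogeneity does the rest. The constant depends on the point, which suffices for
  pointwise convergence.\<close>

lemma norm_coords_le:
  assumes F: "(W, e) \<in> frames G" "p \<in> W"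
  shows "\<exists>k>0. \<forall>v\<in>fib G p. (norm (coords G e p v))\<^sup>2 \<le> k * q p v"
proof -
  let ?f = "\<lambda>c. q p (frame_map G e p c)"
  have "continuous_on (sphere 0 1) ?f"
    unfolding q_def herm_frame[OF F] by (intro continuous_intros)
  moreover have "axis (undefined :: 'r) 1 \<in> sphere (0 :: 'r cvec) 1" by (simp add: norm_axis_1)
  ultimately obtain c0 where c0: "c0 \<in> sphere (0 :: 'r cvec) 1" "\<forall>c\<in>sphere 0 1. ?f c0 \<le> ?f c"
    using continuous_attains_inf[of "sphere (0 :: 'r cvec) 1" ?f] by (metis compact_sphere empty_iff)
  have "frame_map G e p c0 \<noteq> 0"
  proof
    assume "frame_map G e p c0 = 0"
    then have "c0 = 0" using coords_frame_map[OF F, of c0] coords_zero[OF F] by simp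
    then show False using c0(1) by simp
  qed
  then have pos: "?f c0 > 0" using herm_pos[OF frame_map_fib[OF F]] by (simp add: q_def)
  have "(norm (coords G e p v))\<^sup>2 \<le> (1 / ?f c0) * q p v" if v: "v \<in> fib G p" for v
  proof (cases "coords G e p v = 0")
    case True
    then show ?thesis using pos q_nonneg[OF v] by simp
  next
    case False
    define c where "c = coords G e p v"
    have n: "norm c > 0" using False by (simp add: c_def)
    have "(1 / norm c) *\<^sub>R c \<in> sphere 0 1" using n by simp
    then have "?f c0 \<le> ?f ((1 / norm c) *\<^sub>R c)" using c0(2) by blast
    also have "\<dots> = (1 / norm c)\<^sup>2 * q p (frame_map G e p c)"
      unfolding scaleR_eq_smult frame_map_smult using q_scl[OF frame_map_fib[OF F]] n by (simp add: norm_divide)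
    also have "frame_map G e p c = v" using frame_map_coords[OF F v] by (simp add: c_def)
    finally have "?f c0 * (norm c)\<^sup>2 \<le> q p v" using n by (simp add: power_divide pos_le_divide_eq)
    then show ?thesis using pos by (simp add: c_def pos_le_divide_eq mult.commute)
  qed
  then show ?thesis using pos by (intro exI[of _ "1 / ?f c0"]) simp
qed

lemma q_tendsto:
  assumes F: "(W, e) \<in> frames G" "p \<in> W" and f: "\<And>k. v k \<in> fib G p" "l \<in> fib G p" "w \<in> fib G p"
    and lim: "(\<lambda>k. coords G e p (v k)) \<longlonglongrightarrow> coords G e p l"
  shows "(\<lambda>k. q p (w - v k)) \<longlonglongrightarrow> q p (w - l)"
proof -
  have "(\<lambda>k. coords G e p (w - v k)) \<longlonglongrightarrow> coords G e p (w - l)"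
    unfolding coords_minus[OF F f(3) f(1)] coords_minus[OF F f(3) f(2)] by (intro tendsto_intros lim)
  then show ?thesis
    unfolding q_def herm_coords[OF F fib_minus[OF f(3) f(1)] fib_minus[OF f(3) f(1)]]
      herm_coords[OF F fib_minus[OF f(3) f(2)] fib_minus[OF f(3) f(2)]]
    by (intro tendsto_intros)
qed

lemma L2norm_sq: "u \<in> L2 G m \<Longrightarrow> (L2norm G m u)\<^sup>2 = (\<integral>z. q (snd z) (u z) \<partial>cone_measure G m)"
  using ip_self_nonneg[of u m] by (simp add: L2norm_def ip_self[symmetric])

lemma nn_integral_q: "u \<in> L2 G m \<Longrightarrow> (\<integral>\<^sup>+z. ennreal (q (snd z) (u z)) \<partial>cone_measure G m) = ennreal ((L2norm G m u)\<^sup>2)"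
  unfolding L2norm_sq by (rule nn_integral_eq_integral[OF L2D(2) AE_I2]) (auto intro: q_nonneg L2_fib)

text \<open>Riesz-Fischer: along a fast subsequence \<open>v\<close> the sum \<open>S\<close> of the squared fibre norms of
  \<open>v (k + 1) - v k\<close>, weighted with \<open>4 ^ k\<close>, is finite almost everywhere.\<close>

theorem L2_complete:
  assumes u: "\<And>n. u n \<in> L2 G m"
    and Cauchy: "\<And>\<epsilon>. \<epsilon> > 0 \<Longrightarrow> \<exists>N. \<forall>i\<ge>N. \<forall>j\<ge>N. L2norm G m (u i - u j) < \<epsilon>"
  shows "\<exists>l\<in>L2 G m. (\<lambda>n. L2norm G m (u n - l)) \<longlonglongrightarrow> 0"
proof -
  let ?M = "cone_measure G m"
  \<comment> \<open>The rate (1/4)^k is such that its square, multiplied by the weight 4^k, is still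
    summable.\<close>
  have "\<forall>k. \<exists>N. \<forall>i\<ge>N. \<forall>j\<ge>N. L2norm G m (u i - u j) < (1 / 4) ^ k" using Cauchy by simp
  from choice[OF this] obtain N where N: "\<And>k i j. i \<ge> N k \<Longrightarrow> j \<ge> N k \<Longrightarrow> L2norm G m (u i - u j) < (1 / 4) ^ k" by blast
  \<comment> \<open>The sum puts both \<open>r k\<close> and \<open>r (Suc k)\<close> beyond
    \<open>N k\<close>; the summand \<open>k\<close> sends the subsequence to infinity.\<close>
  define r where "r k = k + (\<Sum>i\<le>k. N i)" for k
  have rN: "r k \<ge> N k" "r (Suc k) \<ge> N k" "r k \<ge> k" for k
    using member_le_sum[of k "{..k}" N] by (auto simp: r_def)
  define v where "v k = u (r k)" for k
  define d where "d k = v (Suc k) - v k" for k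
  have vL: "v k \<in> L2 G m" and dL: "d k \<in> L2 G m" for k using u L2_minus by (auto simp: v_def d_def)
  define S where "S z = (\<Sum>k. ennreal (4 ^ k * q (snd z) (d k z)))" for z
  have qm [measurable]: "(\<lambda>z. q (snd z) (d k z)) \<in> borel_measurable ?M" for k by (rule q_measurable[OF L2D(1)[OF dL]])
  have Sm [measurable]: "S \<in> borel_measurable ?M" unfolding S_def by measurable
  have "(\<integral>\<^sup>+z. S z \<partial>?M) = (\<Sum>k. \<integral>\<^sup>+z. ennreal (4 ^ k * q (snd z) (d k z)) \<partial>?M)"
    unfolding S_def by (rule nn_integral_suminf) measurable
  also have "\<dots> \<le> (\<Sum>k. ennreal ((1 / 4) ^ k))"
  proof (rule suminf_le)
    fix k
    have "(\<integral>\<^sup>+z. ennreal (4 ^ k * q (snd z) (d k z)) \<partial>?M) = ennreal (4 ^ k) * (\<integral>\<^sup>+z. ennreal (q (snd z) (d k z)) \<partial>?M)"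
    proof -
      have "ennreal (4 ^ k * q (snd z) (d k z)) = ennreal (4 ^ k) * ennreal (q (snd z) (d k z))" if "z \<in> space ?M" for z
        by (rule ennreal_mult) (simp, rule q_nonneg[OF L2_fib[OF dL that]])
      then show ?thesis by (subst nn_integral_cmult[symmetric]) (simp, rule nn_integral_cong)
    qed
    also have "\<dots> = ennreal (4 ^ k * (L2norm G m (d k))\<^sup>2)" by (simp add: nn_integral_q[OF dL] ennreal_mult)
    also have "\<dots> \<le> ennreal ((1 / 4) ^ k)"
    proof (rule ennreal_leI)
      have "L2norm G m (d k) < (1 / 4) ^ k" unfolding d_def v_def by (rule N[OF rN(2,1)])
      moreover have "0 \<le> L2norm G m (d k)" using ip_self_nonneg[OF dL] by (simp add: L2norm_def)
      ultimately have "(L2norm G m (d k))\<^sup>2 \<le> ((1 / 4) ^ k)\<^sup>2" by (intro power_mono) auto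
      then have "4 ^ k * (L2norm G m (d k))\<^sup>2 \<le> 4 ^ k * ((1 / 4) ^ k)\<^sup>2" by (intro mult_left_mono) auto
      also have "\<dots> = (1 / 4) ^ k" by (simp add: power2_eq_square power_one_over)
      finally show "4 ^ k * (L2norm G m (d k))\<^sup>2 \<le> (1 / 4) ^ k" .
    qed
    finally show "(\<integral>\<^sup>+z. ennreal (4 ^ k * q (snd z) (d k z)) \<partial>?M) \<le> ennreal ((1 / 4) ^ k)" .
  qed auto
  also have "\<dots> = ennreal (\<Sum>k. (1 / 4) ^ k)"
    by (rule suminf_ennreal2) (auto intro: summable_geometric)
  also have "\<dots> < \<infinity>" by simp
  finally have "(\<integral>\<^sup>+z. S z \<partial>?M) \<noteq> \<infinity>" by simp
  from nn_integral_PInf_AE[OF Sm this] have AE_S: "AE z in ?M. S z < \<infinity>"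
    by eventually_elim (simp add: less_top)
  \<comment> \<open>Where \<open>S\<close> is finite, the weight 4^k forces the increments of the
    coordinates to decay like 2^(-k), so the telescoping series converges absolutely.\<close>
  have conv: "convergent (\<lambda>k. coords G e (snd z) (v k z))"
    if z: "z \<in> space ?M" "S z < \<infinity>" and F: "(W, e) \<in> frames G" "snd z \<in> W" for z W e
  proof -
    define c where "c k = coords G e (snd z) (d k z)" for k
    note fv = L2_fib[OF vL z(1)] and fd = L2_fib[OF dL z(1)]
    have v: "coords G e (snd z) (v k z) = coords G e (snd z) (v 0 z) + (\<Sum>i<k. c i)" for k
    proof (induction k)
      case (Suc k)
      have "v (Suc k) z = v k z + d k z" by (simp add: d_def)
      then have "coords G e (snd z) (v (Suc k) z) = coords G e (snd z) (v k z) + c k"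
        using coords_add[OF F fv fd] by (simp add: c_def)
      with Suc show ?case by simp
    qed simp
    obtain k0 where k0: "k0 > 0" "\<forall>v\<in>fib G (snd z). (norm (coords G e (snd z) v))\<^sup>2 \<le> k0 * q (snd z) v"
      using norm_coords_le[OF F] by blast
    define B where "B = enn2real (S z)"
    have "q (snd z) (d k z) \<le> B / 4 ^ k" for k
    proof -
      have "ennreal (4 ^ k * q (snd z) (d k z)) \<le> S z"
        unfolding S_def using sum_le_suminf[of "\<lambda>k. ennreal (4 ^ k * q (snd z) (d k z))" "{k}"] by simp
      then have "4 ^ k * q (snd z) (d k z) \<le> B"
        unfolding B_def using z(2) q_nonneg[OF fd] by (metis enn2real_ennreal enn2real_mono infinity_ennreal_def mult_nonneg_nonneg zero_le_numeral zero_le_power)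
      then show ?thesis by (simp add: pos_le_divide_eq mult.commute)
    qed
    then have "(norm (c k))\<^sup>2 \<le> k0 * (B / 4 ^ k)" for k
      using k0 fd unfolding c_def by (meson mult_left_mono order_trans less_imp_le)
    then have "norm (c k) \<le> sqrt (k0 * (B / 4 ^ k))" for k by (simp add: real_le_rsqrt)
    also have "sqrt (k0 * (B / 4 ^ k)) = sqrt (k0 * B) * (1 / 2) ^ k" for k
    proof -
      have "sqrt ((4::real) ^ k) = 2 ^ k" by (simp add: real_sqrt_power)
      then show ?thesis by (simp add: real_sqrt_mult real_sqrt_divide power_one_over)
    qed
    finally have "norm (c k) \<le> sqrt (k0 * B) * (1 / 2) ^ k" for k .
    then have "summable c"
      by (intro summable_norm_cancel[OF summable_comparison_test'[OF summable_mult[OF summable_geometric], of "1 / 2" 0 "\<lambda>k. norm (c k)" "sqrt (k0 * B)"]]) auto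
    then have "(\<lambda>k. coords G e (snd z) (v 0 z) + (\<Sum>i<k. c i)) \<longlonglongrightarrow> coords G e (snd z) (v 0 z) + suminf c"
      by (intro tendsto_intros summable_LIMSEQ)
    then have "(\<lambda>k. coords G e (snd z) (v k z)) \<longlonglongrightarrow> coords G e (snd z) (v 0 z) + suminf c"
      by (simp only: v[symmetric])
    then show ?thesis by (rule convergentI)
  qed
  \<comment> \<open>The limit is formed in one frame chosen at each point. The fact
    \<open>lim\<close> below shows that every other frame yields the same limit, which measurability
    in a fixed frame requires.\<close>
  define E where "E p = (SOME F. F \<in> frames G \<and> p \<in> fst F)" for p
  have E: "(fst (E p), snd (E p)) \<in> frames G" "p \<in> fst (E p)" for p
  proof -
    have "\<exists>F. F \<in> frames G \<and> p \<in> fst F" using frames_cover[of p] by auto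
    from someI_ex[OF this] show "(fst (E p), snd (E p)) \<in> frames G" "p \<in> fst (E p)" by (simp_all add: E_def)
  qed
  define l where "l z = (if z \<in> space ?M \<and> S z < \<infinity>
    then frame_map G (snd (E (snd z))) (snd z) (lim (\<lambda>k. coords G (snd (E (snd z))) (snd z) (v k z))) else 0)" for z
  have lfib: "l z \<in> fib G (snd z)" for z
    using frame_map_fib[OF E] fib_zero by (simp add: l_def)
  have lim: "(\<lambda>k. coords G e (snd z) (v k z)) \<longlonglongrightarrow> coords G e (snd z) (l z)"
    if z: "z \<in> space ?M" "S z < \<infinity>" and F: "(W, e) \<in> frames G" "snd z \<in> W" for z W e
  proof -
    let ?e = "snd (E (snd z))"
    let ?c = "\<lambda>k. coords G ?e (snd z) (v k z)"
    have c: "?c \<longlonglongrightarrow> lim ?c" using conv[OF z E] by (simp add: convergent_LIMSEQ_iff)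
    have "coords G e (snd z) (v k z) = (\<Sum>j\<in>UNIV. ?c k $ j *s coords G e (snd z) (?e j (snd z)))" for k
      using coords_frame_change[OF E(1) F(1) E(2) F(2), of "?c k"] frame_map_coords[OF E L2_fib[OF vL z(1)]] by simp
    moreover have "coords G e (snd z) (l z) = (\<Sum>j\<in>UNIV. lim ?c $ j *s coords G e (snd z) (?e j (snd z)))"
      using coords_frame_change[OF E(1) F(1) E(2) F(2), of "lim ?c"] z by (simp add: l_def)
    moreover have "(\<lambda>k. \<Sum>j\<in>UNIV. ?c k $ j *s coords G e (snd z) (?e j (snd z)))
        \<longlonglongrightarrow> (\<Sum>j\<in>UNIV. lim ?c $ j *s coords G e (snd z) (?e j (snd z)))"
      by (intro tendsto_sum bounded_bilinear.tendsto[OF bounded_bilinear_smult] tendsto_vec_nth c tendsto_const)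
    ultimately show ?thesis by simp
  qed
  have lm: "msec m l"
  proof (rule msecI[OF lfib])
    fix W e assume F: "(W, e) \<in> frames G"
    let ?R = "restrict_space ?M (cpart W)"
    have SmR [measurable]: "S \<in> borel_measurable ?R" by (rule measurable_restrict_space1[OF Sm])
    note [measurable] = msecD(2)[OF L2D(1)[OF vL] F]
    show "(\<lambda>z. coords G e (snd z) (l z)) \<in> borel_measurable ?R"
    proof (rule borel_measurable_LIMSEQ_metric)
      show "(\<lambda>z. if S z < \<infinity> then coords G e (snd z) (v k z) else 0) \<in> borel_measurable ?R" for k by measurable
      fix z assume "z \<in> space ?R"
      then have z: "z \<in> space ?M" "snd z \<in> W" by (simp_all add: space_cpart)
      show "(\<lambda>k. if S z < \<infinity> then coords G e (snd z) (v k z) else 0) \<longlonglongrightarrow> coords G e (snd z) (l z)"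
        using lim[OF z(1) _ F z(2)] coords_zero[OF F z(2)] by (cases "S z < \<infinity>") (simp_all add: l_def)
    qed
  qed
  have uv: "msec m (u i - l)" for i
    using msec_add[OF L2D(1)[OF u] msec_sscl[OF lm, of "-1"], of i] by (simp add: sscl_simps)
  \<comment> \<open>With \<open>i\<close> fixed and the second index running along the subsequence,
    Fatou's lemma turns the Cauchy condition into a bound for \<open>u i - l\<close>; the same bound
    makes \<open>l\<close> square integrable.\<close>
  have Fatou: "(\<integral>\<^sup>+z. ennreal (q (snd z) ((u i - l) z)) \<partial>?M) \<le> ennreal (\<epsilon>\<^sup>2)"
    if N: "\<And>j. j \<ge> n \<Longrightarrow> L2norm G m (u i - u j) < \<epsilon>" for i n \<epsilon>
  proof -
    have "AE z in ?M. (\<lambda>k. ennreal (q (snd z) ((u i - v k) z))) \<longlonglongrightarrow> ennreal (q (snd z) ((u i - l) z))"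
      using AE_S AE_space
    proof eventually_elim
      fix z assume z: "S z < \<infinity>" "z \<in> space ?M"
      have "(\<lambda>k. q (snd z) (u i z - v k z)) \<longlonglongrightarrow> q (snd z) (u i z - l z)"
        by (rule q_tendsto[OF E L2_fib[OF vL z(2)] lfib L2_fib[OF u z(2)] lim[OF z(2,1) E]])
      then show "(\<lambda>k. ennreal (q (snd z) ((u i - v k) z))) \<longlonglongrightarrow> ennreal (q (snd z) ((u i - l) z))"
        by (intro tendsto_ennrealI) simp
    qed
    then have "AE z in ?M. ennreal (q (snd z) ((u i - l) z)) = liminf (\<lambda>k. ennreal (q (snd z) ((u i - v k) z)))"
      by eventually_elim (rule lim_imp_Liminf[symmetric], simp_all)
    then have "(\<integral>\<^sup>+z. ennreal (q (snd z) ((u i - l) z)) \<partial>?M) = (\<integral>\<^sup>+z. liminf (\<lambda>k. ennreal (q (snd z) ((u i - v k) z))) \<partial>?M)"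
      by (rule nn_integral_cong_AE)
    also have "\<dots> \<le> liminf (\<lambda>k. \<integral>\<^sup>+z. ennreal (q (snd z) ((u i - v k) z)) \<partial>?M)"
      using q_measurable[OF L2D(1)[OF L2_minus[OF u vL]]] by (intro nn_integral_liminf) measurable
    also have "\<dots> \<le> liminf (\<lambda>k. ennreal (\<epsilon>\<^sup>2))"
    proof (rule Liminf_mono)
      have "(\<integral>\<^sup>+z. ennreal (q (snd z) ((u i - v k) z)) \<partial>?M) \<le> ennreal (\<epsilon>\<^sup>2)" if "k \<ge> n" for k
      proof -
        have "L2norm G m (u i - v k) < \<epsilon>" unfolding v_def by (rule N) (use rN(3)[of k] that in linarith)
        moreover have "0 \<le> L2norm G m (u i - v k)" using ip_self_nonneg[OF L2_minus[OF u vL]] by (simp add: L2norm_def)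
        ultimately have "(L2norm G m (u i - v k))\<^sup>2 \<le> \<epsilon>\<^sup>2" by (intro power_mono) auto
        then show ?thesis unfolding nn_integral_q[OF L2_minus[OF u vL]] by (rule ennreal_leI)
      qed
      then show "\<forall>\<^sub>F k in sequentially. (\<integral>\<^sup>+z. ennreal (q (snd z) ((u i - v k) z)) \<partial>?M) \<le> ennreal (\<epsilon>\<^sup>2)"
        unfolding eventually_sequentially by blast
    qed
    also have "\<dots> = ennreal (\<epsilon>\<^sup>2)" by (simp add: Liminf_const)
    finally show ?thesis .
  qed
  have uL: "u i - l \<in> L2 G m \<and> L2norm G m (u i - l) \<le> \<epsilon>"
    if N: "\<And>j. j \<ge> n \<Longrightarrow> L2norm G m (u i - u j) < \<epsilon>" for i n \<epsilon>
  proof -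
    have "integrable ?M (\<lambda>z. q (snd z) ((u i - l) z))"
    proof (rule integrableI_nonneg[OF q_measurable[OF uv]])
      show "AE z in ?M. 0 \<le> q (snd z) ((u i - l) z)" by (intro AE_I2 q_nonneg msecD(1)[OF uv])
      show "(\<integral>\<^sup>+z. ennreal (q (snd z) ((u i - l) z)) \<partial>?M) < \<infinity>"
        using Fatou[OF N] by (rule le_less_trans) simp_all
    qed
    then have L: "u i - l \<in> L2 G m" using uv by (simp add: L2_iff)
    have "0 \<le> L2norm G m (u i - u n)" using ip_self_nonneg[OF L2_minus[OF u u]] by (simp add: L2norm_def)
    then have \<epsilon>: "\<epsilon> > 0" using N[of n] by linarith
    have "ennreal ((L2norm G m (u i - l))\<^sup>2) \<le> ennreal (\<epsilon>\<^sup>2)"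
      using Fatou[OF N] unfolding nn_integral_q[OF L] by simp
    then have "(L2norm G m (u i - l))\<^sup>2 \<le> \<epsilon>\<^sup>2" by simp
    then have "L2norm G m (u i - l) \<le> \<epsilon>" by (rule power2_le_imp_le) (use \<epsilon> in simp)
    with L show ?thesis by blast
  qed
  obtain N1 where N1: "\<forall>i\<ge>N1. \<forall>j\<ge>N1. L2norm G m (u i - u j) < 1" using Cauchy[of 1] by auto
  have "u N1 - l \<in> L2 G m" using uL[of N1 N1 1] N1 by blast
  from L2_minus[OF u this, of N1] have lL: "l \<in> L2 G m" by simp
  have "(\<lambda>n. L2norm G m (u n - l)) \<longlonglongrightarrow> 0"
  proof (rule LIMSEQ_I)
    fix \<epsilon> :: real assume "\<epsilon> > 0"
    then obtain N where N: "\<forall>i\<ge>N. \<forall>j\<ge>N. L2norm G m (u i - u j) < \<epsilon> / 2" using Cauchy[of "\<epsilon> / 2"] by auto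
    have "norm (L2norm G m (u i - l) - 0) < \<epsilon>" if "i \<ge> N" for i
    proof -
      have "L2norm G m (u i - l) \<le> \<epsilon> / 2" using uL[of N i "\<epsilon> / 2"] N that by blast
      moreover have "0 \<le> L2norm G m (u i - l)" using ip_self_nonneg[OF L2_minus[OF u lL]] by (simp add: L2norm_def)
      ultimately show ?thesis using \<open>\<epsilon> > 0\<close> by simp
    qed
    then show "\<exists>no. \<forall>n\<ge>no. norm (L2norm G m (u n - l) - 0) < \<epsilon>" by blast
  qed
  with lL show ?thesis by blast
qed

end

lemma finite_multiindices: "finite {\<alpha> :: 'n::finite \<Rightarrow> nat. sum \<alpha> UNIV \<le> m}"
proof -
  have "{\<alpha> :: 'n \<Rightarrow> nat. sum \<alpha> UNIV \<le> m} \<subseteq> (\<Pi>\<^sub>E i\<in>UNIV. {..m})"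
  proof
    fix \<alpha> :: "'n \<Rightarrow> nat" assume "\<alpha> \<in> {\<alpha>. sum \<alpha> UNIV \<le> m}"
    then have "\<alpha> i \<le> m" for i using member_le_sum[of i UNIV \<alpha>] by (simp add: order_trans)
    then show "\<alpha> \<in> (\<Pi>\<^sub>E i\<in>UNIV. {..m})" by auto
  qed
  moreover have "finite (\<Pi>\<^sub>E i\<in>(UNIV :: 'n set). {..m})" by (intro finite_PiE) auto
  ultimately show ?thesis by (rule finite_subset)
qed

lemma smooth_on_det:
  fixes M :: "'c::real_normed_vector \<Rightarrow> 'r::finite cmat"
  assumes "\<And>i j. smooth_on S (\<lambda>v. M v $ i $ j)"
  shows "smooth_on S (\<lambda>v. det (M v))"
  unfolding det_def by (intro smooth_on_sum smooth_on_mult smooth_on_const smooth_on_prod assms)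

text \<open>Cramer's rule: the determinants are polynomials in smooth entries, and the one in the
  denominator is nonzero by injectivity.\<close>

lemma smooth_linear_solve:
  fixes M :: "'c::real_normed_vector \<Rightarrow> 'r::finite cmat" and b :: "'c \<Rightarrow> 'r cvec"
  assumes M: "\<And>i j. smooth_on S (\<lambda>v. M v $ i $ j)" and b: "smooth_on S b"
    and inj: "\<And>v x. v \<in> S \<Longrightarrow> M v *v x = 0 \<Longrightarrow> x = 0"
  shows "\<exists>x. smooth_on S x \<and> (\<forall>v\<in>S. M v *v x v = b v)"
proof (intro exI conjI ballI)
  let ?x = "\<lambda>v. \<chi> k. det (\<chi> i j. if j = k then b v $ i else M v $ i $ j) / det (M v)"
  have d: "det (M v) \<noteq> 0" if "v \<in> S" for v
  proof -
    have "\<exists>B. B ** M v = mat 1" using matrix_left_invertible_ker[of "M v"] inj[OF that] by blast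
    then show ?thesis using invertible_det_nz invertible_left_inverse by blast
  qed
  show "smooth_on S ?x"
  proof (rule smooth_on_vecI)
    fix k
    have "smooth_on S (\<lambda>v. det (\<chi> i j. if j = k then b v $ i else M v $ i $ j) * inverse (det (M v)))"
    proof (intro smooth_on_mult smooth_on_det smooth_on_inverse d M)
      show "smooth_on S (\<lambda>v. (\<chi> i j. if j = k then b v $ i else M v $ i $ j) $ i $ j)" for i j
        using M smooth_on_nth[OF b] by (cases "j = k") simp_all
    qed
    then show "smooth_on S (\<lambda>v. ?x v $ k)" by (simp add: divide_inverse)
  qed
  show "M v *v ?x v = b v" if "v \<in> S" for v
    using cramer[OF d[OF that], of "?x v" "b v"] by blast
qed

context cone_geom
begin

interpretation vs: vector_space "scl G" by (rule vs)

lemma cdom_bd: "(U, \<phi>) \<in> charts G \<Longrightarrow> cdom U \<phi> (U \<inter> W \<inter> bd G) = cdom U \<phi> W"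
  by (simp add: cdom_eq[symmetric]) (rule arg_cong[where f = "image (cyl \<phi>)"], auto)

lemma chart_part_borel: "(U, \<phi>) \<in> charts G \<Longrightarrow> (W, e) \<in> frames G \<Longrightarrow> U \<inter> W \<inter> bd G \<in> sets borel"
  by (intro sets.Int bd_borel borel_open chartD(1) frameD(1))

section \<open>Integrals and null sets on the cone, computed in a chart\<close>

lemma vertical_indicator_measurable:
  assumes B: "B \<in> sets (densY G)"
  shows "indicat_real (UNIV \<times> B) \<in> borel_measurable (cone_measure G m)"
    and "(indicator (UNIV \<times> B) :: _ \<Rightarrow> ennreal) \<in> borel_measurable (cone_measure G m)"
proof -
  have "(\<lambda>z. indicat_real B (snd z)) \<in> borel_measurable (rad m \<Otimes>\<^sub>M densY G)"
    "(\<lambda>z. indicator B (snd z) :: ennreal) \<in> borel_measurable (rad m \<Otimes>\<^sub>M densY G)"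
    by (rule measurable_compose[OF measurable_snd], use B in simp)+
  moreover have "indicat_real (UNIV \<times> B) = (\<lambda>z :: real \<times> 'a. indicat_real B (snd z))"
    "(indicator (UNIV \<times> B) :: real \<times> 'a \<Rightarrow> ennreal) = (\<lambda>z. indicator B (snd z))"
    by (auto simp: indicator_def fun_eq_iff)
  ultimately show "indicat_real (UNIV \<times> B) \<in> borel_measurable (cone_measure G m)"
    "(indicator (UNIV \<times> B) :: _ \<Rightarrow> ennreal) \<in> borel_measurable (cone_measure G m)"
    by (simp_all add: cone_measure_eq)
qed

lemma integral_chart:
  fixes f :: "real \<times> 'a \<Rightarrow> complex"
  assumes C: "(U, \<phi>) \<in> charts G" and \<rho>: "chart_dens U \<phi> \<rho>" and B: "B \<in> sets borel" "B \<subseteq> U \<inter> bd G"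
    and f: "f \<in> borel_measurable (cone_measure G m)" and zero: "\<And>z. z \<in> space (cone_measure G m) \<Longrightarrow> snd z \<notin> B \<Longrightarrow> f z = 0"
  shows "(\<integral>z. f z \<partial>cone_measure G m) = (\<integral>v. chart_wt m \<phi> \<rho> B v *\<^sub>R f (chart_map U \<phi> B v) \<partial>lborel)"
proof -
  let ?M = "cone_measure G m"
  have im: "indicat_real (UNIV \<times> B) \<in> borel_measurable ?M"
    by (rule vertical_indicator_measurable) (use B in \<open>simp add: sets_densY\<close>)
  have "(\<integral>z. f z \<partial>?M) = (\<integral>z. indicat_real (UNIV \<times> B) z *\<^sub>R f z \<partial>?M)"
  proof (rule Bochner_Integration.integral_cong[OF refl])
    fix z assume z: "z \<in> space ?M"
    show "f z = indicat_real (UNIV \<times> B) z *\<^sub>R f z"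
    proof (cases "snd z \<in> B")
      case True
      then have "z \<in> UNIV \<times> B" by (cases z) simp
      then show ?thesis by simp
    next
      case False
      then show ?thesis using zero[OF z] by simp
    qed
  qed
  also have "\<dots> = (\<integral>z. f z \<partial>density ?M (\<lambda>z. ennreal (indicat_real (UNIV \<times> B) z)))"
    by (rule integral_density[OF f im, symmetric]) simp
  also have "(\<lambda>z. ennreal (indicat_real (UNIV \<times> B) z)) = (indicator (UNIV \<times> B) :: real \<times> 'a \<Rightarrow> ennreal)"
    by (auto simp: indicator_def)
  also have "density ?M (indicator (UNIV \<times> B)) = distr (density lborel (\<lambda>v. ennreal (chart_wt m \<phi> \<rho> B v))) ?M (chart_map U \<phi> B)"
    by (rule chart_measure[OF C \<rho> B])
  also have "(\<integral>z. f z \<partial>\<dots>) = (\<integral>v. f (chart_map U \<phi> B v) \<partial>density lborel (\<lambda>v. ennreal (chart_wt m \<phi> \<rho> B v)))"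
    by (rule integral_distr) (use chart_map_measurable[OF C B] f in simp_all)
  also have "\<dots> = (\<integral>v. chart_wt m \<phi> \<rho> B v *\<^sub>R f (chart_map U \<phi> B v) \<partial>lborel)"
    using chart_wt_measurable[OF C \<rho> B] chart_wt_nonneg[OF \<rho> B(2)] measurable_compose[OF chart_map_measurable[OF C B] f]
    by (intro integral_density) simp_all
  finally show ?thesis .
qed

lemma integrable_chart:
  fixes f :: "real \<times> 'a \<Rightarrow> real"
  assumes C: "(U, \<phi>) \<in> charts G" and \<rho>: "chart_dens U \<phi> \<rho>" and B: "B \<in> sets borel" "B \<subseteq> U \<inter> bd G"
    and f: "integrable (cone_measure G m) f"
  shows "integrable lborel (\<lambda>v. chart_wt m \<phi> \<rho> B v * f (chart_map U \<phi> B v))"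
proof -
  let ?M = "cone_measure G m"
  have fm: "f \<in> borel_measurable ?M" using f by simp
  have im: "indicat_real (UNIV \<times> B) \<in> borel_measurable ?M"
    by (rule vertical_indicator_measurable) (use B in \<open>simp add: sets_densY\<close>)
  have "integrable ?M (\<lambda>z. indicat_real (UNIV \<times> B) z *\<^sub>R f z)"
    by (rule Bochner_Integration.integrable_bound[OF f borel_measurable_scaleR[OF im fm]]) (simp add: indicator_def)
  then have "integrable (density ?M (\<lambda>z. ennreal (indicat_real (UNIV \<times> B) z))) f"
    by (subst integrable_density[OF fm im]) simp_all
  also have "(\<lambda>z. ennreal (indicat_real (UNIV \<times> B) z)) = (indicator (UNIV \<times> B) :: real \<times> 'a \<Rightarrow> ennreal)"
    by (auto simp: indicator_def)
  also have "density ?M (indicator (UNIV \<times> B)) = distr (density lborel (\<lambda>v. ennreal (chart_wt m \<phi> \<rho> B v))) ?M (chart_map U \<phi> B)"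
    by (rule chart_measure[OF C \<rho> B])
  finally have "integrable (density lborel (\<lambda>v. ennreal (chart_wt m \<phi> \<rho> B v))) (\<lambda>v. f (chart_map U \<phi> B v))"
    by (rule integrable_distr[rotated]) (use chart_map_measurable[OF C B] in simp)
  then show ?thesis
    using chart_wt_measurable[OF C \<rho> B] chart_wt_nonneg[OF \<rho> B(2)] measurable_compose[OF chart_map_measurable[OF C B] fm]
    by (subst (asm) integrable_density) simp_all
qed

text \<open>\<open>chart_measure\<close> presents the cone measure over \<open>B\<close> as the
  image of a measure with a density, so a null set in coordinates is mapped to a null set.\<close>

lemma AE_chart:
  assumes C: "(U, \<phi>) \<in> charts G" and \<rho>: "chart_dens U \<phi> \<rho>" and B: "B \<in> sets borel" "B \<subseteq> U \<inter> bd G"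
    and f: "f \<in> borel_measurable (cone_measure G m)"
    and zero: "AE v in lborel. v \<in> cdom U \<phi> B \<longrightarrow> (f (cyl_inv G U \<phi> v) :: complex) = 0"
  shows "AE z in cone_measure G m. snd z \<in> B \<longrightarrow> f z = 0"
proof -
  let ?M = "cone_measure G m"
  let ?W = "density lborel (\<lambda>v. ennreal (chart_wt m \<phi> \<rho> B v))"
  have wm: "(\<lambda>v. ennreal (chart_wt m \<phi> \<rho> B v)) \<in> borel_measurable lborel"
    using chart_wt_measurable[OF C \<rho> B] by simp
  have BU: "B \<subseteq> U" using B(2) by blast
  have "AE v in lborel. 0 < ennreal (chart_wt m \<phi> \<rho> B v) \<longrightarrow> f (chart_map U \<phi> B v) = 0"
    using zero
  proof eventually_elim
    fix v assume v: "v \<in> cdom U \<phi> B \<longrightarrow> f (cyl_inv G U \<phi> v) = 0"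
    show "0 < ennreal (chart_wt m \<phi> \<rho> B v) \<longrightarrow> f (chart_map U \<phi> B v) = 0"
      using v chart_wt_outside[OF BU, of v \<phi> m \<rho>] chart_map_cdom[OF C, of v B] by (cases "v \<in> cdom U \<phi> B") simp_all
  qed
  then have "AE v in ?W. f (chart_map U \<phi> B v) = 0" by (subst AE_density[OF wm])
  moreover have "chart_map U \<phi> B \<in> measurable ?W ?M" using chart_map_measurable[OF C B] by simp
  moreover have "{z \<in> space ?M. f z = 0} \<in> sets ?M" using f by measurable
  ultimately have "AE z in distr ?W ?M (chart_map U \<phi> B). f z = 0"
    by (subst AE_distr_iff)
  then have "AE z in density ?M (indicator (UNIV \<times> B)). f z = 0"
    by (simp only: chart_measure[OF C \<rho> B])
  moreover have "(indicator (UNIV \<times> B) :: real \<times> 'a \<Rightarrow> ennreal) \<in> borel_measurable ?M"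
    by (rule vertical_indicator_measurable) (use B in \<open>simp add: sets_densY\<close>)
  ultimately have "AE z in ?M. 0 < (indicator (UNIV \<times> B) z :: ennreal) \<longrightarrow> f z = 0"
    by (subst (asm) AE_density)
  then show ?thesis by eventually_elim (auto simp: indicator_def)
qed

subsection \<open>The inner product with a section supported in a chart\<close>

text \<open>The Gram matrix of the frame times the density of the cone measure in coordinates. With
  it the Hermitian inner product on the cone becomes an integral of the bilinear \<open>pair\<close>
  against Lebesgue measure.\<close>

definition hloc :: "nat \<Rightarrow> 'a set \<Rightarrow> ('a \<Rightarrow> 'n pt) \<Rightarrow> ('n pt \<Rightarrow> real) \<Rightarrow> ('r \<Rightarrow> 'a \<Rightarrow> 'f) \<Rightarrow> 'n pt \<Rightarrow> 'r cmat" where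
  "hloc m U \<phi> \<rho> e v = (\<chi> j k. of_real (\<rho> (base_pt v) * (v $ xi ^ m * (1 / v $ xi))) *
     herm G (snd (cyl_inv G U \<phi> v)) (e j (snd (cyl_inv G U \<phi> v))) (e k (snd (cyl_inv G U \<phi> v))))"

definition cnjv :: "'r cvec \<Rightarrow> 'r cvec" where
  "cnjv x = (\<chi> k. cnj (x $ k))"

lemma wt_smooth:
  assumes C: "(U, \<phi>) \<in> charts G" and \<rho>: "chart_dens U \<phi> \<rho>"
  shows "smooth_on (cdom U \<phi> W) (\<lambda>v. \<rho> (base_pt v) * (v $ xi ^ m * (1 / v $ xi)))"
proof -
  have "smooth_on (cdom U \<phi> W) (\<lambda>v. \<rho> (base_pt v))"
    by (rule smooth_on_compose[OF chart_densD(1)[OF \<rho>] smooth_on_linear[OF bounded_linear_base_pt]])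
      (auto elim!: cdomE[OF C])
  moreover have x: "smooth_on (cdom U \<phi> W) (\<lambda>v. v $ xi)" by (intro smooth_on_linear bounded_linear_vec_nth)
  moreover have "smooth_on (cdom U \<phi> W) (\<lambda>v. inverse (v $ xi))"
    by (rule smooth_on_inverse[OF x]) (simp add: cdom_def)
  ultimately have "smooth_on (cdom U \<phi> W) (\<lambda>v. \<rho> (base_pt v) * (v $ xi ^ m * inverse (v $ xi)))"
    by (intro smooth_on_mult smooth_on_power)
  then show ?thesis by (simp add: divide_inverse)
qed

lemma hloc_smooth:
  assumes C: "(U, \<phi>) \<in> charts G" and \<rho>: "chart_dens U \<phi> \<rho>" and F: "(W, e) \<in> frames G"
  shows "smooth_on (cdom U \<phi> W) (\<lambda>v. hloc m U \<phi> \<rho> e v $ j $ k)"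
  unfolding hloc_def vec_lambda_beta
  by (intro smooth_on_mult smooth_on_of_real wt_smooth[OF C \<rho>] smooth_fun_cdom[OF C frame_herm_smooth[OF F]])

lemma wt_pos:
  assumes C: "(U, \<phi>) \<in> charts G" and \<rho>: "chart_dens U \<phi> \<rho>" and v: "v \<in> cdom U \<phi> W"
  shows "\<rho> (base_pt v) * (v $ xi ^ m * (1 / v $ xi)) > 0"
proof -
  from v obtain t y where y: "t > 0" "y \<in> U" "y \<in> bd G" "base_pt v = \<phi> y" "v $ xi = t" by (elim cdomE[OF C])
  then have "\<rho> (\<phi> y) > 0" using chart_densD(2)[OF \<rho>] by blast
  then show ?thesis using y by simp
qed

lemma chart_wt_cdom:
  assumes C: "(U, \<phi>) \<in> charts G" and v: "v \<in> cdom U \<phi> W"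
  shows "chart_wt m \<phi> \<rho> (U \<inter> W \<inter> bd G) v = \<rho> (base_pt v) * (v $ xi ^ m * (1 / v $ xi))"
proof -
  from v obtain t y where y: "t > 0" "y \<in> U" "y \<in> W" "y \<in> bd G" "base_pt v = \<phi> y" "v $ xi = t" by (elim cdomE[OF C])
  then have "base_pt v \<in> \<phi> ` (U \<inter> W \<inter> bd G)" by blast
  then show ?thesis using y by (simp add: chart_wt_def hdens_def)
qed

lemma pair_hloc:
  assumes C: "(U, \<phi>) \<in> charts G" and F: "(W, e) \<in> frames G" and v: "v \<in> cdom U \<phi> W"
  shows "pair c (hloc m U \<phi> \<rho> e v *v cnjv d) = of_real (\<rho> (base_pt v) * (v $ xi ^ m * (1 / v $ xi))) *
    herm G (snd (cyl_inv G U \<phi> v)) (frame_map G e (snd (cyl_inv G U \<phi> v)) c) (frame_map G e (snd (cyl_inv G U \<phi> v)) d)"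
proof -
  have p: "snd (cyl_inv G U \<phi> v) \<in> W" using v by (auto elim!: cdomE[OF C])
  show ?thesis
    unfolding herm_frame[OF F p] pair_def matrix_vector_mult_def hloc_def cnjv_def vec_lambda_beta sum_distrib_left
    by (intro sum.cong refl) (simp only: mult_ac)
qed

text \<open>The Gram matrix is positive definite: pairing its product with \<open>x\<close> against
  the conjugate of \<open>x\<close> gives a positive multiple of the squared norm of a combination
  of the frame.\<close>

lemma hloc_injective:
  assumes C: "(U, \<phi>) \<in> charts G" and \<rho>: "chart_dens U \<phi> \<rho>" and F: "(W, e) \<in> frames G" and v: "v \<in> cdom U \<phi> W"
    and zero: "hloc m U \<phi> \<rho> e v *v x = 0"
  shows "x = 0"
proof -
  define p where "p = snd (cyl_inv G U \<phi> v)"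
  have p: "p \<in> W" using v by (auto simp: p_def elim!: cdomE[OF C])
  have x: "x = cnjv (cnjv x)" by (simp add: cnjv_def vec_eq_iff)
  have "pair (cnjv x) (hloc m U \<phi> \<rho> e v *v x) = 0" by (simp add: zero)
  then have "of_real (\<rho> (base_pt v) * (v $ xi ^ m * (1 / v $ xi))) * herm G p (frame_map G e p (cnjv x)) (frame_map G e p (cnjv x)) = 0"
    using pair_hloc[OF C F v, of "cnjv x" m \<rho> "cnjv x"] by (simp only: x[symmetric] p_def)
  moreover have "complex_of_real (\<rho> (base_pt v) * (v $ xi ^ m * (1 / v $ xi))) \<noteq> 0"
    using wt_pos[OF C \<rho> v, of m] by (simp only: of_real_eq_0_iff)
  ultimately have "q p (frame_map G e p (cnjv x)) = 0" by (simp add: q_def)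
  then have "frame_map G e p (cnjv x) = 0" using q_zero_iff[OF frame_map_fib[OF F p]] by simp
  then have "cnjv x = 0" using coords_frame_map[OF F p, of "cnjv x"] coords_zero[OF F p] by simp
  then show ?thesis by (simp add: cnjv_def vec_eq_iff)
qed

lemma smooth_on_cnjv: "smooth_on S h \<Longrightarrow> smooth_on S (\<lambda>v. cnjv (h v))"
  by (rule smooth_on_vecI) (simp add: cnjv_def smooth_on_cnj smooth_on_nth)

lemma hloc_cpt:
  assumes C: "(U, \<phi>) \<in> charts G" and \<rho>: "chart_dens U \<phi> \<rho>" and F: "(W, e) \<in> frames G"
    and h: "cpt_smooth (cdom U \<phi> W) h"
  shows "cpt_smooth (cdom U \<phi> W) (\<lambda>v. hloc m U \<phi> \<rho> e v *v cnjv (h v))"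
proof (rule cpt_smooth_matrix_vector[OF open_cdom[OF C frameD(1)[OF F]]])
  show "smooth_on (cdom U \<phi> W) (hloc m U \<phi> \<rho> e)" by (intro smooth_on_vecI hloc_smooth[OF C \<rho> F])
  show "cpt_smooth (cdom U \<phi> W) (\<lambda>v. cnjv (h v))"
    using h smooth_on_cnjv[of UNIV h] unfolding cpt_smooth_def by (auto simp: cnjv_def zero_vec_def)
qed

lemma ip_sect:
  assumes C: "(U, \<phi>) \<in> charts G" and \<rho>: "chart_dens U \<phi> \<rho>" and F: "(W, e) \<in> frames G"
    and h: "cpt_smooth (cdom U \<phi> W) h" and u: "msec m u"
  shows "ip G m u (sect U \<phi> W e h) = (\<integral>v. pair (cyl_rep G (U, \<phi>) e u v) (hloc m U \<phi> \<rho> e v *v cnjv (h v)) \<partial>lborel)"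
proof -
  let ?B = "U \<inter> W \<inter> bd G"
  have B: "?B \<in> sets borel" "?B \<subseteq> U \<inter> bd G" using chart_part_borel[OF C F] by auto
  let ?s = "sect U \<phi> W e h"
  have s: "?s \<in> L2 G m" by (rule cone_test_L2[OF sect_test[OF C F h]])
  have "ip G m u ?s = (\<integral>v. chart_wt m \<phi> \<rho> ?B v *\<^sub>R (\<lambda>z. herm G (snd z) (u z) (?s z)) (chart_map U \<phi> ?B v) \<partial>lborel)"
    unfolding ip_def
  proof (rule integral_chart[OF C \<rho> B herm_measurable[OF u L2D(1)[OF s]]])
    fix z assume z: "z \<in> space (cone_measure G m)" "snd z \<notin> ?B"
    then have "?s z = 0" by (cases z) (auto simp: sect_def)
    then show "herm G (snd z) (u z) (?s z) = 0" using herm_zero(2)[OF msecD(1)[OF u z(1)]] by simp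
  qed
  also have "\<dots> = (\<integral>v. pair (cyl_rep G (U, \<phi>) e u v) (hloc m U \<phi> \<rho> e v *v cnjv (h v)) \<partial>lborel)"
  proof (rule Bochner_Integration.integral_cong[OF refl])
    fix v :: "'n pt"
    show "chart_wt m \<phi> \<rho> ?B v *\<^sub>R (\<lambda>z. herm G (snd z) (u z) (?s z)) (chart_map U \<phi> ?B v)
        = pair (cyl_rep G (U, \<phi>) e u v) (hloc m U \<phi> \<rho> e v *v cnjv (h v))"
    proof (cases "v \<in> cdom U \<phi> W")
      case True
      then obtain t y where y: "t > 0" "y \<in> U" "y \<in> W" "y \<in> bd G" "v = cyl \<phi> (t, y)" "cyl_inv G U \<phi> v = (t, y)"
        by (elim cdomE[OF C])
      have "(t, y) \<in> space (cone_measure G m)" using y by (simp add: space_cone_measure)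
      from msecD(1)[OF u this] have fib: "u (t, y) \<in> fib G y" by simp
      have cm: "chart_map U \<phi> ?B v = (t, y)" using True y by (simp add: chart_map_def cdom_bd[OF C])
      have s: "?s (t, y) = frame_map G e y (h v)" using y by (simp add: sect_def)
      have r: "u (t, y) = frame_map G e y (cyl_rep G (U, \<phi>) e u v)"
        using y frame_map_coords[OF F y(3) fib] by (simp add: cyl_rep_cyl[OF C])
      show ?thesis
        unfolding pair_hloc[OF C F True] chart_wt_cdom[OF C True] cm y(6) snd_conv
        by (simp only: r s scaleR_conv_of_real)
    next
      case False
      then have "h v = 0" using h unfolding cpt_smooth_def by blast
      then have "cnjv (h v) = 0" by (simp add: cnjv_def vec_eq_iff)
      moreover have "v \<notin> cdom U \<phi> ?B" using False by (simp add: cdom_bd[OF C])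
      then have "chart_wt m \<phi> \<rho> ?B v = 0" by (intro chart_wt_outside) auto
      ultimately show ?thesis by (simp only: matrix_vector_mult_0_right pair_zero scaleR_zero_left)
    qed
  qed
  finally show ?thesis .
qed

text \<open>Testing with a real function \<open>g\<close> times a single frame vector shows by du
  Bois-Reymond that the inner product of \<open>f\<close> with each frame vector vanishes almost
  everywhere; a vector orthogonal to a frame is zero.\<close>

lemma sect_orthogonal_imp_zero_chart:
  assumes C: "(U, \<phi>) \<in> charts G" and F: "(W, e) \<in> frames G" and f: "f \<in> L2 G m"
    and orth: "\<And>h. cpt_smooth (cdom U \<phi> W) h \<Longrightarrow> ip G m f (sect U \<phi> W e h) = 0"
  shows "AE z in cone_measure G m. snd z \<in> U \<inter> W \<inter> bd G \<longrightarrow> f z = 0"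
proof -
  obtain \<rho> where \<rho>: "chart_dens U \<phi> \<rho>" using chart_dens_exists[OF C] by blast
  let ?M = "cone_measure G m"
  let ?B = "U \<inter> W \<inter> bd G"
  let ?V = "cdom U \<phi> W"
  have B: "?B \<in> sets borel" "?B \<subseteq> U \<inter> bd G" using chart_part_borel[OF C F] by auto
  have oV: "open ?V" by (rule open_cdom[OF C frameD(1)[OF F]])
  \<comment> \<open>Written out in coordinates and set to 0 off the part over \<open>W\<close>,
    because the frame vectors are available over \<open>W\<close> only; there \<open>fk k\<close> is
    the inner product of \<open>f\<close> with \<open>e k\<close>.\<close>
  define fk where "fk k z = (if z \<in> cpart W then
      \<Sum>j\<in>UNIV. coords G e (snd z) (f z) $ j * herm G (snd z) (e j (snd z)) (e k (snd z)) else 0)" for k z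
  have fkm: "fk k \<in> borel_measurable ?M" for k
  proof -
    note [measurable] = vec_nth_measurable[OF msecD(2)[OF L2D(1)[OF f] F]]
      continuous_cpart_measurable[OF frame_herm_cpart[OF F]]
    have "(\<lambda>z. \<Sum>j\<in>UNIV. coords G e (snd z) (f z) $ j * herm G (snd z) (e j (snd z)) (e k (snd z)))
        \<in> borel_measurable (restrict_space ?M (cpart W))" by measurable
    moreover have "cpart W \<inter> space ?M \<in> sets ?M" using cpart_sets[OF frameD(1)[OF F]] by blast
    ultimately show ?thesis unfolding fk_def[abs_def] by (subst (asm) measurable_restrict_space_iff[where c = 0]) simp_all
  qed
  have fk: "fk k z = herm G (snd z) (f z) (e k (snd z))" if "z \<in> space ?M" "snd z \<in> W" for k z
  proof -
    have "herm G (snd z) (f z) (frame_map G e (snd z) (axis k 1)) = (\<Sum>j\<in>UNIV. coords G e (snd z) (f z) $ j * herm G (snd z) (e j (snd z)) (e k (snd z)))"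
    proof -
      have "herm G (snd z) (f z) (e k (snd z)) = herm G (snd z) (\<Sum>j\<in>UNIV. scl G (coords G e (snd z) (f z) $ j) (e j (snd z))) (e k (snd z))"
        using frame_map_coords[OF F that(2) L2_fib[OF f that(1)]] by (simp add: frame_map_def)
      also have "\<dots> = (\<Sum>j\<in>UNIV. coords G e (snd z) (f z) $ j * herm G (snd z) (e j (snd z)) (e k (snd z)))"
        using herm_sum_left[OF finite_class.finite_UNIV, of "\<lambda>j. scl G (coords G e (snd z) (f z) $ j) (e j (snd z))" "snd z" "e k (snd z)"]
          fib_scl[OF frame_fib[OF F that(2)]] frame_fib[OF F that(2)]
        by (simp add: herm_scl_left frame_fib[OF F that(2)])
      finally show ?thesis by (simp add: frame_map_axis)
    qed
    then show ?thesis using that by (cases z) (simp add: fk_def cpart_def space_cone_measure frame_map_axis)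
  qed
  let ?F = "\<lambda>k v. chart_wt m \<phi> \<rho> ?B v *\<^sub>R fk k (chart_map U \<phi> ?B v)"
  have Fm: "?F k \<in> borel_measurable lborel" for k
    using chart_wt_measurable[OF C \<rho> B] measurable_compose[OF chart_map_measurable[OF C B] fkm]
    by (intro borel_measurable_scaleR) simp_all
  have cm: "chart_map U \<phi> ?B v = cyl_inv G U \<phi> v" "cyl_inv G U \<phi> v \<in> space ?M" "snd (cyl_inv G U \<phi> v) \<in> W" if "v \<in> ?V" for v
    using that by (auto simp: chart_map_def cdom_bd[OF C] space_cone_measure elim!: cdomE[OF C])
  have ae: "AE v in lborel. v \<in> ?V \<longrightarrow> ?F k v = 0" for k
  proof (rule du_Bois_Reymond[OF oV])
    \<comment> \<open>Local integrability: \<open>herm_bound\<close> majorises the component by the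
      squared norms of \<open>f\<close>, integrable over the chart, and of \<open>e k\<close>,
      continuous on the compact box.\<close>
    fix a b assume ab: "cbox a b \<subseteq> ?V"
    let ?g = "\<lambda>v. herm G (snd (cyl_inv G U \<phi> v)) (e k (snd (cyl_inv G U \<phi> v))) (e k (snd (cyl_inv G U \<phi> v)))"
    have "continuous_on (cbox a b) (\<lambda>v. (\<rho> (base_pt v) * (v $ xi ^ m * (1 / v $ xi))) * Re (?g v))"
      by (intro continuous_intros continuous_on_subset[OF smooth_on_continuous[OF wt_smooth[OF C \<rho>]] ab]
          continuous_on_subset[OF smooth_on_continuous[OF smooth_fun_cdom[OF C frame_herm_smooth[OF F]]] ab])
    from borel_integrable_compact[OF compact_cbox this]
    have i2: "integrable lborel (\<lambda>v. indicator (cbox a b) v *\<^sub>R ((\<rho> (base_pt v) * (v $ xi ^ m * (1 / v $ xi))) * Re (?g v)))" .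
    have i1: "integrable lborel (\<lambda>v. chart_wt m \<phi> \<rho> ?B v * (\<lambda>z. q (snd z) (f z)) (chart_map U \<phi> ?B v))"
      by (rule integrable_chart[OF C \<rho> B L2D(2)[OF f]])
    show "integrable lborel (\<lambda>v. indicator (cbox a b) v *\<^sub>R ?F k v)"
    proof (rule Bochner_Integration.integrable_bound[OF Bochner_Integration.integrable_add[OF i1 i2] _ AE_I2])
      show "(\<lambda>v. indicator (cbox a b) v *\<^sub>R ?F k v) \<in> borel_measurable lborel"
        by (intro borel_measurable_scaleR Fm) simp
      fix v :: "'n pt"
      have nn: "0 \<le> chart_wt m \<phi> \<rho> ?B v * q (snd (chart_map U \<phi> ?B v)) (f (chart_map U \<phi> ?B v))"
      proof -
        have "chart_map U \<phi> ?B v \<in> space ?M" using measurable_space[OF chart_map_measurable[OF C B], of v] by simp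
        from q_nonneg[OF L2_fib[OF f this]] chart_wt_nonneg[OF \<rho> B(2)] show ?thesis by (rule mult_nonneg_nonneg[rotated])
      qed
      show "norm (indicator (cbox a b) v *\<^sub>R ?F k v)
          \<le> norm (chart_wt m \<phi> \<rho> ?B v * q (snd (chart_map U \<phi> ?B v)) (f (chart_map U \<phi> ?B v)) +
            indicator (cbox a b) v *\<^sub>R ((\<rho> (base_pt v) * (v $ xi ^ m * (1 / v $ xi))) * Re (?g v)))"
      proof (cases "v \<in> cbox a b")
        case True
        then have v: "v \<in> ?V" using ab by blast
        define w where "w = \<rho> (base_pt v) * (v $ xi ^ m * (1 / v $ xi))"
        have w: "w > 0" unfolding w_def by (rule wt_pos[OF C \<rho> v])
        define z where "z = cyl_inv G U \<phi> v"
        have z: "z \<in> space ?M" "snd z \<in> W" using cm[OF v] by (simp_all add: z_def)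
        have "cmod (fk k z) \<le> q (snd z) (f z) + q (snd z) (e k (snd z))"
          unfolding fk[OF z] by (rule herm_bound[OF L2_fib[OF f z(1)] frame_fib[OF F z(2)]])
        then have "w * cmod (fk k z) \<le> w * q (snd z) (f z) + w * q (snd z) (e k (snd z))"
          using w by (simp add: distrib_left[symmetric])
        then show ?thesis
          using True w nn unfolding chart_wt_cdom[OF C v] cm(1)[OF v] w_def[symmetric] z_def[symmetric]
          by (simp add: q_def[of _ "e k _"])
      next
        case False
        then show ?thesis using nn by simp
      qed
    qed
  next
    fix g :: "'n pt \<Rightarrow> real" assume g: "cpt_smooth ?V g"
    let ?h = "\<lambda>v. g v *\<^sub>R (axis k 1 :: 'r cvec)"
    have h: "cpt_smooth ?V ?h"
      using g smooth_on_scaleR[OF _ smooth_on_const, of UNIV g "axis k 1 :: 'r cvec"] unfolding cpt_smooth_def by auto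
    have "(\<integral>v. g v *\<^sub>R ?F k v \<partial>lborel) = (\<integral>v. pair (cyl_rep G (U, \<phi>) e f v) (hloc m U \<phi> \<rho> e v *v cnjv (?h v)) \<partial>lborel)"
    proof (rule Bochner_Integration.integral_cong[OF refl])
      fix v :: "'n pt"
      show "g v *\<^sub>R ?F k v = pair (cyl_rep G (U, \<phi>) e f v) (hloc m U \<phi> \<rho> e v *v cnjv (?h v))"
      proof (cases "v \<in> ?V")
        case True
        then obtain t y where y: "t > 0" "y \<in> U" "y \<in> W" "y \<in> bd G" "v = cyl \<phi> (t, y)" "cyl_inv G U \<phi> v = (t, y)"
          by (elim cdomE[OF C])
        note z = cm(2)[OF True, unfolded y(6)]
        from L2_fib[OF f z] have ff: "f (t, y) \<in> fib G y" by simp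
        have fm: "frame_map G e y (cyl_rep G (U, \<phi>) e f v) = f (t, y)"
          using frame_map_coords[OF F y(3) ff] y by (simp add: cyl_rep_cyl[OF C])
        have fh: "frame_map G e y (?h v) = scl G (of_real (g v)) (e k y)"
          unfolding scaleR_eq_smult frame_map_smult frame_map_axis ..
        have "pair (cyl_rep G (U, \<phi>) e f v) (hloc m U \<phi> \<rho> e v *v cnjv (?h v))
            = of_real (chart_wt m \<phi> \<rho> ?B v) * (of_real (g v) * herm G y (f (t, y)) (e k y))"
          unfolding pair_hloc[OF C F True] chart_wt_cdom[OF C True] y(6) snd_conv fm fh
          using herm_scl_right[OF frame_fib[OF F y(3)] ff] by simp
        moreover have "fk k (t, y) = herm G y (f (t, y)) (e k y)" using fk[OF z] y(3) by simp
        ultimately show ?thesis unfolding cm(1)[OF True] y(6) by (simp add: scaleR_conv_of_real mult_ac)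
      next
        case False
        then have g0: "g v = 0" using g unfolding cpt_smooth_def by blast
        then have "cnjv (?h v) = 0" by (simp add: cnjv_def vec_eq_iff)
        then show ?thesis using g0 by (simp only: matrix_vector_mult_0_right pair_zero scaleR_zero_left)
      qed
    qed
    also have "\<dots> = 0" using ip_sect[OF C \<rho> F h L2D(1)[OF f]] orth[OF h] by simp
    finally show "(\<integral>v. g v *\<^sub>R ?F k v \<partial>lborel) = 0" .
  qed
  have "AE z in ?M. snd z \<in> ?B \<longrightarrow> fk k z = 0" for k
  proof (rule AE_chart[OF C \<rho> B fkm])
    show "AE v in lborel. v \<in> cdom U \<phi> ?B \<longrightarrow> fk k (cyl_inv G U \<phi> v) = 0"
      using ae[of k]
    proof eventually_elim
      fix v assume a: "v \<in> ?V \<longrightarrow> ?F k v = 0"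
      show "v \<in> cdom U \<phi> ?B \<longrightarrow> fk k (cyl_inv G U \<phi> v) = 0"
      proof
        assume "v \<in> cdom U \<phi> ?B"
        then have v: "v \<in> ?V" by (simp add: cdom_bd[OF C])
        then have "?F k v = 0" using a by blast
        then show "fk k (cyl_inv G U \<phi> v) = 0"
          using wt_pos[OF C \<rho> v, of m] unfolding chart_wt_cdom[OF C v] cm(1)[OF v] scaleR_eq_0_iff by linarith
      qed
    qed
  qed
  then have "AE z in ?M. \<forall>k. snd z \<in> ?B \<longrightarrow> fk k z = 0"
    unfolding AE_all_countable by blast
  with AE_space show ?thesis
  proof eventually_elim
    fix z assume z: "z \<in> space ?M" "\<forall>k. snd z \<in> ?B \<longrightarrow> fk k z = 0"
    show "snd z \<in> ?B \<longrightarrow> f z = 0"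
    proof
      assume zB: "snd z \<in> ?B"
      then have W: "snd z \<in> W" by blast
      have k: "herm G (snd z) (f z) (e k (snd z)) = 0" for k using fk[OF z(1) W] z(2) zB by simp
      have "herm G (snd z) (f z) (f z) = herm G (snd z) (f z) (\<Sum>k\<in>UNIV. scl G (coords G e (snd z) (f z) $ k) (e k (snd z)))"
        using frame_map_coords[OF F W L2_fib[OF f z(1)]] by (simp add: frame_map_def)
      also have "\<dots> = 0"
        using herm_sum_right[OF finite_class.finite_UNIV, of "\<lambda>k. scl G (coords G e (snd z) (f z) $ k) (e k (snd z))" "snd z" "f z"]
          fib_scl[OF frame_fib[OF F W]]
        by (simp add: herm_scl_right frame_fib[OF F W] L2_fib[OF f z(1)] k)
      finally show "f z = 0" using q_zero_iff[OF L2_fib[OF f z(1)]] by (simp add: q_def)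
    qed
  qed
qed

lemma finite_chart_cover: "\<exists>\<C>\<subseteq>charts G. finite \<C> \<and> (\<Union>C\<in>\<C>. fst C) = UNIV"
proof -
  have "open (fst C)" if "C \<in> charts G" for C using chartD(1)[of "fst C" "snd C"] that by simp
  moreover have "UNIV \<subseteq> (\<Union>C\<in>charts G. fst C)"
  proof
    fix p :: 'a
    obtain U \<phi> where "(U, \<phi>) \<in> charts G" "p \<in> U" using charts_cover by blast
    then show "p \<in> (\<Union>C\<in>charts G. fst C)" by (metis UN_I fst_conv)
  qed
  ultimately obtain \<C> where "\<C> \<subseteq> charts G" "finite \<C>" "UNIV \<subseteq> (\<Union>C\<in>\<C>. fst C)"
    using compactE_image[OF compact_M, of "charts G" fst] by metis
  then show ?thesis by (intro exI[of _ \<C>]) auto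
qed

text \<open>Vanishing almost everywhere may be checked over each of finitely many chart and frame
  domains that cover the manifold, so test sections supported in one chart suffice.\<close>

lemma sect_orthogonal_imp_zero:
  assumes f: "f \<in> L2 G m"
    and orth: "\<And>U \<phi> W e h. (U, \<phi>) \<in> charts G \<Longrightarrow> (W, e) \<in> frames G \<Longrightarrow> cpt_smooth (cdom U \<phi> W) h \<Longrightarrow>
      ip G m f (sect U \<phi> W e h) = 0"
  shows "L2norm G m f = 0"
proof -
  obtain \<C> where \<C>: "\<C> \<subseteq> charts G" "finite \<C>" "(\<Union>C\<in>\<C>. fst C) = UNIV" using finite_chart_cover by blast
  obtain \<F> where \<F>: "\<F> \<subseteq> frames G" "finite \<F>" "(\<Union>F\<in>\<F>. fst F) = UNIV" using finite_frame_cover by blast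
  have "AE z in cone_measure G m. \<forall>C\<in>\<C>. \<forall>F\<in>\<F>. snd z \<in> fst C \<inter> fst F \<inter> bd G \<longrightarrow> f z = 0"
  proof (intro AE_finite_allI \<C>(2) \<F>(2))
    fix C F assume "C \<in> \<C>" "F \<in> \<F>"
    then have "(fst C, snd C) \<in> charts G" "(fst F, snd F) \<in> frames G" using \<C>(1) \<F>(1) by auto
    from sect_orthogonal_imp_zero_chart[OF this f orth[OF this]]
    show "AE z in cone_measure G m. snd z \<in> fst C \<inter> fst F \<inter> bd G \<longrightarrow> f z = 0" .
  qed
  with AE_space have "AE z in cone_measure G m. f z = 0"
  proof eventually_elim
    fix z assume z: "z \<in> space (cone_measure G m)" "\<forall>C\<in>\<C>. \<forall>F\<in>\<F>. snd z \<in> fst C \<inter> fst F \<inter> bd G \<longrightarrow> f z = 0"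
    have "snd z \<in> (\<Union>C\<in>\<C>. fst C)" "snd z \<in> (\<Union>F\<in>\<F>. fst F)" using \<C>(3) \<F>(3) by simp_all
    then obtain C F where "C \<in> \<C>" "snd z \<in> fst C" "F \<in> \<F>" "snd z \<in> fst F" by (elim UN_E)
    moreover have "snd z \<in> bd G" using z(1) by (auto simp: space_cone_measure)
    ultimately show "f z = 0" using z(2)[rule_format, of C F] by simp
  qed
  then show ?thesis using L2norm_zero_iff[OF f] by simp
qed

end

section \<open>The model operator\<close>

locale cone_model_operator = cone_geom G
  for G :: "('a::{t2_space,second_countable_topology}, 'n::{finite,linorder}, 'f::ab_group_add, 'r::finite) cone_data" +
  fixes m :: nat and A :: "('a \<Rightarrow> 'f) \<Rightarrow> 'a \<Rightarrow> 'f" and Aw :: "('a, 'f) csec \<Rightarrow> ('a, 'f) csec"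
  assumes cone_op_A: "cone_operator G m A" and model: "model_operator G m A Aw"
begin

interpretation vs: vector_space "scl G" by (rule vs)

section \<open>The model operator in coordinates\<close>

lemma coeffs_exist:
  assumes "C \<in> charts G" "F \<in> frames G"
  shows "\<exists>a. cone_coeffs G m (x_pow_times G m A) C F a"
proof -
  have "\<forall>C\<in>charts G. \<forall>F\<in>frames G.
        (\<exists>a. interior_coeffs G m (x_pow_times G m A) C F a) \<and>
        (\<exists>a. cone_coeffs G m (x_pow_times G m A) C F a)"
    using cone_op_A unfolding cone_operator_def by (elim conjE)
  from bspec[OF bspec[OF this assms(1)] assms(2)] show ?thesis by (elim conjE)
qed

lemma model_raw:
  assumes "u \<in> cone_smooth_sections G" "t > 0"
  shows "(\<forall>y\<in>bd G. Aw u (t, y) \<in> fib G y) \<and>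
        (\<forall>(U, \<phi>)\<in>charts G. \<forall>(W, e)\<in>frames G. \<forall>a.
           cone_coeffs G m (x_pow_times G m A) (U, \<phi>) (W, e) a \<longrightarrow>
           (\<forall>y\<in>U \<inter> W \<inter> bd G.
              coords G e y (Aw u (t, y)) = complex_of_real (1 / t ^ m) *s
                (\<Sum>\<alpha> | sum \<alpha> UNIV \<le> m. a \<alpha> (cyl \<phi> (0, y)) *v
                   bDmulti \<alpha> (cyl_rep G (U, \<phi>) e u) (cyl \<phi> (t, y)))))"
  using bspec[OF model[unfolded model_operator_def] assms(1), THEN spec, THEN mp, OF assms(2)] .

lemma model_formula:
  assumes u: "u \<in> cone_smooth_sections G" "t > 0" and C: "(U, \<phi>) \<in> charts G" and F: "(W, e) \<in> frames G"
    and a: "cone_coeffs G m (x_pow_times G m A) (U, \<phi>) (W, e) a" and y: "y \<in> U \<inter> W \<inter> bd G"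
  shows "coords G e y (Aw u (t, y)) = complex_of_real (1 / t ^ m) *s
                (\<Sum>\<alpha> | sum \<alpha> UNIV \<le> m. a \<alpha> (cyl \<phi> (0, y)) *v
                   bDmulti \<alpha> (cyl_rep G (U, \<phi>) e u) (cyl \<phi> (t, y)))"
proof -
  have "\<forall>(W, e)\<in>frames G. \<forall>a. cone_coeffs G m (x_pow_times G m A) (U, \<phi>) (W, e) a \<longrightarrow>
           (\<forall>y\<in>U \<inter> W \<inter> bd G. coords G e y (Aw u (t, y)) = complex_of_real (1 / t ^ m) *s
                (\<Sum>\<alpha> | sum \<alpha> UNIV \<le> m. a \<alpha> (cyl \<phi> (0, y)) *v
                   bDmulti \<alpha> (cyl_rep G (U, \<phi>) e u) (cyl \<phi> (t, y))))"
    using bspec[OF conjunct2[OF model_raw[OF u]] C] by (simp only: prod.case)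
  from bspec[OF this F]
  have "\<forall>a. cone_coeffs G m (x_pow_times G m A) (U, \<phi>) (W, e) a \<longrightarrow>
           (\<forall>y\<in>U \<inter> W \<inter> bd G. coords G e y (Aw u (t, y)) = complex_of_real (1 / t ^ m) *s
                (\<Sum>\<alpha> | sum \<alpha> UNIV \<le> m. a \<alpha> (cyl \<phi> (0, y)) *v
                   bDmulti \<alpha> (cyl_rep G (U, \<phi>) e u) (cyl \<phi> (t, y))))"
    by (simp only: prod.case)
  from bspec[OF mp[OF spec[OF this] a] y] show ?thesis .
qed

lemma Aw_fib: "u \<in> cone_smooth_sections G \<Longrightarrow> t > 0 \<Longrightarrow> y \<in> bd G \<Longrightarrow> Aw u (t, y) \<in> fib G y"
  using model_raw[of u t] by blast

text \<open>The coefficients are frozen at x = 0, so they depend on \<open>base_pt v\<close> only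
  and are unchanged by dilations; with the invariance of \<open>bDmulti\<close> this yields a
  \<open>cone_op\<close>. Positive width of the collar puts x = 0 into the set on which the
  coefficients are smooth.\<close>

lemma local_operator:
  assumes C: "(U, \<phi>) \<in> charts G" and F: "(W, e) \<in> frames G"
  shows "\<exists>P. cone_op (cdom U \<phi> W) P \<and> (\<forall>u\<in>cone_smooth_sections G. \<forall>v\<in>cdom U \<phi> W.
    cyl_rep G (U, \<phi>) e (Aw u) v = complex_of_real (1 / (v $ xi) ^ m) *s P (cyl_rep G (U, \<phi>) e u) v)"
proof -
  obtain a where a: "cone_coeffs G m (x_pow_times G m A) (U, \<phi>) (W, e) a"
    using coeffs_exist[OF C F] by blast
  define P :: "('n pt \<Rightarrow> 'r cvec) \<Rightarrow> 'n pt \<Rightarrow> 'r cvec"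
    where "P = (\<lambda>g v. \<Sum>\<alpha> | sum \<alpha> UNIV \<le> m. a \<alpha> (base_pt v) *v bDmulti \<alpha> g v)"
  let ?V = "cdom U \<phi> W"
  have V: "open ?V" by (rule open_cdom[OF C frameD(1)[OF F]])
  have width: "width G > 0"
    using geo unfolding cone_geometry_def collar_structure_def by (elim conjE)
  have "cone_op ?V P" unfolding P_def
  proof (rule cone_op_sum[OF V dil_cdom finite_multiindices])
    fix \<alpha> :: "'n \<Rightarrow> nat" assume "\<alpha> \<in> {\<alpha>. sum \<alpha> UNIV \<le> m}"
    then have s: "smooth_on (cyl \<phi> ` ({0..<width G} \<times> (U \<inter> W \<inter> bd G))) (a \<alpha>)"
      using a unfolding cone_coeffs_def by (simp only: prod.case mem_Collect_eq)
    have "smooth_on ?V (\<lambda>v. a \<alpha> (base_pt v))"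
    proof (rule smooth_on_compose[OF s smooth_on_linear[OF bounded_linear_base_pt]], rule image_subsetI)
      fix v assume "v \<in> ?V"
      then obtain t y where y: "y \<in> U" "y \<in> W" "y \<in> bd G" "base_pt v = \<phi> y" by (elim cdomE[OF C])
      then have "base_pt v = cyl \<phi> (0, y)" by (simp add: cyl_def)
      then show "base_pt v \<in> cyl \<phi> ` ({0..<width G} \<times> (U \<inter> W \<inter> bd G))" using y width by auto
    qed
    then have "cone_op ?V (\<lambda>g v. a \<alpha> (base_pt v) *v g v)"
      by (intro cone_op_matrix V dil_cdom) (simp_all add: base_pt_dil)
    from cone_op_compose[OF V dil_cdom this cone_op_bDmulti[OF V dil_cdom]]
    show "cone_op ?V (\<lambda>g v. a \<alpha> (base_pt v) *v bDmulti \<alpha> g v)" .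
  qed
  moreover have "cyl_rep G (U, \<phi>) e (Aw u) v = complex_of_real (1 / (v $ xi) ^ m) *s P (cyl_rep G (U, \<phi>) e u) v"
    if u: "u \<in> cone_smooth_sections G" and v: "v \<in> ?V" for u v
  proof -
    from v obtain t y where y: "t > 0" "y \<in> U" "y \<in> W" "y \<in> bd G" "v = cyl \<phi> (t, y)" "base_pt v = \<phi> y" "v $ xi = t"
      by (elim cdomE[OF C])
    have b: "base_pt v = cyl \<phi> (0, y)" using y(6) by (simp add: cyl_def)
    have "cyl_rep G (U, \<phi>) e (Aw u) v = coords G e y (Aw u (t, y))"
      unfolding y(5) by (rule cyl_rep_cyl[OF C y(2,4)])
    also have "\<dots> = complex_of_real (1 / t ^ m) *s
                (\<Sum>\<alpha> | sum \<alpha> UNIV \<le> m. a \<alpha> (cyl \<phi> (0, y)) *v bDmulti \<alpha> (cyl_rep G (U, \<phi>) e u) (cyl \<phi> (t, y)))"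
      by (rule model_formula[OF u y(1) C F a]) (use y in blast)
    finally show ?thesis unfolding P_def b y(7) unfolding y(5) .
  qed
  ultimately show ?thesis by (intro exI[of _ P]) simp
qed

lemma chart_frame_at: "\<exists>U \<phi> W e. (U, \<phi>) \<in> charts G \<and> (W, e) \<in> frames G \<and> y \<in> U \<and> y \<in> W"
  using charts_cover[of y] frames_cover[of y] by blast

lemma Aw_smooth:
  assumes u: "u \<in> cone_smooth_sections G"
  shows "Aw u \<in> cone_smooth_sections G"
proof (rule cone_smoothI[OF Aw_fib[OF u]])
  fix U \<phi> W e assume C: "(U, \<phi>) \<in> charts G" and F: "(W, e) \<in> frames G"
  obtain P where P: "cone_op (cdom U \<phi> W) P" "\<And>v. v \<in> cdom U \<phi> W \<Longrightarrow>
      cyl_rep G (U, \<phi>) e (Aw u) v = complex_of_real (1 / (v $ xi) ^ m) *s P (cyl_rep G (U, \<phi>) e u) v"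
    using local_operator[OF C F] u by blast
  have "smooth_on (cdom U \<phi> W) (\<lambda>v. complex_of_real (inverse (v $ xi ^ m)))"
    by (intro smooth_on_of_real smooth_on_inverse smooth_on_power smooth_on_linear bounded_linear_vec_nth)
      (simp add: cdom_def)
  moreover have "smooth_on (cdom U \<phi> W) (P (cyl_rep G (U, \<phi>) e u))"
    using P(1) diffopD(1) cone_smoothD(2)[OF u C F] unfolding cone_op_def by blast
  ultimately have "smooth_on (cdom U \<phi> W) (\<lambda>v. complex_of_real (inverse (v $ xi ^ m)) *s P (cyl_rep G (U, \<phi>) e u) v)"
    by (rule smooth_on_smult)
  then show "smooth_on (cdom U \<phi> W) (cyl_rep G (U, \<phi>) e (Aw u))"
    by (rule smooth_on_cong[THEN iffD2, rotated]) (simp add: P(2) divide_inverse)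
qed

text \<open>Coordinates in one chart and frame determine the value at a point, and the coefficients
  enter through an abstract \<open>P\<close> only. The pointwise identities for \<open>Aw\<close>
  that follow are instances.\<close>

lemma Aw_eqI:
  assumes t: "t > 0" and y: "y \<in> bd G" and w: "w \<in> fib G y" and u: "u \<in> cone_smooth_sections G"
    and eq: "\<And>U \<phi> W e P v. (U, \<phi>) \<in> charts G \<Longrightarrow> (W, e) \<in> frames G \<Longrightarrow> y \<in> U \<Longrightarrow> y \<in> W \<Longrightarrow>
      cone_op (cdom U \<phi> W) P \<Longrightarrow>
      (\<And>u v. u \<in> cone_smooth_sections G \<Longrightarrow> v \<in> cdom U \<phi> W \<Longrightarrow>
        cyl_rep G (U, \<phi>) e (Aw u) v = complex_of_real (1 / (v $ xi) ^ m) *s P (cyl_rep G (U, \<phi>) e u) v) \<Longrightarrow>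
      v = cyl \<phi> (t, y) \<Longrightarrow> v \<in> cdom U \<phi> W \<Longrightarrow> v $ xi = t \<Longrightarrow>
      complex_of_real (1 / t ^ m) *s P (cyl_rep G (U, \<phi>) e u) v = coords G e y w"
  shows "Aw u (t, y) = w"
proof -
  obtain U \<phi> W e where C: "(U, \<phi>) \<in> charts G" and F: "(W, e) \<in> frames G" and yU: "y \<in> U" "y \<in> W"
    using chart_frame_at by blast
  obtain P where P: "cone_op (cdom U \<phi> W) P" "\<And>u v. u \<in> cone_smooth_sections G \<Longrightarrow> v \<in> cdom U \<phi> W \<Longrightarrow>
      cyl_rep G (U, \<phi>) e (Aw u) v = complex_of_real (1 / (v $ xi) ^ m) *s P (cyl_rep G (U, \<phi>) e u) v"
    using local_operator[OF C F] by blast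
  have v: "cyl \<phi> (t, y) \<in> cdom U \<phi> W" by (rule cyl_in_cdom[OF C t yU y])
  have x: "cyl \<phi> (t, y) $ xi = t" by (rule cyl_inv_cyl(3)[OF C yU(1) y])
  have "coords G e y (Aw u (t, y)) = coords G e y w"
    using P(2)[OF u v] eq[OF C F yU P refl v x] unfolding cyl_rep_cyl[OF C yU(1) y] x by simp
  then show ?thesis by (rule coords_inject[OF F yU(2) Aw_fib[OF u t y] w])
qed

text \<open>\<open>Aw\<close> is a map on all functions which \<open>model_operator\<close>
  prescribes on smooth sections, and only over the cone; linearity has to be read off from the local
  operator.\<close>

lemma Aw_add:
  assumes u: "u \<in> cone_smooth_sections G" and w: "w \<in> cone_smooth_sections G" and t: "t > 0" "y \<in> bd G"
  shows "Aw (u + w) (t, y) = Aw u (t, y) + Aw w (t, y)"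
proof (rule Aw_eqI[OF t fib_add[OF Aw_fib[OF u t] Aw_fib[OF w t]] cone_smooth_add[OF u w]])
  fix U \<phi> W e P v
  assume C: "(U, \<phi>) \<in> charts G" and F: "(W, e) \<in> frames G" and y: "y \<in> U" "y \<in> W"
    and P: "cone_op (cdom U \<phi> W) P"
    and rep: "\<And>u v. u \<in> cone_smooth_sections G \<Longrightarrow> v \<in> cdom U \<phi> W \<Longrightarrow>
        cyl_rep G (U, \<phi>) e (Aw u) v = complex_of_real (1 / (v $ xi) ^ m) *s P (cyl_rep G (U, \<phi>) e u) v"
    and v: "v = cyl \<phi> (t, y)" "v \<in> cdom U \<phi> W" "v $ xi = t"
  have D: "diffop (cdom U \<phi> W) P" using P by (simp add: cone_op_def)
  note su = cone_smoothD(2)[OF u C F] and sw = cone_smoothD(2)[OF w C F]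
  have "P (cyl_rep G (U, \<phi>) e (u + w)) v = P (\<lambda>v. cyl_rep G (U, \<phi>) e u v + cyl_rep G (U, \<phi>) e w v) v"
    by (rule diffop_cong_point[OF D open_cdom[OF C frameD(1)[OF F]] cone_smoothD(2)[OF cone_smooth_add[OF u w] C F]
        smooth_on_add[OF su sw] cyl_rep_add[OF C F _ cone_smoothD(1)[OF u] cone_smoothD(1)[OF w]] v(2)])
  also have "\<dots> = P (cyl_rep G (U, \<phi>) e u) v + P (cyl_rep G (U, \<phi>) e w) v" by (rule diffopD(3)[OF D su sw v(2)])
  finally have "complex_of_real (1 / t ^ m) *s P (cyl_rep G (U, \<phi>) e (u + w)) v
      = cyl_rep G (U, \<phi>) e (Aw u) v + cyl_rep G (U, \<phi>) e (Aw w) v"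
    unfolding rep[OF u v(2)] rep[OF w v(2)] v(3) by (simp only: vec.scale_right_distrib)
  also have "\<dots> = coords G e y (Aw u (t, y) + Aw w (t, y))"
    unfolding v(1) cyl_rep_cyl[OF C y(1) t(2)] by (rule coords_add[OF F y(2) Aw_fib[OF u t] Aw_fib[OF w t], symmetric])
  finally show "complex_of_real (1 / t ^ m) *s P (cyl_rep G (U, \<phi>) e (u + w)) v = coords G e y (Aw u (t, y) + Aw w (t, y))" .
qed

lemma Aw_sscl:
  assumes u: "u \<in> cone_smooth_sections G" and t: "t > 0" "y \<in> bd G"
  shows "Aw (sscl G c u) (t, y) = scl G c (Aw u (t, y))"
proof (rule Aw_eqI[OF t fib_scl[OF Aw_fib[OF u t]] cone_smooth_sscl[OF u]])
  fix U \<phi> W e P v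
  assume C: "(U, \<phi>) \<in> charts G" and F: "(W, e) \<in> frames G" and y: "y \<in> U" "y \<in> W"
    and P: "cone_op (cdom U \<phi> W) P"
    and rep: "\<And>u v. u \<in> cone_smooth_sections G \<Longrightarrow> v \<in> cdom U \<phi> W \<Longrightarrow>
        cyl_rep G (U, \<phi>) e (Aw u) v = complex_of_real (1 / (v $ xi) ^ m) *s P (cyl_rep G (U, \<phi>) e u) v"
    and v: "v = cyl \<phi> (t, y)" "v \<in> cdom U \<phi> W" "v $ xi = t"
  have D: "diffop (cdom U \<phi> W) P" using P by (simp add: cone_op_def)
  note su = cone_smoothD(2)[OF u C F]
  have "P (cyl_rep G (U, \<phi>) e (sscl G c u)) v = P (\<lambda>v. c *s cyl_rep G (U, \<phi>) e u v) v"
    by (rule diffop_cong_point[OF D open_cdom[OF C frameD(1)[OF F]] cone_smoothD(2)[OF cone_smooth_sscl[OF u] C F]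
        smooth_on_smult[OF smooth_on_const su] cyl_rep_sscl[OF C F _ cone_smoothD(1)[OF u]] v(2)])
  also have "\<dots> = c *s P (cyl_rep G (U, \<phi>) e u) v" by (rule diffopD(4)[OF D su v(2)])
  finally have "complex_of_real (1 / t ^ m) *s P (cyl_rep G (U, \<phi>) e (sscl G c u)) v = c *s cyl_rep G (U, \<phi>) e (Aw u) v"
    unfolding rep[OF u v(2)] v(3) by (simp only: vec.scale_scale mult.commute)
  also have "\<dots> = coords G e y (scl G c (Aw u (t, y)))"
    unfolding v(1) cyl_rep_cyl[OF C y(1) t(2)] by (rule coords_scl[OF F y(2) Aw_fib[OF u t], symmetric])
  finally show "complex_of_real (1 / t ^ m) *s P (cyl_rep G (U, \<phi>) e (sscl G c u)) v = coords G e y (scl G c (Aw u (t, y)))" .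
qed

text \<open>\<open>P\<close> commutes with dilations, so only the factor x^(-m) sees them: at the
  dilated point it is \<rho>^(-m) t^(-m), whence the factor \<rho>^m.\<close>

lemma Aw_kappa:
  assumes \<rho>: "\<rho> > 0" and u: "u \<in> cone_smooth_sections G" and t: "t > 0" "y \<in> bd G"
  shows "Aw (kappa G m \<rho> u) (t, y) = scl G (of_real (\<rho> ^ m)) (kappa G m \<rho> (Aw u) (t, y))"
proof (rule Aw_eqI[OF t _ cone_smooth_kappa[OF \<rho> u]])
  let ?k = "complex_of_real (\<rho> powr (real m / 2))"
  have fk: "kappa G m \<rho> (Aw u) (t, y) \<in> fib G y" by (rule cone_smoothD(1)[OF cone_smooth_kappa[OF \<rho> Aw_smooth[OF u]] t])
  then show "scl G (of_real (\<rho> ^ m)) (kappa G m \<rho> (Aw u) (t, y)) \<in> fib G y" by (rule fib_scl)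
  fix U \<phi> W e P v
  assume C: "(U, \<phi>) \<in> charts G" and F: "(W, e) \<in> frames G" and y: "y \<in> U" "y \<in> W"
    and P: "cone_op (cdom U \<phi> W) P"
    and rep: "\<And>u v. u \<in> cone_smooth_sections G \<Longrightarrow> v \<in> cdom U \<phi> W \<Longrightarrow>
        cyl_rep G (U, \<phi>) e (Aw u) v = complex_of_real (1 / (v $ xi) ^ m) *s P (cyl_rep G (U, \<phi>) e u) v"
    and v: "v = cyl \<phi> (t, y)" "v \<in> cdom U \<phi> W" "v $ xi = t"
  let ?V = "cdom U \<phi> W"
  have D: "diffop ?V P" using P by (simp add: cone_op_def)
  have V: "open ?V" by (rule open_cdom[OF C frameD(1)[OF F]])
  note su = cone_smoothD(2)[OF u C F]
  note sd = smooth_on_dil[OF V dil_cdom \<rho> su]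
  have dv: "dil \<rho> v \<in> ?V" "dil \<rho> v $ xi = \<rho> * t" using dil_cdom[OF \<rho> v(2)] v(3) by (simp_all add: dil_nth)
  have "P (cyl_rep G (U, \<phi>) e (kappa G m \<rho> u)) v = P (\<lambda>v. ?k *s cyl_rep G (U, \<phi>) e u (dil \<rho> v)) v"
    by (rule diffop_cong_point[OF D V cone_smoothD(2)[OF cone_smooth_kappa[OF \<rho> u] C F]
        smooth_on_smult[OF smooth_on_const sd] cyl_rep_kappa[OF C F _ \<rho> cone_smoothD(1)[OF u]] v(2)])
  also have "\<dots> = ?k *s P (\<lambda>v. cyl_rep G (U, \<phi>) e u (dil \<rho> v)) v" by (rule diffopD(4)[OF D sd v(2)])
  also have "P (\<lambda>v. cyl_rep G (U, \<phi>) e u (dil \<rho> v)) v = P (cyl_rep G (U, \<phi>) e u) (dil \<rho> v)"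
    using P \<rho> su v(2) unfolding cone_op_def by blast
  finally have 1: "P (cyl_rep G (U, \<phi>) e (kappa G m \<rho> u)) v = ?k *s P (cyl_rep G (U, \<phi>) e u) (dil \<rho> v)" .
  have 2: "cyl_rep G (U, \<phi>) e (kappa G m \<rho> (Aw u)) v = ?k *s cyl_rep G (U, \<phi>) e (Aw u) (dil \<rho> v)"
    by (rule cyl_rep_kappa[OF C F v(2) \<rho>]) (rule Aw_fib[OF u])
  have "coords G e y (scl G (of_real (\<rho> ^ m)) (kappa G m \<rho> (Aw u) (t, y))) = of_real (\<rho> ^ m) *s cyl_rep G (U, \<phi>) e (kappa G m \<rho> (Aw u)) v"
    unfolding v(1) cyl_rep_cyl[OF C y(1) t(2)] by (rule coords_scl[OF F y(2) fk])
  also have "\<dots> = of_real (\<rho> ^ m) *s (?k *s (complex_of_real (1 / (\<rho> * t) ^ m) *s P (cyl_rep G (U, \<phi>) e u) (dil \<rho> v)))"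
    unfolding 2 rep[OF u dv(1)] dv(2) ..
  also have "\<dots> = (of_real (\<rho> ^ m * (1 / (\<rho> * t) ^ m)) * ?k) *s P (cyl_rep G (U, \<phi>) e u) (dil \<rho> v)"
    by (simp add: mult_ac)
  also have "\<rho> ^ m * (1 / (\<rho> * t) ^ m) = 1 / t ^ m" using \<rho> by (simp add: power_mult_distrib)
  finally show "complex_of_real (1 / t ^ m) *s P (cyl_rep G (U, \<phi>) e (kappa G m \<rho> u)) v
      = coords G e y (scl G (of_real (\<rho> ^ m)) (kappa G m \<rho> (Aw u) (t, y)))"
    unfolding 1 by (simp only: vec.scale_scale)
qed

text \<open>Differential operators are local: near a point off the support the section agrees with 0
  on an open set.\<close>

lemma Aw_test:
  assumes "u \<in> cone_test_sections G"
  shows "Aw u \<in> cone_test_sections G"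
proof -
  obtain K where u: "u \<in> cone_smooth_sections G" and K: "compact K" "K \<subseteq> {0<..} \<times> bd G"
    "\<forall>z\<in>({0<..} \<times> bd G) - K. u z = 0" using assms unfolding cone_test_sections_def by blast
  have cK: "closed K" using K(1) by (rule compact_imp_closed)
  show ?thesis
  proof (rule cone_testI[OF Aw_smooth[OF u] K(1,2)])
    fix t y assume t: "t > 0" "y \<in> bd G" and nK: "(t, y) \<notin> K"
    show "Aw u (t, y) = 0"
    proof (rule Aw_eqI[OF t fib_zero u])
      fix U \<phi> W e v and P :: "('n pt \<Rightarrow> 'r cvec) \<Rightarrow> 'n pt \<Rightarrow> 'r cvec"
      assume C: "(U, \<phi>) \<in> charts G" and F: "(W, e) \<in> frames G" and y: "y \<in> U" "y \<in> W"
        and P: "cone_op (cdom U \<phi> W) P"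
        and v: "v = cyl \<phi> (t, y)" "v \<in> cdom U \<phi> W" "v $ xi = t"
      let ?V = "cdom U \<phi> W"
      have D: "diffop ?V P" using P by (simp add: cone_op_def)
      have V: "open ?V" by (rule open_cdom[OF C frameD(1)[OF F]])
      let ?X = "cyl_inv G U \<phi> -` (- K) \<inter> ?V"
      have X: "open ?X"
        using continuous_cyl_inv[OF C, of W] cK unfolding continuous_on_open_vimage[OF V] by blast
      \<comment> \<open>Writing 0 as a multiple \<open>0 *s 0\<close> lets the homogeneity of
        \<open>P\<close> give P 0 = 0.\<close>
      have "P (cyl_rep G (U, \<phi>) e u) v = P (\<lambda>v. 0 *s (0 :: 'r cvec)) v"
      proof (rule diffopD(2)[OF D cone_smoothD(2)[OF u C F] smooth_on_const X])
        show "v \<in> ?X" using v(2) nK unfolding v(1) by (simp add: cyl_inv_cyl[OF C y(1) t(2)])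
        fix w assume w: "w \<in> ?X"
        then have "w \<in> ?V" by blast
        then obtain s x where x: "s > 0" "x \<in> U" "x \<in> W" "x \<in> bd G" "w = cyl \<phi> (s, x)" "cyl_inv G U \<phi> w = (s, x)"
          by (elim cdomE[OF C])
        then have "u (s, x) = 0" using K(3) w by simp
        then show "cyl_rep G (U, \<phi>) e u w = 0 *s (0 :: 'r cvec)"
          unfolding x(5) by (simp add: cyl_rep_cyl[OF C x(2,4)] coords_zero[OF F x(3)])
      qed blast
      also have "\<dots> = 0 *s P (\<lambda>v. 0) v" by (rule diffopD(4)[OF D smooth_on_const v(2)])
      finally show "complex_of_real (1 / t ^ m) *s P (cyl_rep G (U, \<phi>) e u) v = coords G e y 0"
        by (simp add: coords_zero[OF F y(2)])
    qed
  qed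
qed

subsection \<open>Formal adjoints\<close>

text \<open>In coordinates the inner product pairs the representation with \<open>hloc\<close> times
  the conjugate of \<open>h\<close>. The transpose of the local operator acts on this function, and
  solving for the Gram matrix turns the result back into a section
  \<open>sect U \<phi> W e h'\<close> supported in the same chart.\<close>

lemma formal_adjoint_sect:
  assumes C: "(U, \<phi>) \<in> charts G" and F: "(W, e) \<in> frames G" and h: "cpt_smooth (cdom U \<phi> W) h"
  shows "\<exists>\<psi>\<in>cone_test_sections G. \<forall>\<eta>\<in>cone_test_sections G. ip G m (Aw \<eta>) (sect U \<phi> W e h) = ip G m \<eta> \<psi>"
proof -
  let ?V = "cdom U \<phi> W"
  have V: "open ?V" by (rule open_cdom[OF C frameD(1)[OF F]])
  obtain \<rho> where \<rho>: "chart_dens U \<phi> \<rho>" using chart_dens_exists[OF C] by blast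
  obtain P where P: "cone_op ?V P" "\<And>u v. u \<in> cone_smooth_sections G \<Longrightarrow> v \<in> ?V \<Longrightarrow>
      cyl_rep G (U, \<phi>) e (Aw u) v = complex_of_real (1 / (v $ xi) ^ m) *s P (cyl_rep G (U, \<phi>) e u) v"
    using local_operator[OF C F] by blast
  let ?H = "\<lambda>v. hloc m U \<phi> \<rho> e v"
  let ?c = "\<lambda>v. complex_of_real (1 / (v $ xi) ^ m)"
  have cs: "smooth_on ?V ?c"
  proof -
    have "smooth_on ?V (\<lambda>v. complex_of_real (inverse (v $ xi ^ m)))"
      by (intro smooth_on_of_real smooth_on_inverse smooth_on_power smooth_on_linear bounded_linear_vec_nth)
        (simp add: cdom_def)
    then show ?thesis by (simp add: divide_inverse)
  qed
  have cc0: "cnjv 0 = 0" by (simp add: cnjv_def vec_eq_iff)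
  have "cpt_smooth ?V (\<lambda>v. ?c v *s (?H v *v cnjv (h v)))" (is "cpt_smooth ?V ?Q")
    by (rule cpt_smooth_smult[OF V cs hloc_cpt[OF C \<rho> F h]])
  then obtain Q' where Q': "cpt_smooth ?V Q'"
      "\<And>g. smooth_on ?V g \<Longrightarrow> (\<integral>v. pair (P g v) (?Q v) \<partial>lborel) = (\<integral>v. pair (g v) (Q' v) \<partial>lborel)"
    using diffopD(5)[of ?V P] P(1) unfolding cone_op_def by blast
  obtain K where K: "smooth_on UNIV Q'" "compact K" "K \<subseteq> ?V" "\<And>v. v \<notin> K \<Longrightarrow> Q' v = 0"
    using Q'(1) unfolding cpt_smooth_def by blast
  have "\<exists>x. smooth_on ?V x \<and> (\<forall>v\<in>?V. ?H v *v x v = Q' v)"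
  proof (rule smooth_linear_solve)
    show "smooth_on ?V (\<lambda>v. ?H v $ i $ j)" for i j by (rule hloc_smooth[OF C \<rho> F])
    show "smooth_on ?V Q'" by (rule smooth_on_subset[OF K(1) subset_UNIV])
    show "x = 0" if "v \<in> ?V" "?H v *v x = 0" for v x by (rule hloc_injective[OF C \<rho> F that])
  qed
  then obtain x where x: "smooth_on ?V x" "\<forall>v\<in>?V. ?H v *v x v = Q' v" by blast
  \<comment> \<open>Off the coordinate domain the smooth solution \<open>x\<close> is arbitrary, so
    it is cut to 0 there; inside, injectivity makes it vanish off the support \<open>K\<close> of
    \<open>Q'\<close>.\<close>
  define h' where "h' v = (if v \<in> ?V then cnjv (x v) else 0)" for v
  have h': "cpt_smooth ?V h'"
  proof (rule cpt_smoothI[OF V _ K(2,3)])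
    show "smooth_on ?V h'"
      by (rule smooth_on_cong[THEN iffD2, OF _ smooth_on_cnjv[OF x(1)]]) (simp add: h'_def)
    fix v assume "v \<notin> K"
    then have "v \<in> ?V \<Longrightarrow> ?H v *v x v = 0" using x(2) K(4) by simp
    then have "v \<in> ?V \<Longrightarrow> x v = 0" using hloc_injective[OF C \<rho> F] by blast
    then show "h' v = 0" by (simp add: h'_def cc0)
  qed
  have h'Q: "?H v *v cnjv (h' v) = Q' v" for v
  proof (cases "v \<in> ?V")
    case True
    have "cnjv (cnjv (x v)) = x v" by (simp add: cnjv_def vec_eq_iff)
    then show ?thesis using True x(2) by (simp add: h'_def)
  next
    case False
    then have "Q' v = 0" using K(3,4) by blast
    then show ?thesis using False by (simp add: h'_def cc0)
  qed
  have "ip G m (Aw \<eta>) (sect U \<phi> W e h) = ip G m \<eta> (sect U \<phi> W e h')" if \<eta>: "\<eta> \<in> cone_test_sections G" for \<eta>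
  proof -
    have s: "\<eta> \<in> cone_smooth_sections G" using \<eta> unfolding cone_test_sections_def by blast
    have "ip G m (Aw \<eta>) (sect U \<phi> W e h) = (\<integral>v. pair (cyl_rep G (U, \<phi>) e (Aw \<eta>) v) (?H v *v cnjv (h v)) \<partial>lborel)"
      by (rule ip_sect[OF C \<rho> F h smooth_msec[OF Aw_smooth[OF s]]])
    also have "\<dots> = (\<integral>v. pair (P (cyl_rep G (U, \<phi>) e \<eta>) v) (?Q v) \<partial>lborel)"
    proof (rule Bochner_Integration.integral_cong[OF refl])
      fix v :: "'n pt"
      have pc: "pair (a *s x) y = pair x (a *s y)" for a and x y :: "'r cvec" by (simp add: pair_def mult_ac)
      show "pair (cyl_rep G (U, \<phi>) e (Aw \<eta>) v) (?H v *v cnjv (h v)) = pair (P (cyl_rep G (U, \<phi>) e \<eta>) v) (?Q v)"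
      proof (cases "v \<in> ?V")
        case True
        show ?thesis unfolding P(2)[OF s True] by (rule pc)
      next
        case False
        then have "h v = 0" using h unfolding cpt_smooth_def by blast
        then have "?H v *v cnjv (h v) = 0" by (simp only: cc0 matrix_vector_mult_0_right)
        then show ?thesis by simp
      qed
    qed
    also have "\<dots> = (\<integral>v. pair (cyl_rep G (U, \<phi>) e \<eta> v) (Q' v) \<partial>lborel)"
      by (rule Q'(2)[OF cone_smoothD(2)[OF s C F]])
    also have "\<dots> = ip G m \<eta> (sect U \<phi> W e h')"
      unfolding ip_sect[OF C \<rho> F h' smooth_msec[OF s]] h'Q ..
    finally show ?thesis .
  qed
  then show ?thesis using sect_test[OF C F h'] by blast
qed

text \<open>Only test sections that have a formal adjoint are available for testing. By
  \<open>formal_adjoint_sect\<close> the sections supported in a chart are among them, and these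
  already separate L2.\<close>

lemma weak_unique:
  assumes f: "f \<in> L2 G m"
    and orth: "\<And>\<phi> \<psi>. \<phi> \<in> cone_test_sections G \<Longrightarrow> \<psi> \<in> cone_test_sections G \<Longrightarrow>
      (\<And>\<eta>. \<eta> \<in> cone_test_sections G \<Longrightarrow> ip G m (Aw \<eta>) \<phi> = ip G m \<eta> \<psi>) \<Longrightarrow> ip G m f \<phi> = 0"
  shows "L2norm G m f = 0"
proof (rule sect_orthogonal_imp_zero[OF f])
  fix U \<phi> W e and h :: "'n pt \<Rightarrow> 'r cvec"
  assume C: "(U, \<phi>) \<in> charts G" and F: "(W, e) \<in> frames G" and h: "cpt_smooth (cdom U \<phi> W) h"
  obtain \<psi> where "\<psi> \<in> cone_test_sections G" "\<forall>\<eta>\<in>cone_test_sections G. ip G m (Aw \<eta>) (sect U \<phi> W e h) = ip G m \<eta> \<psi>"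
    using formal_adjoint_sect[OF C F h] by blast
  then show "ip G m f (sect U \<phi> W e h) = 0" by (intro orth[OF sect_test[OF C F h]]) auto
qed

end

section \<open>Orthogonal projection\<close>

text \<open>Only semi-definite, and on a subset \<open>V\<close> of a vector space of functions,
  since null sections are not divided out. The instances are the L2 product and the graph product on
  the maximal domain.\<close>

locale semi_inner_product = vs: vector_space sc
  for sc :: "complex \<Rightarrow> 'v::ab_group_add \<Rightarrow> 'v" +
  fixes V :: "'v set" and p :: "'v \<Rightarrow> 'v \<Rightarrow> complex"
  assumes V_add: "u \<in> V \<Longrightarrow> v \<in> V \<Longrightarrow> u + v \<in> V"
    and V_sc: "u \<in> V \<Longrightarrow> sc c u \<in> V"
    and p_add_left: "u \<in> V \<Longrightarrow> v \<in> V \<Longrightarrow> w \<in> V \<Longrightarrow> p (u + v) w = p u w + p v w"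
    and p_sc_left: "u \<in> V \<Longrightarrow> w \<in> V \<Longrightarrow> p (sc c u) w = c * p u w"
    and p_cnj: "u \<in> V \<Longrightarrow> w \<in> V \<Longrightarrow> p w u = cnj (p u w)"
    and p_nonneg: "u \<in> V \<Longrightarrow> Re (p u u) \<ge> 0"
begin

definition nrm :: "'v \<Rightarrow> real" where
  "nrm u = sqrt (Re (p u u))"

lemma V_minus: "u \<in> V \<Longrightarrow> v \<in> V \<Longrightarrow> u - v \<in> V"
  using V_add[of u "sc (-1) v"] V_sc[of v "-1"] by simp

lemma p_add_right: "u \<in> V \<Longrightarrow> v \<in> V \<Longrightarrow> w \<in> V \<Longrightarrow> p w (u + v) = p w u + p w v"
  by (simp add: p_cnj[of _ w] p_add_left V_add)

lemma p_sc_right: "u \<in> V \<Longrightarrow> w \<in> V \<Longrightarrow> p w (sc c u) = cnj c * p w u"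
  by (simp add: p_cnj[of _ w] p_sc_left V_sc)

lemma p_minus_left: "u \<in> V \<Longrightarrow> v \<in> V \<Longrightarrow> w \<in> V \<Longrightarrow> p (u - v) w = p u w - p v w"
  using p_add_left[of u "sc (-1) v" w] p_sc_left[of v w "-1"] V_sc[of v "-1"] by simp

lemma p_minus_right: "u \<in> V \<Longrightarrow> v \<in> V \<Longrightarrow> w \<in> V \<Longrightarrow> p w (u - v) = p w u - p w v"
  using p_add_right[of u "sc (-1) v" w] p_sc_right[of v w "-1"] V_sc[of v "-1"] by simp

lemma nrm_ge0: "u \<in> V \<Longrightarrow> nrm u \<ge> 0"
  by (simp add: nrm_def p_nonneg)

lemma nrm_sq: "u \<in> V \<Longrightarrow> (nrm u)\<^sup>2 = Re (p u u)"
  by (simp add: nrm_def p_nonneg)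

lemma p_self: "u \<in> V \<Longrightarrow> p u u = of_real ((nrm u)\<^sup>2)"
  using p_cnj[of u u] by (simp add: nrm_sq complex_eq_iff)

text \<open>One expansion serves both the Cauchy-Schwarz inequality and the first variation at a
  nearest point; the phase of \<open>p u v\<close> is built into the perturbation, so that only a
  real parameter \<open>s\<close> remains.\<close>

lemma nrm_sq_minus_sc:
  assumes "u \<in> V" "v \<in> V"
  shows "(nrm (u - sc (of_real s * p u v) v))\<^sup>2 = (nrm u)\<^sup>2 - 2 * s * (cmod (p u v))\<^sup>2 + s\<^sup>2 * (cmod (p u v))\<^sup>2 * (nrm v)\<^sup>2"
proof -
  define z where "z = p u v"
  let ?c = "of_real s * z"
  have cv: "sc ?c v \<in> V" using assms V_sc by blast
  have vu: "p v u = cnj z" unfolding z_def by (rule p_cnj[OF assms])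
  have "p (u - sc ?c v) (u - sc ?c v) = (p u u - ?c * p v u) - cnj ?c * (p u v - ?c * p v v)"
    using assms cv V_minus[OF assms(1) cv] p_sc_right[OF assms(2) V_minus[OF assms(1) cv], of ?c]
    by (simp add: p_minus_left p_minus_right p_sc_left)
  also have "\<dots> = (p u u - ?c * cnj z) - cnj ?c * (z - ?c * p v v)"
    unfolding vu z_def[symmetric] ..
  also have "\<dots> = of_real ((nrm u)\<^sup>2) - 2 * of_real s * (z * cnj z) + (of_real s)\<^sup>2 * (z * cnj z) * of_real ((nrm v)\<^sup>2)"
    by (simp add: p_self assms algebra_simps power2_eq_square)
  also have "z * cnj z = of_real ((cmod z)\<^sup>2)" by (rule complex_norm_square[symmetric])
  finally have "p (u - sc ?c v) (u - sc ?c v) = of_real ((nrm u)\<^sup>2 - 2 * s * (cmod z)\<^sup>2 + s\<^sup>2 * (cmod z)\<^sup>2 * (nrm v)\<^sup>2)"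
    by simp
  then show ?thesis using nrm_sq[OF V_minus[OF assms(1) cv]] by (simp only: z_def) simp
qed

lemma Cauchy_Schwarz:
  assumes "u \<in> V" "v \<in> V"
  shows "cmod (p u v) \<le> nrm u * nrm v"
proof -
  define c where "c = (cmod (p u v))\<^sup>2"
  define a where "a = (nrm u)\<^sup>2"
  define b where "b = (nrm v)\<^sup>2"
  have c: "c \<ge> 0" and a: "a \<ge> 0" and b: "b \<ge> 0" by (auto simp: c_def a_def b_def)
  have pos: "0 \<le> a - 2 * s * c + s\<^sup>2 * c * b" for s
    using nrm_sq_minus_sc[OF assms, of s] unfolding a_def b_def c_def by (metis zero_le_power2)
  have "c \<le> a * b"
  \<comment> \<open>For b = 0 the quadratic in s is affine, and s = (a + 1) / c would make it
    negative unless c = 0. For b > 0 the choice s = 1 / b minimises it.\<close>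
  proof (cases "b = 0")
    case True
    have "0 \<le> a - 2 * ((a + 1) / c) * c" if "c > 0" using pos[of "(a + 1) / c"] True by simp
    then show ?thesis using c a True by (cases "c = 0") auto
  next
    case False
    then have "b > 0" using b by simp
    then have "(1 / b)\<^sup>2 * c * b = c / b" by (simp add: power2_eq_square)
    then have "0 \<le> a - c / b" using pos[of "1 / b"] by simp
    then show ?thesis using \<open>b > 0\<close> by (simp add: pos_divide_le_eq)
  qed
  then have "(cmod (p u v))\<^sup>2 \<le> (nrm u * nrm v)\<^sup>2" by (simp add: a_def b_def c_def power_mult_distrib)
  then show ?thesis by (rule power2_le_imp_le) (simp add: nrm_ge0 assms)
qed

lemma nrm_sq_add: "u \<in> V \<Longrightarrow> v \<in> V \<Longrightarrow> (nrm (u + v))\<^sup>2 = (nrm u)\<^sup>2 + (nrm v)\<^sup>2 + 2 * Re (p u v)"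
  using p_cnj[of u v] by (simp add: nrm_sq V_add p_add_left p_add_right)

lemma nrm_sq_minus: "u \<in> V \<Longrightarrow> v \<in> V \<Longrightarrow> (nrm (u - v))\<^sup>2 = (nrm u)\<^sup>2 + (nrm v)\<^sup>2 - 2 * Re (p u v)"
  using p_cnj[of u v] by (simp add: nrm_sq V_minus p_minus_left p_minus_right)

lemma nrm_triangle: "u \<in> V \<Longrightarrow> v \<in> V \<Longrightarrow> nrm (u + v) \<le> nrm u + nrm v"
proof -
  assume a: "u \<in> V" "v \<in> V"
  have "(nrm (u + v))\<^sup>2 \<le> (nrm u)\<^sup>2 + (nrm v)\<^sup>2 + 2 * (nrm u * nrm v)"
    using nrm_sq_add[OF a] Cauchy_Schwarz[OF a] complex_Re_le_cmod[of "p u v"] by linarith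
  also have "\<dots> = (nrm u + nrm v)\<^sup>2" by (simp add: power2_sum)
  finally show ?thesis by (rule power2_le_imp_le) (simp add: nrm_ge0 a)
qed

lemma nrm_sc: "u \<in> V \<Longrightarrow> nrm (sc c u) = cmod c * nrm u"
proof -
  assume u: "u \<in> V"
  have "p (sc c u) (sc c u) = (c * cnj c) * p u u" using u V_sc by (simp add: p_sc_left p_sc_right)
  also have "\<dots> = of_real ((cmod c)\<^sup>2 * (nrm u)\<^sup>2)"
    using complex_norm_square[of c] by (simp add: p_self u)
  finally have "(nrm (sc c u))\<^sup>2 = (cmod c * nrm u)\<^sup>2"
    using nrm_sq[OF V_sc[OF u], of c] by (simp add: power_mult_distrib)
  then show ?thesis by (simp add: nrm_ge0 u V_sc power2_eq_iff_nonneg)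
qed

lemma nrm_minus_commute: "u \<in> V \<Longrightarrow> v \<in> V \<Longrightarrow> nrm (u - v) = nrm (v - u)"
  using nrm_sc[OF V_minus, of u v "-1"] by simp

lemma nrm_triangle_minus: "u \<in> V \<Longrightarrow> v \<in> V \<Longrightarrow> nrm (u - v) \<le> nrm u + nrm v"
  using nrm_triangle[of u "sc (-1) v"] nrm_sc[of v "-1"] V_sc[of v "-1"] by simp

lemma nrm_triangle3: "u \<in> V \<Longrightarrow> v \<in> V \<Longrightarrow> w \<in> V \<Longrightarrow> nrm (u - w) \<le> nrm (u - v) + nrm (v - w)"
  using nrm_triangle[OF V_minus V_minus, of u v v w] by simp

lemma nrm_le_add: "u \<in> V \<Longrightarrow> v \<in> V \<Longrightarrow> nrm u \<le> nrm v + nrm (u - v)"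
  using nrm_triangle[OF _ V_minus, of v u v] by simp

lemma nrm_null_cong: "u \<in> V \<Longrightarrow> v \<in> V \<Longrightarrow> nrm (u - v) = 0 \<Longrightarrow> nrm u = nrm v"
  using nrm_le_add[of u v] nrm_le_add[of v u] nrm_minus_commute[of u v] by simp

lemma p_null: "u \<in> V \<Longrightarrow> w \<in> V \<Longrightarrow> nrm u = 0 \<Longrightarrow> p u w = 0"
  using Cauchy_Schwarz[of u w] by simp

lemma p_null_cong: "u \<in> V \<Longrightarrow> v \<in> V \<Longrightarrow> w \<in> V \<Longrightarrow> nrm (u - v) = 0 \<Longrightarrow> p u w = p v w"
  using p_null[OF V_minus, of u v w] by (simp add: p_minus_left)

text \<open>Nearest point argument: the parallelogram law makes a minimising sequence Cauchy, and
  the first variation at its limit gives orthogonality. Completeness is a hypothesis on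
  \<open>S\<close>, in terms of the seminorm.\<close>

theorem orthogonal_projection:
  assumes S: "S \<subseteq> V" "0 \<in> S" "\<And>u v. u \<in> S \<Longrightarrow> v \<in> S \<Longrightarrow> u + v \<in> S" "\<And>c u. u \<in> S \<Longrightarrow> sc c u \<in> S"
    and complete: "\<And>d. (\<And>n. d n \<in> S) \<Longrightarrow> (\<And>\<epsilon>. \<epsilon> > 0 \<Longrightarrow> \<exists>N. \<forall>i\<ge>N. \<forall>j\<ge>N. nrm (d i - d j) < \<epsilon>) \<Longrightarrow>
      \<exists>l\<in>S. (\<lambda>n. nrm (d n - l)) \<longlonglongrightarrow> 0"
    and u: "u \<in> V"
  shows "\<exists>d\<in>S. \<forall>s\<in>S. p (u - d) s = 0"
proof -
  define Q where "Q = (\<lambda>s. (nrm (u - s))\<^sup>2) ` S"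
  define \<delta> where "\<delta> = Inf Q"
  have Qne: "Q \<noteq> {}" and Qbdd: "bdd_below Q" using S(2) by (auto simp: Q_def intro!: bdd_belowI[of _ 0])
  have lower: "\<delta> \<le> (nrm (u - s))\<^sup>2" if "s \<in> S" for s
    unfolding \<delta>_def by (rule cInf_lower[OF _ Qbdd]) (use that in \<open>simp add: Q_def\<close>)
  have "\<exists>s\<in>S. (nrm (u - s))\<^sup>2 < \<delta> + \<epsilon>" if "\<epsilon> > 0" for \<epsilon>
  proof -
    have "Inf Q < \<delta> + \<epsilon>" using that by (simp add: \<delta>_def)
    then obtain x where "x \<in> Q" "x < \<delta> + \<epsilon>" using cInf_lessD[OF Qne] by blast
    then show ?thesis by (auto simp: Q_def)
  qed
  then have "\<forall>n. \<exists>s. s \<in> S \<and> (nrm (u - s))\<^sup>2 < \<delta> + inverse (real (Suc n))" by (metis inverse_positive_iff_positive of_nat_0_less_iff zero_less_Suc)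
  from choice[OF this] obtain d where d: "\<And>n. d n \<in> S" "\<And>n. (nrm (u - d n))\<^sup>2 < \<delta> + inverse (real (Suc n))" by blast
  have dV: "d n \<in> V" for n using d(1) S(1) by blast
  have half: "sc (1 / 2) (x + y) \<in> S" if "x \<in> S" "y \<in> S" for x y using S(3,4) that by blast
  have par: "(nrm (d i - d j))\<^sup>2 \<le> 2 * inverse (real (Suc i)) + 2 * inverse (real (Suc j))" for i j
  proof -
    let ?a = "u - d i" and ?b = "u - d j"
    have ab: "?a \<in> V" "?b \<in> V" using u dV V_minus by auto
    have e1: "d j - d i = ?a - ?b" by simp
    \<comment> \<open>The midpoint of two members of the sequence lies in \<open>S\<close>, so its
      squared distance to \<open>u\<close> is at least \<delta>; this bounds one term of the
      parallelogram law from below.\<close>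
    have "?a + ?b = sc 2 (u - sc (1 / 2) (d i + d j))"
    proof -
      have "sc 2 u = u + u" using vs.scale_left_distrib[of 1 1 u] by simp
      then show ?thesis by (simp add: vs.scale_right_diff_distrib)
    qed
    then have "(nrm (?a + ?b))\<^sup>2 = 4 * (nrm (u - sc (1 / 2) (d i + d j)))\<^sup>2"
      using nrm_sc[OF V_minus[OF u V_sc[OF V_add[OF dV dV]]], of 2 "1 / 2" i j] by (simp add: power_mult_distrib)
    moreover have "\<delta> \<le> (nrm (u - sc (1 / 2) (d i + d j)))\<^sup>2" by (rule lower[OF half[OF d(1) d(1)]])
    moreover have "(nrm (?a + ?b))\<^sup>2 + (nrm (?a - ?b))\<^sup>2 = 2 * (nrm ?a)\<^sup>2 + 2 * (nrm ?b)\<^sup>2"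
      using nrm_sq_add[OF ab] nrm_sq_minus[OF ab] by simp
    moreover have "nrm (d i - d j) = nrm (?a - ?b)" unfolding e1[symmetric] by (rule nrm_minus_commute[OF dV dV])
    ultimately show ?thesis using d(2)[of i] d(2)[of j] by simp
  qed
  have "\<exists>N. \<forall>i\<ge>N. \<forall>j\<ge>N. nrm (d i - d j) < \<epsilon>" if \<epsilon>: "\<epsilon> > 0" for \<epsilon>
  proof -
    obtain N where N: "inverse (real (Suc N)) < \<epsilon>\<^sup>2 / 4" using reals_Archimedean[of "\<epsilon>\<^sup>2 / 4"] \<epsilon> by auto
    have "nrm (d i - d j) < \<epsilon>" if "i \<ge> N" "j \<ge> N" for i j
    proof -
      have "inverse (real (Suc i)) \<le> inverse (real (Suc N))" "inverse (real (Suc j)) \<le> inverse (real (Suc N))"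
        using that by (auto intro!: le_imp_inverse_le)
      then have "(nrm (d i - d j))\<^sup>2 < \<epsilon>\<^sup>2" using par[of i j] N by linarith
      then show ?thesis using \<epsilon> by (simp add: power2_less_imp_less)
    qed
    then show ?thesis by blast
  qed
  from complete[OF d(1) this] obtain l where l: "l \<in> S" "(\<lambda>n. nrm (d n - l)) \<longlonglongrightarrow> 0" by blast
  have lV: "l \<in> V" using l(1) S(1) by blast
  have "(nrm (u - l))\<^sup>2 \<le> \<delta>"
  proof (rule LIMSEQ_le_const)
    have "(\<lambda>n. (sqrt (\<delta> + inverse (real (Suc n))) + nrm (d n - l))\<^sup>2) \<longlonglongrightarrow> (sqrt (\<delta> + 0) + 0)\<^sup>2"
      by (intro tendsto_intros l(2) LIMSEQ_inverse_real_of_nat)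
    moreover have "\<delta> \<ge> 0" unfolding \<delta>_def using Qne by (intro cInf_greatest) (auto simp: Q_def)
    ultimately show "(\<lambda>n. (sqrt (\<delta> + inverse (real (Suc n))) + nrm (d n - l))\<^sup>2) \<longlonglongrightarrow> \<delta>" by simp
    have "(nrm (u - l))\<^sup>2 \<le> (sqrt (\<delta> + inverse (real (Suc n))) + nrm (d n - l))\<^sup>2" for n
    proof (rule power_mono)
      have "nrm (u - d n) \<le> sqrt (\<delta> + inverse (real (Suc n)))" using d(2)[of n] by (intro real_le_rsqrt) simp
      then show "nrm (u - l) \<le> sqrt (\<delta> + inverse (real (Suc n))) + nrm (d n - l)"
        using nrm_triangle3[OF u dV lV, of n] by simp
    qed (simp add: nrm_ge0 V_minus u lV)
    then show "\<exists>N. \<forall>n\<ge>N. (nrm (u - l))\<^sup>2 \<le> (sqrt (\<delta> + inverse (real (Suc n))) + nrm (d n - l))\<^sup>2" by blast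
  qed
  then have eq: "(nrm (u - l))\<^sup>2 = \<delta>" using lower[OF l(1)] by simp
  have "p (u - l) s = 0" if s: "s \<in> S" for s
  proof (rule ccontr)
    assume z: "p (u - l) s \<noteq> 0"
    have sV: "s \<in> V" and w: "u - l \<in> V" using s S(1) u lV V_minus by auto
    define c where "c = (cmod (p (u - l) s))\<^sup>2"
    have c: "c > 0" using z by (simp add: c_def)
    have ineq: "\<delta> \<le> \<delta> - 2 * t * c + t\<^sup>2 * c * (nrm s)\<^sup>2" for t
    proof -
      let ?k = "of_real t * p (u - l) s"
      have "u - l - sc ?k s = u - (l + sc ?k s)" by simp
      then have "\<delta> \<le> (nrm (u - l - sc ?k s))\<^sup>2" using lower[OF S(3)[OF l(1) S(4)[OF s]]] by metis
      also have "\<dots> = \<delta> - 2 * t * c + t\<^sup>2 * c * (nrm s)\<^sup>2"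
        unfolding nrm_sq_minus_sc[OF w sV] eq c_def ..
      finally show ?thesis .
    qed
    define b where "b = (nrm s)\<^sup>2"
    \<comment> \<open>Any positive t with t b < 2 makes the variation -2 t c + t^2 c b negative; the
      summand 1 avoids a division by zero.\<close>
    define t where "t = 1 / (b + 1)"
    have b: "b \<ge> 0" by (simp add: b_def)
    then have t: "t > 0" "t * b < 1" by (auto simp: t_def field_simps)
    have "0 \<le> t * c * (t * b - 2)" using ineq[of t, folded b_def] by (simp add: algebra_simps power2_eq_square)
    then have "0 \<le> t * b - 2" using mult_pos_pos[OF t(1) c] zero_le_mult_iff[of "t * c" "t * b - 2"] by linarith
    then show False using t(2) by linarith
  qed
  with l(1) show ?thesis by blast
qed

end

section \<open>Closed extensions\<close>

context cone_model_operator
begin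

interpretation vs: vector_space "scl G" by (rule vs)

lemma vs_sec: "vector_space (sscl G :: complex \<Rightarrow> ('a, 'f) csec \<Rightarrow> _)"
  by unfold_locales (auto simp: sscl_def fun_eq_iff vs.scale_right_distrib vs.scale_left_distrib)

sublocale L2: semi_inner_product "sscl G" "L2 G m" "ip G m"
proof -
  interpret vector_space "sscl G :: complex \<Rightarrow> ('a, 'f) csec \<Rightarrow> _" by (rule vs_sec)
  show "semi_inner_product (sscl G) (L2 G m) (ip G m)"
    by unfold_locales (auto intro: L2_add L2_sscl ip_add_left ip_sscl_left ip_cnj ip_self_nonneg)
qed

abbreviation N where "N \<equiv> L2.nrm"
abbreviation T where "T \<equiv> cone_test_sections G"
abbreviation Dm where "Dm \<equiv> Dmax G m Aw"
abbreviation D0 where "D0 \<equiv> Dmin G m Aw"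
abbreviation AM where "AM \<equiv> Amax G m Aw"

lemma L2norm_eq: "L2norm G m = N"
  by (simp add: fun_eq_iff L2norm_def L2.nrm_def)

lemma zero_L2: "0 \<in> L2 G m"
  by (rule cone_test_L2[OF cone_test_zero])

text \<open>Sections are functions on all of \<open>real \<times> 'a\<close>, while the identities
  for \<open>Aw\<close> hold over the open cone only; they become usable as statements that a
  difference has norm 0.\<close>

lemma N_cone_zero: "u \<in> L2 G m \<Longrightarrow> (\<And>t y. t > 0 \<Longrightarrow> y \<in> bd G \<Longrightarrow> u (t, y) = 0) \<Longrightarrow> N u = 0"
  unfolding L2norm_eq[symmetric] by (subst L2norm_zero_iff) (auto simp: space_cone_measure intro!: AE_I2)

lemma test_smooth: "u \<in> T \<Longrightarrow> u \<in> cone_smooth_sections G"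
  unfolding cone_test_sections_def by blast

lemma test_L2: "u \<in> T \<Longrightarrow> u \<in> L2 G m"
  by (rule cone_test_L2)

lemma Aw_L2: "u \<in> T \<Longrightarrow> Aw u \<in> L2 G m"
  by (rule cone_test_L2[OF Aw_test])

lemma N_Aw_add: "u \<in> T \<Longrightarrow> v \<in> T \<Longrightarrow> N (Aw (u + v) - (Aw u + Aw v)) = 0"
  by (rule N_cone_zero) (auto intro!: L2_minus L2_add Aw_L2 cone_test_add simp: Aw_add test_smooth)

lemma N_Aw_sscl: "u \<in> T \<Longrightarrow> N (Aw (sscl G c u) - sscl G c (Aw u)) = 0"
  by (intro N_cone_zero L2_minus L2_sscl Aw_L2 cone_test_sscl) (simp_all add: Aw_sscl test_smooth sscl_def[of G c "Aw u"])

lemma N_Aw_kappa: "\<rho> > 0 \<Longrightarrow> u \<in> T \<Longrightarrow> N (Aw (kappa G m \<rho> u) - sscl G (of_real (\<rho> ^ m)) (kappa G m \<rho> (Aw u))) = 0"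
  by (intro N_cone_zero L2_minus L2_sscl Aw_L2 cone_test_kappa kappa_L2)
    (simp_all add: Aw_kappa test_smooth sscl_def[of G _ "kappa G m \<rho> (Aw u)"])

subsection \<open>The maximal operator\<close>

abbreviation weak where "weak \<equiv> weak_eq G m Aw"

lemma weakD: "weak u f \<Longrightarrow> u \<in> L2 G m" "weak u f \<Longrightarrow> f \<in> L2 G m"
  "weak u f \<Longrightarrow> \<phi> \<in> T \<Longrightarrow> \<psi> \<in> T \<Longrightarrow> (\<And>\<eta>. \<eta> \<in> T \<Longrightarrow> ip G m (Aw \<eta>) \<phi> = ip G m \<eta> \<psi>) \<Longrightarrow> ip G m f \<phi> = ip G m u \<psi>"
  unfolding weak_eq_def by auto

lemma weakI:
  assumes "u \<in> L2 G m" "f \<in> L2 G m"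
    "\<And>\<phi> \<psi>. \<phi> \<in> T \<Longrightarrow> \<psi> \<in> T \<Longrightarrow> (\<And>\<eta>. \<eta> \<in> T \<Longrightarrow> ip G m (Aw \<eta>) \<phi> = ip G m \<eta> \<psi>) \<Longrightarrow> ip G m f \<phi> = ip G m u \<psi>"
  shows "weak u f"
  unfolding weak_eq_def using assms by simp

lemma weak_add: "weak u f \<Longrightarrow> weak v g \<Longrightarrow> weak (u + v) (f + g)"
proof (rule weakI)
  fix \<phi> \<psi> assume a: "weak u f" "weak v g" and t: "\<phi> \<in> T" "\<psi> \<in> T" "\<And>\<eta>. \<eta> \<in> T \<Longrightarrow> ip G m (Aw \<eta>) \<phi> = ip G m \<eta> \<psi>"
  show "ip G m (f + g) \<phi> = ip G m (u + v) \<psi>"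
    using weakD(3)[OF a(1) t] weakD(3)[OF a(2) t] weakD(1,2)[OF a(1)] weakD(1,2)[OF a(2)] test_L2[OF t(1)] test_L2[OF t(2)]
    by (simp add: ip_add_left)
qed (auto intro: L2_add weakD)

lemma weak_sscl: "weak u f \<Longrightarrow> weak (sscl G c u) (sscl G c f)"
proof (rule weakI)
  fix \<phi> \<psi> assume a: "weak u f" and t: "\<phi> \<in> T" "\<psi> \<in> T" "\<And>\<eta>. \<eta> \<in> T \<Longrightarrow> ip G m (Aw \<eta>) \<phi> = ip G m \<eta> \<psi>"
  show "ip G m (sscl G c f) \<phi> = ip G m (sscl G c u) \<psi>"
    using weakD(3)[OF a t] weakD(1,2)[OF a] test_L2[OF t(1)] test_L2[OF t(2)] by (simp add: ip_sscl_left)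
qed (auto intro: L2_sscl weakD)

text \<open>The difference of two weak images annihilates every test section that has a formal
  adjoint, so \<open>weak_unique\<close> applies.\<close>

lemma weak_N_unique:
  assumes a: "weak u f" "weak u g"
  shows "N (f - g) = 0"
  unfolding L2norm_eq[symmetric]
proof (rule weak_unique)
  show "f - g \<in> L2 G m" using weakD(2)[OF a(1)] weakD(2)[OF a(2)] by (rule L2_minus)
  fix \<phi> \<psi> assume t: "\<phi> \<in> T" "\<psi> \<in> T" "\<And>\<eta>. \<eta> \<in> T \<Longrightarrow> ip G m (Aw \<eta>) \<phi> = ip G m \<eta> \<psi>"
  show "ip G m (f - g) \<phi> = 0"
    using weakD(3)[OF a(1) t] weakD(3)[OF a(2) t] L2.p_minus_left[OF weakD(2)[OF a(1)] weakD(2)[OF a(2)] test_L2[OF t(1)]]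
    by simp
qed

lemma Amax_weak: "u \<in> Dm \<Longrightarrow> weak u (AM u)"
  unfolding Dmax_def Amax_def mem_Collect_eq by (rule someI_ex[of "weak u"])

lemma Dmax_weak: "weak u f \<Longrightarrow> u \<in> Dm"
  unfolding Dmax_def by blast

lemma Dmax_L2: "u \<in> Dm \<Longrightarrow> u \<in> L2 G m"
  by (rule weakD(1)[OF Amax_weak])

lemma AM_L2: "u \<in> Dm \<Longrightarrow> AM u \<in> L2 G m"
  by (rule weakD(2)[OF Amax_weak])

lemma AM_eq: "weak u f \<Longrightarrow> N (AM u - f) = 0"
  by (rule weak_N_unique[OF Amax_weak[OF Dmax_weak]])

lemma Dmax_add: "u \<in> Dm \<Longrightarrow> v \<in> Dm \<Longrightarrow> u + v \<in> Dm"
  by (rule Dmax_weak[OF weak_add[OF Amax_weak Amax_weak]])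

lemma Dmax_sscl: "u \<in> Dm \<Longrightarrow> sscl G c u \<in> Dm"
  by (rule Dmax_weak[OF weak_sscl[OF Amax_weak]])

lemma weak_minus: "weak u f \<Longrightarrow> weak v g \<Longrightarrow> weak (u - v) (f - g)"
  using weak_add[of u f "sscl G (-1) v" "sscl G (-1) g"] weak_sscl[of v g "-1"] by (simp add: sscl_simps)

lemma Dmax_minus: "u \<in> Dm \<Longrightarrow> v \<in> Dm \<Longrightarrow> u - v \<in> Dm"
  by (rule Dmax_weak[OF weak_minus[OF Amax_weak Amax_weak]])

lemma AM_add: "u \<in> Dm \<Longrightarrow> v \<in> Dm \<Longrightarrow> N (AM (u + v) - (AM u + AM v)) = 0"
  by (rule AM_eq[OF weak_add[OF Amax_weak Amax_weak]])

lemma AM_sscl: "u \<in> Dm \<Longrightarrow> N (AM (sscl G c u) - sscl G c (AM u)) = 0"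
  by (rule AM_eq[OF weak_sscl[OF Amax_weak]])

lemma AM_minus: "u \<in> Dm \<Longrightarrow> v \<in> Dm \<Longrightarrow> N (AM (u - v) - (AM u - AM v)) = 0"
  by (rule AM_eq[OF weak_minus[OF Amax_weak Amax_weak]])

text \<open>\<open>AM\<close> is a choice and hence linear only up to null sections; inner products
  do not see these, which makes the graph product sesquilinear on the nose.\<close>

lemma ip_graph_cong:
  assumes "u \<in> Dm" "v \<in> Dm" "w \<in> L2 G m"
  shows "ip G m (AM (u + v)) w = ip G m (AM u) w + ip G m (AM v) w"
    "ip G m (AM (sscl G c u)) w = c * ip G m (AM u) w"
  using L2.p_null_cong[OF AM_L2[OF Dmax_add[OF assms(1,2)]] L2_add[OF AM_L2[OF assms(1)] AM_L2[OF assms(2)]] assms(3) AM_add[OF assms(1,2)]]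
    L2.p_null_cong[OF AM_L2[OF Dmax_sscl[OF assms(1)]] L2_sscl[OF AM_L2[OF assms(1)]] assms(3) AM_sscl[OF assms(1)]]
    ip_add_left[OF AM_L2[OF assms(1)] AM_L2[OF assms(2)] assms(3)] ip_sscl_left[OF AM_L2[OF assms(1)] assms(3)]
  by simp_all

sublocale graph: semi_inner_product "sscl G" Dm "graph_ip G m Aw"
proof (unfold_locales, goal_cases)
  case (3 u v w)
  then show ?case by (simp add: graph_ip_def ip_graph_cong AM_L2 Dmax_L2 ip_add_left)
next
  case (4 u w c)
  then show ?case by (simp add: graph_ip_def ip_graph_cong[of u u] AM_L2 Dmax_L2 ip_sscl_left distrib_left)
next
  case (5 u w)
  show ?case unfolding graph_ip_def complex_cnj_add
    using ip_cnj[OF AM_L2[OF 5(1)] AM_L2[OF 5(2)]] ip_cnj[OF Dmax_L2[OF 5(1)] Dmax_L2[OF 5(2)]] by (simp only:)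
next
  case (6 u)
  then show ?case by (simp add: graph_ip_def ip_self_nonneg AM_L2 Dmax_L2)
qed (auto intro: Dmax_add Dmax_sscl)

abbreviation gn where "gn \<equiv> graph.nrm"

lemma graph_norm_eq: "graph_norm G m Aw = gn"
  by (simp add: fun_eq_iff graph_norm_def graph.nrm_def)

lemma gn_sq: "u \<in> Dm \<Longrightarrow> (gn u)\<^sup>2 = (N (AM u))\<^sup>2 + (N u)\<^sup>2"
  by (simp add: graph.nrm_sq L2.nrm_sq AM_L2 Dmax_L2 graph_ip_def)

lemma N_le_gn: "u \<in> Dm \<Longrightarrow> N u \<le> gn u"
  by (rule power2_le_imp_le[OF _ graph.nrm_ge0]) (simp_all add: gn_sq)

lemma AM_le_gn: "u \<in> Dm \<Longrightarrow> N (AM u) \<le> gn u"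
  by (rule power2_le_imp_le[OF _ graph.nrm_ge0]) (simp_all add: gn_sq)

lemma gn_le: "u \<in> Dm \<Longrightarrow> gn u \<le> N (AM u) + N u"
proof -
  assume u: "u \<in> Dm"
  have "(gn u)\<^sup>2 \<le> (N (AM u) + N u)\<^sup>2"
    using gn_sq[OF u] L2.nrm_ge0[OF AM_L2[OF u]] L2.nrm_ge0[OF Dmax_L2[OF u]] by (simp add: power2_sum)
  then show ?thesis
    by (rule power2_le_imp_le) (simp add: L2.nrm_ge0 AM_L2 Dmax_L2 u)
qed

subsection \<open>The minimal domain\<close>

text \<open>Passing to the limit in the identity for formally adjoint pairs shows that the closure
  of \<open>Aw\<close> on test sections is a restriction of the weak maximal operator.\<close>

lemma Dmin_weak:
  assumes u: "u \<in> L2 G m" and f: "f \<in> L2 G m"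
    and app: "\<And>\<epsilon>. \<epsilon> > 0 \<Longrightarrow> \<exists>\<phi>\<in>T. N (u - \<phi>) < \<epsilon> \<and> N (f - Aw \<phi>) < \<epsilon>"
  shows "weak u f"
proof (rule weakI[OF u f])
  fix \<phi>0 \<psi>0 assume t: "\<phi>0 \<in> T" "\<psi>0 \<in> T" "\<And>\<eta>. \<eta> \<in> T \<Longrightarrow> ip G m (Aw \<eta>) \<phi>0 = ip G m \<eta> \<psi>0"
  note L = test_L2[OF t(1)] test_L2[OF t(2)]
  define K where "K = N \<phi>0 + N \<psi>0"
  have K: "K \<ge> 0" using L by (simp add: K_def L2.nrm_ge0)
  have "cmod (ip G m f \<phi>0 - ip G m u \<psi>0) \<le> 0"
  proof (rule field_le_epsilon)
    fix e :: real assume e: "e > 0"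
    define \<epsilon> where "\<epsilon> = e / (K + 1)"
    have \<epsilon>: "\<epsilon> > 0" "\<epsilon> * K \<le> e" using e K by (auto simp: \<epsilon>_def field_simps)
    obtain \<phi> where \<phi>: "\<phi> \<in> T" "N (u - \<phi>) < \<epsilon>" "N (f - Aw \<phi>) < \<epsilon>" using app[OF \<epsilon>(1)] by blast
    note L' = test_L2[OF \<phi>(1)] Aw_L2[OF \<phi>(1)]
    have "ip G m f \<phi>0 - ip G m u \<psi>0 = ip G m (f - Aw \<phi>) \<phi>0 - ip G m (u - \<phi>) \<psi>0"
      using t(3)[OF \<phi>(1)] by (simp add: L2.p_minus_left u f L L')
    also have "cmod \<dots> \<le> cmod (ip G m (f - Aw \<phi>) \<phi>0) + cmod (ip G m (u - \<phi>) \<psi>0)" by (rule norm_triangle_ineq4)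
    also have "\<dots> \<le> N (f - Aw \<phi>) * N \<phi>0 + N (u - \<phi>) * N \<psi>0"
      by (intro add_mono L2.Cauchy_Schwarz L2_minus u f L L')
    also have "\<dots> \<le> \<epsilon> * N \<phi>0 + \<epsilon> * N \<psi>0"
      using \<phi>(2,3) L by (intro add_mono mult_right_mono) (simp_all add: L2.nrm_ge0)
    also have "\<dots> \<le> e" using \<epsilon>(2) by (simp add: K_def distrib_left)
    finally show "cmod (ip G m f \<phi>0 - ip G m u \<psi>0) \<le> 0 + e" by simp
  qed
  then show "ip G m f \<phi>0 = ip G m u \<psi>0" by simp
qed

lemma DminI:
  assumes "u \<in> L2 G m" "f \<in> L2 G m" "\<And>\<epsilon>. \<epsilon> > 0 \<Longrightarrow> \<exists>\<phi>\<in>T. N (u - \<phi>) < \<epsilon> \<and> N (f - Aw \<phi>) < \<epsilon>"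
  shows "u \<in> D0"
  using assms unfolding Dmin_def L2norm_eq by blast

text \<open>\<open>Dmin\<close> supplies some limit \<open>f\<close> of the images; by weak
  uniqueness it differs from \<open>AM u\<close> by a null section, so the images approximate
  \<open>AM u\<close> as well.\<close>

lemma DminE:
  assumes "u \<in> D0"
  shows "u \<in> Dm" "\<epsilon> > 0 \<Longrightarrow> \<exists>\<phi>\<in>T. N (u - \<phi>) < \<epsilon> \<and> N (AM u - Aw \<phi>) < \<epsilon>"
proof -
  from assms obtain f where f: "u \<in> L2 G m" "f \<in> L2 G m"
      "\<forall>\<epsilon>>0. \<exists>\<phi>\<in>T. N (u - \<phi>) < \<epsilon> \<and> N (f - Aw \<phi>) < \<epsilon>"
    unfolding Dmin_def L2norm_eq by blast
  have w: "weak u f" by (rule Dmin_weak[OF f(1,2)]) (use f(3) in simp)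
  show uD: "u \<in> Dm" by (rule Dmax_weak[OF w])
  assume "\<epsilon> > 0"
  then obtain \<phi> where \<phi>: "\<phi> \<in> T" "N (u - \<phi>) < \<epsilon>" "N (f - Aw \<phi>) < \<epsilon>" using f(3) by blast
  have "N (AM u - Aw \<phi>) \<le> N (AM u - f) + N (f - Aw \<phi>)"
    by (rule L2.nrm_triangle3[OF AM_L2[OF uD] f(2) Aw_L2[OF \<phi>(1)]])
  then show "\<exists>\<phi>\<in>T. N (u - \<phi>) < \<epsilon> \<and> N (AM u - Aw \<phi>) < \<epsilon>" using \<phi> AM_eq[OF w] by auto
qed

lemma Dmin_add: "u \<in> D0 \<Longrightarrow> v \<in> D0 \<Longrightarrow> u + v \<in> D0"
proof -
  assume u: "u \<in> D0" and v: "v \<in> D0"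
  note uD = DminE(1)[OF u] and vD = DminE(1)[OF v]
  show ?thesis
  proof (rule DminI[OF L2_add[OF Dmax_L2[OF uD] Dmax_L2[OF vD]] L2_add[OF AM_L2[OF uD] AM_L2[OF vD]]])
    fix \<epsilon> :: real assume "\<epsilon> > 0"
    then have e: "\<epsilon> / 2 > 0" by simp
    obtain \<phi> where \<phi>: "\<phi> \<in> T" "N (u - \<phi>) < \<epsilon> / 2" "N (AM u - Aw \<phi>) < \<epsilon> / 2" using DminE(2)[OF u e] by blast
    obtain \<psi> where \<psi>: "\<psi> \<in> T" "N (v - \<psi>) < \<epsilon> / 2" "N (AM v - Aw \<psi>) < \<epsilon> / 2" using DminE(2)[OF v e] by blast
    note L = Dmax_L2[OF uD] Dmax_L2[OF vD] AM_L2[OF uD] AM_L2[OF vD] test_L2[OF \<phi>(1)] test_L2[OF \<psi>(1)] Aw_L2[OF \<phi>(1)] Aw_L2[OF \<psi>(1)]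
    have s: "u + v - (\<phi> + \<psi>) = (u - \<phi>) + (v - \<psi>)" "AM u + AM v - (Aw \<phi> + Aw \<psi>) = (AM u - Aw \<phi>) + (AM v - Aw \<psi>)" by simp_all
    have "N (u + v - (\<phi> + \<psi>)) < \<epsilon>"
      unfolding s using L2.nrm_triangle[OF L2_minus[OF L(1,5)] L2_minus[OF L(2,6)]] \<phi>(2) \<psi>(2) by simp
    moreover have "N (AM u + AM v - Aw (\<phi> + \<psi>)) < \<epsilon>"
    proof -
      have 1: "N (AM u + AM v - Aw (\<phi> + \<psi>)) \<le> N (AM u + AM v - (Aw \<phi> + Aw \<psi>)) + N (Aw \<phi> + Aw \<psi> - Aw (\<phi> + \<psi>))"
        by (intro L2.nrm_triangle3 L2_add L Aw_L2 cone_test_add \<phi>(1) \<psi>(1))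
      have 2: "N (Aw \<phi> + Aw \<psi> - Aw (\<phi> + \<psi>)) = 0"
        using N_Aw_add[OF \<phi>(1) \<psi>(1)] L2.nrm_minus_commute[OF L2_add[OF L(7,8)] Aw_L2[OF cone_test_add[OF \<phi>(1) \<psi>(1)]]] by simp
      have 3: "N (AM u + AM v - (Aw \<phi> + Aw \<psi>)) \<le> N (AM u - Aw \<phi>) + N (AM v - Aw \<psi>)"
        unfolding s by (intro L2.nrm_triangle L2_minus L)
      show ?thesis using 1 2 3 \<phi>(3) \<psi>(3) by linarith
    qed
    ultimately show "\<exists>\<phi>\<in>T. N (u + v - \<phi>) < \<epsilon> \<and> N (AM u + AM v - Aw \<phi>) < \<epsilon>"
      using cone_test_add[OF \<phi>(1) \<psi>(1)] by blast
  qed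
qed

lemma sscl_minus: "sscl G c (u - v) = sscl G c u - sscl G c v"
  by (simp add: L2.vs.scale_right_diff_distrib)

lemma Dmin_sscl: "u \<in> D0 \<Longrightarrow> sscl G c u \<in> D0"
proof -
  assume u: "u \<in> D0"
  note uD = DminE(1)[OF u]
  show ?thesis
  proof (rule DminI[OF L2_sscl[OF Dmax_L2[OF uD]] L2_sscl[OF AM_L2[OF uD]]])
    fix \<epsilon> :: real assume e: "\<epsilon> > 0"
    have "\<epsilon> / (cmod c + 1) > 0" using e by (simp add: add_nonneg_pos)
    from DminE(2)[OF u this] obtain \<phi> where \<phi>: "\<phi> \<in> T" "N (u - \<phi>) < \<epsilon> / (cmod c + 1)" "N (AM u - Aw \<phi>) < \<epsilon> / (cmod c + 1)"
      by blast
    note L = Dmax_L2[OF uD] AM_L2[OF uD] test_L2[OF \<phi>(1)] Aw_L2[OF \<phi>(1)]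
    have lt: "cmod c * x < \<epsilon>" if "x < \<epsilon> / (cmod c + 1)" "x \<ge> 0" for x
    proof -
      have "cmod c * x \<le> (cmod c + 1) * x" using that(2) by (simp add: distrib_right)
      also have "\<dots> < \<epsilon>" using that(1) by (simp add: pos_less_divide_eq add_nonneg_pos mult.commute)
      finally show ?thesis .
    qed
    have "N (sscl G c u - sscl G c \<phi>) < \<epsilon>"
      unfolding sscl_minus[symmetric] L2.nrm_sc[OF L2_minus[OF L(1,3)]] by (rule lt[OF \<phi>(2) L2.nrm_ge0[OF L2_minus[OF L(1,3)]]])
    moreover have "N (sscl G c (AM u) - Aw (sscl G c \<phi>)) < \<epsilon>"
    proof -
      have 1: "N (sscl G c (AM u) - Aw (sscl G c \<phi>)) \<le> N (sscl G c (AM u) - sscl G c (Aw \<phi>)) + N (sscl G c (Aw \<phi>) - Aw (sscl G c \<phi>))"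
        by (intro L2.nrm_triangle3 L2_sscl L Aw_L2 cone_test_sscl \<phi>(1))
      have 2: "N (sscl G c (Aw \<phi>) - Aw (sscl G c \<phi>)) = 0"
        using N_Aw_sscl[OF \<phi>(1)] L2.nrm_minus_commute[OF L2_sscl[OF L(4)] Aw_L2[OF cone_test_sscl[OF \<phi>(1)]]] by simp
      have 3: "N (sscl G c (AM u) - sscl G c (Aw \<phi>)) < \<epsilon>"
        unfolding sscl_minus[symmetric] L2.nrm_sc[OF L2_minus[OF L(2,4)]] by (rule lt[OF \<phi>(3) L2.nrm_ge0[OF L2_minus[OF L(2,4)]]])
      show ?thesis using 1 2 3 by linarith
    qed
    ultimately show "\<exists>\<phi>\<in>T. N (sscl G c u - \<phi>) < \<epsilon> \<and> N (sscl G c (AM u) - Aw \<phi>) < \<epsilon>"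
      using cone_test_sscl[OF \<phi>(1)] by blast
  qed
qed

text \<open>A null section is approximated by the test section 0, and \<open>Aw 0\<close> is null by
  homogeneity. Hence null sections belong to every domain.\<close>

lemma Dmin_null: "u \<in> L2 G m \<Longrightarrow> N u = 0 \<Longrightarrow> u \<in> D0"
proof (rule DminI[of u 0])
  fix \<epsilon> :: real assume u: "u \<in> L2 G m" "N u = 0" and e: "\<epsilon> > 0"
  have "N (Aw (sscl G 0 0)) = N (sscl G 0 (Aw 0))"
    using N_Aw_sscl[OF cone_test_zero, of 0] by (intro L2.nrm_null_cong Aw_L2 L2_sscl cone_test_sscl cone_test_zero)
  then have "N (Aw 0) = 0" by (simp add: sscl_simps L2.nrm_sc[OF Aw_L2[OF cone_test_zero], of 0, unfolded sscl_simps])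
  then have "N (0 - Aw 0) = 0" using L2.nrm_minus_commute[OF zero_L2 Aw_L2[OF cone_test_zero]] by simp
  then show "\<exists>\<phi>\<in>T. N (u - \<phi>) < \<epsilon> \<and> N (0 - Aw \<phi>) < \<epsilon>"
    using u e cone_test_zero by (intro bexI[of _ 0]) simp_all
qed (simp_all add: zero_L2)

lemma Dmin_zero: "0 \<in> D0"
  using Dmin_null[OF zero_L2] L2.nrm_sc[OF zero_L2, of 0] by (simp add: sscl_simps)

text \<open>For a Cauchy sequence in the graph norm both components converge in L2; test sections
  approximating late members approximate the pair of limits, which is therefore in the
  closure.\<close>

lemma Dmin_complete:
  assumes d: "\<And>n. d n \<in> D0" and Cauchy: "\<And>\<epsilon>. \<epsilon> > 0 \<Longrightarrow> \<exists>N. \<forall>i\<ge>N. \<forall>j\<ge>N. gn (d i - d j) < \<epsilon>"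
  shows "\<exists>l\<in>D0. (\<lambda>n. gn (d n - l)) \<longlonglongrightarrow> 0"
proof -
  note dD = DminE(1)[OF d]
  have 1: "N (d i - d j) \<le> gn (d i - d j)" for i j by (rule N_le_gn[OF Dmax_minus[OF dD dD]])
  have 2: "N (AM (d i) - AM (d j)) \<le> gn (d i - d j)" for i j
    using AM_le_gn[OF Dmax_minus[OF dD dD], of i j]
      L2.nrm_null_cong[OF AM_L2[OF Dmax_minus[OF dD dD]] L2_minus[OF AM_L2[OF dD] AM_L2[OF dD]] AM_minus[OF dD dD], of i j] by simp
  have "\<exists>l\<in>L2 G m. (\<lambda>n. N (d n - l)) \<longlonglongrightarrow> 0"
    unfolding L2norm_eq[symmetric]
  proof (rule L2_complete[OF Dmax_L2[OF dD]])
    fix \<epsilon> :: real assume "\<epsilon> > 0"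
    then obtain n where "\<forall>i\<ge>n. \<forall>j\<ge>n. gn (d i - d j) < \<epsilon>" using Cauchy by blast
    then show "\<exists>n. \<forall>i\<ge>n. \<forall>j\<ge>n. L2norm G m (d i - d j) < \<epsilon>"
      unfolding L2norm_eq using 1 by (meson le_less_trans)
  qed
  then obtain l where l: "l \<in> L2 G m" "(\<lambda>n. N (d n - l)) \<longlonglongrightarrow> 0" by blast
  have "\<exists>f\<in>L2 G m. (\<lambda>n. N (AM (d n) - f)) \<longlonglongrightarrow> 0"
    unfolding L2norm_eq[symmetric]
  proof (rule L2_complete[OF AM_L2[OF dD]])
    fix \<epsilon> :: real assume "\<epsilon> > 0"
    then obtain n where "\<forall>i\<ge>n. \<forall>j\<ge>n. gn (d i - d j) < \<epsilon>" using Cauchy by blast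
    then show "\<exists>n. \<forall>i\<ge>n. \<forall>j\<ge>n. L2norm G m (AM (d i) - AM (d j)) < \<epsilon>"
      unfolding L2norm_eq using 2 by (meson le_less_trans)
  qed
  then obtain f where f: "f \<in> L2 G m" "(\<lambda>n. N (AM (d n) - f)) \<longlonglongrightarrow> 0" by blast
  have app: "\<exists>\<phi>\<in>T. N (l - \<phi>) < \<epsilon> \<and> N (f - Aw \<phi>) < \<epsilon>" if "\<epsilon> > 0" for \<epsilon>
  proof -
    have e: "\<epsilon> / 2 > 0" using that by simp
    have "\<forall>\<^sub>F n in sequentially. N (d n - l) < \<epsilon> / 2 \<and> N (AM (d n) - f) < \<epsilon> / 2"
      by (intro eventually_conj order_tendstoD(2)[OF l(2) e] order_tendstoD(2)[OF f(2) e])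
    then obtain n where n: "N (d n - l) < \<epsilon> / 2" "N (AM (d n) - f) < \<epsilon> / 2"
      using eventually_happens[of _ sequentially] by auto
    obtain \<phi> where \<phi>: "\<phi> \<in> T" "N (d n - \<phi>) < \<epsilon> / 2" "N (AM (d n) - Aw \<phi>) < \<epsilon> / 2" using DminE(2)[OF d e] by blast
    have "N (l - \<phi>) < \<epsilon>"
      using L2.nrm_triangle3[OF l(1) Dmax_L2[OF dD] test_L2[OF \<phi>(1)], of n] L2.nrm_minus_commute[OF l(1) Dmax_L2[OF dD], of n] n(1) \<phi>(2) by simp
    moreover have "N (f - Aw \<phi>) < \<epsilon>"
      using L2.nrm_triangle3[OF f(1) AM_L2[OF dD] Aw_L2[OF \<phi>(1)], of n] L2.nrm_minus_commute[OF f(1) AM_L2[OF dD], of n] n(2) \<phi>(3) by simp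
    ultimately show ?thesis using \<phi>(1) by blast
  qed
  have lD0: "l \<in> D0" by (rule DminI[OF l(1) f(1) app])
  have w: "weak l f" by (rule Dmin_weak[OF l(1) f(1) app])
  note lD = DminE(1)[OF lD0]
  have "gn (d n - l) \<le> N (AM (d n) - f) + N (d n - l)" for n
  proof -
    have "gn (d n - l) \<le> N (AM (d n - l)) + N (d n - l)" by (rule gn_le[OF Dmax_minus[OF dD lD]])
    also have "N (AM (d n - l)) = N (AM (d n) - f)"
      by (rule L2.nrm_null_cong[OF AM_L2[OF Dmax_minus[OF dD lD]] L2_minus[OF AM_L2[OF dD] f(1)]
          AM_eq[OF weak_minus[OF Amax_weak[OF dD] w]]])
    finally show ?thesis .
  qed
  moreover have "(\<lambda>n. N (AM (d n) - f) + N (d n - l)) \<longlonglongrightarrow> 0" using tendsto_add[OF f(2) l(2)] by simp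
  ultimately have "(\<lambda>n. gn (d n - l)) \<longlonglongrightarrow> 0"
    by (intro tendsto_sandwich[where f = "\<lambda>_. 0" and g = "\<lambda>n. gn (d n - l)" and h = "\<lambda>n. N (AM (d n) - f) + N (d n - l)"] tendsto_const)
      (simp_all add: graph.nrm_ge0[OF Dmax_minus[OF dD lD]])
  with lD0 show ?thesis by blast
qed

lemma Emax_decomposition: "u \<in> Dm \<Longrightarrow> \<exists>e. e \<in> Emax G m Aw \<and> u - e \<in> D0"
proof -
  assume u: "u \<in> Dm"
  have "\<exists>d\<in>D0. \<forall>s\<in>D0. graph_ip G m Aw (u - d) s = 0"
    by (rule graph.orthogonal_projection[OF _ Dmin_zero Dmin_add Dmin_sscl Dmin_complete u]) (auto intro: DminE(1))
  then obtain d where d: "d \<in> D0" "\<forall>s\<in>D0. graph_ip G m Aw (u - d) s = 0" by blast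
  then have "u - d \<in> Emax G m Aw" unfolding Emax_def using Dmax_minus[OF u DminE(1)[OF d(1)]] by blast
  then show ?thesis using d(1) by (intro exI[of _ "u - d"]) simp
qed

text \<open>Whatever element was chosen, it is orthogonal to the remainder, so by Pythagoras the
  projection is a contraction in the graph norm.\<close>

lemma pi_max:
  assumes u: "u \<in> Dm"
  shows "pi_max G m Aw u \<in> Dm" "pi_max G m Aw u \<in> Emax G m Aw" "u - pi_max G m Aw u \<in> D0" "gn (pi_max G m Aw u) \<le> gn u"
proof -
  define e where "e = pi_max G m Aw u"
  have e: "e \<in> Emax G m Aw \<and> u - e \<in> D0"
    unfolding e_def pi_max_def proj_along_def by (rule someI_ex[OF Emax_decomposition[OF u]])
  then have eD: "e \<in> Dm" and orth: "graph_ip G m Aw e (u - e) = 0" unfolding Emax_def by blast+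
  have "u = e + (u - e)" by simp
  then have "(gn u)\<^sup>2 = (gn e)\<^sup>2 + (gn (u - e))\<^sup>2"
    using graph.nrm_sq_add[OF eD DminE(1)[OF conjunct2[OF e]]] orth by simp
  then have "(gn e)\<^sup>2 \<le> (gn u)\<^sup>2" by simp
  then have "gn e \<le> gn u" by (rule power2_le_imp_le) (rule graph.nrm_ge0[OF u])
  with e eD show "pi_max G m Aw u \<in> Dm" "pi_max G m Aw u \<in> Emax G m Aw" "u - pi_max G m Aw u \<in> D0" "gn (pi_max G m Aw u) \<le> gn u"
    by (simp_all add: e_def)
qed

subsection \<open>Homogeneity\<close>

lemma kappa_add: "kappa G m \<rho> (u + v) = kappa G m \<rho> u + kappa G m \<rho> v"
  by (auto simp: fun_eq_iff kappa_def vs.scale_right_distrib)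

lemma kappa_minus: "kappa G m \<rho> (u - v) = kappa G m \<rho> u - kappa G m \<rho> v"
  by (auto simp: fun_eq_iff kappa_def vs.scale_right_diff_distrib)

lemma kappa_sscl: "kappa G m \<rho> (sscl G c u) = sscl G c (kappa G m \<rho> u)"
  by (auto simp: fun_eq_iff kappa_def sscl_def mult.commute)

lemma kappa_kappa_inverse:
  assumes "\<rho> > 0"
  shows "kappa G m \<rho> (kappa G m (inverse \<rho>) u) = u" "kappa G m (inverse \<rho>) (kappa G m \<rho> u) = u"
proof -
  have c: "complex_of_real (\<rho> powr (real m / 2)) * complex_of_real (inverse \<rho> powr (real m / 2)) = 1"
    unfolding of_real_mult[symmetric] using assms by (subst powr_mult[symmetric]) auto
  have d: "complex_of_real (inverse \<rho> powr (real m / 2)) * complex_of_real (\<rho> powr (real m / 2)) = 1"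
    using c by (simp only: mult.commute)
  show "kappa G m \<rho> (kappa G m (inverse \<rho>) u) = u" "kappa G m (inverse \<rho>) (kappa G m \<rho> u) = u"
    using assms c d by (auto simp: fun_eq_iff kappa_def simp flip: mult.assoc)
qed

lemma N_kappa: "\<rho> > 0 \<Longrightarrow> u \<in> L2 G m \<Longrightarrow> N (kappa G m \<rho> u) = N u"
  by (simp add: L2.nrm_def ip_kappa)

lemma ip_kappa_adjoint:
  assumes "\<rho> > 0" "u \<in> L2 G m" "v \<in> L2 G m"
  shows "ip G m (kappa G m \<rho> u) v = ip G m u (kappa G m (inverse \<rho>) v)"
proof -
  have "kappa G m (inverse \<rho>) v \<in> L2 G m" using assms by (intro kappa_L2) simp_all
  from ip_kappa[OF assms(1,2) this] show ?thesis using kappa_kappa_inverse[OF assms(1)] by simp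
qed

text \<open>If \<phi> has formal adjoint \<psi>, then
  \<open>kappa G m (inverse \<rho>) \<phi>\<close> has as formal adjoint \<rho>^(-m) times
  \<open>kappa G m (inverse \<rho>) \<psi>\<close>. So test pairs are transported to test pairs, and
  the weak identity for \<open>u\<close> can be applied to the transported pair.\<close>

lemma weak_kappa:
  assumes \<rho>: "\<rho> > 0" and w: "weak u f"
  shows "weak (kappa G m \<rho> u) (sscl G (of_real (\<rho> ^ m)) (kappa G m \<rho> f))"
proof (rule weakI)
  note L = weakD(1,2)[OF w]
  have \<rho>': "inverse \<rho> > 0" using \<rho> by simp
  define r where "r = complex_of_real (\<rho> ^ m)"
  define s where "s = complex_of_real (inverse (\<rho> ^ m))"
  have rs: "r * s = 1" "s * r = 1" "cnj s = s" using \<rho> by (auto simp: r_def s_def)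
  show "kappa G m \<rho> u \<in> L2 G m" "sscl G (of_real (\<rho> ^ m)) (kappa G m \<rho> f) \<in> L2 G m"
    by (intro L2_sscl kappa_L2 \<rho> L)+
  fix \<phi> \<psi> assume t: "\<phi> \<in> T" "\<psi> \<in> T" "\<And>\<eta>. \<eta> \<in> T \<Longrightarrow> ip G m (Aw \<eta>) \<phi> = ip G m \<eta> \<psi>"
  define \<phi>' where "\<phi>' = kappa G m (inverse \<rho>) \<phi>"
  define \<psi>1 where "\<psi>1 = kappa G m (inverse \<rho>) \<psi>"
  define \<psi>' where "\<psi>' = sscl G s \<psi>1"
  have t1: "\<phi>' \<in> T" "\<psi>1 \<in> T" unfolding \<phi>'_def \<psi>1_def by (intro cone_test_kappa \<rho>' t)+
  then have t2: "\<psi>' \<in> T" unfolding \<psi>'_def by (intro cone_test_sscl)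
  have "ip G m (Aw \<eta>) \<phi>' = ip G m \<eta> \<psi>'" if \<eta>: "\<eta> \<in> T" for \<eta>
  proof -
    have K: "kappa G m \<rho> \<eta> \<in> T" by (rule cone_test_kappa[OF \<rho> \<eta>])
    have "r * ip G m (Aw \<eta>) \<phi>' = ip G m (sscl G r (kappa G m \<rho> (Aw \<eta>))) \<phi>"
      unfolding \<phi>'_def ip_kappa_adjoint[OF \<rho> Aw_L2[OF \<eta>] test_L2[OF t(1)], symmetric]
      by (rule ip_sscl_left[OF kappa_L2[OF \<rho> Aw_L2[OF \<eta>]] test_L2[OF t(1)], symmetric])
    also have "\<dots> = ip G m (Aw (kappa G m \<rho> \<eta>)) \<phi>"
      unfolding r_def
      by (rule L2.p_null_cong[OF Aw_L2[OF K] L2_sscl[OF kappa_L2[OF \<rho> Aw_L2[OF \<eta>]]] test_L2[OF t(1)] N_Aw_kappa[OF \<rho> \<eta>], symmetric])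
    also have "\<dots> = ip G m (kappa G m \<rho> \<eta>) \<psi>" by (rule t(3)[OF K])
    also have "\<dots> = ip G m \<eta> \<psi>1" unfolding \<psi>1_def by (rule ip_kappa_adjoint[OF \<rho> test_L2[OF \<eta>] test_L2[OF t(2)]])
    finally have "s * (r * ip G m (Aw \<eta>) \<phi>') = s * ip G m \<eta> \<psi>1" by simp
    then show ?thesis
      using L2.p_sc_right[OF test_L2[OF t1(2)] test_L2[OF \<eta>], of s] rs by (simp add: \<psi>'_def flip: mult.assoc)
  qed
  then have e: "ip G m f \<phi>' = ip G m u \<psi>'" by (rule weakD(3)[OF w t1(1) t2])
  have "ip G m (sscl G (of_real (\<rho> ^ m)) (kappa G m \<rho> f)) \<phi> = r * ip G m f \<phi>'"
    unfolding \<phi>'_def ip_kappa_adjoint[OF \<rho> L(2) test_L2[OF t(1)], symmetric] r_def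
    by (rule ip_sscl_left[OF kappa_L2[OF \<rho> L(2)] test_L2[OF t(1)]])
  also have "\<dots> = r * (s * ip G m u \<psi>1)"
    unfolding e \<psi>'_def using L2.p_sc_right[OF test_L2[OF t1(2)] L(1), of s] rs by simp
  also have "\<dots> = ip G m u \<psi>1" using rs by (simp flip: mult.assoc)
  also have "\<dots> = ip G m (kappa G m \<rho> u) \<psi>"
    unfolding \<psi>1_def by (rule ip_kappa_adjoint[OF \<rho> L(1) test_L2[OF t(2)], symmetric])
  finally show "ip G m (sscl G (of_real (\<rho> ^ m)) (kappa G m \<rho> f)) \<phi> = ip G m (kappa G m \<rho> u) \<psi>" .
qed

lemma Dmax_kappa: "\<rho> > 0 \<Longrightarrow> u \<in> Dm \<Longrightarrow> kappa G m \<rho> u \<in> Dm"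
  by (rule Dmax_weak[OF weak_kappa[OF _ Amax_weak]])

lemma AM_kappa: "\<rho> > 0 \<Longrightarrow> u \<in> Dm \<Longrightarrow> N (AM (kappa G m \<rho> u) - sscl G (of_real (\<rho> ^ m)) (kappa G m \<rho> (AM u))) = 0"
  by (rule AM_eq[OF weak_kappa[OF _ Amax_weak]])

lemma Dmin_kappa:
  assumes \<rho>: "\<rho> > 0" and u: "u \<in> D0"
  shows "kappa G m \<rho> u \<in> D0"
proof -
  note uD = DminE(1)[OF u]
  define r where "r = complex_of_real (\<rho> ^ m)"
  have r: "cmod r = \<rho> ^ m" using \<rho> by (simp add: r_def norm_power)
  show ?thesis
  proof (rule DminI[OF kappa_L2[OF \<rho> Dmax_L2[OF uD]] L2_sscl[OF kappa_L2[OF \<rho> AM_L2[OF uD]], of r]])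
    fix \<epsilon> :: real assume e: "\<epsilon> > 0"
    \<comment> \<open>The bound \<epsilon> serves the section itself, where \<open>kappa\<close> is
      an isometry; its image picks up the factor \<rho>^m, hence the second bound.\<close>
    have "min \<epsilon> (\<epsilon> / \<rho> ^ m) > 0" using e \<rho> by simp
    from DminE(2)[OF u this] obtain \<phi> where \<phi>: "\<phi> \<in> T" "N (u - \<phi>) < \<epsilon>" "N (AM u - Aw \<phi>) < \<epsilon> / \<rho> ^ m"
      by auto
    note K = cone_test_kappa[OF \<rho> \<phi>(1)]
    note L = Dmax_L2[OF uD] AM_L2[OF uD] test_L2[OF \<phi>(1)] Aw_L2[OF \<phi>(1)]
    have "N (kappa G m \<rho> u - kappa G m \<rho> \<phi>) < \<epsilon>"
      unfolding kappa_minus[symmetric] N_kappa[OF \<rho> L2_minus[OF L(1,3)]] by (rule \<phi>(2))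
    moreover have "N (sscl G r (kappa G m \<rho> (AM u)) - Aw (kappa G m \<rho> \<phi>)) < \<epsilon>"
    proof -
      have 1: "N (sscl G r (kappa G m \<rho> (AM u)) - Aw (kappa G m \<rho> \<phi>))
          \<le> N (sscl G r (kappa G m \<rho> (AM u)) - sscl G r (kappa G m \<rho> (Aw \<phi>)))
            + N (sscl G r (kappa G m \<rho> (Aw \<phi>)) - Aw (kappa G m \<rho> \<phi>))"
        by (intro L2.nrm_triangle3 L2_sscl kappa_L2 \<rho> L Aw_L2 K)
      have 2: "N (sscl G r (kappa G m \<rho> (Aw \<phi>)) - Aw (kappa G m \<rho> \<phi>)) = 0"
        using N_Aw_kappa[OF \<rho> \<phi>(1)] L2.nrm_minus_commute[OF L2_sscl[OF kappa_L2[OF \<rho> L(4)], of r] Aw_L2[OF K]]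
        by (simp only: r_def)
      have 3: "N (sscl G r (kappa G m \<rho> (AM u)) - sscl G r (kappa G m \<rho> (Aw \<phi>))) = \<rho> ^ m * N (AM u - Aw \<phi>)"
        unfolding sscl_minus[symmetric] kappa_minus[symmetric]
        by (simp only: L2.nrm_sc[OF kappa_L2[OF \<rho> L2_minus[OF L(2,4)]]] N_kappa[OF \<rho> L2_minus[OF L(2,4)]] r)
      have 4: "\<rho> ^ m * N (AM u - Aw \<phi>) < \<epsilon>"
        using \<phi>(3) \<rho> by (simp add: pos_less_divide_eq mult.commute)
      show ?thesis using 1 2 3 4 by linarith
    qed
    ultimately show "\<exists>\<phi>\<in>T. N (kappa G m \<rho> u - \<phi>) < \<epsilon> \<and> N (sscl G r (kappa G m \<rho> (AM u)) - Aw \<phi>) < \<epsilon>"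
      using K by blast
  qed
qed

abbreviation B where "B \<equiv> A_minus G m Aw"

lemma B_L2: "u \<in> Dm \<Longrightarrow> B \<mu> u \<in> L2 G m"
  unfolding A_minus_def by (intro L2_minus L2_sscl AM_L2 Dmax_L2)

lemma N_B_minus:
  assumes u: "u \<in> Dm" and v: "v \<in> Dm"
  shows "N (B \<mu> (u - v) - (B \<mu> u - B \<mu> v)) = 0"
proof -
  have "B \<mu> (u - v) - (B \<mu> u - B \<mu> v) = AM (u - v) - (AM u - AM v)"
    by (simp add: A_minus_def sscl_minus)
  then show ?thesis using AM_minus[OF u v] by (simp only:)
qed

lemma N_B_minus_eq:
  assumes u: "u \<in> Dm" and v: "v \<in> Dm"
  shows "N (B \<mu> (u - v)) = N (B \<mu> u - B \<mu> v)"
  by (rule L2.nrm_null_cong[OF B_L2[OF Dmax_minus[OF u v]] L2_minus[OF B_L2[OF u] B_L2[OF v]] N_B_minus[OF u v]])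

lemma B_shift: "B \<mu> u = B \<nu> u - sscl G (\<mu> - \<nu>) u"
  by (simp add: A_minus_def L2.vs.scale_left_diff_distrib)

lemma N_B_shift: "u \<in> Dm \<Longrightarrow> N (B \<nu> u) \<le> N (B \<mu> u) + cmod (\<mu> - \<nu>) * N u"
proof -
  assume u: "u \<in> Dm"
  have "N (B \<nu> u) = N (B \<mu> u - sscl G (\<nu> - \<mu>) u)" by (simp only: B_shift[of \<nu> u \<mu>])
  also have "\<dots> \<le> N (B \<mu> u) + N (sscl G (\<nu> - \<mu>) u)"
    by (rule L2.nrm_triangle_minus[OF B_L2[OF u] L2_sscl[OF Dmax_L2[OF u]]])
  also have "N (sscl G (\<nu> - \<mu>) u) = cmod (\<mu> - \<nu>) * N u"
    by (simp only: L2.nrm_sc[OF Dmax_L2[OF u]] norm_minus_commute)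
  finally show ?thesis .
qed

lemma N_B_le_gn: "u \<in> Dm \<Longrightarrow> cmod \<mu> = 1 \<Longrightarrow> N (B \<mu> u) \<le> 2 * gn u"
  using L2.nrm_triangle_minus[OF AM_L2 L2_sscl[OF Dmax_L2], of u u \<mu>] L2.nrm_sc[OF Dmax_L2, of u \<mu>] N_le_gn[of u] AM_le_gn[of u]
  by (simp add: A_minus_def)

text \<open>Together with \<open>N_B_le_gn\<close> this makes the graph norm comparable to
  \<open>N (B \<mu> u) + N u\<close>, with constants that do not depend on \<mu> on the unit
  circle.\<close>

lemma gn_le_N_B: "u \<in> Dm \<Longrightarrow> cmod \<mu> = 1 \<Longrightarrow> gn u \<le> N (B \<mu> u) + 2 * N u"
proof -
  assume u: "u \<in> Dm" and \<mu>: "cmod \<mu> = 1"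
  have "AM u = B \<mu> u + sscl G \<mu> u" by (simp add: A_minus_def)
  then have "N (AM u) \<le> N (B \<mu> u) + N (sscl G \<mu> u)"
    using L2.nrm_triangle[OF B_L2[OF u] L2_sscl[OF Dmax_L2[OF u]], of \<mu> \<mu>] by (simp only:)
  then show ?thesis using gn_le[OF u] L2.nrm_sc[OF Dmax_L2[OF u], of \<mu>] \<mu> by simp
qed

lemma N_B_kappa:
  assumes \<rho>: "\<rho> > 0" and u: "u \<in> Dm"
  shows "N (B (of_real (\<rho> ^ m) * \<mu>) (kappa G m \<rho> u) - sscl G (of_real (\<rho> ^ m)) (kappa G m \<rho> (B \<mu> u))) = 0"
proof -
  have "B (of_real (\<rho> ^ m) * \<mu>) (kappa G m \<rho> u) - sscl G (of_real (\<rho> ^ m)) (kappa G m \<rho> (B \<mu> u))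
      = AM (kappa G m \<rho> u) - sscl G (of_real (\<rho> ^ m)) (kappa G m \<rho> (AM u))"
    by (simp add: A_minus_def kappa_minus kappa_sscl sscl_minus)
  then show ?thesis using AM_kappa[OF \<rho> u] by (simp only:)
qed

lemma N_B_kappa_eq:
  assumes \<rho>: "\<rho> > 0" and u: "u \<in> Dm"
  shows "N (B (of_real (\<rho> ^ m) * \<mu>) (kappa G m \<rho> u)) = \<rho> ^ m * N (B \<mu> u)"
proof -
  have "N (B (of_real (\<rho> ^ m) * \<mu>) (kappa G m \<rho> u)) = N (sscl G (of_real (\<rho> ^ m)) (kappa G m \<rho> (B \<mu> u)))"
    by (rule L2.nrm_null_cong[OF B_L2[OF Dmax_kappa[OF \<rho> u]] L2_sscl[OF kappa_L2[OF \<rho> B_L2[OF u]]] N_B_kappa[OF \<rho> u]])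
  also have "\<dots> = cmod (of_real (\<rho> ^ m)) * N (B \<mu> u)"
    by (simp only: L2.nrm_sc[OF kappa_L2[OF \<rho> B_L2[OF u]]] N_kappa[OF \<rho> B_L2[OF u]])
  also have "cmod (of_real (\<rho> ^ m)) = \<rho> ^ m" using \<rho> by (simp add: norm_power)
  finally show ?thesis .
qed

subsection \<open>Domains and the resolvent\<close>

lemma domainsD:
  assumes "E \<in> domains G m Aw"
  shows "E \<subseteq> Dm" "D0 \<subseteq> E" "u \<in> E \<Longrightarrow> v \<in> E \<Longrightarrow> u + v \<in> E" "u \<in> E \<Longrightarrow> v \<in> E \<Longrightarrow> u - v \<in> E"
    "u \<in> E \<Longrightarrow> sscl G c u \<in> E"
proof -
  have s: "module.subspace (sscl G) E" and i: "D0 \<subseteq> E" "E \<subseteq> Dm" using assms unfolding domains_def by simp_all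
  show "E \<subseteq> Dm" "D0 \<subseteq> E" using i by simp_all
  show "u \<in> E \<Longrightarrow> v \<in> E \<Longrightarrow> u + v \<in> E" by (rule L2.vs.subspace_add[OF s])
  show "u \<in> E \<Longrightarrow> v \<in> E \<Longrightarrow> u - v \<in> E" by (rule L2.vs.subspace_diff[OF s])
  show "u \<in> E \<Longrightarrow> sscl G c u \<in> E" by (rule L2.vs.subspace_scale[OF s])
qed

text \<open>The preimage stands for the inverse image of the domain under the group action; it is
  again a domain because \<open>kappa\<close> and its inverse preserve the maximal domain and
  \<open>kappa\<close> preserves the minimal one.\<close>

lemma domains_kappa_vimage:
  assumes E: "E \<in> domains G m Aw" and \<rho>: "\<rho> > 0"
  shows "kappa G m \<rho> -` E \<in> domains G m Aw"
proof -
  have i: "inverse \<rho> > 0" using \<rho> by simp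
  have s: "L2.vs.subspace (kappa G m \<rho> -` E)"
  proof (rule L2.vs.subspaceI)
    have "kappa G m \<rho> 0 = 0" using kappa_minus[of \<rho> 0 0] by simp
    then show "0 \<in> kappa G m \<rho> -` E" using domainsD(2)[OF E] Dmin_zero by auto
    show "u + v \<in> kappa G m \<rho> -` E" if "u \<in> kappa G m \<rho> -` E" "v \<in> kappa G m \<rho> -` E" for u v
      using that unfolding vimage_eq kappa_add by (rule domainsD(3)[OF E])
    show "sscl G c u \<in> kappa G m \<rho> -` E" if "u \<in> kappa G m \<rho> -` E" for u c
      using that unfolding vimage_eq kappa_sscl by (rule domainsD(5)[OF E])
  qed
  have "u \<in> Dm" if "kappa G m \<rho> u \<in> E" for u
    using Dmax_kappa[OF i subsetD[OF domainsD(1)[OF E] that]] by (simp only: kappa_kappa_inverse(2)[OF \<rho>])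
  moreover have "kappa G m \<rho> u \<in> E" if "u \<in> D0" for u
    by (rule subsetD[OF domainsD(2)[OF E] Dmin_kappa[OF \<rho> that]])
  ultimately show ?thesis using s unfolding domains_def by auto
qed

text \<open>Surjectivity in a form that is insensitive to null sections. It is also what produces
  projections on the kernel along \<open>E\<close>.\<close>

definition onto :: "('a, 'f) csec set \<Rightarrow> complex \<Rightarrow> bool" where
  "onto E \<mu> \<longleftrightarrow> (\<forall>f\<in>L2 G m. \<exists>u\<in>E. N (B \<mu> u - f) = 0)"

text \<open>For \<mu> in the resolvent set this says that the inverse has norm at most
  \<open>C\<close>; as a lower bound on \<open>E\<close> it passes to subspaces such as the minimal
  domain and needs no chosen resolvent.\<close>

definition below :: "('a, 'f) csec set \<Rightarrow> complex \<Rightarrow> real \<Rightarrow> bool" where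
  "below E \<mu> C \<longleftrightarrow> (\<forall>u\<in>E. N u \<le> C * N (B \<mu> u))"

lemma eq_ae_N: "u \<in> L2 G m \<Longrightarrow> v \<in> L2 G m \<Longrightarrow> eq_ae G m u v \<longleftrightarrow> N (u - v) = 0"
  unfolding L2norm_eq[symmetric] by (rule eq_ae_iff)

lemma ker_on_iff: "u \<in> Dm \<Longrightarrow> u \<in> ker_on G m Aw Dm \<mu> \<longleftrightarrow> N (B \<mu> u) = 0"
  by (simp add: ker_on_def eq_ae_N B_L2 zero_L2)

lemma res_set_onto:
  assumes E: "E \<in> domains G m Aw" and \<mu>: "\<mu> \<in> res_set G m Aw E"
  shows "onto E \<mu>"
  unfolding onto_def
proof
  fix f assume f: "f \<in> L2 G m"
  then have "f \<in> range_on G m Aw E \<mu>" using \<mu> unfolding res_set_def by simp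
  then obtain u where u: "u \<in> E" "eq_ae G m (B \<mu> u) f" unfolding range_on_def by blast
  have "u \<in> Dm" using u(1) domainsD(1)[OF E] by blast
  then show "\<exists>u\<in>E. N (B \<mu> u - f) = 0" using u eq_ae_N[OF B_L2 f, of u \<mu>] by blast
qed

lemma resolvent:
  assumes E: "E \<in> domains G m Aw" and \<mu>: "\<mu> \<in> res_set G m Aw E" and f: "f \<in> L2 G m"
  shows "resolvent G m Aw E \<mu> f \<in> E" "N (B \<mu> (resolvent G m Aw E \<mu> f) - f) = 0"
proof -
  have "f \<in> range_on G m Aw E \<mu>" using \<mu> f unfolding res_set_def by simp
  then have "\<exists>u. u \<in> E \<and> eq_ae G m (B \<mu> u) f" unfolding range_on_def by blast
  then have r: "resolvent G m Aw E \<mu> f \<in> E \<and> eq_ae G m (B \<mu> (resolvent G m Aw E \<mu> f)) f"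
    unfolding resolvent_def by (rule someI_ex)
  then show "resolvent G m Aw E \<mu> f \<in> E" by simp
  then have "resolvent G m Aw E \<mu> f \<in> Dm" using domainsD(1)[OF E] by blast
  then show "N (B \<mu> (resolvent G m Aw E \<mu> f) - f) = 0" using r eq_ae_N[OF B_L2 f] by blast
qed

lemma res_set_injective:
  assumes E: "E \<in> domains G m Aw" and \<mu>: "\<mu> \<in> res_set G m Aw E" and u: "u \<in> E" "N (B \<mu> u) = 0"
  shows "N u = 0"
proof -
  have uD: "u \<in> Dm" using u(1) domainsD(1)[OF E] by blast
  have "eq_ae G m (B \<mu> u) 0" using u(2) by (simp add: eq_ae_N B_L2 uD zero_L2)
  then have "u \<in> ker_on G m Aw E \<mu>" using u(1) unfolding ker_on_def by blast
  then have "u \<in> null_sections G m" using \<mu> unfolding res_set_def by simp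
  then have "eq_ae G m u 0" unfolding null_sections_def by blast
  then show ?thesis by (simp add: eq_ae_N Dmax_L2 uD zero_L2)
qed

text \<open>\<open>resolvent\<close> picks some solution in \<open>E\<close>. Injectivity up to null
  sections gives all solutions the same norm, so bounding the chosen one bounds every element of
  \<open>E\<close> by its image.\<close>

lemma resolvent_bound_iff:
  assumes E: "E \<in> domains G m Aw" and \<mu>: "\<mu> \<in> res_set G m Aw E"
  shows "(\<forall>f\<in>L2 G m. N (resolvent G m Aw E \<mu> f) \<le> C * N f) \<longleftrightarrow> below E \<mu> C"
proof
  assume R: "\<forall>f\<in>L2 G m. N (resolvent G m Aw E \<mu> f) \<le> C * N f"
  show "below E \<mu> C"
    unfolding below_def
  proof
    fix u assume u: "u \<in> E"
    have uD: "u \<in> Dm" using u domainsD(1)[OF E] by blast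
    note f = B_L2[OF uD, of \<mu>]
    define v where "v = resolvent G m Aw E \<mu> (B \<mu> u)"
    have v: "v \<in> E" "N (B \<mu> v - B \<mu> u) = 0" unfolding v_def by (rule resolvent[OF E \<mu> f])+
    have vD: "v \<in> Dm" using v(1) domainsD(1)[OF E] by blast
    have "N (v - u) = 0"
      using N_B_minus_eq[OF vD uD, of \<mu>] v(2) by (intro res_set_injective[OF E \<mu> domainsD(4)[OF E v(1) u]]) simp
    then have "N v = N u" by (rule L2.nrm_null_cong[OF Dmax_L2[OF vD] Dmax_L2[OF uD]])
    then show "N u \<le> C * N (B \<mu> u)" using bspec[OF R f] by (simp add: v_def)
  qed
next
  assume b: "below E \<mu> C"
  show "\<forall>f\<in>L2 G m. N (resolvent G m Aw E \<mu> f) \<le> C * N f"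
  proof
    fix f assume f: "f \<in> L2 G m"
    note r = resolvent[OF E \<mu> f]
    have rD: "resolvent G m Aw E \<mu> f \<in> Dm" using r(1) domainsD(1)[OF E] by blast
    have "N (B \<mu> (resolvent G m Aw E \<mu> f)) = N f" by (rule L2.nrm_null_cong[OF B_L2[OF rD] f r(2)])
    then show "N (resolvent G m Aw E \<mu> f) \<le> C * N f" using bspec[OF b[unfolded below_def] r(1)] by simp
  qed
qed

lemma res_set_below:
  assumes E: "E \<in> domains G m Aw" and \<mu>: "\<mu> \<in> res_set G m Aw E"
  shows "\<exists>C\<ge>0. below E \<mu> C"
proof -
  obtain C where "\<forall>f\<in>L2 G m. N (resolvent G m Aw E \<mu> f) \<le> C * N f"
    using \<mu> unfolding res_set_def L2norm_eq by blast
  then have b: "below E \<mu> C" by (simp add: resolvent_bound_iff[OF E \<mu>])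
  have "below E \<mu> \<bar>C\<bar>"
    unfolding below_def
  proof
    fix u assume u: "u \<in> E"
    have "u \<in> Dm" using u domainsD(1)[OF E] by blast
    then have "C * N (B \<mu> u) \<le> \<bar>C\<bar> * N (B \<mu> u)" by (intro mult_right_mono) (simp_all add: L2.nrm_ge0 B_L2)
    then show "N u \<le> \<bar>C\<bar> * N (B \<mu> u)" using bspec[OF b[unfolded below_def] u] by linarith
  qed
  then show ?thesis by (intro exI[of _ "\<bar>C\<bar>"]) simp
qed

lemma onto_kappa_vimage:
  assumes E: "E \<in> domains G m Aw" and \<rho>: "\<rho> > 0" and o: "onto E (of_real (\<rho> ^ m) * \<mu>)"
  shows "onto (kappa G m \<rho> -` E) \<mu>"
  unfolding onto_def
proof
  fix f assume f: "f \<in> L2 G m"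
  have i: "inverse \<rho> > 0" using \<rho> by simp
  let ?r = "complex_of_real (\<rho> ^ m)"
  have g: "sscl G ?r (kappa G m \<rho> f) \<in> L2 G m" by (intro L2_sscl kappa_L2 \<rho> f)
  obtain u where u: "u \<in> E" "N (B (?r * \<mu>) u - sscl G ?r (kappa G m \<rho> f)) = 0"
    using o g unfolding onto_def by blast
  have uD: "u \<in> Dm" using u(1) domainsD(1)[OF E] by blast
  define v where "v = kappa G m (inverse \<rho>) u"
  have v: "v \<in> Dm" "kappa G m \<rho> v = u" unfolding v_def by (rule Dmax_kappa[OF i uD], rule kappa_kappa_inverse[OF \<rho>])
  note L = B_L2[OF uD] L2_sscl[OF kappa_L2[OF \<rho> B_L2[OF v(1)]]]
  have 1: "N (sscl G ?r (kappa G m \<rho> (B \<mu> v)) - sscl G ?r (kappa G m \<rho> f))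
      \<le> N (sscl G ?r (kappa G m \<rho> (B \<mu> v)) - B (?r * \<mu>) u) + N (B (?r * \<mu>) u - sscl G ?r (kappa G m \<rho> f))"
    by (rule L2.nrm_triangle3[OF L(2) L(1) g])
  have 2: "N (sscl G ?r (kappa G m \<rho> (B \<mu> v)) - B (?r * \<mu>) u) = 0"
    using N_B_kappa[OF \<rho> v(1), of \<mu>] L2.nrm_minus_commute[OF L(1) L(2)[of ?r \<mu>], of "?r * \<mu>"] by (simp only: v(2))
  have "N (sscl G ?r (kappa G m \<rho> (B \<mu> v - f))) \<le> 0"
    using 1 2 u(2) unfolding kappa_minus sscl_minus by linarith
  moreover note F = L2_minus[OF B_L2[OF v(1), of \<mu>] f]
  moreover have "N (sscl G ?r (kappa G m \<rho> (B \<mu> v - f))) = \<rho> ^ m * N (B \<mu> v - f)"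
    using \<rho> by (simp only: L2.nrm_sc[OF kappa_L2[OF \<rho> F]] N_kappa[OF \<rho> F] norm_of_real) simp
  ultimately have "\<rho> ^ m * N (B \<mu> v - f) \<le> 0" by simp
  then have "N (B \<mu> v - f) \<le> 0" using zero_less_power[OF \<rho>, of m] mult_le_0_iff[of "\<rho> ^ m" "N (B \<mu> v - f)"] by linarith
  then have "N (B \<mu> v - f) = 0" using L2.nrm_ge0[OF F] by simp
  then show "\<exists>v\<in>kappa G m \<rho> -` E. N (B \<mu> v - f) = 0" using u(1) v(2) by (intro bexI[of _ v]) simp_all
qed

text \<open>\<open>kappa\<close> is an isometry and the operator picks up \<rho>^m. With \<rho>^m =
  |\<lambda>| this trades the decay C / |\<lambda>| for a constant bound C at the normalised
  parameter.\<close>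

lemma below_kappa_vimage_iff:
  assumes E: "E \<in> domains G m Aw" and \<rho>: "\<rho> > 0"
  shows "below (kappa G m \<rho> -` E) \<mu> C \<longleftrightarrow> below E (of_real (\<rho> ^ m) * \<mu>) (C / \<rho> ^ m)"
proof -
  note E' = domains_kappa_vimage[OF E \<rho>]
  have i: "inverse \<rho> > 0" using \<rho> by simp
  have eq: "C / \<rho> ^ m * N (B (of_real (\<rho> ^ m) * \<mu>) (kappa G m \<rho> v)) = C * N (B \<mu> v)"
    "N (kappa G m \<rho> v) = N v" if "v \<in> Dm" for v
    using \<rho> by (simp_all only: N_B_kappa_eq[OF \<rho> that] N_kappa[OF \<rho> Dmax_L2[OF that]]) simp
  show ?thesis
  proof
    assume b: "below (kappa G m \<rho> -` E) \<mu> C"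
    show "below E (of_real (\<rho> ^ m) * \<mu>) (C / \<rho> ^ m)"
      unfolding below_def
    proof
      fix u assume u: "u \<in> E"
      define v where "v = kappa G m (inverse \<rho>) u"
      have v: "kappa G m \<rho> v = u" unfolding v_def by (rule kappa_kappa_inverse[OF \<rho>])
      then have v': "v \<in> kappa G m \<rho> -` E" using u by simp
      then have vD: "v \<in> Dm" using domainsD(1)[OF E'] by blast
      show "N u \<le> C / \<rho> ^ m * N (B (of_real (\<rho> ^ m) * \<mu>) u)"
        using bspec[OF b[unfolded below_def] v'] eq[OF vD] by (simp only: v)
    qed
  next
    assume b: "below E (of_real (\<rho> ^ m) * \<mu>) (C / \<rho> ^ m)"
    show "below (kappa G m \<rho> -` E) \<mu> C"
      unfolding below_def
    proof
      fix v assume v: "v \<in> kappa G m \<rho> -` E"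
      then have vD: "v \<in> Dm" using domainsD(1)[OF E'] by blast
      have "kappa G m \<rho> v \<in> E" using v by simp
      from bspec[OF b[unfolded below_def] this] show "N v \<le> C * N (B \<mu> v)" by (simp only: eq[OF vD])
    qed
  qed
qed

text \<open>Solving \<open>B \<mu> v = B \<mu> u\<close> up to a null section within
  \<open>E\<close> exhibits \<open>u - v\<close> as an admissible value, so the choice in
  \<open>proj_along\<close> has the properties it is meant to have.\<close>

lemma proj_along_ker:
  assumes E: "E \<in> domains G m Aw" and o: "onto E \<mu>" and u: "u \<in> Dm"
  defines "k \<equiv> proj_along (ker_on G m Aw Dm \<mu>) E u"
  shows "k \<in> Dm" "N (B \<mu> k) = 0" "u - k \<in> E"
proof -
  obtain v where v: "v \<in> E" "N (B \<mu> v - B \<mu> u) = 0" using o B_L2[OF u, of \<mu>] unfolding onto_def by blast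
  have vD: "v \<in> Dm" using v(1) domainsD(1)[OF E] by blast
  have "N (B \<mu> (u - v)) = 0"
    using N_B_minus_eq[OF u vD] v(2) L2.nrm_minus_commute[OF B_L2[OF u] B_L2[OF vD], of \<mu> \<mu>] by simp
  then have "u - v \<in> ker_on G m Aw Dm \<mu> \<and> u - (u - v) \<in> E"
    using v(1) by (simp add: ker_on_iff Dmax_minus u vD)
  then have k: "k \<in> ker_on G m Aw Dm \<mu> \<and> u - k \<in> E"
    unfolding k_def proj_along_def by (rule someI[where P = "\<lambda>k. k \<in> ker_on G m Aw Dm \<mu> \<and> u - k \<in> E"])
  then show "k \<in> Dm" "u - k \<in> E" unfolding ker_on_def by blast+
  then show "N (B \<mu> k) = 0" using k ker_on_iff by blast
qed

subsection \<open>The two estimates\<close>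

text \<open>With k the projection, the image of u - k has norm at most 2 \<open>gn u\<close>, so u -
  k has L2 norm at most 2 C \<open>gn u\<close>, and \<open>gn_le_N_B\<close> gives it graph norm at
  most 2 + 4 C times \<open>gn u\<close>. Adding u itself gives 3 + 4 C.\<close>

lemma below_imp_projection_bound:
  assumes E: "E \<in> domains G m Aw" and o: "onto E \<mu>" and b: "below E \<mu> C" and C: "C \<ge> 0"
    and \<mu>: "cmod \<mu> = 1" and u: "u \<in> Dm"
  shows "gn (pi_max G m Aw (proj_along (ker_on G m Aw Dm \<mu>) E u)) \<le> (3 + 4 * C) * gn u"
proof -
  define k where "k = proj_along (ker_on G m Aw Dm \<mu>) E u"
  have k: "k \<in> Dm" "N (B \<mu> k) = 0" "u - k \<in> E" unfolding k_def by (rule proj_along_ker[OF E o u])+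
  define v where "v = u - k"
  have vE: "v \<in> E" and vD: "v \<in> Dm" using k domainsD(1)[OF E] by (auto simp: v_def)
  have "N (B \<mu> v) \<le> N (B \<mu> u) + N (B \<mu> k)"
    unfolding v_def N_B_minus_eq[OF u k(1)] by (rule L2.nrm_triangle_minus[OF B_L2[OF u] B_L2[OF k(1)]])
  then have Bv: "N (B \<mu> v) \<le> 2 * gn u" using N_B_le_gn[OF u \<mu>] k(2) by simp
  have "N v \<le> C * N (B \<mu> v)" using b vE unfolding below_def by (rule bspec)
  also have "\<dots> \<le> C * (2 * gn u)" by (rule mult_left_mono[OF Bv C])
  finally have "gn v \<le> 2 * gn u + 4 * (C * gn u)" using gn_le_N_B[OF vD \<mu>] Bv by simp
  moreover have "gn k \<le> gn u + gn v"
    using graph.nrm_triangle_minus[OF u vD] by (simp add: v_def)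
  moreover have "gn (pi_max G m Aw k) \<le> gn k" by (rule pi_max(4)[OF k(1)])
  ultimately show ?thesis unfolding k_def by (simp add: algebra_simps)
qed

text \<open>The a priori constant \<open>M\<close> only starts the iteration \<open>M \<mapsto> K + M / 2\<close>, whose fixed point is \<open>2 * K\<close>.\<close>

lemma below_absorb:
  assumes E: "E \<in> domains G m Aw" and b: "below E \<mu> M" and M: "M \<ge> 0" and K: "K \<ge> 0"
    and step: "\<And>f. f \<in> L2 G m \<Longrightarrow> \<exists>v\<in>E. \<exists>g\<in>L2 G m. N v \<le> K * N f \<and> N g \<le> N f / 2 \<and> N (B \<mu> v - (f - g)) = 0"
  shows "below E \<mu> (2 * K)"
proof -
  have iter: "below E \<mu> (K + M' / 2)" if b': "below E \<mu> M'" and M': "M' \<ge> 0" for M'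
    unfolding below_def
  proof
    fix u assume u: "u \<in> E"
    have uD: "u \<in> Dm" using u domainsD(1)[OF E] by blast
    note f = B_L2[OF uD, of \<mu>]
    \<comment> \<open>An approximate solution \<open>v\<close> leaves the remainder
      \<open>u - v\<close>, still in \<open>E\<close>, whose image is at most half as large; the a
      priori bound is spent on this remainder only.\<close>
    obtain v g where v: "v \<in> E" and g: "g \<in> L2 G m" and
      vg: "N v \<le> K * N (B \<mu> u)" "N g \<le> N (B \<mu> u) / 2" "N (B \<mu> v - (B \<mu> u - g)) = 0"
      using step[OF f] by blast
    have vD: "v \<in> Dm" using v domainsD(1)[OF E] by blast
    have "N (B \<mu> u - B \<mu> v) = N g"
    proof (rule L2.nrm_null_cong[OF L2_minus[OF f B_L2[OF vD]] g])
      have "B \<mu> u - B \<mu> v - g = (B \<mu> u - g) - B \<mu> v" by simp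
      then show "N (B \<mu> u - B \<mu> v - g) = 0"
        using vg(3) L2.nrm_minus_commute[OF B_L2[OF vD] L2_minus[OF f g], of \<mu>] by (simp only:)
    qed
    then have "N (B \<mu> (u - v)) \<le> N (B \<mu> u) / 2" using vg(2) N_B_minus_eq[OF uD vD, of \<mu>] by simp
    then have "M' * N (B \<mu> (u - v)) \<le> M' * (N (B \<mu> u) / 2)" by (rule mult_left_mono[OF _ M'])
    moreover have "N (u - v) \<le> M' * N (B \<mu> (u - v))"
      using b' domainsD(4)[OF E u v] unfolding below_def by (rule bspec)
    moreover have "N u \<le> N v + N (u - v)" by (rule L2.nrm_le_add[OF Dmax_L2[OF uD] Dmax_L2[OF vD]])
    ultimately show "N u \<le> (K + M' / 2) * N (B \<mu> u)" using vg(1) by (simp add: distrib_right)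
  qed
  have n: "below E \<mu> (2 * K + M / 2 ^ n)" for n
  proof (induction n)
    case 0
    show ?case
      unfolding below_def
    proof
      fix u assume u: "u \<in> E"
      have "u \<in> Dm" using u domainsD(1)[OF E] by blast
      then have "0 \<le> 2 * K * N (B \<mu> u)" using K by (intro mult_nonneg_nonneg L2.nrm_ge0 B_L2) simp_all
      then show "N u \<le> (2 * K + M / 2 ^ 0) * N (B \<mu> u)"
        using bspec[OF b[unfolded below_def] u] by (simp add: distrib_right)
    qed
  next
    case (Suc n)
    have "below E \<mu> (K + (2 * K + M / 2 ^ n) / 2)" by (rule iter[OF Suc]) (use K M in simp)
    also have "K + (2 * K + M / 2 ^ n) / 2 = 2 * K + M / 2 ^ Suc n" by (simp add: field_simps)
    finally show ?case .
  qed
  show ?thesis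
    unfolding below_def
  proof
    fix u assume u: "u \<in> E"
    have "(\<lambda>n. M / 2 ^ n) \<longlonglongrightarrow> 0"
      by (intro LIMSEQ_divide_realpow_zero) simp
    then have "(\<lambda>n. (2 * K + M / 2 ^ n) * N (B \<mu> u)) \<longlonglongrightarrow> (2 * K + 0) * N (B \<mu> u)"
      by (intro tendsto_intros)
    moreover have "N u \<le> (2 * K + M / 2 ^ n) * N (B \<mu> u)" for n
      using n[of n] u unfolding below_def by (rule bspec)
    ultimately have "N u \<le> (2 * K + 0) * N (B \<mu> u)"
      by (intro LIMSEQ_le_const) blast+
    then show "N u \<le> 2 * K * N (B \<mu> u)" by simp
  qed
qed

lemma projection_bound_imp_below:
  assumes W: "W \<in> domains G m Aw" and oW: "onto W \<nu>" and bW: "below W \<nu> C0" and C0: "C0 \<ge> 0"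
    and \<nu>: "cmod \<nu> = 1" and \<mu>: "cmod \<mu> = 1" and close: "cmod (\<mu> - \<nu>) * C0 \<le> 1 / 2"
    and E: "E \<in> domains G m Aw" and oE: "onto E \<mu>" and bE: "\<exists>M\<ge>0. below E \<mu> M"
    and C: "C \<ge> 0" "\<And>u. u \<in> Emax G m Aw \<Longrightarrow> gn (pi_max G m Aw (proj_along (ker_on G m Aw Dm \<mu>) E u)) \<le> C * gn u"
  shows "below E \<mu> (2 * (C0 + (1 + 4 * C0) * (C * (1 + 2 * C0))))"
proof -
  \<comment> \<open>The first \<open>C0\<close> bounds w. The factor 1 + 2 C0 passes from
    \<open>f\<close> to the graph norm of w, \<open>C\<close> to that of the component \<epsilon> of
    k in \<open>Emax\<close>, and 1 + 4 C0 to the L2 norm of k. The factor 2 in the claim comes from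
    the absorption.\<close>
  define K where "K = C0 + (1 + 4 * C0) * (C * (1 + 2 * C0))"
  have K: "K \<ge> 0" using C0 C(1) by (simp add: K_def)
  from bE obtain M where M: "M \<ge> 0" "below E \<mu> M" by blast
  \<comment> \<open>The lower bound at \<nu> survives the passage to \<mu>: the perturbation costs
    at most half of \<open>N u\<close>, which is absorbed at the price of a factor 2. It holds on
    the minimal domain because that is contained in \<open>W\<close>.\<close>
  have min: "N u \<le> 2 * C0 * N (B \<mu> u)" if u: "u \<in> D0" for u
  proof -
    note uD = DminE(1)[OF u]
    have "N u \<le> C0 * N (B \<nu> u)" using bW subsetD[OF domainsD(2)[OF W] u] unfolding below_def by (rule bspec)
    also have "\<dots> \<le> C0 * (N (B \<mu> u) + cmod (\<mu> - \<nu>) * N u)" by (rule mult_left_mono[OF N_B_shift[OF uD] C0])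
    also have "\<dots> = C0 * N (B \<mu> u) + cmod (\<mu> - \<nu>) * C0 * N u" by (simp add: algebra_simps)
    also have "\<dots> \<le> C0 * N (B \<mu> u) + 1 / 2 * N u"
      by (intro add_left_mono mult_right_mono[OF close] L2.nrm_ge0[OF Dmax_L2[OF uD]])
    finally show ?thesis by simp
  qed
  have "\<exists>v\<in>E. \<exists>g\<in>L2 G m. N v \<le> K * N f \<and> N g \<le> N f / 2 \<and> N (B \<mu> v - (f - g)) = 0" if f: "f \<in> L2 G m" for f
  proof -
    from oW f obtain w where w: "w \<in> W" "N (B \<nu> w - f) = 0" unfolding onto_def by blast
    have wD: "w \<in> Dm" using w(1) domainsD(1)[OF W] by blast
    have Bw: "N (B \<nu> w) = N f" by (rule L2.nrm_null_cong[OF B_L2[OF wD] f w(2)])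
    have Nw: "N w \<le> C0 * N f" using bspec[OF bW[unfolded below_def] w(1)] Bw by simp
    have gw: "gn w \<le> (1 + 2 * C0) * N f" using gn_le_N_B[OF wD \<nu>] Nw Bw by (simp add: distrib_right)
    define e where "e = pi_max G m Aw w"
    have e: "e \<in> Dm" "e \<in> Emax G m Aw" "w - e \<in> D0" "gn e \<le> gn w" unfolding e_def by (rule pi_max[OF wD])+
    define k where "k = proj_along (ker_on G m Aw Dm \<mu>) E e"
    have k: "k \<in> Dm" "N (B \<mu> k) = 0" "e - k \<in> E" unfolding k_def by (rule proj_along_ker[OF E oE e(1)])+
    define \<epsilon> where "\<epsilon> = pi_max G m Aw k"
    have \<epsilon>: "\<epsilon> \<in> Dm" "k - \<epsilon> \<in> D0" unfolding \<epsilon>_def by (rule pi_max[OF k(1)])+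
    have "gn \<epsilon> \<le> C * gn e" unfolding \<epsilon>_def k_def by (rule C(2)[OF e(2)])
    also have "\<dots> \<le> C * ((1 + 2 * C0) * N f)" by (rule mult_left_mono[OF order_trans[OF e(4) gw] C(1)])
    finally have g\<epsilon>: "gn \<epsilon> \<le> C * (1 + 2 * C0) * N f" by simp
    have "N (B \<mu> (k - \<epsilon>)) \<le> N (B \<mu> k) + N (B \<mu> \<epsilon>)"
      unfolding N_B_minus_eq[OF k(1) \<epsilon>(1)] by (rule L2.nrm_triangle_minus[OF B_L2[OF k(1)] B_L2[OF \<epsilon>(1)]])
    also have "\<dots> \<le> 2 * gn \<epsilon>" using N_B_le_gn[OF \<epsilon>(1) \<mu>] k(2) by simp
    finally have "2 * C0 * N (B \<mu> (k - \<epsilon>)) \<le> 2 * C0 * (2 * gn \<epsilon>)" by (rule mult_left_mono) (use C0 in simp)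
    then have "N (k - \<epsilon>) \<le> 4 * C0 * gn \<epsilon>" using min[OF \<epsilon>(2)] by simp
    moreover have "N k \<le> N \<epsilon> + N (k - \<epsilon>)" by (rule L2.nrm_le_add[OF Dmax_L2[OF k(1)] Dmax_L2[OF \<epsilon>(1)]])
    ultimately have "N k \<le> (1 + 4 * C0) * gn \<epsilon>" using N_le_gn[OF \<epsilon>(1)] by (simp add: distrib_right)
    also have "\<dots> \<le> (1 + 4 * C0) * (C * (1 + 2 * C0) * N f)" by (rule mult_left_mono[OF g\<epsilon>]) (use C0 in simp)
    finally have Nk: "N k \<le> (1 + 4 * C0) * (C * (1 + 2 * C0)) * N f" by (simp only: mult.assoc)
    define v where "v = w - k"
    \<comment> \<open>The first summand is in the minimal domain, hence in \<open>E\<close>. So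
      projecting only the component \<open>e\<close> of w already moves w into \<open>E\<close>, and
      the hypothesis is needed on \<open>Emax\<close> alone.\<close>
    have "v = (w - e) + (e - k)" by (simp add: v_def)
    then have v: "v \<in> E" using domainsD(3)[OF E subsetD[OF domainsD(2)[OF E] e(3)] k(3)] by (simp only:)
    have "N v \<le> N w + N k" unfolding v_def by (rule L2.nrm_triangle_minus[OF Dmax_L2[OF wD] Dmax_L2[OF k(1)]])
    then have Nv: "N v \<le> K * N f" using Nw Nk by (simp add: K_def distrib_right)
    \<comment> \<open>The error made by using the inverse at \<nu> for the equation at \<mu>;
      \<open>close\<close> makes it at most half of \<open>f\<close>, as \<open>below_absorb\<close>
      demands.\<close>
    define g where "g = sscl G (\<mu> - \<nu>) w"
    have g: "g \<in> L2 G m" unfolding g_def by (rule L2_sscl[OF Dmax_L2[OF wD]])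
    have "cmod (\<mu> - \<nu>) * N w \<le> cmod (\<mu> - \<nu>) * (C0 * N f)" by (rule mult_left_mono[OF Nw]) simp
    also have "\<dots> \<le> 1 / 2 * N f" unfolding mult.assoc[symmetric] by (rule mult_right_mono[OF close L2.nrm_ge0[OF f]])
    finally have Ng: "N g \<le> N f / 2" unfolding g_def L2.nrm_sc[OF Dmax_L2[OF wD]] by simp
    note L = B_L2[OF Dmax_minus[OF wD k(1)], of \<mu>] B_L2[OF wD, of \<mu>] B_L2[OF k(1), of \<mu>]
    have "N (B \<mu> v - (f - g)) \<le> N (B \<mu> v - B \<mu> w) + N (B \<mu> w - (f - g))"
      unfolding v_def by (rule L2.nrm_triangle3[OF L(1,2) L2_minus[OF f g]])
    moreover have "N (B \<mu> v - B \<mu> w) \<le> N (B \<mu> v - (B \<mu> w - B \<mu> k)) + N (B \<mu> w - B \<mu> k - B \<mu> w)"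
      unfolding v_def by (rule L2.nrm_triangle3[OF L(1) L2_minus[OF L(2,3)] L(2)])
    moreover have "N (B \<mu> v - (B \<mu> w - B \<mu> k)) = 0" unfolding v_def by (rule N_B_minus[OF wD k(1)])
    moreover have "N (B \<mu> w - B \<mu> k - B \<mu> w) = N (B \<mu> k)"
      using L2.nrm_minus_commute[OF L2_minus[OF L(2,3)] L(2)] by simp
    moreover have "B \<mu> w - (f - g) = B \<nu> w - f" by (simp add: B_shift[of \<mu> w \<nu>] g_def)
    then have "N (B \<mu> w - (f - g)) = 0" using w(2) by (simp only:)
    ultimately have "N (B \<mu> v - (f - g)) \<le> 0" using k(2) by linarith
    moreover have "N (B \<mu> v - (f - g)) \<ge> 0" unfolding v_def by (rule L2.nrm_ge0[OF L2_minus[OF L(1) L2_minus[OF f g]]])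
    ultimately show ?thesis using v g Nv Ng by (intro bexI[of _ v] bexI[of _ g]) simp_all
  qed
  then have "below E \<mu> (2 * K)" by (rule below_absorb[OF E M(2,1) K])
  then show ?thesis by (simp only: K_def)
qed

lemma below_mono:
  assumes E: "E \<in> domains G m Aw" and b: "below E \<mu> C" and le: "C \<le> C'"
  shows "below E \<mu> C'"
  unfolding below_def
proof
  fix u assume u: "u \<in> E"
  have "u \<in> Dm" using u domainsD(1)[OF E] by blast
  then have "C * N (B \<mu> u) \<le> C' * N (B \<mu> u)" by (intro mult_right_mono[OF le] L2.nrm_ge0 B_L2)
  then show "N u \<le> C' * N (B \<mu> u)" using bspec[OF b[unfolded below_def] u] by linarith
qed

lemma bg_res_D:
  assumes "\<nu> \<in> bg_res G m Aw"
  shows "\<exists>W\<in>domains G m Aw. \<exists>C0\<ge>0. onto W \<nu> \<and> below W \<nu> C0"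
proof -
  from assms obtain W where W: "W \<in> domains G m Aw" "\<nu> \<in> res_set G m Aw W"
    unfolding bg_res_def bg_spec_def spec_def by auto
  show ?thesis using W res_set_onto[OF W] res_set_below[OF W] by blast
qed

text \<open>\<open>K\<close> may depend on \<open>S\<close> and \<open>C\<close> but on neither
  \<mu> nor \<open>E\<close>, although \<open>E\<close> varies freely and the a priori bound
  \<open>M\<close> is arbitrary: the estimates involve only the bounds at finitely many fixed
  centres.\<close>

lemma uniform_below:
  assumes S: "compact S" "S \<subseteq> bg_res G m Aw" "\<And>\<mu>. \<mu> \<in> S \<Longrightarrow> cmod \<mu> = 1" and C: "C \<ge> 0"
  shows "\<exists>K>0. \<forall>\<mu>\<in>S. \<forall>E\<in>domains G m Aw. onto E \<mu> \<longrightarrow> (\<exists>M\<ge>0. below E \<mu> M) \<longrightarrow>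
    (\<forall>u\<in>Emax G m Aw. gn (pi_max G m Aw (proj_along (ker_on G m Aw Dm \<mu>) E u)) \<le> C * gn u) \<longrightarrow> below E \<mu> K"
proof -
  have "\<forall>\<nu>\<in>S. \<exists>W C0. W \<in> domains G m Aw \<and> C0 \<ge> 0 \<and> onto W \<nu> \<and> below W \<nu> C0"
    using bg_res_D S(2) by blast
  then obtain W c where W: "\<And>\<nu>. \<nu> \<in> S \<Longrightarrow> W \<nu> \<in> domains G m Aw" "\<And>\<nu>. \<nu> \<in> S \<Longrightarrow> onto (W \<nu>) \<nu>"
      "\<And>\<nu>. \<nu> \<in> S \<Longrightarrow> below (W \<nu>) \<nu> (c \<nu>)" and c: "\<And>\<nu>. \<nu> \<in> S \<Longrightarrow> c \<nu> \<ge> 0"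
    unfolding bchoice_iff by auto
  \<comment> \<open>The radius guarantees |\<mu> - \<nu>| c \<le> 1/2, the closeness required for
    the local estimate; the summand 2 keeps it defined when c = 0.\<close>
  have c2: "1 / (2 * c \<nu> + 2) > 0" if "\<nu> \<in> S" for \<nu> using c[OF that] by simp
  have cover: "S \<subseteq> (\<Union>\<nu>\<in>S. ball \<nu> (1 / (2 * c \<nu> + 2)))"
  proof
    fix \<nu> assume \<nu>: "\<nu> \<in> S"
    then show "\<nu> \<in> (\<Union>\<nu>\<in>S. ball \<nu> (1 / (2 * c \<nu> + 2)))" using c2[OF \<nu>] by (intro UN_I[OF \<nu>]) simp
  qed
  obtain P where P: "P \<subseteq> S" "finite P" "S \<subseteq> (\<Union>\<nu>\<in>P. ball \<nu> (1 / (2 * c \<nu> + 2)))"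
    by (rule compactE_image[OF S(1) _ cover]) simp_all
  define k where "k \<nu> = 2 * (c \<nu> + (1 + 4 * c \<nu>) * (C * (1 + 2 * c \<nu>)))" for \<nu>
  have k: "k \<nu> \<ge> 0" if "\<nu> \<in> P" for \<nu> using c[of \<nu>] that P(1) C by (auto simp: k_def)
  \<comment> \<open>The sum dominates the constant of every centre, and the summand 1 makes it
    positive.\<close>
  define K where "K = 1 + sum k P"
  have "sum k P \<ge> 0" using k by (rule sum_nonneg)
  then have "K > 0" by (simp add: K_def)
  moreover have "below E \<mu> K"
    if \<mu>: "\<mu> \<in> S" and E: "E \<in> domains G m Aw" "onto E \<mu>" "\<exists>M\<ge>0. below E \<mu> M"
      and e: "\<And>u. u \<in> Emax G m Aw \<Longrightarrow> gn (pi_max G m Aw (proj_along (ker_on G m Aw Dm \<mu>) E u)) \<le> C * gn u" for \<mu> E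
  proof -
    from P(3) \<mu> obtain \<nu> where \<nu>: "\<nu> \<in> P" "\<mu> \<in> ball \<nu> (1 / (2 * c \<nu> + 2))" by blast
    then have \<nu>S: "\<nu> \<in> S" using P(1) by blast
    have "cmod (\<mu> - \<nu>) \<le> 1 / (2 * c \<nu> + 2)" using \<nu>(2) by (simp add: dist_norm norm_minus_commute)
    then have "cmod (\<mu> - \<nu>) * c \<nu> \<le> 1 / (2 * c \<nu> + 2) * c \<nu>" by (rule mult_right_mono[OF _ c[OF \<nu>S]])
    also have "\<dots> \<le> 1 / 2" using c[OF \<nu>S] by (simp add: divide_simps)
    finally have "below E \<mu> (k \<nu>)"
      unfolding k_def
      by (intro projection_bound_imp_below[OF W(1)[OF \<nu>S] W(2)[OF \<nu>S] W(3)[OF \<nu>S] c[OF \<nu>S] S(3)[OF \<nu>S] S(3)[OF \<mu>] _ E C e])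
    moreover have "k \<nu> \<le> sum k P" by (rule member_le_sum[OF \<nu>(1) _ P(2)]) (use k in auto)
    then have "k \<nu> \<le> K" by (simp add: K_def)
    ultimately show ?thesis by (rule below_mono[OF E(1)])
  qed
  ultimately show ?thesis by (intro exI[of _ K] conjI ballI impI) simp_all
qed

theorem minimal_growth_iff:
  assumes m: "m > 0" and D: "D \<in> domains G m Aw"
    and \<Lambda>: "closed_sector \<Lambda>" "\<Lambda> - {0} \<subseteq> bg_res G m Aw"
  shows "minimal_growth G m Aw D \<Lambda> \<longleftrightarrow>
    (\<exists>C R. C > 0 \<and> R > 0 \<and> outer_part \<Lambda> R \<subseteq> res_set G m Aw D \<and>
      (\<forall>\<mu>\<in>outer_part \<Lambda> R. \<forall>u\<in>Emax G m Aw.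
         gn (pi_max G m Aw (proj_along (ker_on G m Aw Dm (\<mu> / of_real (norm \<mu>))) (kappa G m (root m (norm \<mu>)) -` D) u))
         \<le> C * gn u))" (is "_ \<longleftrightarrow> ?R")
proof -
  obtain \<theta>\<^sub>0 a where a: "a \<ge> 0" "\<Lambda> = {of_real r * cis \<theta> |r \<theta>. r \<ge> 0 \<and> \<bar>\<theta> - \<theta>\<^sub>0\<bar> \<le> a}"
    using \<Lambda>(1) unfolding closed_sector_def by blast
  \<comment> \<open>The sector is the union of the rays through this compact arc, so every
    normalised parameter lies on it.\<close>
  define S where "S = cis ` {\<theta>\<^sub>0 - a..\<theta>\<^sub>0 + a}"
  have S: "compact S" unfolding S_def by (intro compact_continuous_image continuous_on_cis continuous_on_id compact_Icc)
  have S1: "cmod \<mu> = 1" if "\<mu> \<in> S" for \<mu> using that by (auto simp: S_def)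
  have S\<Lambda>: "S \<subseteq> bg_res G m Aw"
  proof
    fix \<mu> assume "\<mu> \<in> S"
    then obtain \<theta> where \<theta>: "\<mu> = cis \<theta>" "\<theta> \<in> {\<theta>\<^sub>0 - a..\<theta>\<^sub>0 + a}" unfolding S_def by (rule imageE)
    have "\<mu> = of_real 1 * cis \<theta>" "(1::real) \<ge> 0" "\<bar>\<theta> - \<theta>\<^sub>0\<bar> \<le> a" using \<theta> by (auto simp: abs_le_iff)
    then have "\<mu> \<in> \<Lambda>" unfolding a(2) by blast
    moreover have "\<mu> \<noteq> 0" using \<theta> by simp
    ultimately show "\<mu> \<in> bg_res G m Aw" using \<Lambda>(2) by blast
  qed
  \<comment> \<open>Here m > 0 enters: the m-th root \<rho> of |\<mu>| satisfies \<rho>^m = |\<mu>|,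
    so conjugation moves the spectral parameter onto the arc.\<close>
  have outer: "norm \<mu> > 0 \<and> \<mu> / of_real (norm \<mu>) \<in> S \<and> root m (norm \<mu>) > 0 \<and> root m (norm \<mu>) ^ m = norm \<mu> \<and>
      of_real (root m (norm \<mu>) ^ m) * (\<mu> / of_real (norm \<mu>)) = \<mu>"
    if R: "R > 0" and \<mu>: "\<mu> \<in> outer_part \<Lambda> R" for R \<mu>
  proof -
    obtain r \<theta> where r: "\<mu> = of_real r * cis \<theta>" "r \<ge> 0" "\<bar>\<theta> - \<theta>\<^sub>0\<bar> \<le> a"
      using \<mu> unfolding outer_part_def a(2) by blast
    have n: "norm \<mu> = r" using r by (simp add: norm_mult)
    have "R \<le> norm \<mu>" using \<mu> unfolding outer_part_def by simp
    then have p: "norm \<mu> > 0" using R by linarith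
    have eq: "of_real (norm \<mu>) * (\<mu> / of_real (norm \<mu>)) = \<mu>" using p by simp
    have "\<mu> / of_real (norm \<mu>) = cis \<theta>" using p n r(1) by simp
    moreover have "\<theta> \<in> {\<theta>\<^sub>0 - a..\<theta>\<^sub>0 + a}" using r(3) by (auto simp: abs_le_iff)
    moreover have "root m (norm \<mu>) ^ m = norm \<mu>" using m p by (simp add: real_root_pow_pos2)
    moreover have "root m (norm \<mu>) > 0" using m p by simp
    ultimately show ?thesis using p eq unfolding S_def by (simp only: imageI simp_thms)
  qed
  define E where "E \<mu> = kappa G m (root m (norm \<mu>)) -` D" for \<mu> :: complex
  define h where "h \<mu> = \<mu> / of_real (norm \<mu>)" for \<mu> :: complex
  have dom: "E \<mu> \<in> domains G m Aw" if "R > 0" "\<mu> \<in> outer_part \<Lambda> R" for R \<mu>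
    unfolding E_def using outer[OF that] by (intro domains_kappa_vimage[OF D]) simp
  have ont: "onto (E \<mu>) (h \<mu>)" if "R > 0" "\<mu> \<in> outer_part \<Lambda> R" "\<mu> \<in> res_set G m Aw D" for R \<mu>
    unfolding E_def h_def using outer[OF that(1,2)] res_set_onto[OF D that(3)] by (intro onto_kappa_vimage[OF D]) simp_all
  have bel: "below (E \<mu>) (h \<mu>) C \<longleftrightarrow> below D \<mu> (C / norm \<mu>)" if "R > 0" "\<mu> \<in> outer_part \<Lambda> R" for R \<mu> C
  proof -
    note o = outer[OF that]
    have e1: "of_real (root m (norm \<mu>) ^ m) * h \<mu> = \<mu>" unfolding h_def using o by (elim conjE)
    have e2: "root m (norm \<mu>) ^ m = norm \<mu>" using o by (elim conjE)
    have "below (E \<mu>) (h \<mu>) C \<longleftrightarrow> below D (of_real (root m (norm \<mu>) ^ m) * h \<mu>) (C / root m (norm \<mu>) ^ m)"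
      unfolding E_def by (rule below_kappa_vimage_iff[OF D]) (use o in simp)
    then show ?thesis unfolding e1 unfolding e2 .
  qed
  show ?thesis
    unfolding E_def[symmetric] h_def[symmetric]
  proof
    assume "minimal_growth G m Aw D \<Lambda>"
    then obtain R C where R: "R > 0" "outer_part \<Lambda> R \<subseteq> res_set G m Aw D" and C: "C > 0"
      and b: "\<And>\<mu> f. \<mu> \<in> outer_part \<Lambda> R \<Longrightarrow> f \<in> L2 G m \<Longrightarrow> N (resolvent G m Aw D \<mu> f) \<le> C / norm \<mu> * N f"
      unfolding minimal_growth_def L2norm_eq by blast
    have "gn (pi_max G m Aw (proj_along (ker_on G m Aw Dm (h \<mu>)) (E \<mu>) u)) \<le> (3 + 4 * C) * gn u"
      if \<mu>: "\<mu> \<in> outer_part \<Lambda> R" and u: "u \<in> Emax G m Aw" for \<mu> u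
    proof (rule below_imp_projection_bound[OF dom[OF R(1) \<mu>] ont[OF R(1) \<mu> subsetD[OF R(2) \<mu>]]])
      have "below D \<mu> (C / norm \<mu>)"
        using b[OF \<mu>] resolvent_bound_iff[OF D subsetD[OF R(2) \<mu>], of "C / norm \<mu>"] by simp
      then show "below (E \<mu>) (h \<mu>) C" by (simp only: bel[OF R(1) \<mu>])
      show "C \<ge> 0" using C by simp
      show "cmod (h \<mu>) = 1" unfolding h_def using outer[OF R(1) \<mu>] by (intro S1) simp
      show "u \<in> Dm" using u unfolding Emax_def by simp
    qed
    then show "\<exists>C R. C > 0 \<and> R > 0 \<and> outer_part \<Lambda> R \<subseteq> res_set G m Aw D \<and>
      (\<forall>\<mu>\<in>outer_part \<Lambda> R. \<forall>u\<in>Emax G m Aw.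
         gn (pi_max G m Aw (proj_along (ker_on G m Aw Dm (h \<mu>)) (E \<mu>) u)) \<le> C * gn u)"
      using R C by (intro exI[of _ "3 + 4 * C"] exI[of _ R] conjI ballI) simp_all
  next
    assume "\<exists>C R. C > 0 \<and> R > 0 \<and> outer_part \<Lambda> R \<subseteq> res_set G m Aw D \<and>
      (\<forall>\<mu>\<in>outer_part \<Lambda> R. \<forall>u\<in>Emax G m Aw.
         gn (pi_max G m Aw (proj_along (ker_on G m Aw Dm (h \<mu>)) (E \<mu>) u)) \<le> C * gn u)"
    then obtain C R where C: "C > 0" and R: "R > 0" "outer_part \<Lambda> R \<subseteq> res_set G m Aw D"
      and p: "\<And>\<mu> u. \<mu> \<in> outer_part \<Lambda> R \<Longrightarrow> u \<in> Emax G m Aw \<Longrightarrow>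
         gn (pi_max G m Aw (proj_along (ker_on G m Aw Dm (h \<mu>)) (E \<mu>) u)) \<le> C * gn u"
      by blast
    obtain K where K: "K > 0" and KK: "\<forall>\<mu>\<in>S. \<forall>E\<in>domains G m Aw. onto E \<mu> \<longrightarrow> (\<exists>M\<ge>0. below E \<mu> M) \<longrightarrow>
      (\<forall>u\<in>Emax G m Aw. gn (pi_max G m Aw (proj_along (ker_on G m Aw Dm \<mu>) E u)) \<le> C * gn u) \<longrightarrow> below E \<mu> K"
      using uniform_below[OF S S\<Lambda> S1 less_imp_le[OF C]] by blast
    have "N (resolvent G m Aw D \<mu> f) \<le> K / norm \<mu> * N f" if \<mu>: "\<mu> \<in> outer_part \<Lambda> R" and f: "f \<in> L2 G m" for \<mu> f
    proof -
      note r = subsetD[OF R(2) \<mu>] and o = outer[OF R(1) \<mu>]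
      have hS: "h \<mu> \<in> S" unfolding h_def using o by simp
      \<comment> \<open>This bound may depend on \<mu>. Rescaled, it is the a priori bound that
        \<open>uniform_below\<close> asks for, while the constant \<open>K\<close> obtained there
        does not depend on it.\<close>
      obtain M where M: "M \<ge> 0" "below D \<mu> M" using res_set_below[OF D r] by blast
      have "below D \<mu> (norm \<mu> * M / norm \<mu>)" using M(2) o by simp
      then have "below (E \<mu>) (h \<mu>) (norm \<mu> * M)" by (simp only: bel[OF R(1) \<mu>])
      then have "\<exists>M\<ge>0. below (E \<mu>) (h \<mu>) M" using M(1) by (intro exI[of _ "norm \<mu> * M"]) simp
      then have "below (E \<mu>) (h \<mu>) K"
        using bspec[OF bspec[OF KK hS] dom[OF R(1) \<mu>]] ont[OF R(1) \<mu> r] p[OF \<mu>] by simp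
      then have "below D \<mu> (K / norm \<mu>)" by (simp only: bel[OF R(1) \<mu>])
      then show ?thesis using resolvent_bound_iff[OF D r, of "K / norm \<mu>"] f by simp
    qed
    then show "minimal_growth G m Aw D \<Lambda>"
      unfolding minimal_growth_def L2norm_eq using R K by (intro exI[of _ R] exI[of _ K] conjI ballI) simp_all
  qed
qed

end

text \<open>The operator norm is rendered by an inequality with the constant \<open>C\<close>, since
  sections rather than classes are estimated. The values chosen by \<open>pi_max\<close> and
  \<open>proj_along\<close> enter the proof only through their defining properties.\<close>

theorem theorem8p7:
  fixes G :: "('a::{t2_space,second_countable_topology}, 'n::{finite,linorder}, 'f::ab_group_add, 'r::finite) cone_data"
    and m :: nat
    and A :: "('a \<Rightarrow> 'f) \<Rightarrow> 'a \<Rightarrow> 'f"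
    and Aw :: "('a, 'f) csec \<Rightarrow> ('a, 'f) csec"
    and D :: "('a, 'f) csec set"
    and \<Omega> \<Lambda> :: "complex set"
  assumes "cone_geometry G"
    and "m > 0"
    and "cone_operator G m A"
    and "c_elliptic G m A"
    and "model_operator G m A Aw"
    and "\<Omega> \<in> components (bg_res G m Aw)"
    and "D \<in> index_domains G m Aw \<Omega>"
    and "closed_sector \<Lambda>"
    and "\<Lambda> - {0} \<subseteq> \<Omega>"
  shows "minimal_growth G m Aw D \<Lambda> \<longleftrightarrow>
    (\<exists>C R. C > 0 \<and> R > 0 \<and> outer_part \<Lambda> R \<subseteq> res_set G m Aw D \<and>
      (\<forall>\<mu>\<in>outer_part \<Lambda> R. \<forall>u\<in>Emax G m Aw.
         graph_norm G m Aw
           (pi_max G m Aw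
             (proj_along (ker_on G m Aw (Dmax G m Aw) (\<mu> / of_real (norm \<mu>)))
               (kappa G m (root m (norm \<mu>)) -` D) u))
         \<le> C * graph_norm G m Aw u))"
proof -
  interpret cone_model_operator G m A Aw
    by unfold_locales (rule assms)+
  have "D \<in> domains G m Aw" using assms(7) unfolding index_domains_def by simp
  moreover have "\<Lambda> - {0} \<subseteq> bg_res G m Aw" using assms(9) in_components_subset[OF assms(6)] by (rule subset_trans)
  ultimately show ?thesis unfolding graph_norm_eq by (rule minimal_growth_iff[OF assms(2) _ assms(8)])
qed

end
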